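(* Over $\mathsf{RCA_0}$, the following are equivalent: (1) $\mathsf{2\text{-}WWKL}$. (2) For every compact separable metric space $\mathcal X$ with measure $\mu$: if $(f_n)$ is a sequence of test functions such that $(f_n(x))$ is Cauchy for almost every $x$, then $(f_n)$ is almost uniformly Cauchy. (3) ($\mathsf{DCT^*}$) For every compact separable metric space $\mathcal X$ with measure $\mu$: if $g\in L^1(\mu)$, $(f_n)$ is a sequence of elements of $L^1(\mu)$ dominated by $g$, and $(f_n(x))$ is Cauchy for almost every $x$, then $(\int f_n\,d\mu)$ is Cauchy. (4) For every compact separable metric space $\mathcal X$ with measure $\mu$: if $(f_n)$ is a sequence of test functions with $0\le f_n\le1$ for all $n$ and $(f_n(x))$ is Cauchy for every $x$, then $(\int f_n\,d\mu)$ is Cauchy.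
   Context: Work in second-order arithmetic; $\mathsf{RCA_0}$ is the usual base system. Compact separable metric spaces $(\mathcal X,d)$ are coded as in reverse mathematics (Simpson, Subsystems of Second Order Arithmetic) via a countable dense set of ideal points; basic open sets are balls with ideal centers and rational radii. $C(\mathcal X,\mathbb R)$ is the uniform closure of a countable set of test functions ("polynomials" in Simpson's sense). A measure $\mu$ (finite Borel, normalized so $\mu(\mathcal X)=1$) is coded by the values $\int f\,d\mu$ on test functions; the measure of an open set $G$ is the supremum of $\int h\,d\mu$ over test functions $0\le h\le1$ vanishing outside $G$. An element of $L^1(\mu)$ is named by a sequence $(h_k)$ of test functions with $\|h_k-h_j\|_1<2^{-k}$ for $j\ge k$; its value at $x$ is $\lim_kh_k(x)$ when this exists. "$(f_n)$ is dominated by $g$" means $|f_n|\le g$ for all $n$. "$(f_n(x))$ is Cauchy for almost every $x$" means there is a null $G_\delta$ set $C=\bigcap_iG_i$ (open sets with, for every rational $\varepsilon>0$, some $i$ with $\mu(G_i)<\varepsilon$) such that for every $x\notin C$ all $f_n(x)$ are defined and $(f_n(x))$ is Cauchy. A sequence of test functions $(f_n)$ is almost uniformly Cauchy if for every rational $\lambda>0$ and $\varepsilon>0$ there is $n$ such that the open set $\{x:\exists m,m'\ge n\,|f_m(x)-f_{m'}(x)|>\varepsilon\}$ has measure $<\lambda$. $\mathsf{2\text{-}WWKL}$: for every $X$ and every infinite binary tree $T$ computable from $X'$ (the jump handled by formulas: $e\in X'$ abbreviates $\exists\sigma\subset X\,\varphi^\sigma_e(0)\downarrow$, $T$ given by an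 index $e$ with $\varphi^{X'}_e$ total $\{0,1\}$-valued) such that for some rational $\delta>0$ and all $n$, $|\{\sigma\in T:\mathrm{length}(\sigma)=n\}|/2^n>\delta$, there is a path through $T$. *)

theory Defs
  imports Main
begin

text \<open>
  Second-order arithmetic is treated semantically.  A structure for its language consists of a
  number sort (the whole type variable, possibly nonstandard) and a family \<open>cls\<close> of sets of numbers
  over which the set quantifiers range; it need be neither an omega-model nor a full model.  A
  statement holds over RCA0 iff it holds in all such structures that satisfy the axioms of RCA0.
  All coding below is internal to the structure: quantifiers range over the number sort, over
  \<open>cls\<close>, or over functions whose graph lies in \<open>cls\<close>, and finite objects have codes in
  the number sort.
\<close>

record 'n l2_struct =
  zero :: 'n (\<open>\<zero>\<index>\<close>)
  one :: 'n (\<open>\<one>\<index>\<close>)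
  add :: "'n \<Rightarrow> 'n \<Rightarrow> 'n" (infixl \<open>\<oplus>\<index>\<close> 65)
  mult :: "'n \<Rightarrow> 'n \<Rightarrow> 'n" (infixl \<open>\<otimes>\<index>\<close> 70)
  lt :: "'n \<Rightarrow> 'n \<Rightarrow> bool" (infix \<open>\<prec>\<index>\<close> 50)
  cls :: "'n set set"

section \<open>Bounded formulas and the axioms of RCA0\<close>

text \<open>Formulas with bounded number quantifiers only.  Number variables are de Bruijn indices;
  \<open>BEx t \<phi>\<close> binds index 0 in \<open>\<phi>\<close>, while its bound \<open>t\<close> lies outside the scope of the binder.
  Set variables are parameters and are never quantified.\<close>

datatype tm = TVar nat | TZero | TOne | TAdd tm tm | TMul tm tm

datatype bfm = Eq tm tm | Less tm tm | Mem tm nat | Neg bfm | Conj bfm bfm | BEx tm bfm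

locale L2 =
  fixes M :: "'n l2_struct" (structure)
begin

primrec tm_val :: "(nat \<Rightarrow> 'n) \<Rightarrow> tm \<Rightarrow> 'n" where
  "tm_val e (TVar i) = e i"
| "tm_val e TZero = \<zero>"
| "tm_val e TOne = \<one>"
| "tm_val e (TAdd s t) = tm_val e s \<oplus> tm_val e t"
| "tm_val e (TMul s t) = tm_val e s \<otimes> tm_val e t"

primrec bsat :: "(nat \<Rightarrow> 'n set) \<Rightarrow> (nat \<Rightarrow> 'n) \<Rightarrow> bfm \<Rightarrow> bool" where
  "bsat E e (Eq s t) \<longleftrightarrow> tm_val e s = tm_val e t"
| "bsat E e (Less s t) \<longleftrightarrow> tm_val e s \<prec> tm_val e t"
| "bsat E e (Mem t X) \<longleftrightarrow> tm_val e t \<in> E X"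
| "bsat E e (Neg \<phi>) \<longleftrightarrow> \<not> bsat E e \<phi>"
| "bsat E e (Conj \<phi> \<psi>) \<longleftrightarrow> bsat E e \<phi> \<and> bsat E e \<psi>"
| "bsat E e (BEx t \<phi>) \<longleftrightarrow> (\<exists>x. x \<prec> tm_val e t \<and> bsat E (case_nat x e) \<phi>)"

text \<open>The \<open>\<Sigma>\<^sup>0\<^sub>1\<close> formula \<open>\<exists>m. \<theta>(m, n, \<dots>)\<close> and the \<open>\<Pi>\<^sup>0\<^sub>1\<close> formula \<open>\<forall>m. \<theta>(m, n, \<dots>)\<close> as predicates
  of \<open>n\<close>: index 0 of \<open>\<theta>\<close> is \<open>m\<close>, index 1 is \<open>n\<close>, and the remaining ones are parameters.\<close>

definition sigma1 :: "(nat \<Rightarrow> 'n set) \<Rightarrow> (nat \<Rightarrow> 'n) \<Rightarrow> bfm \<Rightarrow> 'n \<Rightarrow> bool" where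
  "sigma1 E e \<theta> n \<longleftrightarrow> (\<exists>m. bsat E (case_nat m (case_nat n e)) \<theta>)"

definition pi1 :: "(nat \<Rightarrow> 'n set) \<Rightarrow> (nat \<Rightarrow> 'n) \<Rightarrow> bfm \<Rightarrow> 'n \<Rightarrow> bool" where
  "pi1 E e \<theta> n \<longleftrightarrow> (\<forall>m. bsat E (case_nat m (case_nat n e)) \<theta>)"

definition basic_axioms :: bool where
  "basic_axioms \<longleftrightarrow>
     (\<forall>n. n \<oplus> \<one> \<noteq> \<zero>) \<and>
     (\<forall>m n. m \<oplus> \<one> = n \<oplus> \<one> \<longrightarrow> m = n) \<and>
     (\<forall>m. m \<oplus> \<zero> = m) \<and>
     (\<forall>m n. m \<oplus> (n \<oplus> \<one>) = (m \<oplus> n) \<oplus> \<one>) \<and>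
     (\<forall>m. m \<otimes> \<zero> = \<zero>) \<and>
     (\<forall>m n. m \<otimes> (n \<oplus> \<one>) = (m \<otimes> n) \<oplus> m) \<and>
     (\<forall>m. \<not> m \<prec> \<zero>) \<and>
     (\<forall>m n. m \<prec> n \<oplus> \<one> \<longleftrightarrow> m \<prec> n \<or> m = n)"

definition sigma1_induction :: bool where
  "sigma1_induction \<longleftrightarrow>
     (\<forall>\<theta> E e. range E \<subseteq> cls M \<longrightarrow>
        sigma1 E e \<theta> \<zero> \<longrightarrow> (\<forall>n. sigma1 E e \<theta> n \<longrightarrow> sigma1 E e \<theta> (n \<oplus> \<one>)) \<longrightarrow>
        (\<forall>n. sigma1 E e \<theta> n))"

definition delta1_comprehension :: bool where
  "delta1_comprehension \<longleftrightarrow>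
     (\<forall>\<theta> \<eta> E e. range E \<subseteq> cls M \<longrightarrow>
        (\<forall>n. sigma1 E e \<theta> n \<longleftrightarrow> pi1 E e \<eta> n) \<longrightarrow> {n. sigma1 E e \<theta> n} \<in> cls M)"

text \<open>The set sort is nonempty, as in any structure of two-sorted logic.\<close>

definition RCA0 :: bool where
  "RCA0 \<longleftrightarrow> cls M \<noteq> {} \<and> basic_axioms \<and> sigma1_induction \<and> delta1_comprehension"

section \<open>Coding of pairs, functions and finite sequences\<close>

primrec num :: "nat \<Rightarrow> 'n" where
  "num 0 = \<zero>"
| "num (Suc k) = num k \<oplus> \<one>"

definition le :: "'n \<Rightarrow> 'n \<Rightarrow> bool" (infix \<open>\<preceq>\<close> 50) where
  "m \<preceq> n \<longleftrightarrow> m \<prec> n \<or> m = n"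

definition pair :: "'n \<Rightarrow> 'n \<Rightarrow> 'n" (\<open>\<langle>_,/ _\<rangle>\<close>) where
  "\<langle>i, j\<rangle> = (i \<oplus> j) \<otimes> (i \<oplus> j) \<oplus> i"

definition pfst :: "'n \<Rightarrow> 'n" where
  "pfst p = (THE i. \<exists>j. p = \<langle>i, j\<rangle>)"

definition psnd :: "'n \<Rightarrow> 'n" where
  "psnd p = (THE j. \<exists>i. p = \<langle>i, j\<rangle>)"

text \<open>The functions of one, two and three arguments that exist in the structure.\<close>

definition Fn :: "('n \<Rightarrow> 'n) set" where
  "Fn = {f. {\<langle>i, f i\<rangle> |i. True} \<in> cls M}"

definition Fn2 :: "('n \<Rightarrow> 'n \<Rightarrow> 'n) set" where
  "Fn2 = {f. {\<langle>\<langle>i, j\<rangle>, f i j\<rangle> |i j. True} \<in> cls M}"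

definition Fn3 :: "('n \<Rightarrow> 'n \<Rightarrow> 'n \<Rightarrow> 'n) set" where
  "Fn3 = {f. {\<langle>\<langle>\<langle>i, j\<rangle>, k\<rangle>, f i j k\<rangle> |i j k. True} \<in> cls M}"

text \<open>Goedel's beta function (the remainder of \<open>b\<close> modulo \<open>a * (i + 1) + 1\<close>).  A finite sequence of
  length \<open>l\<close> is given by \<open>a\<close>, \<open>b\<close> and the values for \<open>i < l\<close>.\<close>

definition beta :: "'n \<Rightarrow> 'n \<Rightarrow> 'n \<Rightarrow> 'n" where
  "beta a b i = (THE r. r \<prec> a \<otimes> (i \<oplus> \<one>) \<oplus> \<one> \<and> (\<exists>q. b = q \<otimes> (a \<otimes> (i \<oplus> \<one>) \<oplus> \<one>) \<oplus> r))"

definition pow2 :: "'n \<Rightarrow> 'n" where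
  "pow2 k = (THE y. \<exists>a b. beta a b \<zero> = \<one> \<and>
     (\<forall>i. i \<prec> k \<longrightarrow> beta a b (i \<oplus> \<one>) = num 2 \<otimes> beta a b i) \<and> beta a b k = y)"

text \<open>There is a finite sequence of \<open>c\<close> distinct elements of \<open>P\<close>.  Here \<open>P\<close> may be any definable
  class; it need not belong to \<open>cls\<close>.\<close>

definition card_ge :: "'n set \<Rightarrow> 'n \<Rightarrow> bool" where
  "card_ge P c \<longleftrightarrow> (\<exists>a b. (\<forall>i. i \<prec> c \<longrightarrow> beta a b i \<in> P) \<and>
     (\<forall>i j. i \<prec> c \<and> j \<prec> c \<and> beta a b i = beta a b j \<longrightarrow> i = j))"

section \<open>Rational and real numbers\<close>

text \<open>\<open>rat a b c\<close> codes the rational \<open>(a - b) / c\<close>.  A rational has many codes; the comparisons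
  below are those of the values.\<close>

definition rat :: "'n \<Rightarrow> 'n \<Rightarrow> 'n \<Rightarrow> 'n" where
  "rat a b c = \<langle>\<langle>a, b\<rangle>, c\<rangle>"

definition isQ :: "'n \<Rightarrow> bool" where
  "isQ q \<longleftrightarrow> (\<exists>a b c. c \<noteq> \<zero> \<and> q = rat a b c)"

text \<open>The components of a code: the positive and negative part of the numerator, and the denominator.\<close>

definition qpos :: "'n \<Rightarrow> 'n" where "qpos q = pfst (pfst q)"
definition qneg :: "'n \<Rightarrow> 'n" where "qneg q = psnd (pfst q)"
definition qden :: "'n \<Rightarrow> 'n" where "qden q = psnd q"

definition qnat :: "'n \<Rightarrow> 'n" where
  "qnat n = rat n \<zero> \<one>"

definition qadd :: "'n \<Rightarrow> 'n \<Rightarrow> 'n" (infixl \<open>+\<^sub>Q\<close> 65) where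
  "p +\<^sub>Q q = rat (qpos p \<otimes> qden q \<oplus> qpos q \<otimes> qden p)
                (qneg p \<otimes> qden q \<oplus> qneg q \<otimes> qden p) (qden p \<otimes> qden q)"

definition quminus :: "'n \<Rightarrow> 'n" where
  "quminus q = rat (qneg q) (qpos q) (qden q)"

definition qmul :: "'n \<Rightarrow> 'n \<Rightarrow> 'n" (infixl \<open>*\<^sub>Q\<close> 70) where
  "p *\<^sub>Q q = rat (qpos p \<otimes> qpos q \<oplus> qneg p \<otimes> qneg q)
                (qpos p \<otimes> qneg q \<oplus> qneg p \<otimes> qpos q) (qden p \<otimes> qden q)"

definition qle :: "'n \<Rightarrow> 'n \<Rightarrow> bool" (infix \<open>\<le>\<^sub>Q\<close> 50) where
  "p \<le>\<^sub>Q q \<longleftrightarrow> qpos p \<otimes> qden q \<oplus> qneg q \<otimes> qden p \<preceq> qpos q \<otimes> qden p \<oplus> qneg p \<otimes> qden q"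

definition qlt :: "'n \<Rightarrow> 'n \<Rightarrow> bool" (infix \<open><\<^sub>Q\<close> 50) where
  "p <\<^sub>Q q \<longleftrightarrow> \<not> q \<le>\<^sub>Q p"

definition qmax :: "'n \<Rightarrow> 'n \<Rightarrow> 'n" where
  "qmax p q = (if p \<le>\<^sub>Q q then q else p)"

definition qabs :: "'n \<Rightarrow> 'n" where
  "qabs q = qmax q (quminus q)"

definition posQ :: "'n \<Rightarrow> bool" where
  "posQ q \<longleftrightarrow> isQ q \<and> qnat \<zero> <\<^sub>Q q"

text \<open>\<open>2\<close> to the power \<open>-k\<close>.\<close>

definition qhalf :: "'n \<Rightarrow> 'n" where
  "qhalf k = rat \<one> \<zero> (pow2 k)"

text \<open>Reals are Cauchy sequences of rationals with \<open>|q\<^sub>k - q\<^sub>k\<^sub>+\<^sub>i| \<le> 2\<^sup>-\<^sup>k\<close>.  Equality of reals is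
  the defined relation \<open>=\<^sub>R\<close>, with the bound \<open>2\<^sup>-\<^sup>k\<^sup>+\<^sup>1\<close>, written as a sum.\<close>

definition is_real :: "('n \<Rightarrow> 'n) \<Rightarrow> bool" where
  "is_real x \<longleftrightarrow> x \<in> Fn \<and> (\<forall>k. isQ (x k)) \<and>
     (\<forall>k i. qabs (x k +\<^sub>Q quminus (x (k \<oplus> i))) \<le>\<^sub>Q qhalf k)"

definition req :: "('n \<Rightarrow> 'n) \<Rightarrow> ('n \<Rightarrow> 'n) \<Rightarrow> bool" (infix \<open>=\<^sub>R\<close> 50) where
  "x =\<^sub>R y \<longleftrightarrow> (\<forall>k. qabs (x k +\<^sub>Q quminus (y k)) \<le>\<^sub>Q qhalf k +\<^sub>Q qhalf k)"

definition rle :: "('n \<Rightarrow> 'n) \<Rightarrow> ('n \<Rightarrow> 'n) \<Rightarrow> bool" (infix \<open>\<le>\<^sub>R\<close> 50) where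
  "x \<le>\<^sub>R y \<longleftrightarrow> (\<forall>k. x k \<le>\<^sub>Q y k +\<^sub>Q (qhalf k +\<^sub>Q qhalf k))"

definition rlt :: "('n \<Rightarrow> 'n) \<Rightarrow> ('n \<Rightarrow> 'n) \<Rightarrow> bool" (infix \<open><\<^sub>R\<close> 50) where
  "x <\<^sub>R y \<longleftrightarrow> \<not> y \<le>\<^sub>R x"

definition rconst :: "'n \<Rightarrow> 'n \<Rightarrow> 'n" where
  "rconst q = (\<lambda>k. q)"

definition radd :: "('n \<Rightarrow> 'n) \<Rightarrow> ('n \<Rightarrow> 'n) \<Rightarrow> 'n \<Rightarrow> 'n" (infixl \<open>+\<^sub>R\<close> 65) where
  "x +\<^sub>R y = (\<lambda>k. x (k \<oplus> \<one>) +\<^sub>Q y (k \<oplus> \<one>))"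

definition ruminus :: "('n \<Rightarrow> 'n) \<Rightarrow> 'n \<Rightarrow> 'n" where
  "ruminus x = (\<lambda>k. quminus (x k))"

definition rmax :: "('n \<Rightarrow> 'n) \<Rightarrow> ('n \<Rightarrow> 'n) \<Rightarrow> 'n \<Rightarrow> 'n" where
  "rmax x y = (\<lambda>k. qmax (x k) (y k))"

definition rabs :: "('n \<Rightarrow> 'n) \<Rightarrow> 'n \<Rightarrow> 'n" where
  "rabs x = (\<lambda>k. qabs (x k))"

text \<open>The shift is the least \<open>s\<close> such that the bound \<open>|x\<^sub>0| + |y\<^sub>0| + 2\<close> for
  \<open>|x| + |y|\<close> is at most the \<open>s\<close>-th power of two.\<close>

definition rmul_shift :: "('n \<Rightarrow> 'n) \<Rightarrow> ('n \<Rightarrow> 'n) \<Rightarrow> 'n" where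
  "rmul_shift x y =
     (let P = (\<lambda>s. qabs (x \<zero>) +\<^sub>Q qabs (y \<zero>) +\<^sub>Q qnat (num 2) \<le>\<^sub>Q qnat (pow2 s))
      in (THE s. P s \<and> (\<forall>t. P t \<longrightarrow> s \<preceq> t)))"

definition rmul :: "('n \<Rightarrow> 'n) \<Rightarrow> ('n \<Rightarrow> 'n) \<Rightarrow> 'n \<Rightarrow> 'n" (infixl \<open>*\<^sub>R\<close> 70) where
  "x *\<^sub>R y = (\<lambda>k. x (k \<oplus> rmul_shift x y) *\<^sub>Q y (k \<oplus> rmul_shift x y))"

definition rdiff :: "('n \<Rightarrow> 'n) \<Rightarrow> ('n \<Rightarrow> 'n) \<Rightarrow> 'n \<Rightarrow> 'n" where
  "rdiff x y = rabs (x +\<^sub>R ruminus y)"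

definition rcauchy :: "('n \<Rightarrow> 'n \<Rightarrow> 'n) \<Rightarrow> bool" where
  "rcauchy y \<longleftrightarrow> (\<forall>\<epsilon>. posQ \<epsilon> \<longrightarrow>
     (\<exists>N. \<forall>m n. N \<preceq> m \<and> N \<preceq> n \<longrightarrow> rdiff (y m) (y n) <\<^sub>R rconst \<epsilon>))"

definition rlim :: "('n \<Rightarrow> 'n \<Rightarrow> 'n) \<Rightarrow> ('n \<Rightarrow> 'n) \<Rightarrow> bool" where
  "rlim y z \<longleftrightarrow> (\<forall>\<epsilon>. posQ \<epsilon> \<longrightarrow>
     (\<exists>N. \<forall>n. N \<preceq> n \<longrightarrow> rdiff (y n) z <\<^sub>R rconst \<epsilon>))"

section \<open>Compact separable metric spaces\<close>

text \<open>The space is the completion of the set \<open>A\<close> of ideal points under the pseudometric \<open>d\<close>;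
  \<open>d a b\<close> is (a name of) a real, and its values for arguments outside \<open>A\<close> are irrelevant.\<close>

definition metric_code :: "'n set \<Rightarrow> ('n \<Rightarrow> 'n \<Rightarrow> 'n \<Rightarrow> 'n) \<Rightarrow> bool" where
  "metric_code A d \<longleftrightarrow> A \<in> cls M \<and> A \<noteq> {} \<and> d \<in> Fn3 \<and>
     (\<forall>a\<in>A. \<forall>b\<in>A. is_real (d a b) \<and> rconst (qnat \<zero>) \<le>\<^sub>R d a b \<and> d a b =\<^sub>R d b a) \<and>
     (\<forall>a\<in>A. d a a =\<^sub>R rconst (qnat \<zero>)) \<and>
     (\<forall>a\<in>A. \<forall>b\<in>A. \<forall>c\<in>A. d a c \<le>\<^sub>R d a b +\<^sub>R d b c)"

definition point :: "'n set \<Rightarrow> ('n \<Rightarrow> 'n \<Rightarrow> 'n \<Rightarrow> 'n) \<Rightarrow> ('n \<Rightarrow> 'n) \<Rightarrow> bool" where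
  "point A d x \<longleftrightarrow> x \<in> Fn \<and> (\<forall>k. x k \<in> A) \<and>
     (\<forall>i j. i \<prec> j \<longrightarrow> d (x i) (x j) \<le>\<^sub>R rconst (qhalf i))"

text \<open>The name of the real \<open>lim\<^sub>k d(x\<^sub>k, y\<^sub>k)\<close>; the index shift by 3 gives the rate of
  convergence demanded of reals.  An ideal point \<open>a\<close> is identified with the constant sequence.\<close>

definition dist :: "('n \<Rightarrow> 'n \<Rightarrow> 'n \<Rightarrow> 'n) \<Rightarrow> ('n \<Rightarrow> 'n) \<Rightarrow> ('n \<Rightarrow> 'n) \<Rightarrow> 'n \<Rightarrow> 'n" where
  "dist d x y = (\<lambda>k. d (x (k \<oplus> num 3)) (y (k \<oplus> num 3)) (k \<oplus> num 3))"

definition compact_space :: "'n set \<Rightarrow> ('n \<Rightarrow> 'n \<Rightarrow> 'n \<Rightarrow> 'n) \<Rightarrow> bool" where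
  "compact_space A d \<longleftrightarrow> metric_code A d \<and>
     (\<exists>p\<in>Fn3. \<exists>l\<in>Fn. (\<forall>j i. i \<preceq> l j \<longrightarrow> point A d (p j i)) \<and>
        (\<forall>z j. point A d z \<longrightarrow> (\<exists>i. i \<preceq> l j \<and> dist d (p j i) z <\<^sub>R rconst (qhalf j))))"

text \<open>An open set is coded by a set of triples \<open>(n, a, r)\<close>, the triple standing for the ball with
  center \<open>a\<close> and radius \<open>r\<close>; \<open>n\<close> is a dummy that allows enumerating the balls.  A sequence
  of open sets is coded by a set of pairs.\<close>

definition open_set :: "'n set \<Rightarrow> ('n \<Rightarrow> 'n \<Rightarrow> 'n \<Rightarrow> 'n) \<Rightarrow> 'n set \<Rightarrow> ('n \<Rightarrow> 'n) set" where
  "open_set A d U = {x. point A d x \<and>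
     (\<exists>n a r. \<langle>n, \<langle>a, r\<rangle>\<rangle> \<in> U \<and> a \<in> A \<and> posQ r \<and> dist d (\<lambda>_. a) x <\<^sub>R rconst r)}"

definition section_at :: "'n set \<Rightarrow> 'n \<Rightarrow> 'n set" where
  "section_at G i = {m. \<langle>m, i\<rangle> \<in> G}"

section \<open>Test functions\<close>

text \<open>Test functions are the polynomials, in the lattice-ordered sense, in the distance functions:
  the least class of functions that contains the rational constants and \<open>x \<mapsto> d(a, x)\<close> for
  \<open>a \<in> A\<close> and is closed under sum, product and maximum (hence under minimum and absolute
  value).  They are coded by numbers; all other numbers code the zero function, so that every
  number is a code.\<close>

definition tconst :: "'n \<Rightarrow> 'n" where "tconst q = \<langle>num 0, q\<rangle>"
definition tdist :: "'n \<Rightarrow> 'n" where "tdist a = \<langle>num 1, a\<rangle>"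
definition tadd :: "'n \<Rightarrow> 'n \<Rightarrow> 'n" where "tadd f g = \<langle>num 2, \<langle>f, g\<rangle>\<rangle>"
definition tmul :: "'n \<Rightarrow> 'n \<Rightarrow> 'n" where "tmul f g = \<langle>num 3, \<langle>f, g\<rangle>\<rangle>"
definition tmax :: "'n \<Rightarrow> 'n \<Rightarrow> 'n" where "tmax f g = \<langle>num 4, \<langle>f, g\<rangle>\<rangle>"

definition tsub :: "'n \<Rightarrow> 'n \<Rightarrow> 'n" where
  "tsub f g = tadd f (tmul (tconst (quminus (qnat \<one>))) g)"

definition tabs :: "'n \<Rightarrow> 'n" where
  "tabs f = tmax f (tsub (tconst (qnat \<zero>)) f)"

text \<open>\<open>E\<close> is the sequence of the values at \<open>x\<close> of all test functions, indexed by their codes.  As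
  codes may be nonstandard, the recursion has to take place inside the structure.\<close>

definition is_eval :: "'n set \<Rightarrow> ('n \<Rightarrow> 'n \<Rightarrow> 'n \<Rightarrow> 'n) \<Rightarrow> ('n \<Rightarrow> 'n) \<Rightarrow> ('n \<Rightarrow> 'n \<Rightarrow> 'n) \<Rightarrow> bool" where
  "is_eval A d x E \<longleftrightarrow> E \<in> Fn2 \<and> (\<forall>c. is_real (E c)) \<and>
     (\<forall>q. isQ q \<longrightarrow> E (tconst q) =\<^sub>R rconst q) \<and>
     (\<forall>a\<in>A. E (tdist a) =\<^sub>R dist d (\<lambda>_. a) x) \<and>
     (\<forall>f g. E (tadd f g) =\<^sub>R E f +\<^sub>R E g) \<and>
     (\<forall>f g. E (tmul f g) =\<^sub>R E f *\<^sub>R E g) \<and>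
     (\<forall>f g. E (tmax f g) =\<^sub>R rmax (E f) (E g)) \<and>
     (\<forall>c. (\<forall>q. isQ q \<longrightarrow> c \<noteq> tconst q) \<and> (\<forall>a\<in>A. c \<noteq> tdist a) \<and>
          (\<forall>f g. c \<noteq> tadd f g \<and> c \<noteq> tmul f g \<and> c \<noteq> tmax f g) \<longrightarrow> E c =\<^sub>R rconst (qnat \<zero>))"

text \<open>The value at \<open>x\<close> of the test function with code \<open>c\<close>.  In RCA0 an \<open>E\<close> as above exists and
  is unique up to \<open>=\<^sub>R\<close>; \<open>tval\<close> is only used in contexts invariant under \<open>=\<^sub>R\<close>.\<close>

definition tval :: "'n set \<Rightarrow> ('n \<Rightarrow> 'n \<Rightarrow> 'n \<Rightarrow> 'n) \<Rightarrow> ('n \<Rightarrow> 'n) \<Rightarrow> 'n \<Rightarrow> 'n \<Rightarrow> 'n" where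
  "tval A d x = (SOME E. is_eval A d x E)"

section \<open>Measures and integrable functions\<close>

text \<open>A measure is given by the integrals \<open>I c\<close> of the test functions, a positive linear functional
  with \<open>I 1 = 1\<close>; boundedness with respect to the supremum norm follows.\<close>

definition is_measure :: "'n set \<Rightarrow> ('n \<Rightarrow> 'n \<Rightarrow> 'n \<Rightarrow> 'n) \<Rightarrow> ('n \<Rightarrow> 'n \<Rightarrow> 'n) \<Rightarrow> bool" where
  "is_measure A d I \<longleftrightarrow> I \<in> Fn2 \<and> (\<forall>f. is_real (I f)) \<and>
     (\<forall>f g. I (tadd f g) =\<^sub>R I f +\<^sub>R I g) \<and>
     (\<forall>q f. isQ q \<longrightarrow> I (tmul (tconst q) f) =\<^sub>R rconst q *\<^sub>R I f) \<and>
     (\<forall>f. (\<forall>x. point A d x \<longrightarrow> rconst (qnat \<zero>) \<le>\<^sub>R tval A d x f) \<longrightarrow> rconst (qnat \<zero>) \<le>\<^sub>R I f) \<and>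
     I (tconst (qnat \<one>)) =\<^sub>R rconst (qnat \<one>)"

definition unit_valued :: "'n set \<Rightarrow> ('n \<Rightarrow> 'n \<Rightarrow> 'n \<Rightarrow> 'n) \<Rightarrow> 'n \<Rightarrow> bool" where
  "unit_valued A d h \<longleftrightarrow> (\<forall>x. point A d x \<longrightarrow>
     rconst (qnat \<zero>) \<le>\<^sub>R tval A d x h \<and> tval A d x h \<le>\<^sub>R rconst (qnat \<one>))"

text \<open>For open \<open>G\<close>: the supremum of \<open>I h\<close> over the test functions \<open>0 \<le> h \<le> 1\<close> vanishing
  outside \<open>G\<close> is less than \<open>\<epsilon>\<close>.  The supremum need not exist as a real of the structure.\<close>

definition measure_less :: "'n set \<Rightarrow> ('n \<Rightarrow> 'n \<Rightarrow> 'n \<Rightarrow> 'n) \<Rightarrow> ('n \<Rightarrow> 'n \<Rightarrow> 'n) \<Rightarrow>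
    ('n \<Rightarrow> 'n) set \<Rightarrow> 'n \<Rightarrow> bool" where
  "measure_less A d I G \<epsilon> \<longleftrightarrow> (\<exists>q. isQ q \<and> q <\<^sub>Q \<epsilon> \<and>
     (\<forall>h. unit_valued A d h \<and>
          (\<forall>x. point A d x \<and> x \<notin> G \<longrightarrow> tval A d x h =\<^sub>R rconst (qnat \<zero>)) \<longrightarrow> I h \<le>\<^sub>R rconst q))"

text \<open>\<open>P x\<close> for all points \<open>x\<close> outside some null \<open>G\<^sub>\<delta>\<close> set.\<close>

definition almost_every :: "'n set \<Rightarrow> ('n \<Rightarrow> 'n \<Rightarrow> 'n \<Rightarrow> 'n) \<Rightarrow> ('n \<Rightarrow> 'n \<Rightarrow> 'n) \<Rightarrow>
    (('n \<Rightarrow> 'n) \<Rightarrow> bool) \<Rightarrow> bool" where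
  "almost_every A d I P \<longleftrightarrow> (\<exists>G\<in>cls M.
     (\<forall>\<epsilon>. posQ \<epsilon> \<longrightarrow> (\<exists>i. measure_less A d I (open_set A d (section_at G i)) \<epsilon>)) \<and>
     (\<forall>x. point A d x \<and> \<not> (\<forall>i. x \<in> open_set A d (section_at G i)) \<longrightarrow> P x))"

definition almost_uniformly_cauchy :: "'n set \<Rightarrow> ('n \<Rightarrow> 'n \<Rightarrow> 'n \<Rightarrow> 'n) \<Rightarrow> ('n \<Rightarrow> 'n \<Rightarrow> 'n) \<Rightarrow>
    ('n \<Rightarrow> 'n) \<Rightarrow> bool" where
  "almost_uniformly_cauchy A d I f \<longleftrightarrow> (\<forall>\<mu> \<epsilon>. posQ \<mu> \<and> posQ \<epsilon> \<longrightarrow> (\<exists>n.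
     measure_less A d I
       {x. point A d x \<and> (\<exists>m m'. n \<preceq> m \<and> n \<preceq> m' \<and>
             rconst \<epsilon> <\<^sub>R rdiff (tval A d x (f m)) (tval A d x (f m')))} \<mu>))"

definition l1_name :: "('n \<Rightarrow> 'n \<Rightarrow> 'n) \<Rightarrow> ('n \<Rightarrow> 'n) \<Rightarrow> bool" where
  "l1_name I h \<longleftrightarrow> h \<in> Fn \<and>
     (\<forall>k j. k \<preceq> j \<longrightarrow> I (tabs (tsub (h k) (h j))) <\<^sub>R rconst (qhalf k))"

text \<open>The value of \<open>h\<close> at \<open>x\<close> is defined and equal to \<open>y\<close>.\<close>

definition l1_value :: "'n set \<Rightarrow> ('n \<Rightarrow> 'n \<Rightarrow> 'n \<Rightarrow> 'n) \<Rightarrow> ('n \<Rightarrow> 'n) \<Rightarrow> ('n \<Rightarrow> 'n) \<Rightarrow> ('n \<Rightarrow> 'n) \<Rightarrow> bool" where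
  "l1_value A d h x y \<longleftrightarrow> is_real y \<and> rlim (\<lambda>k. tval A d x (h k)) y"

text \<open>All values \<open>f\<^sub>n(x)\<close> are defined and they form a Cauchy sequence.\<close>

definition l1_cauchy_at :: "'n set \<Rightarrow> ('n \<Rightarrow> 'n \<Rightarrow> 'n \<Rightarrow> 'n) \<Rightarrow> ('n \<Rightarrow> 'n \<Rightarrow> 'n) \<Rightarrow> ('n \<Rightarrow> 'n) \<Rightarrow> bool" where
  "l1_cauchy_at A d f x \<longleftrightarrow> (\<forall>n. \<exists>y. l1_value A d (f n) x y) \<and>
     (\<forall>\<epsilon>. posQ \<epsilon> \<longrightarrow> (\<exists>N. \<forall>m n y z. N \<preceq> m \<and> N \<preceq> n \<and>
        l1_value A d (f m) x y \<and> l1_value A d (f n) x z \<longrightarrow> rdiff y z <\<^sub>R rconst \<epsilon>))"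

text \<open>\<open>|f| \<le> g\<close> as elements of \<open>L\<^sup>1\<close>: the positive part of \<open>|f| - g\<close> has norm 0.\<close>

definition l1_dominated :: "('n \<Rightarrow> 'n \<Rightarrow> 'n) \<Rightarrow> ('n \<Rightarrow> 'n) \<Rightarrow> ('n \<Rightarrow> 'n) \<Rightarrow> bool" where
  "l1_dominated I f g \<longleftrightarrow>
     rlim (\<lambda>k. I (tmax (tsub (tabs (f k)) (g k)) (tconst (qnat \<zero>)))) (rconst (qnat \<zero>))"

text \<open>The name of the real \<open>lim\<^sub>k I (h\<^sub>k)\<close>, the shift by 2 giving the required rate.\<close>

definition l1_integral :: "('n \<Rightarrow> 'n \<Rightarrow> 'n) \<Rightarrow> ('n \<Rightarrow> 'n) \<Rightarrow> 'n \<Rightarrow> 'n" where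
  "l1_integral I h = (\<lambda>k. I (h (k \<oplus> num 2)) (k \<oplus> num 2))"

section \<open>Relative computability\<close>

text \<open>Binary strings are coded by the nonzero numbers: 1 is the empty string, and appending the bit
  \<open>b\<close> to \<open>s\<close> gives \<open>2 * s + b\<close>.\<close>

definition string_length :: "'n \<Rightarrow> 'n \<Rightarrow> bool" where
  "string_length s n \<longleftrightarrow> pow2 n \<preceq> s \<and> s \<prec> pow2 (n \<oplus> \<one>)"

definition prefix :: "'n \<Rightarrow> 'n \<Rightarrow> bool" where
  "prefix s t \<longleftrightarrow> s \<noteq> \<zero> \<and> (\<exists>k v. v \<prec> pow2 k \<and> t = s \<otimes> pow2 k \<oplus> v)"

definition string_bit :: "'n \<Rightarrow> 'n \<Rightarrow> 'n \<Rightarrow> bool" where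
  "string_bit s i b \<longleftrightarrow> (b = \<zero> \<or> b = \<one>) \<and>
     (\<exists>p. string_length p i \<and> prefix (num 2 \<otimes> p \<oplus> b) s)"

text \<open>\<open>s\<close> is an initial segment of the characteristic function of \<open>X\<close>, where \<open>X\<close> may be any
  definable class.\<close>

definition segment_of :: "'n \<Rightarrow> 'n set \<Rightarrow> bool" where
  "segment_of s X \<longleftrightarrow> (\<exists>n. string_length s n \<and>
     (\<forall>i. i \<prec> n \<longrightarrow> string_bit s i (if i \<in> X then \<one> else \<zero>)))"

text \<open>Indices of partial recursive functions with a finite oracle \<open>s\<close>.  The initial functions are
  zero, successor, identity, the two projections from pairs, and the oracle; the closure operations
  are composition, pairing, primitive recursion and minimization.  \<open>justified s H e x y\<close> says that
  \<open>\<phi>\<^sub>e(x) = y\<close> follows in one step from the facts \<open>H\<close>.\<close>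

definition justified :: "'n \<Rightarrow> ('n \<Rightarrow> 'n \<Rightarrow> 'n \<Rightarrow> bool) \<Rightarrow> 'n \<Rightarrow> 'n \<Rightarrow> 'n \<Rightarrow> bool" where
  "justified s H e x y \<longleftrightarrow>
     (e = \<langle>num 0, num 0\<rangle> \<and> y = \<zero>) \<or>
     (e = \<langle>num 0, num 1\<rangle> \<and> y = x \<oplus> \<one>) \<or>
     (e = \<langle>num 0, num 2\<rangle> \<and> y = x) \<or>
     (e = \<langle>num 0, num 3\<rangle> \<and> (\<exists>b. x = \<langle>y, b\<rangle>)) \<or>
     (e = \<langle>num 0, num 4\<rangle> \<and> (\<exists>a. x = \<langle>a, y\<rangle>)) \<or>
     (e = \<langle>num 0, num 5\<rangle> \<and> string_bit s x y) \<or>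
     (\<exists>f g z. e = \<langle>num 1, \<langle>f, g\<rangle>\<rangle> \<and> H g x z \<and> H f z y) \<or>
     (\<exists>f g u v. e = \<langle>num 2, \<langle>f, g\<rangle>\<rangle> \<and> H f x u \<and> H g x v \<and> y = \<langle>u, v\<rangle>) \<or>
     (\<exists>f g a. e = \<langle>num 3, \<langle>f, g\<rangle>\<rangle> \<and> x = \<langle>a, \<zero>\<rangle> \<and> H f a y) \<or>
     (\<exists>f g a n z. e = \<langle>num 3, \<langle>f, g\<rangle>\<rangle> \<and> x = \<langle>a, n \<oplus> \<one>\<rangle> \<and> H e \<langle>a, n\<rangle> z \<and> H g \<langle>a, \<langle>n, z\<rangle>\<rangle> y) \<or>
     (\<exists>f. e = \<langle>num 4, f\<rangle> \<and> H f \<langle>x, y\<rangle> \<zero> \<and> (\<forall>k. k \<prec> y \<longrightarrow> (\<exists>z. z \<noteq> \<zero> \<and> H f \<langle>x, k\<rangle> z)))"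

text \<open>\<open>\<phi>\<^sub>e(x) = y\<close> with oracle \<open>s\<close>: the fact occurs in a finite sequence of facts, each of which
  is justified by earlier ones.\<close>

definition phi :: "'n \<Rightarrow> 'n \<Rightarrow> 'n \<Rightarrow> 'n \<Rightarrow> bool" where
  "phi s e x y \<longleftrightarrow> (\<exists>a b l.
     (\<forall>i. i \<prec> l \<longrightarrow> (\<exists>e' x' y'. beta a b i = \<langle>e', \<langle>x', y'\<rangle>\<rangle> \<and>
        justified s (\<lambda>f u v. \<exists>j. j \<prec> i \<and> beta a b j = \<langle>f, \<langle>u, v\<rangle>\<rangle>) e' x' y')) \<and>
     (\<exists>i. i \<prec> l \<and> beta a b i = \<langle>e, \<langle>x, y\<rangle>\<rangle>))"

text \<open>The jump is a definable class that need not belong to \<open>cls\<close>.\<close>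

definition jump :: "'n set \<Rightarrow> 'n set" where
  "jump X = {e. \<exists>s. segment_of s X \<and> (\<exists>y. phi s e \<zero> y)}"

definition phi_jump :: "'n set \<Rightarrow> 'n \<Rightarrow> 'n \<Rightarrow> 'n \<Rightarrow> bool" where
  "phi_jump X e x y \<longleftrightarrow> (\<exists>s. segment_of s (jump X) \<and> phi s e x y)"

definition binary_tree :: "'n set \<Rightarrow> bool" where
  "binary_tree T \<longleftrightarrow> (\<forall>t\<in>T. t \<noteq> \<zero>) \<and> (\<forall>s t. t \<in> T \<and> prefix s t \<longrightarrow> s \<in> T)"

section \<open>The four principles\<close>

definition two_WWKL :: bool where
  "two_WWKL \<longleftrightarrow> (\<forall>X\<in>cls M. \<forall>e T.
     (\<forall>s. phi_jump X e s \<zero> \<or> phi_jump X e s \<one>) \<and> T = {s. phi_jump X e s \<one>} \<and>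
     binary_tree T \<and> (\<forall>n. \<exists>s\<in>T. string_length s n) \<and>
     (\<exists>\<delta>. posQ \<delta> \<and> (\<forall>n. \<exists>c. card_ge {s \<in> T. string_length s n} c \<and>
                              \<delta> *\<^sub>Q qnat (pow2 n) <\<^sub>Q qnat c)) \<longrightarrow>
     (\<exists>Z\<in>cls M. \<forall>s. segment_of s Z \<longrightarrow> s \<in> T))"

definition ae_cauchy_imp_almost_uniform :: bool where
  "ae_cauchy_imp_almost_uniform \<longleftrightarrow> (\<forall>A d I f.
     compact_space A d \<and> is_measure A d I \<and> f \<in> Fn \<and>
     almost_every A d I (\<lambda>x. rcauchy (\<lambda>n. tval A d x (f n))) \<longrightarrow>
     almost_uniformly_cauchy A d I f)"

definition DCT_star :: bool where
  "DCT_star \<longleftrightarrow> (\<forall>A d I g f.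
     compact_space A d \<and> is_measure A d I \<and> l1_name I g \<and>
     f \<in> Fn2 \<and> (\<forall>n. l1_name I (f n)) \<and> (\<forall>n. l1_dominated I (f n) g) \<and>
     almost_every A d I (l1_cauchy_at A d f) \<longrightarrow>
     rcauchy (\<lambda>n. l1_integral I (f n)))"

definition bounded_convergence :: bool where
  "bounded_convergence \<longleftrightarrow> (\<forall>A d I f.
     compact_space A d \<and> is_measure A d I \<and> f \<in> Fn \<and> (\<forall>n. unit_valued A d (f n)) \<and>
     (\<forall>x. point A d x \<longrightarrow> rcauchy (\<lambda>n. tval A d x (f n))) \<longrightarrow>
     rcauchy (\<lambda>n. I (f n)))"

end

end

theory Submission
  imports Defs "HOL-Computational_Algebra.Fraction_Field"
begin

text \<open>The implications from 2-WWKL rest on a compactness principle: given test functions \<open>u t\<close> and a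
  \<open>\<Pi>\<^sup>0\<^sub>1\<close> property \<open>\<rho>\<close> such that any finite part of the conditions \<open>g \<le> u t\<close>, \<open>\<rho> t\<close>, is satisfied by some
  \<open>g \<le> 1\<close> of integral at least \<open>c\<close>, there is a point where all these \<open>u t\<close> are at least \<open>c / 4\<close>.  To find
  it, split the space by a binary tree of partitions of unity and map the pieces to nested dyadic
  intervals whose lengths approximate their measures.  The expansions of reals in the intervals of
  those pieces that still contain a witness form a tree of positive measure which is recursively
  enumerable, hence many-one reducible to a jump, and a path through it singles out a point.
  Applied to the limit superior of the sets where the sequence still oscillates, the principle
  yields a point of divergence outside a given null set.  Conversely, on the 2-adic integers bounded
  convergence says that clopen sets which eventually miss every point have measure tending to 0.
  This gives the bounding principle for \<open>\<Sigma>\<^sup>0\<^sub>2\<close> formulas and then a path through a tree computable from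
  a jump, by considering the levels of recursive approximations to the tree.\<close>

text \<open>Only Sigma-1 induction is at hand. Strict inequality between reals, values and integrals
  is Sigma-1, so inequalities are proved by Pi-1 induction. Suprema and limits that need not exist
  are replaced by indices from which on little growth remains; being such an index is Pi-1, and this
  is the source of the property \<open>\<rho>\<close> in the compactness principle. A piece contains
  a witness when some ideal point meets finitely many conditions, each a strict inequality or a
  refutation of \<open>\<rho>\<close>: a Sigma-1 statement, so the tree is enumerable but need not
  be decidable. Measures of pieces can only be approximated, hence the interval lengths are integer
  lower estimates. Their scale grows by 4 per level while the number of pieces only doubles, which
  keeps the accumulated losses a bounded fraction. The quarter of \<open>c\<close> pays for these
  losses and for passing from mass to pointwise values. For the converse, a tree computable from a
  jump is a limit of decidable sets, but only string by string; bounding for Sigma-2 formulas makes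
  all strings of one level settle at a common stage, so that its density becomes visible
  there.\<close>

locale rca = L2 M for M :: "'n l2_struct" (structure) +
 assumes RCA0: RCA0
begin

abbreviation plus_number (infixl "+." 65) where "x +. y \<equiv> x \<oplus> y"
abbreviation times_number (infixl "*." 70) where "x *. y \<equiv> x \<otimes> y"
abbreviation less_number (infix "<." 50) where "x <. y \<equiv> x \<prec> y"
abbreviation le_number (infix "<=." 50) where "x <=. y \<equiv> x \<preceq> y"
abbreviation zero_number ("#0") where "#0 \<equiv> \<zero>"
abbreviation one_number ("#1") where "#1 \<equiv> \<one>"
abbreviation number_pair ("<<_,/ _>>") where "<<i, j>> \<equiv> \<langle>i, j\<rangle>"

section \<open>Arithmetic and order of the number sort\<close>

lemma basic: basic_axioms
 using RCA0 by (simp add: RCA0_def)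

lemma plus_zero [simp]: "m +. #0 = m"
 and plus_Suc: "m +. (n +. #1) = m +. n +. #1"
 and times_zero [simp]: "m *. #0 = #0"
 and times_Suc: "m *. (n +. #1) = m *. n +. m"
 and not_lt_zero [simp]: "~ m <. #0"
 and lt_Suc: "m <. n +. #1 \<longleftrightarrow> m <. n \<or> m = n"
 and Suc_neq_zero [simp]: "n +. #1 ~= #0"
 and Suc_inject: "m +. #1 = n +. #1 ==> m = n"
 using basic unfolding basic_axioms_def by blast+

lemma induct_bfm:
 assumes "!!n. P n \<longleftrightarrow> sigma1 E e \<theta> n" "range E \<subseteq> cls M"
  and "P #0" "!!n. P n ==> P (n +. #1)"
 shows "P n"
proof -
 have sigma1_induction using RCA0 by (simp add: RCA0_def)
 then show ?thesis using assms unfolding sigma1_induction_def by metis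
qed

text \<open>The arithmetic below speaks of no sets, but an environment must send every set variable
  into \<open>cls\<close>; all of them denote one arbitrary member.\<close>

lemma induct_bfm0:
 assumes "!!n. P n \<longleftrightarrow> (EX m. bsat (%_. SOME X. X \<in> cls M) (case_nat m (case_nat n e)) \<theta>)"
  and "P #0" "!!n. P n ==> P (n +. #1)"
 shows "P n"
proof (rule induct_bfm[of P "%_. SOME X. X \<in> cls M" e \<theta>])
 have "cls M ~= {}" using RCA0 by (simp add: RCA0_def)
 then show "range (%_::nat. SOME X. X \<in> cls M) \<subseteq> cls M" by (auto simp: some_in_eq)
qed (use assms in \<open>auto simp: sigma1_def\<close>)

abbreviation env2 :: "'n => 'n => nat => 'n" where
 "env2 a b \<equiv> case_nat a (case_nat b (%_. #0))"

lemma add_assoc': "a +. b +. c = a +. (b +. c)"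
 by (rule induct_bfm0[where n = c and e = "env2 a b" and \<theta> = "Eq
    (TAdd (TAdd (TVar 2) (TVar 3)) (TVar 1)) (TAdd (TVar 2) (TAdd (TVar 3) (TVar 1)))"])
   (simp_all add: eval_nat_numeral plus_Suc)

lemma zero_plus: "#0 +. a = a"
 by (rule induct_bfm0[where n = a and e = "env2 a a" and \<theta> = "Eq (TAdd TZero (TVar 1)) (TVar 1)"])
   (simp_all add: eval_nat_numeral plus_Suc)

lemma times_one: "a *. #1 = a"
 using times_Suc[of a \<zero>] by (simp add: zero_plus)

lemma Suc_plus: "a +. #1 +. b = a +. b +. #1"
 by (rule induct_bfm0[where n = b and e = "env2 a a" and \<theta> = "Eq
    (TAdd (TAdd (TVar 2) TOne) (TVar 1)) (TAdd (TAdd (TVar 2) (TVar 1)) TOne)"])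
   (simp_all add: eval_nat_numeral plus_Suc)

lemma add_commute': "a +. b = b +. a"
 by (rule induct_bfm0[where n = b and e = "env2 a a" and \<theta> = "Eq
    (TAdd (TVar 2) (TVar 1)) (TAdd (TVar 1) (TVar 2))"])
   (simp_all add: eval_nat_numeral plus_Suc zero_plus Suc_plus)

lemma add_left_commute': "a +. (b +. c) = b +. (a +. c)"
 by (metis add_assoc' add_commute')

lemmas add_ac' = add_assoc' add_commute' add_left_commute'

lemma add_cancel': "a +. c = b +. c ==> a = b"
 by (erule rev_mp, rule induct_bfm0[where n = c and e = "env2 a b" and \<theta> = "Neg (Conj (Eq
    (TAdd (TVar 2) (TVar 1)) (TAdd (TVar 3) (TVar 1))) (Neg (Eq (TVar 2) (TVar 3))))"])
   (auto simp add: eval_nat_numeral plus_Suc dest: Suc_inject)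

lemma zero_times: "#0 *. a = #0"
 by (rule induct_bfm0[where n = a and e = "env2 a a" and \<theta> = "Eq (TMul TZero (TVar 1)) TZero"])
   (simp_all add: eval_nat_numeral times_Suc)

lemma Suc_times: "(a +. #1) *. b = a *. b +. b"
 by (rule induct_bfm0[where n = b and e = "env2 a a" and \<theta> = "Eq
    (TMul (TAdd (TVar 2) TOne) (TVar 1)) (TAdd (TMul (TVar 2) (TVar 1)) (TVar 1))"])
   (simp_all add: eval_nat_numeral times_Suc add_ac')

lemma mult_commute': "a *. b = b *. a"
 by (rule induct_bfm0[where n = b and e = "env2 a a" and \<theta> = "Eq
    (TMul (TVar 2) (TVar 1)) (TMul (TVar 1) (TVar 2))"])
   (simp_all add: eval_nat_numeral times_Suc zero_times Suc_times)

lemma distrib': "a *. (b +. c) = a *. b +. a *. c"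
 by (rule induct_bfm0[where n = c and e = "env2 a b" and \<theta> = "Eq
    (TMul (TVar 2) (TAdd (TVar 3) (TVar 1))) (TAdd (TMul (TVar 2) (TVar 3)) (TMul (TVar 2) (TVar 1)))"])
   (simp_all add: eval_nat_numeral times_Suc flip: add_assoc')

lemma mult_assoc': "a *. b *. c = a *. (b *. c)"
 by (rule induct_bfm0[where n = c and e = "env2 a b" and \<theta> = "Eq
    (TMul (TMul (TVar 2) (TVar 3)) (TVar 1)) (TMul (TVar 2) (TMul (TVar 3) (TVar 1)))"])
   (simp_all add: eval_nat_numeral times_one distrib')

lemma one_times: "#1 *. a = a"
 by (metis mult_commute' times_Suc times_zero zero_plus)

lemma zero_or_Suc: "a = #0 \<or> (EX b. a = b +. #1)"
 by (rule induct_bfm0[where n = a and e = "env2 a a" and \<theta> = "Neg (Conj (Neg (Eq (TVar 1) TZero))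
    (Neg (Eq (TVar 1) (TAdd (TVar 0) TOne))))"])
   (auto simp: eval_nat_numeral)

text \<open>The difference \<open>c\<close> is the unbounded witness in a Sigma-1 induction on
  \<open>b\<close>; it takes the place of subtraction.\<close>

lemma lt_imp_plus:
 assumes "a <. b" shows "EX c. b = a +. (c +. #1)"
proof -
 have "EX c. a <. b --> b = a +. (c +. #1)"
 proof (rule induct_bfm0[where n = b and e = "env2 a a" and \<theta> = "Neg (Conj (Less (TVar 2) (TVar 1))
    (Neg (Eq (TVar 1) (TAdd (TVar 2) (TAdd (TVar 0) TOne)))))"])
  show "EX c. a <. n +. #1 --> n +. #1 = a +. (c +. #1)" if "EX c. a <. n --> n = a +. (c +. #1)" for n
   using that by (metis lt_Suc plus_Suc plus_zero)
 qed (auto simp: eval_nat_numeral)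
 then show ?thesis using assms by blast
qed

lemma lt_plus_Suc: "a <. a +. (c +. #1)"
 by (rule induct_bfm0[where n = c and e = "env2 a a" and \<theta> = "Less (TVar 2) (TAdd (TVar 2) (TAdd (TVar 1) TOne))"])
   (auto simp: eval_nat_numeral lt_Suc plus_Suc)

lemma lt_iff: "a <. b \<longleftrightarrow> (EX c. b = a +. (c +. #1))"
 using lt_imp_plus lt_plus_Suc by blast

lemma lt_irrefl' [simp]: "~ a <. a"
proof
 assume "a <. a"
 then obtain c where "a = a +. (c +. #1)" by (auto simp: lt_iff)
 then have "#0 +. a = (c +. #1) +. a" by (simp add: zero_plus add_ac')
 then show False by (metis Suc_neq_zero add_cancel')
qed

lemma lt_trans':
 assumes "a <. b" "b <. c" shows "a <. c"
proof -
 obtain d e where "b = a +. (d +. #1)" "c = b +. (e +. #1)" using lt_iff assms by blast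
 then have "c = a +. (d +. #1 +. e +. #1)" by (simp add: add_ac')
 then show ?thesis by (simp add: lt_plus_Suc)
qed

lemma zero_lt_iff: "#0 <. a \<longleftrightarrow> a ~= #0"
proof
 assume "a ~= #0"
 then obtain b where "a = b +. #1" using zero_or_Suc by blast
 then have "a = #0 +. (b +. #1)" by (simp add: zero_plus)
 then show "#0 <. a" by (metis lt_plus_Suc)
qed auto

lemma lt_linear: "a <. b \<or> a = b \<or> b <. a"
proof (rule induct_bfm0[where P = "%b. a <. b \<or> a = b \<or> b <. a" and n = b and e = "env2 a a" and \<theta> = "Neg (Conj (Neg (Less (TVar 2) (TVar 1)))
    (Conj (Neg (Eq (TVar 2) (TVar 1))) (Neg (Less (TVar 1) (TVar 2)))))"])
 show "a <. n +. #1 \<or> a = n +. #1 \<or> n +. #1 <. a" if "a <. n \<or> a = n \<or> n <. a" for n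
 proof -
  have "a = n +. #1 \<or> n +. #1 <. a" if na: "n <. a"
  proof -
   obtain c where c: "a = n +. (c +. #1)" using lt_imp_plus[OF na] by blast
   from zero_or_Suc[of c] show ?thesis
   proof
    assume "c = #0" then show ?thesis using c by (simp add: zero_plus)
   next
    assume "EX b. c = b +. #1"
    then obtain b where "c = b +. #1" by blast
    then have "a = n +. #1 +. (b +. #1)" using c Suc_plus[of n "b +. #1"] plus_Suc[of n "b +. #1"] by simp
    then show ?thesis by (simp add: lt_plus_Suc)
   qed
  qed
  then show ?thesis using that by (auto simp: lt_Suc)
 qed
qed (auto simp: eval_nat_numeral zero_lt_iff)

lemma lt_add_mono: "a <. b ==> a +. c <. b +. c"
proof -
 assume "a <. b"
 then obtain d where "b = a +. (d +. #1)" using lt_iff by blast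
 then have "b +. c = a +. c +. (d +. #1)" by (simp add: add_ac')
 then show ?thesis by (simp add: lt_plus_Suc)
qed

lemma lt_mult_mono:
 assumes "a <. b" "#0 <. c" shows "c *. a <. c *. b"
proof -
 obtain d where d: "b = a +. (d +. #1)" using lt_imp_plus[OF assms(1)] by blast
 obtain e where e: "c = e +. #1" using zero_or_Suc[of c] assms by auto
 have "c *. b = c *. a +. (c *. d +. e +. #1)"
  unfolding d distrib' times_one by (simp add: e add_assoc')
 then show ?thesis by (simp add: lt_plus_Suc)
qed

end

section \<open>The ordered ring of differences of an ordered semiring\<close>

class osemiring = comm_semiring_1 + linorder +
 assumes osr_cancel: "a + c = b + c ==> a = b"
  and osr_add: "a < b ==> a + c < b + c"
  and osr_mult: "a < b ==> 0 < c ==> c * a < c * b"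
  and osr_diff: "a < b ==> EX c. 0 < c & b = a + c"
begin

lemma osr_less_iff: "a + c < b + c \<longleftrightarrow> a < b"
 using osr_add by (metis local.less_asym local.neqE)

end

quotient_type (overloaded) 'a gint = "'a::osemiring \<times> 'a" / "%(x, y) (u, v). x + v = u + y"
 morphisms rep_gint Gint
proof (rule equivpI)
 show "reflp (%(x, y) (u, v). x + v = u + (y::'a))" by (auto simp: reflp_def)
 show "symp (%(x, y) (u, v). x + v = u + (y::'a))" by (auto simp: symp_def)
 show "transp (%(x, y) (u, v). x + v = u + (y::'a))"
 proof (rule transpI, clarify)
  fix a b c d e f :: 'a
  assume "a + d = c + b" "c + f = e + d"
  then have "(a + f) + (c + d) = (e + b) + (c + d)"
   by (metis (no_types, lifting) add.assoc add.commute)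
  then show "a + f = e + b" by (rule osr_cancel)
 qed
qed

instantiation gint :: (osemiring) comm_ring_1
begin

lift_definition zero_gint :: "'a gint" is "(0, 0)" .
lift_definition one_gint :: "'a gint" is "(1, 0)" .

lift_definition plus_gint :: "'a gint => 'a gint => 'a gint" is "%(x, y) (u, v). (x + u, y + v)"
 by clarsimp (metis (no_types, lifting) add.assoc add.commute)

lift_definition uminus_gint :: "'a gint => 'a gint" is "%(x, y). (y, x)"
 by (clarsimp simp: add.commute)

lift_definition minus_gint :: "'a gint => 'a gint => 'a gint" is "%(x, y) (u, v). (x + v, y + u)"
 by clarsimp (metis (no_types, lifting) add.assoc add.commute)

lift_definition times_gint :: "'a gint => 'a gint => 'a gint"
 is "%(x, y) (u, v). (x * u + y * v, x * v + y * u)"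
proof (clarsimp)
 fix s t u v w x y z :: 'a
 assume 1: "s + v = u + t" and 2: "w + z = y + x"
 have "(s * w + t * x + (u * z + v * y)) + (v * w + u * x)
   = (s + v) * w + (u + t) * x + u * z + v * y"
  by (simp add: algebra_simps)
 also have "\<dots> = (u + t) * w + (s + v) * x + u * z + v * y"
  using 1 by simp
 also have "\<dots> = t * w + s * x + u * (w + z) + v * (y + x)"
  by (simp add: algebra_simps)
 also have "\<dots> = t * w + s * x + u * (y + x) + v * (w + z)"
  using 2 by simp
 also have "\<dots> = (u * y + v * z + (s * x + t * w)) + (v * w + u * x)"
  by (simp add: algebra_simps)
 finally show "s * w + t * x + (u * z + v * y) = u * y + v * z + (s * x + t * w)"
  by (rule osr_cancel)
qed

instance
 by standard (transfer; clarsimp simp: algebra_simps)+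

end

instantiation gint :: (osemiring) linordered_idom
begin

lift_definition less_gint :: "'a gint => 'a gint => bool" is "%(x, y) (u, v). x + v < u + y"
proof (clarsimp)
 fix a b c d e f g h :: 'a
 assume 1: "a + d = c + b" and 2: "e + h = g + f"
 have "a + f < e + b \<longleftrightarrow> (a + f) + (d + h) < (e + b) + (d + h)" by (simp add: osr_less_iff)
 also have "(a + f) + (d + h) = (a + d) + (f + h)" by (simp add: algebra_simps)
 also have "(e + b) + (d + h) = (e + h) + (b + d)" by (simp add: algebra_simps)
 also have "(a + d) + (f + h) = (c + h) + (b + f)" unfolding 1 by (simp add: algebra_simps)
 also have "(e + h) + (b + d) = (g + d) + (b + f)" unfolding 2 by (simp add: algebra_simps)
 also have "(c + h) + (b + f) < (g + d) + (b + f) \<longleftrightarrow> c + h < g + d" by (simp add: osr_less_iff)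
 finally show "(a + f < e + b) = (c + h < g + d)" .
qed

definition "x <= y \<longleftrightarrow> x < y \<or> x = (y :: 'a gint)"
definition "\<bar>x\<bar> = (if x < 0 then - x else (x :: 'a gint))"
definition "sgn x = (if x = 0 then 0 else if 0 < x then 1 else - (1 :: 'a gint))"

instance
proof
 fix x y z :: "'a gint"
 have irr: "~ x < x" for x :: "'a gint" by transfer auto
 have tr: "x < z" if "x < y" "y < z" for x y z :: "'a gint"
  using that
 proof (transfer, clarify)
  fix a b c d e f :: 'a
  assume "a + d < c + b" "c + f < e + d"
  then have "(a + d) + (c + f) < (c + b) + (e + d)"
   by (metis osr_add add.commute less_trans)
  then have "(a + f) + (c + d) < (e + b) + (c + d)" by (simp add: algebra_simps)
  then show "a + f < e + b" by (simp only: osr_less_iff)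
 qed
 show "x <= x" by (simp add: less_eq_gint_def)
 show "(x < y) = (x <= y & ~ y <= x)" unfolding less_eq_gint_def by (metis irr tr)
 show "x <= z" if "x <= y" "y <= z" using that unfolding less_eq_gint_def using tr by blast
 show "x = y" if "x <= y" "y <= x" using that unfolding less_eq_gint_def using irr tr by blast
 show "x <= y \<or> y <= x" unfolding less_eq_gint_def by transfer auto
 have less_add: "x < y ==> z + x < z + y" for x y z :: "'a gint"
 proof (transfer, clarify)
  fix a b c d e f :: 'a
  assume "a + d < c + b"
  then have "(a + d) + (e + f) < (c + b) + (e + f)" by (simp add: osr_less_iff)
  then show "e + a + (f + d) < e + c + (f + b)" by (simp add: algebra_simps)
 qed
 show "x <= y ==> z + x <= z + y" unfolding less_eq_gint_def using less_add by blast
 show "z * x < z * y" if "x < y" "0 < z"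
  using that
 proof (transfer, clarsimp)
  fix a b c d e f :: 'a
  assume 1: "a + d < c + b" and 2: "f < e"
  \<comment> \<open>The positive factor is a difference of two semiring elements; subtraction in the
    semiring turns it into a single positive \<open>k\<close>, to which monotonicity there
    applies.\<close>
  obtain k where k: "0 < k" "e = f + k" using osr_diff[OF 2] by blast
  have "k * (a + d) < k * (c + b)" using 1 k(1) by (rule osr_mult)
  then have "k * (a + d) + (f * a + f * b + f * c + f * d) < k * (c + b) + (f * a + f * b + f * c + f * d)"
   by (simp only: osr_less_iff)
  then show "e * a + f * b + (e * d + f * c) < e * c + f * d + (e * b + f * a)"
   unfolding k(2) by (simp add: algebra_simps)
 qed
qed (simp_all add: abs_gint_def sgn_gint_def)

end

lift_definition gint_of :: "'a::osemiring => 'a gint" is "%x. (x, 0)" .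

lemma gint_of_0: "gint_of 0 = 0" and gint_of_1: "gint_of 1 = 1"
 and gint_of_add: "gint_of (x + y) = gint_of x + gint_of y"
 and gint_of_mult: "gint_of (x * y) = gint_of x * gint_of y"
 and gint_of_less: "gint_of x < gint_of y \<longleftrightarrow> x < y"
 by (transfer, simp)+

lemma gint_diff: "EX a b. x = gint_of a - gint_of b"
 by transfer auto

section \<open>Completion of an ordered field\<close>

text \<open>The index set is the field itself. The field may be non-Archimedean, and then sequences
  indexed by \<open>nat\<close> cannot be expected to reach all errors, whereas the field is cofinal
  in itself.\<close>

definition cauchy_net :: "('a::linordered_field => 'a) => bool" where
 "cauchy_net X \<longleftrightarrow> (\<forall>e>0. EX N. \<forall>m\<ge>N. \<forall>n\<ge>N. \<bar>X m - X n\<bar> < e)"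

definition null_net :: "('a::linordered_field => 'a) => bool" where
 "null_net X \<longleftrightarrow> (\<forall>e>0. EX N. \<forall>n\<ge>N. \<bar>X n\<bar> < e)"

lemma cauchy_net_const: "cauchy_net (%_. c)"
 by (auto simp: cauchy_net_def)

lemma null_net_0: "null_net (%_. 0)"
 by (auto simp: null_net_def)

lemma cauchy_net_add:
 assumes "cauchy_net X" "cauchy_net Y" shows "cauchy_net (%n. X n + Y n)"
 unfolding cauchy_net_def
proof (intro allI impI)
 fix e :: 'a assume "0 < e"
 then have "0 < e / 2" by simp
 obtain N1 where 1: "!!m n. m \<ge> N1 ==> n \<ge> N1 ==> \<bar>X m - X n\<bar> < e / 2"
  using assms(1) \<open>0 < e / 2\<close> unfolding cauchy_net_def by meson
 obtain N2 where 2: "!!m n. m \<ge> N2 ==> n \<ge> N2 ==> \<bar>Y m - Y n\<bar> < e / 2"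
  using assms(2) \<open>0 < e / 2\<close> unfolding cauchy_net_def by meson
 have "\<bar>(X m + Y m) - (X n + Y n)\<bar> < e" if "m \<ge> max N1 N2" "n \<ge> max N1 N2" for m n
 proof -
   have a: "\<bar>X m - X n\<bar> < e / 2" using 1[of m n] that by simp
   have b: "\<bar>Y m - Y n\<bar> < e / 2" using 2[of m n] that by simp
   show ?thesis using a b by linarith
  qed
 then show "EX N. \<forall>m\<ge>N. \<forall>n\<ge>N. \<bar>(X m + Y m) - (X n + Y n)\<bar> < e" by blast
qed

lemma null_net_add:
 assumes "null_net X" "null_net Y" shows "null_net (%n. X n + Y n)"
 unfolding null_net_def
proof (intro allI impI)
 fix e :: 'a assume "0 < e"
 then have "0 < e / 2" by simp
 obtain N1 where 1: "!!n. n \<ge> N1 ==> \<bar>X n\<bar> < e / 2"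
  using assms(1) \<open>0 < e / 2\<close> unfolding null_net_def by meson
 obtain N2 where 2: "!!n. n \<ge> N2 ==> \<bar>Y n\<bar> < e / 2"
  using assms(2) \<open>0 < e / 2\<close> unfolding null_net_def by meson
 have "\<bar>X n + Y n\<bar> < e" if "n \<ge> max N1 N2" for n
 proof -
   have a: "\<bar>X n\<bar> < e / 2" using 1[of n] that by simp
   have b: "\<bar>Y n\<bar> < e / 2" using 2[of n] that by simp
   show ?thesis using a b by linarith
  qed
 then show "EX N. \<forall>n\<ge>N. \<bar>X n + Y n\<bar> < e" by blast
qed

lemma cauchy_net_minus: "cauchy_net X ==> cauchy_net (%n. - X n)"
 unfolding cauchy_net_def by (simp add: abs_minus_commute)

lemma null_net_minus: "null_net X ==> null_net (%n. - X n)"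
 unfolding null_net_def by simp

lemma cauchy_net_bound:
 assumes "cauchy_net X" obtains B N where "0 < B" "!!n. n \<ge> N ==> \<bar>X n\<bar> < B"
proof -
 obtain N where N: "!!m n. m \<ge> N ==> n \<ge> N ==> \<bar>X m - X n\<bar> < 1"
  using assms zero_less_one unfolding cauchy_net_def by meson
 have "\<bar>X n\<bar> < 1 + \<bar>X N\<bar>" if "n \<ge> N" for n
  using N[of n N] that by linarith
 moreover have "0 < 1 + \<bar>X N\<bar>" by linarith
 ultimately show thesis using that by blast
qed

lemma null_net_mult:
 assumes "cauchy_net X" "null_net Y" shows "null_net (%n. X n * Y n)"
 unfolding null_net_def
proof (intro allI impI)
 fix e :: 'a assume "0 < e"
 obtain B N where B: "0 < B" "!!n. n \<ge> N ==> \<bar>X n\<bar> < B" using cauchy_net_bound[OF assms(1)] by blast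
 obtain N2 where 2: "!!n. n \<ge> N2 ==> \<bar>Y n\<bar> < e / B"
  using assms(2) B(1) \<open>0 < e\<close> unfolding null_net_def by (meson divide_pos_pos)
 have "\<bar>X n * Y n\<bar> < e" if "n \<ge> max N N2" for n
 proof -
  have "\<bar>X n\<bar> * \<bar>Y n\<bar> < B * (e / B)"
   using B 2 that by (intro mult_strict_mono) auto
  then show ?thesis using B(1) by (simp add: abs_mult)
 qed
 then show "EX N. \<forall>n\<ge>N. \<bar>X n * Y n\<bar> < e" by blast
qed

lemma cauchy_net_mult:
 assumes "cauchy_net X" "cauchy_net Y" shows "cauchy_net (%n. X n * Y n)"
 unfolding cauchy_net_def
proof (intro allI impI)
 fix e :: 'a assume "0 < e"
 obtain A N1 where A: "0 < A" "!!n. n \<ge> N1 ==> \<bar>X n\<bar> < A" using cauchy_net_bound[OF assms(1)] by blast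
 obtain B N2 where B: "0 < B" "!!n. n \<ge> N2 ==> \<bar>Y n\<bar> < B" using cauchy_net_bound[OF assms(2)] by blast
 have p: "0 < e / (2 * A)" "0 < e / (2 * B)" using A B \<open>0 < e\<close> by auto
 obtain N3 where 3: "!!m n. m \<ge> N3 ==> n \<ge> N3 ==> \<bar>X m - X n\<bar> < e / (2 * B)"
  using assms(1) p unfolding cauchy_net_def by meson
 obtain N4 where 4: "!!m n. m \<ge> N4 ==> n \<ge> N4 ==> \<bar>Y m - Y n\<bar> < e / (2 * A)"
  using assms(2) p unfolding cauchy_net_def by meson
 have "\<bar>X m * Y m - X n * Y n\<bar> < e"
  if "m \<ge> max (max N1 N2) (max N3 N4)" "n \<ge> max (max N1 N2) (max N3 N4)" for m n
 proof -
  have "\<bar>X m\<bar> * \<bar>Y m - Y n\<bar> < A * (e / (2 * A))"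
   using A 4 that by (intro mult_strict_mono) auto
  moreover have "\<bar>X m - X n\<bar> * \<bar>Y n\<bar> < e / (2 * B) * B"
   using B 3 p that by (intro mult_strict_mono) auto
  moreover have "\<bar>X m * Y m - X n * Y n\<bar> <= \<bar>X m\<bar> * \<bar>Y m - Y n\<bar> + \<bar>X m - X n\<bar> * \<bar>Y n\<bar>"
   using abs_triangle_ineq[of "X m * (Y m - Y n)" "(X m - X n) * Y n"]
   unfolding abs_mult[symmetric] by (simp add: algebra_simps)
  moreover have "A * (e / (2 * A)) = e / 2" "e / (2 * B) * B = e / 2" using A B by auto
  ultimately show ?thesis by (simp add: field_simps)
 qed
 then show "EX N. \<forall>m\<ge>N. \<forall>n\<ge>N. \<bar>X m * Y m - X n * Y n\<bar> < e" by blast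
qed

definition same_net :: "('a::linordered_field => 'a) => ('a => 'a) => bool" where
 "same_net X Y \<longleftrightarrow> cauchy_net X & cauchy_net Y & null_net (%n. X n - Y n)"

lemma same_netI: "cauchy_net X ==> X = Y ==> same_net X Y"
 by (simp add: same_net_def null_net_0)

lemma same_net_sym: "same_net X Y ==> same_net Y X"
 unfolding same_net_def using null_net_minus by force

quotient_type (overloaded) 'a completion = "'a::linordered_field => 'a" / partial: same_net
 morphisms rep_completion Lim
proof (rule part_equivpI)
 show "\<exists>X::'a => 'a. same_net X X" by (rule exI[of _ "%_. 0"]) (simp add: same_netI cauchy_net_const)
 show "symp (same_net :: ('a => 'a) => _)" by (simp add: symp_def same_net_sym)
 show "transp (same_net :: ('a => 'a) => _)"
  unfolding same_net_def by (rule transpI) (auto dest: null_net_add)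
qed

instantiation completion :: (linordered_field) comm_ring_1
begin

lift_definition zero_completion :: "'a completion" is "%_. 0"
 by (simp add: same_netI cauchy_net_const)

lift_definition one_completion :: "'a completion" is "%_. 1"
 by (simp add: same_netI cauchy_net_const)

lift_definition plus_completion :: "'a completion => 'a completion => 'a completion" is "%X Y n. X n + Y n"
 unfolding same_net_def
 using null_net_add by (fastforce simp: cauchy_net_add algebra_simps)

lift_definition uminus_completion :: "'a completion => 'a completion" is "%X n. - X n"
 unfolding same_net_def
 using null_net_minus by (fastforce simp: cauchy_net_minus)

lift_definition times_completion :: "'a completion => 'a completion => 'a completion" is "%X Y n. X n * Y n"
proof -
 fix X X' Y Y' :: "'a => 'a"
 assume 1: "same_net X X'" and 2: "same_net Y Y'"
 have "null_net (%n. X n * (Y n - Y' n) + Y' n * (X n - X' n))"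
  using 1 2 by (intro null_net_add null_net_mult) (auto simp: same_net_def)
 then show "same_net (%n. X n * Y n) (%n. X' n * Y' n)"
  using 1 2 by (auto simp: same_net_def cauchy_net_mult algebra_simps)
qed

definition "x - y = x + - (y :: 'a completion)"

instance
proof
 show "a - b = a + - b" for a b :: "'a completion" by (rule minus_completion_def)
 show "(0::'a completion) ~= 1"
  by transfer (auto simp: same_net_def null_net_def intro: exI[of _ 1])
qed (transfer; rule same_netI; auto simp: same_net_def cauchy_net_add cauchy_net_mult cauchy_net_const
    cauchy_net_minus algebra_simps)+

end

text \<open>Positivity with a fixed margin \<open>r\<close>, so that adding a null net cannot
  destroy it.\<close>

lift_definition pos_net :: "'a::linordered_field completion => bool"
 is "%X. \<exists>r>0. EX N. \<forall>n\<ge>N. r < X n"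
proof -
 have 1: "\<exists>r>0. EX N. \<forall>n\<ge>N. r < Y n"
  if *: "same_net X Y" and **: "\<exists>r>0. EX N. \<forall>n\<ge>N. r < X n" for X Y :: "'a => 'a"
 proof -
  obtain r N where r: "0 < r" "!!n. n \<ge> N ==> r < X n" using ** by blast
  then have "0 < r / 2" by simp
  then obtain N2 where 2: "!!n. n \<ge> N2 ==> \<bar>X n - Y n\<bar> < r / 2"
   using * unfolding same_net_def null_net_def by meson
  have "r / 2 < Y n" if "n \<ge> max N N2" for n
   proof -
   have a: "r < X n" using r(2)[of n] that by simp
   have b: "\<bar>X n - Y n\<bar> < r / 2" using 2[of n] that by simp
   show ?thesis using a b by linarith
  qed
  then show ?thesis using \<open>0 < r / 2\<close> by blast
 qed
 show "same_net X Y ==> (\<exists>r>0. EX N. \<forall>n\<ge>N. r < X n) \<longleftrightarrow> (\<exists>r>0. EX N. \<forall>n\<ge>N. r < Y n)" for X Y :: "'a => 'a"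
  using 1 same_net_sym by blast
qed

lemma pos_net_add: "pos_net x ==> pos_net y ==> pos_net (x + y)"
proof (transfer, clarify)
 fix X Y :: "'a => 'a" and r s N N'
 assume "0 < r" "\<forall>n\<ge>N. r < X n" "0 < s" "\<forall>n\<ge>N'. s < Y n"
 then have "0 < r + s" "\<forall>n\<ge>max N N'. r + s < X n + Y n" by (auto intro: add_strict_mono)
 then show "\<exists>r>0. EX N. \<forall>n\<ge>N. r < X n + Y n" by blast
qed

lemma pos_net_mult: "pos_net x ==> pos_net y ==> pos_net (x * y)"
proof (transfer, clarify)
 fix X Y :: "'a => 'a" and r s N N'
 assume "0 < r" "\<forall>n\<ge>N. r < X n" "0 < s" "\<forall>n\<ge>N'. s < Y n"
 then have "0 < r * s" "\<forall>n\<ge>max N N'. r * s < X n * Y n" by (auto intro!: mult_strict_mono dest: order.strict_trans)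
 then show "\<exists>r>0. EX N. \<forall>n\<ge>N. r < X n * Y n" by blast
qed

lemma not_pos_net_0: "~ pos_net 0"
 by transfer auto

text \<open>A Cauchy net that is not null has a value of size at least \<open>e\<close> at an index
  \<open>m\<close> so late that all later values differ from it by less than \<open>e / 2\<close>;
  they all share the sign of \<open>X m\<close>.\<close>

lemma pos_net_cases: "pos_net x \<or> x = 0 \<or> pos_net (- x)"
proof (transfer, rule disjCI)
 fix X :: "'a => 'a"
 assume X: "same_net X X" and "~ (same_net X (%_. 0) \<or> (\<exists>r>0. EX N. \<forall>n\<ge>N. r < - X n))"
 then have n1: "~ (\<exists>r>0. EX N. \<forall>n\<ge>N. r < - X n)" and n2: "~ same_net X (%_. 0)" by blast+
 from X have c: "cauchy_net X" by (simp add: same_net_def)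
 with n2 have "~ null_net X" by (simp add: same_net_def cauchy_net_const)
 then obtain e where e: "0 < e" "!!N. \<exists>n\<ge>N. e <= \<bar>X n\<bar>"
  unfolding null_net_def by (meson not_le)
 from e have e2: "0 < e / 2" by simp
 obtain N where N: "!!m n. m \<ge> N ==> n \<ge> N ==> \<bar>X m - X n\<bar> < e / 2"
  using c e2 unfolding cauchy_net_def by meson
 obtain m where m: "m \<ge> N" "e <= \<bar>X m\<bar>" using e(2) by blast
 have s: "e / 2 < X n \<or> e / 2 < - X n" if "n \<ge> N" for n
  using N[of m n] m that by linarith
 have "0 < X m"
 proof (rule ccontr)
  assume "~ 0 < X m"
  then have "e / 2 < - X n" if "n \<ge> N" for n
   using N[of m n] m that s[OF that] \<open>~ 0 < X m\<close> e by linarith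
  then show False using n1 e2 by blast
 qed
 then have "e / 2 < X n" if "n \<ge> N" for n
  using N[of m n] m that s[OF that] \<open>0 < X m\<close> e by linarith
 then show "\<exists>r>0. EX N. \<forall>n\<ge>N. r < X n" using e2 by blast
qed

instantiation completion :: (linordered_field) linordered_idom
begin

definition "x < y \<longleftrightarrow> pos_net (y - (x :: 'a completion))"
definition "x <= y \<longleftrightarrow> x < y \<or> x = (y :: 'a completion)"
definition "\<bar>x\<bar> = (if x < 0 then - x else (x :: 'a completion))"
definition "sgn x = (if x = 0 then 0 else if 0 < x then 1 else - (1 :: 'a completion))"

instance
proof
 fix x y z :: "'a completion"
 have irr: "~ x < x" for x :: "'a completion" by (simp add: less_completion_def not_pos_net_0)
 have tr: "x < z" if "x < y" "y < z" for x y z :: "'a completion"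
  using pos_net_add[of "y - x" "z - y"] that by (simp add: less_completion_def algebra_simps)
 show "x <= x" by (simp add: less_eq_completion_def)
 show "(x < y) = (x <= y & ~ y <= x)" unfolding less_eq_completion_def by (metis irr tr)
 show "x <= z" if "x <= y" "y <= z" using that unfolding less_eq_completion_def using tr by blast
 show "x = y" if "x <= y" "y <= x" using that unfolding less_eq_completion_def using irr tr by blast
 show "x <= y \<or> y <= x" unfolding less_eq_completion_def less_completion_def
  using pos_net_cases[of "y - x"] by auto
 show "x <= y ==> z + x <= z + y" unfolding less_eq_completion_def less_completion_def by auto
 show "z * x < z * y" if "x < y" "0 < z"
  using that pos_net_mult[of z "y - x"] by (simp add: less_completion_def algebra_simps)
qed (simp_all add: abs_completion_def sgn_completion_def)

end

lift_definition completion_of :: "'a::linordered_field => 'a completion" is "%c _. c"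
 by (simp add: same_netI cauchy_net_const)

lemma completion_of_0: "completion_of 0 = 0" and completion_of_1: "completion_of 1 = 1"
 by (transfer; simp add: same_netI cauchy_net_const)+

lemma completion_of_add: "completion_of (x + y) = completion_of x + completion_of y"
 and completion_of_mult: "completion_of (x * y) = completion_of x * completion_of y"
 and completion_of_diff: "completion_of (x - y) = completion_of x - completion_of y"
 unfolding minus_completion_def by (transfer; simp add: same_netI cauchy_net_const)+

lemma completion_of_less: "completion_of x < completion_of y \<longleftrightarrow> x < y"
proof -
 have "pos_net (completion_of z) \<longleftrightarrow> 0 < z" for z :: 'a
  by transfer (metis dense order.strict_trans order_refl)
 then show ?thesis by (simp add: less_completion_def flip: completion_of_diff)
qed

text \<open>With \<open>completion_upper\<close> this says that the base field is coinitial among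
  the positive elements and cofinal in the completion, which is how the Archimedean property reaches
  the reals in \<open>nv_arch\<close>.\<close>

lemma completion_lower:
 assumes "0 < (x :: 'a::linordered_field completion)"
 shows "\<exists>r>0. completion_of r < x"
proof -
 have *: "\<exists>r>0. \<exists>r'>0. EX N. \<forall>n\<ge>N. r' < X n + - r" if ex: "\<exists>r>0. EX N. \<forall>n\<ge>N. r < X n" for X :: "'a => 'a"
 proof -
  obtain r N where r: "0 < r" "\<forall>n\<ge>N. r < X n" using ex by blast
  then have "\<forall>n\<ge>N. r / 2 < X n + - (r / 2)" by (auto simp: field_simps)
  then show ?thesis using r(1) by (metis half_gt_zero)
 qed
 have "\<exists>r>0. pos_net (x - completion_of r)"
  using assms unfolding less_completion_def diff_0_right unfolding minus_completion_def
  by transfer (rule *)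
 then show ?thesis by (simp add: less_completion_def)
qed

lemma completion_upper: "EX r. (x :: 'a::linordered_field completion) < completion_of r"
proof -
 have "EX r. pos_net (completion_of r - x)"
  unfolding minus_completion_def
 proof (transfer)
  fix X :: "'a => 'a" assume "same_net X X"
  then obtain B N where B: "0 < B" "!!n. n \<ge> N ==> \<bar>X n\<bar> < B"
   using cauchy_net_bound unfolding same_net_def by blast
  have "\<forall>n\<ge>N. 1 < B + 1 + - X n" using B(2) by (auto simp: abs_less_iff)
  then show "EX r. \<exists>r'>0. EX N. \<forall>n\<ge>N. r' < r + - X n" using zero_less_one by blast
 qed
 then show ?thesis by (simp add: less_completion_def)
qed

text \<open>Completeness in the form in which it is applied: a bound \<open>e\<close> that holds on
  a tail of the net survives in the limit, because weak inequalities with constants are closed under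
  limits.\<close>

lemma completion_complete:
 fixes X :: "'a::linordered_field => 'a"
 assumes "cauchy_net X"
 obtains x where "!!a e N. (!!n. n \<ge> N ==> \<bar>a - X n\<bar> <= e) ==> \<bar>completion_of a - x\<bar> <= completion_of e"
proof -
 define x where "x = Lim X"
 have sX: "same_net X X" using assms by (simp add: same_netI)
 have c: "cauchy_net (%n. b + - X n)" "cauchy_net (%n. X n + - b)" for b
  using cauchy_net_add[OF cauchy_net_const cauchy_net_minus[OF assms], of b]
   cauchy_net_add[OF assms cauchy_net_const[of "- b"]] by auto
 have eq: "completion_of b + - x = Lim (%n. b + - X n)" "x + - completion_of b = Lim (%n. X n + - b)"
  "same_net (%n. b + - X n) (%n. b + - X n)" "same_net (%n. X n + - b) (%n. X n + - b)" for b
  using sX c[of b] unfolding x_def completion_of_def map_fun_def comp_def id_def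
  by (auto simp: uminus_completion.abs_eq plus_completion.abs_eq same_netI cauchy_net_const
    cauchy_net_minus assms simp del: add_uminus_conv_diff)
 have ge: "completion_of b <= x" if b: "!!n. n \<ge> N ==> b <= X n" for b N
 proof -
  have "~ (\<exists>r>0. EX N. \<forall>n\<ge>N. r < b + - X n)"
  proof clarify
   fix r K assume "0 < r" "\<forall>n\<ge>K. r < b + - X n"
   then have "r < b + - X (max N K)" "b <= X (max N K)" using b by auto
   then show False using \<open>0 < r\<close> by linarith
  qed
  then have "~ pos_net (completion_of b + - x)" unfolding eq(1) pos_net.abs_eq[OF eq(3)] .
  then show ?thesis by (metis less_completion_def minus_completion_def not_le)
 qed
 have le: "x <= completion_of b" if b: "!!n. n \<ge> N ==> X n <= b" for b N
 proof -
  have "~ (\<exists>r>0. EX N. \<forall>n\<ge>N. r < X n + - b)"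
  proof clarify
   fix r K assume "0 < r" "\<forall>n\<ge>K. r < X n + - b"
   then have "r < X (max N K) + - b" "X (max N K) <= b" using b by auto
   then show False using \<open>0 < r\<close> by linarith
  qed
  then have "~ pos_net (x + - completion_of b)" unfolding eq(2) pos_net.abs_eq[OF eq(4)] .
  then show ?thesis by (metis less_completion_def minus_completion_def not_le)
 qed
 show thesis
 proof (rule that)
  fix a e N assume "!!n. n \<ge> N ==> \<bar>a - X n\<bar> <= e"
  then have "!!n. n \<ge> N ==> a - e <= X n" "!!n. n \<ge> N ==> X n <= a + e"
   by (auto simp: abs_le_iff algebra_simps)
  then have "completion_of (a - e) <= x" "x <= completion_of (a + e)" using ge le by blast+
  then show "\<bar>completion_of a - x\<bar> <= completion_of e"
   by (simp add: abs_le_iff completion_of_add completion_of_diff algebra_simps)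
 qed
qed

section \<open>The real numbers of a model\<close>

definition (in L2) principles_equivalent :: bool where
 "principles_equivalent \<longleftrightarrow> (two_WWKL \<longleftrightarrow> ae_cauchy_imp_almost_uniform) &
   (ae_cauchy_imp_almost_uniform \<longleftrightarrow> DCT_star) & (DCT_star \<longleftrightarrow> bounded_convergence)"

text \<open>A type cannot depend on the model \<open>M\<close>, but it may depend on one chosen counterexample to the
 theorem on each type \<open>'n\<close>.  This makes the numbers, integers, rationals and reals of that model
 available as types of the usual algebraic classes, so that linear arithmetic applies to them.
 If there is no counterexample, the standard numbers serve as a dummy.\<close>

definition mdl :: "'n l2_struct" where
 "mdl = (SOME M. L2.RCA0 M & ~ L2.principles_equivalent M)"

definition number_carrier :: "('n + nat) set" where
 "number_carrier = (if L2.RCA0 (mdl :: 'n l2_struct) then range Inl else range Inr)"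

typedef 'n number = "number_carrier :: ('n + nat) set"
 by (auto simp: number_carrier_def)

setup_lifting type_definition_number

primrec sum_op :: "('n => 'n => 'n) => (nat => nat => nat) => 'n + nat => 'n + nat => 'n + nat" where
 "sum_op f g (Inl a) y = Inl (f a (projl y))"
| "sum_op f g (Inr a) y = Inr (g a (projr y))"

instantiation number :: (type) osemiring
begin

lift_definition zero_number :: "'a number" is "if L2.RCA0 (mdl :: 'a l2_struct) then Inl (zero mdl) else Inr 0"
 by (simp add: number_carrier_def)
lift_definition one_number :: "'a number" is "if L2.RCA0 (mdl :: 'a l2_struct) then Inl (one mdl) else Inr 1"
 by (simp add: number_carrier_def)
lift_definition plus_number :: "'a number => 'a number => 'a number" is "sum_op (add mdl) (+)"
 by (auto simp: number_carrier_def)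
lift_definition times_number :: "'a number => 'a number => 'a number" is "sum_op (mult mdl) (*)"
 by (auto simp: number_carrier_def)
lift_definition less_number :: "'a number => 'a number => bool" is
 "%x y. if L2.RCA0 (mdl :: 'a l2_struct) then lt mdl (projl x) (projl y) else projr x < projr y" .
definition "x <= y \<longleftrightarrow> x < y \<or> x = (y :: 'a number)"

text \<open>One conclusion per obligation of the instance proof. \<open>number_axioms_dummy\<close>
  repeats the list, because whether the type copies a model or the standard numbers is settled only
  by a case distinction inside that proof.\<close>

lemma number_axioms_model:
 fixes a b c :: "'a number"
 assumes R: "L2.RCA0 (mdl :: 'a l2_struct)"
 shows "a <= a"
  and "(a < b) = (a <= b & ~ b <= a)"
  and "a <= b ==> b <= c ==> a <= c"
  and "a <= b ==> b <= a ==> a = b"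
  and "a <= b \<or> b <= a"
  and "a + b + c = a + (b + c)"
  and "a + b = b + a"
  and "0 + a = a"
  and "a * b * c = a * (b * c)"
  and "a * b = b * a"
  and "1 * a = a"
  and "(a + b) * c = a * c + b * c"
  and "0 * a = 0"
  and "a * 0 = 0"
  and "(0 :: 'a number) ~= 1"
  and "a + c = b + c ==> a = b"
  and "a < b ==> a + c < b + c"
  and "a < b ==> 0 < c ==> c * a < c * b"
  and "a < b ==> EX c. 0 < c & b = a + c"
proof -
 interpret rca "mdl :: 'a l2_struct" using R by unfold_locales
 have c: "number_carrier = range (Inl :: 'a => _)" using R by (simp add: number_carrier_def)
 have irr: "~ x < x" and lin: "x < y \<or> x = y \<or> y < x" for x y :: "'a number"
  by (transfer, use R lt_linear in \<open>auto simp: c\<close>)+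
 have tr: "x < y ==> y < z ==> x < z" for x y z :: "'a number"
  by transfer (use R lt_trans' in \<open>auto simp: c\<close>)
 have diff: "EX z. \<zero>\<^bsub>mdl\<^esub> \<prec>\<^bsub>mdl\<^esub> z & y = x \<oplus>\<^bsub>mdl\<^esub> z" if "x \<prec>\<^bsub>mdl\<^esub> y" for x y :: 'a
  using lt_imp_plus[OF that] zero_lt_iff Suc_neq_zero by metis
 show "a <= a" by (simp add: less_eq_number_def)
 show "(a < b) = (a <= b & ~ b <= a)" unfolding less_eq_number_def by (metis irr tr)
 show "a <= b ==> b <= c ==> a <= c" unfolding less_eq_number_def by (metis tr)
 show "a <= b ==> b <= a ==> a = b" unfolding less_eq_number_def by (metis irr tr)
 show "a <= b \<or> b <= a" unfolding less_eq_number_def using lin by metis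
 show "a + b + c = a + (b + c)" by transfer (auto simp: c add_assoc')
 show "a + b = b + a" by transfer (auto simp: c add_commute')
 show "0 + a = a" by transfer (use R in \<open>auto simp: c zero_plus\<close>)
 show "a * b * c = a * (b * c)" by transfer (auto simp: c mult_assoc')
 show "a * b = b * a" by transfer (auto simp: c mult_commute')
 show "1 * a = a" by transfer (use R in \<open>auto simp: c one_times\<close>)
 show "(a + b) * c = a * c + b * c" by transfer (use distrib' mult_commute' in \<open>auto simp: c\<close>)
 show "0 * a = 0" by transfer (use R in \<open>auto simp: c zero_times\<close>)
 show "a * 0 = 0" by transfer (use R in \<open>auto simp: c\<close>)
 show "(0 :: 'a number) ~= 1" by transfer (use R Suc_neq_zero[of "zero mdl"] in \<open>auto simp: c zero_plus simp del: Suc_neq_zero\<close>)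
 show "a + c = b + c ==> a = b" by transfer (auto simp: c dest: add_cancel')
 show "a < b ==> a + c < b + c" by transfer (use R in \<open>auto simp: c lt_add_mono\<close>)
 show "a < b ==> 0 < c ==> c * a < c * b" by transfer (use R in \<open>auto simp: c lt_mult_mono\<close>)
 show "a < b ==> EX c. 0 < c & b = a + c" by transfer (use R diff in \<open>auto simp: c\<close>)
qed

lemma number_axioms_dummy:
 fixes a b c :: "'a number"
 assumes R: "~ L2.RCA0 (mdl :: 'a l2_struct)"
 shows "a <= a"
  and "(a < b) = (a <= b & ~ b <= a)"
  and "a <= b ==> b <= c ==> a <= c"
  and "a <= b ==> b <= a ==> a = b"
  and "a <= b \<or> b <= a"
  and "a + b + c = a + (b + c)"
  and "a + b = b + a"
  and "0 + a = a"
  and "a * b * c = a * (b * c)"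
  and "a * b = b * a"
  and "1 * a = a"
  and "(a + b) * c = a * c + b * c"
  and "0 * a = 0"
  and "a * 0 = 0"
  and "(0 :: 'a number) ~= 1"
  and "a + c = b + c ==> a = b"
  and "a < b ==> a + c < b + c"
  and "a < b ==> 0 < c ==> c * a < c * b"
  and "a < b ==> EX c. 0 < c & b = a + c"
proof -
 have c: "number_carrier = range (Inr :: nat => 'a + nat)" using R by (simp add: number_carrier_def)
 have irr: "~ x < x" and lin: "x < y \<or> x = y \<or> y < x" for x y :: "'a number"
  by (transfer, use R in \<open>auto simp: c\<close>)+
 have tr: "x < y ==> y < z ==> x < z" for x y z :: "'a number"
  by transfer (use R in \<open>auto simp: c\<close>)
 show "a <= a" by (simp add: less_eq_number_def)
 show "(a < b) = (a <= b & ~ b <= a)" unfolding less_eq_number_def by (metis irr tr)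
 show "a <= b ==> b <= c ==> a <= c" unfolding less_eq_number_def by (metis tr)
 show "a <= b ==> b <= a ==> a = b" unfolding less_eq_number_def by (metis irr tr)
 show "a <= b \<or> b <= a" unfolding less_eq_number_def using lin by metis
 show "a + b + c = a + (b + c)" by transfer (auto simp: c)
 show "a + b = b + a" by transfer (auto simp: c)
 show "0 + a = a" by transfer (use R in \<open>auto simp: c\<close>)
 show "a * b * c = a * (b * c)" by transfer (auto simp: c)
 show "a * b = b * a" by transfer (auto simp: c)
 show "1 * a = a" by transfer (use R in \<open>auto simp: c\<close>)
 show "(a + b) * c = a * c + b * c" by transfer (auto simp: c algebra_simps)
 show "0 * a = 0" by transfer (use R in \<open>auto simp: c\<close>)
 show "a * 0 = 0" by transfer (use R in \<open>auto simp: c\<close>)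
 show "(0 :: 'a number) ~= 1" by transfer (use R in \<open>auto simp: c\<close>)
 show "a + c = b + c ==> a = b" by transfer (auto simp: c)
 show "a < b ==> a + c < b + c" by transfer (use R in \<open>auto simp: c\<close>)
 show "a < b ==> 0 < c ==> c * a < c * b" by transfer (use R in \<open>auto simp: c\<close>)
 show "a < b ==> EX c. 0 < c & b = a + c" by transfer (use R in \<open>auto simp: c less_iff_Suc_add\<close>)
qed

instance
 by standard (cases "L2.RCA0 (mdl :: 'a l2_struct)"; (rule number_axioms_model number_axioms_dummy; assumption))+

end

type_synonym 'n ratl = "'n number gint fract"
text \<open>The completion is made an ordered domain only; the fraction field then supplies division
  without inverting nets.\<close>

type_synonym 'n rl = "'n ratl completion fract"

locale model = rca M for M :: "'n l2_struct" (structure) +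
 assumes M_mdl: "M = mdl"
begin

definition ratl_of :: "'n => 'n ratl" where
 "ratl_of a = Fract (gint_of (Abs_number (Inl a))) 1"

text \<open>The order embedding of the numbers into the reals of the model. Statements about codes
  are moved along it into an ordered field, where linear arithmetic is available.\<close>

definition nv :: "'n => 'n rl" where
 "nv a = Fract (completion_of (ratl_of a)) 1"

lemma carrier: "number_carrier = range (Inl :: 'n => _)"
 using RCA0 by (simp add: number_carrier_def M_mdl)

lemma Rep_Abs_Inl: "Rep_number (Abs_number (Inl a)) = Inl (a :: 'n)"
 by (rule Abs_number_inverse) (simp add: carrier)

lemma number_ops:
 "Abs_number (Inl #0) = 0" "Abs_number (Inl #1) = 1"
 "Abs_number (Inl (a +. b)) = Abs_number (Inl a) + Abs_number (Inl b)"
 "Abs_number (Inl (a *. b)) = Abs_number (Inl a) * Abs_number (Inl b)"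
 "Abs_number (Inl a) < Abs_number (Inl b) \<longleftrightarrow> a <. b"
 using RCA0 unfolding M_mdl
 by (simp_all add: zero_number_def one_number_def plus_number_def times_number_def less_number_def
   Rep_Abs_Inl)

lemma ratl_of_ops:
 "ratl_of #0 = 0" "ratl_of #1 = 1" "ratl_of (a +. b) = ratl_of a + ratl_of b"
 "ratl_of (a *. b) = ratl_of a * ratl_of b" "ratl_of a < ratl_of b \<longleftrightarrow> a <. b"
 unfolding ratl_of_def
 by (simp_all add: number_ops gint_of_0 gint_of_1 gint_of_add gint_of_mult gint_of_less
   Zero_fract_def One_fract_def)

lemma nv_0 [simp]: "nv #0 = 0" and nv_1 [simp]: "nv #1 = 1"
 and nv_add [simp]: "nv (a +. b) = nv a + nv b"
 and nv_mult [simp]: "nv (a *. b) = nv a * nv b"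
 and nv_less: "nv a < nv b \<longleftrightarrow> a <. b"
 unfolding nv_def
 by (simp_all add: ratl_of_ops completion_of_0 completion_of_1 completion_of_add completion_of_mult
   completion_of_less flip: Zero_fract_def One_fract_def)

lemma nv_eq: "a = b \<longleftrightarrow> nv a = nv b"
 using nv_less lt_linear by (metis less_irrefl)

lemma nv_le: "nv a <= nv b \<longleftrightarrow> a <=. b"
 unfolding le_def le_less nv_less[symmetric] using nv_eq by blast

lemma nv_nonneg [simp]: "0 <= nv a"
 using nv_le[of \<zero> a] zero_lt_iff[of a] by (auto simp: le_def)

text \<open>A positive difference of numbers is itself a number and hence at least 1, so a fraction
  cannot exceed the positive part of its numerator.\<close>

lemma ratl_arch: "EX n. (q :: 'n ratl) < ratl_of n"
proof (induct q rule: fract_induct_pos)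
 case (Fract a b)
 obtain u v where b: "b = gint_of u - gint_of v" using gint_diff by blast
 then have "v < u" using Fract by (simp add: gint_of_less)
 then obtain c where c: "0 < c" "u = v + c" using osr_diff by blast
 obtain n' m where a: "a = gint_of n' - gint_of m" using gint_diff by blast
 obtain n where n: "n' = Abs_number (Inl n)" by (cases n') (auto simp: carrier)
 obtain c' where c': "c = Abs_number (Inl c')" by (cases c) (auto simp: carrier)
 have "#0 <. c'" using c(1) unfolding c' number_ops(1)[symmetric] number_ops(5) .
 then obtain d where d: "c' = d +. #1" using zero_or_Suc[of c'] by auto
 have "b = gint_of c" using b c by (simp add: gint_of_add)
 then have b1: "b = gint_of (Abs_number (Inl d)) + 1"
  by (simp add: c' d number_ops gint_of_add gint_of_1)
 have nonneg: "0 <= gint_of (Abs_number (Inl x))" for x :: 'n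
  unfolding gint_of_0[symmetric] number_ops(1)[symmetric] not_less[symmetric] gint_of_less number_ops(5) by simp
 let ?N = "gint_of (Abs_number (Inl n)) :: 'n number gint"
 obtain m' where "m = Abs_number (Inl m')" by (cases m) (auto simp: carrier)
 then have "a <= ?N" using nonneg by (simp add: a n)
 also have "?N < (?N + 1) * b" unfolding b1 using nonneg[of n] nonneg[of d] by (simp add: algebra_simps add_pos_nonneg)
 finally have "a * b < (?N + 1) * b * b" using Fract by simp
 then have "Fract a b < ratl_of (n +. #1)"
  using Fract by (simp add: ratl_of_def number_ops gint_of_add gint_of_1 mult.assoc)
 then show ?case by blast
qed

text \<open>A rational above the numerator and a positive rational below the denominator reduce the
  claim to \<open>ratl_arch\<close>.\<close>

lemma nv_arch: "EX n. (r :: 'n rl) < nv n"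
proof (induct r rule: fract_induct_pos)
 case (Fract a b)
 obtain q where q: "a < completion_of q" using completion_upper by blast
 obtain p where p: "0 < p" "completion_of p < b" using completion_lower[OF Fract] by blast
 obtain n where n: "max q 0 / p < ratl_of n" using ratl_arch by blast
 then have "max q 0 < ratl_of n * p" using p(1) by (simp add: pos_divide_less_eq)
 then have 0: "0 < ratl_of n" and "q < ratl_of n * p" using p(1) by (auto simp: zero_less_mult_iff)
 then have "a < completion_of (ratl_of n) * completion_of p"
  unfolding completion_of_mult[symmetric] using q by (meson completion_of_less less_trans)
 also have "\<dots> < completion_of (ratl_of n) * b"
  using 0 p(2) by (intro mult_strict_left_mono) (simp_all flip: completion_of_0 add: completion_of_less)
 finally have "a * b < completion_of (ratl_of n) * b * b" using Fract by simp
 then have "Fract a b < nv n" using Fract by (simp add: nv_def mult.assoc)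
 then show ?case by blast
qed

definition of_ratl :: "'n ratl => 'n rl" where
 "of_ratl q = Fract (completion_of q) 1"

lemma of_ratl_diff: "of_ratl (a - b) = of_ratl a - of_ratl b"
 and of_ratl_mult: "of_ratl (a * b) = of_ratl a * of_ratl b"
 and of_ratl_less: "of_ratl a < of_ratl b \<longleftrightarrow> a < b"
 and of_ratl_nv: "of_ratl (ratl_of n) = nv n"
 unfolding of_ratl_def nv_def
 by (simp_all add: completion_of_diff completion_of_mult completion_of_less)

lemma of_ratl_eq: "of_ratl a = of_ratl b \<longleftrightarrow> a = b"
 by (metis of_ratl_less linorder_neqE less_irrefl)

lemma of_ratl_le: "of_ratl a <= of_ratl b \<longleftrightarrow> a <= b"
 by (metis of_ratl_less not_less)

lemma of_ratl_divide: "b ~= 0 ==> of_ratl (a / b) = of_ratl a / of_ratl b"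
 by (metis of_ratl_mult of_ratl_eq of_ratl_diff diff_self eq_divide_eq nonzero_eq_divide_eq)

lemma of_ratl_abs: "of_ratl \<bar>a\<bar> = \<bar>of_ratl a\<bar>"
 using of_ratl_less[of a 0] of_ratl_diff[of 0 a] of_ratl_diff[of 0 0] by (simp add: abs_if)

text \<open>The index set \<open>'n\<close> is cofinal in the rationals, hence sequences over it that converge
 with a rate tending to zero have limits in the completion.\<close>

lemma rl_complete:
 fixes x :: "'n => 'n ratl" and e :: "'n => 'n ratl"
 assumes x: "!!k j. k <=. j ==> \<bar>x k - x j\<bar> <= e k"
  and e: "!!k j. k <=. j ==> e j <= e k" "!!d. 0 < d ==> EX k. e k < d"
 shows "EX r. ALL k. \<bar>of_ratl (x k) - r\<bar> <= of_ratl (e k)"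
proof -
 \<comment> \<open>\<open>ix\<close> reindexes the sequence by rationals, which makes it a net in
   the sense of \<open>cauchy_net\<close>.\<close>
 define ix where "ix t = (SOME k. t < ratl_of k)" for t
 have ix: "t < ratl_of (ix t)" for t unfolding ix_def by (rule someI_ex) (rule ratl_arch)
 have le: "k <=. ix t" if "ratl_of k <= t" for k t
  using that ix[of t] ratl_of_ops(5)[of k "ix t"] by (auto simp: le_def)
 have "cauchy_net (%t. x (ix t))"
  unfolding cauchy_net_def
 proof (intro allI impI)
  fix d :: "'n ratl" assume "0 < d"
  then obtain k where k: "e k < d / 2" using e(2)[of "d / 2"] by auto
  have "\<bar>x (ix s) - x (ix t)\<bar> < d" if "s \<ge> ratl_of k" "t \<ge> ratl_of k" for s t
   using x[OF le[OF that(1)]] x[OF le[OF that(2)]] k by linarith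
  then show "EX N. \<forall>s\<ge>N. \<forall>t\<ge>N. \<bar>x (ix s) - x (ix t)\<bar> < d" by blast
 qed
 then obtain r where r: "!!a e N. (!!n. n \<ge> N ==> \<bar>a - x (ix n)\<bar> <= e) ==> \<bar>completion_of a - r\<bar> <= completion_of e"
  using completion_complete by blast
 have "\<bar>completion_of (x k) - r\<bar> <= completion_of (e k)" for k
  using r[of "ratl_of k" "x k" "e k"] x[OF le] by blast
 then have "\<bar>of_ratl (x k) - Fract r 1\<bar> <= of_ratl (e k)" for k
  unfolding of_ratl_def abs_le_iff by simp
 then show ?thesis by blast
qed

end

section \<open>Decidable relations and recursive functions of a model\<close>

named_theorems decs and renums

context model
begin

text \<open>Discreteness of the numbers in the form that linear arithmetic over the reals can
  use.\<close>

lemma nv_Suc_le: "a <. b \<longleftrightarrow> nv a + 1 <= nv b"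
proof -
 have "a <. b \<longleftrightarrow> a +. #1 <=. b"
  unfolding le_def using lt_Suc lt_linear lt_trans' lt_irrefl' by metis
 then show ?thesis by (simp flip: nv_le)
qed

lemmas nv_simps = nv_eq nv_less[symmetric] nv_le[symmetric]

lemma le_imp_plus: "a <=. b ==> EX c. b = a +. c"
 unfolding le_def using lt_imp_plus plus_zero by metis

lemma lt_Suc_le: "a <. b +. #1 \<longleftrightarrow> a <=. b"
 by (simp add: lt_Suc le_def)

lemma le_zero [simp]: "a <=. #0 \<longleftrightarrow> a = #0"
 by (simp add: le_def)

lemma not_lt: "~ a <. b \<longleftrightarrow> b <=. a"
 by (auto simp: nv_simps)

lemma nv_le_square: "nv a <= nv a * nv a"
proof (cases "a = #0")
 case False
 then have "1 <= nv a" using zero_lt_iff[of a] by (simp add: nv_Suc_le)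
 then show ?thesis by (simp add: mult_left_mono)
qed simp

text \<open>With \<open>s = i +. j\<close> the code is \<open>s *. s +. i\<close> and lies below the
  square of \<open>s +. #1\<close>; codes are therefore ordered by the sum first, which is the
  reason why pairing is injective.\<close>

lemma pair_less_mono:
 assumes "i +. j <. k +. l" shows "<<i, j>> <. <<k, l>>"
proof -
 have "(nv i + nv j + 1) * (nv i + nv j + 1) <= (nv k + nv l) * (nv k + nv l)"
  using assms by (intro mult_mono) (simp_all add: nv_Suc_le)
 then have "nv <<i, j>> < nv <<k, l>>"
  unfolding pair_def nv_add nv_mult
  by (simp add: algebra_simps) (insert nv_nonneg[of i] nv_nonneg[of j] nv_nonneg[of k], linarith)
 then show ?thesis by (simp add: nv_less)
qed

lemma pair_eq [simp]: "<<i, j>> = <<k, l>> \<longleftrightarrow> i = k & j = l"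
proof
 assume eq: "<<i, j>> = <<k, l>>"
 then have s: "i +. j = k +. l"
  using pair_less_mono[of i j k l] pair_less_mono[of k l i j] lt_linear[of "i +. j" "k +. l"] by auto
 have "nv i = nv k"
  using eq unfolding pair_def s by (simp add: nv_eq)
 then have "i = k" by (simp add: nv_eq)
 then show "i = k & j = l" using s by (simp add: nv_eq)
qed simp

lemma le_pair: "i <=. <<i, j>>" "j <=. <<i, j>>"
proof -
 have "nv i + nv j <= (nv i + nv j) * (nv i + nv j)" using nv_le_square[of "i +. j"] by simp
 then show "i <=. <<i, j>>" "j <=. <<i, j>>"
  using nv_nonneg[of i] nv_nonneg[of j] unfolding pair_def nv_simps nv_add nv_mult by linarith+
qed

lemma le_trans': "a <=. b ==> b <=. c ==> a <=. c"
 and le_refl' [simp]: "a <=. a"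
 by (auto simp: nv_simps)

lemma pfst_pair [simp]: "pfst <<i, j>> = i" and psnd_pair [simp]: "psnd <<i, j>> = j"
 unfolding pfst_def psnd_def by auto

definition is_pair :: "'n => bool" where
 "is_pair p \<longleftrightarrow> (EX i j. p = <<i, j>>)"

text \<open>The common value of both projections outside the pairs, where the defining description
  has no solution. As a number parameter it makes the projections definable everywhere.\<close>

definition no_number :: 'n where
 "no_number = (THE i. False)"

lemma is_pair_pair [simp]: "is_pair <<i, j>>"
 by (auto simp: is_pair_def)

lemma pfst_junk: "~ is_pair p ==> pfst p = no_number"
 and psnd_junk: "~ is_pair p ==> psnd p = no_number"
 unfolding pfst_def psnd_def is_pair_def no_number_def by metis+

text \<open>Membership in \<open>cls\<close> takes the place of decidability; Delta-1 comprehension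
  yields the expected closure properties.\<close>

definition dec :: "('n => bool) => bool" where
 "dec P \<longleftrightarrow> {n. P n} \<in> cls M"

abbreviation recfn :: "('n => 'n) => bool" where
 "recfn f \<equiv> f \<in> Fn"

lemma recfn_dec: "recfn f \<longleftrightarrow> dec (%q. EX i. q = <<i, f i>>)"
proof -
 have "{<<i, f i>> |i. True} = {q. EX i. q = <<i, f i>>}" by auto
 then show ?thesis by (simp add: dec_def Fn_def)
qed

abbreviation sets2 :: "('n => bool) => ('n => bool) => nat => 'n set" where
 "sets2 P Q \<equiv> case_nat {n. P n} (%_. {n. Q n})"

lemma range_sets2: "dec P ==> dec Q ==> range (sets2 P Q) \<subseteq> cls M"
 by (auto simp: dec_def split: nat.splits)

lemma dec_delta_bfm:
 assumes "dec Q" "dec R"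
  and "!!n. P n \<longleftrightarrow> (EX m. bsat (sets2 Q R) (case_nat m (case_nat n e)) \<theta>)"
  and "!!n. P n \<longleftrightarrow> (ALL m. bsat (sets2 Q R) (case_nat m (case_nat n e)) \<eta>)"
 shows "dec P"
proof -
 have 1: delta1_comprehension using RCA0 by (simp add: RCA0_def)
 have 2: "sigma1 (sets2 Q R) e \<theta> n \<longleftrightarrow> pi1 (sets2 Q R) e \<eta> n" for n
  unfolding sigma1_def pi1_def using assms(3,4) by simp
 have "{n. sigma1 (sets2 Q R) e \<theta> n} \<in> cls M"
  using 1[unfolded delta1_comprehension_def, rule_format, OF range_sets2[OF assms(1,2)] 2] .
 then show ?thesis using assms(3) by (simp add: dec_def sigma1_def)
qed

lemma dec_bfm:
 assumes "dec Q" "dec R" "!!m n. P n \<longleftrightarrow> bsat (sets2 Q R) (case_nat m (case_nat n e)) \<theta>"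
 shows "dec P"
 using assms by (intro dec_delta_bfm[of Q R P e \<theta> \<theta>]) auto

lemma ex_dec: "EX Q. dec Q"
proof -
 obtain X where "X \<in> cls M" using RCA0 by (auto simp: RCA0_def)
 then have "dec (%n. n \<in> X)" by (simp add: dec_def)
 then show ?thesis by blast
qed

definition tpair :: "tm => tm => tm" where
 "tpair s t = TAdd (TMul (TAdd s t) (TAdd s t)) s"

definition BExLe :: "tm => bfm => bfm" where
 "BExLe t \<phi> = BEx (TAdd t TOne) \<phi>"

lemma tm_val_tpair [simp]: "tm_val e (tpair s t) = <<tm_val e s, tm_val e t>>"
 by (simp add: tpair_def pair_def)

lemma bsat_BExLe [simp]: "bsat E e (BExLe t \<phi>) \<longleftrightarrow> (EX x. x <=. tm_val e t & bsat E (case_nat x e) \<phi>)"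
 by (simp add: BExLe_def lt_Suc_le)

lemma dec_not: "dec P ==> dec (%p. ~ P p)"
 by (rule dec_bfm[of P P _ "%_. #0" "Neg (Mem (TVar 1) 0)"]) auto

lemma dec_conj: "dec P ==> dec Q ==> dec (%p. P p & Q p)"
 by (rule dec_bfm[of P Q _ "%_. #0" "Conj (Mem (TVar 1) 0) (Mem (TVar 1) 1)"]) auto

lemma dec_True: "dec (%p. True)"
 using ex_dec dec_bfm[of _ _ "%p. True" "%_. #0" "Eq TZero TZero"] by auto

lemma recfn_ident: "recfn (%p. p)"
 unfolding recfn_dec
 by (rule dec_bfm[OF dec_True dec_True, of _ "%_. #0"
    "BExLe (TVar 1) (Eq (TVar 2) (tpair (TVar 0) (TVar 0)))"])
   (auto simp: eval_nat_numeral intro: le_pair)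

lemma recfn_const: "recfn (%p. c)"
 unfolding recfn_dec
 by (rule dec_bfm[OF dec_True dec_True, of _ "%_. c"
    "BExLe (TVar 1) (Eq (TVar 2) (tpair (TVar 0) (TVar 3)))"])
   (auto simp: eval_nat_numeral intro: le_pair)

text \<open>The value of \<open>f\<close> can be quantified existentially or universally, and these
  are the two forms that Delta-1 comprehension asks for.\<close>

lemma dec_subst:
 assumes "dec P" "recfn f" shows "dec (%p. P (f p))"
 by (rule dec_delta_bfm[OF assms(2)[unfolded recfn_dec] assms(1), of _ "%_. #0"
    "Conj (Mem (tpair (TVar 1) (TVar 0)) 0) (Mem (TVar 0) 1)"
    "Neg (Conj (Mem (tpair (TVar 1) (TVar 0)) 0) (Neg (Mem (TVar 0) 1)))"]) auto

lemma recfn_comp: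
 assumes "recfn f" "recfn g" shows "recfn (%p. f (g p))"
 unfolding recfn_dec
 by (rule dec_delta_bfm[OF assms[unfolded recfn_dec], of _ "%_. #0"
    "BExLe (TVar 1) (BExLe (TVar 2) (Conj (Eq (TVar 3) (tpair (TVar 1) (TVar 0)))
     (Conj (Mem (tpair (TVar 1) (TVar 2)) 1) (Mem (tpair (TVar 2) (TVar 0)) 0))))"
    "BExLe (TVar 1) (BExLe (TVar 2) (Conj (Eq (TVar 3) (tpair (TVar 1) (TVar 0)))
     (Neg (Conj (Mem (tpair (TVar 1) (TVar 2)) 1) (Neg (Mem (tpair (TVar 2) (TVar 0)) 0))))))"])
   (auto simp: eval_nat_numeral intro: le_pair, metis pfst_pair)

lemma recfn_pair:
 assumes "recfn f" "recfn g" shows "recfn (%p. <<f p, g p>>)"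
 unfolding recfn_dec
 by (rule dec_bfm[OF assms[unfolded recfn_dec], of _ "%_. #0"
    "BExLe (TVar 1) (BExLe (TVar 2) (BExLe (TVar 3) (Conj (Eq (TVar 4) (tpair (TVar 2) (tpair (TVar 1) (TVar 0))))
     (Conj (Mem (tpair (TVar 2) (TVar 1)) 0) (Mem (tpair (TVar 2) (TVar 0)) 1)))))"])
   (auto simp: eval_nat_numeral intro: le_pair le_trans'[OF le_pair(1) le_pair(2)] le_trans'[OF le_pair(2) le_pair(2)])

lemma dec_is_pair: "dec is_pair"
 by (rule dec_bfm[OF dec_True dec_True, of _ "%_. #0"
    "BExLe (TVar 1) (BExLe (TVar 2) (Eq (TVar 3) (tpair (TVar 1) (TVar 0))))"])
   (auto simp: eval_nat_numeral is_pair_def intro: le_pair)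

lemma recfn_binop_tm:
 assumes C: "!!e s t. tm_val e (C s t) = opr (tm_val e s) (tm_val e t)"
 shows "recfn (%p. opr (pfst p) (psnd p))"
 unfolding recfn_dec
proof (rule dec_bfm[OF dec_is_pair dec_True, of _ "%_. no_number"
  "BExLe (TVar 1) (BExLe (TVar 2) (Conj (Eq (TVar 3) (tpair (TVar 1) (TVar 0)))
   (Neg (Conj
    (Neg (BExLe (TVar 1) (BExLe (TVar 2) (Conj (Eq (TVar 3) (tpair (TVar 1) (TVar 0))) (Eq (TVar 2) (C (TVar 1) (TVar 0)))))))
    (Neg (Conj (Neg (Mem (TVar 1) 0)) (Eq (TVar 0) (C (TVar 4) (TVar 4)))))))))"])
 fix m n
 have "opr (pfst p) (psnd p) = a \<longleftrightarrow> (EX x y. p = <<x, y>> & a = opr x y) \<or> ~ is_pair p & a = opr no_number no_number" for p a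
  by (cases "is_pair p") (auto simp: pfst_junk psnd_junk is_pair_def)
 then show "(EX i. n = <<i, opr (pfst i) (psnd i)>>) = bsat (sets2 is_pair (%p. True))
   (case_nat m (case_nat n (%_. no_number)))
  (BExLe (TVar 1) (BExLe (TVar 2) (Conj (Eq (TVar 3) (tpair (TVar 1) (TVar 0)))
   (Neg (Conj
    (Neg (BExLe (TVar 1) (BExLe (TVar 2) (Conj (Eq (TVar 3) (tpair (TVar 1) (TVar 0))) (Eq (TVar 2) (C (TVar 1) (TVar 0)))))))
    (Neg (Conj (Neg (Mem (TVar 1) 0)) (Eq (TVar 0) (C (TVar 4) (TVar 4)))))))))) "
  using le_pair by (simp add: eval_nat_numeral C) metis
qed

lemma dec_binrel_bfm:
 assumes C: "!!E e s t. bsat E e (C s t) \<longleftrightarrow> R (tm_val e s) (tm_val e t)"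
 shows "dec (%p. R (pfst p) (psnd p))"
proof (rule dec_bfm[OF dec_is_pair dec_True, of _ "%_. no_number"
  "Neg (Conj (Neg (BExLe (TVar 1) (BExLe (TVar 2) (Conj (Eq (TVar 3) (tpair (TVar 1) (TVar 0))) (C (TVar 1) (TVar 0))))))
    (Neg (Conj (Neg (Mem (TVar 1) 0)) (C (TVar 2) (TVar 2)))))"])
 fix m n
 have "R (pfst p) (psnd p) \<longleftrightarrow> (EX x y. p = <<x, y>> & R x y) \<or> ~ is_pair p & R no_number no_number" for p
  by (cases "is_pair p") (auto simp: pfst_junk psnd_junk is_pair_def)
 then show "R (pfst n) (psnd n) = bsat (sets2 is_pair (%p. True)) (case_nat m (case_nat n (%_. no_number)))
  (Neg (Conj (Neg (BExLe (TVar 1) (BExLe (TVar 2) (Conj (Eq (TVar 3) (tpair (TVar 1) (TVar 0))) (C (TVar 1) (TVar 0))))))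
    (Neg (Conj (Neg (Mem (TVar 1) 0)) (C (TVar 2) (TVar 2))))))"
  using le_pair by (simp add: eval_nat_numeral C) metis
qed

lemma recfn_pfst: "recfn pfst" and recfn_psnd: "recfn psnd"
 using recfn_binop_tm[of "%s t. s" "%x y. x"] recfn_binop_tm[of "%s t. t" "%x y. y"] by simp_all

lemma recfn_add: "recfn f ==> recfn g ==> recfn (%p. f p +. g p)"
 and recfn_mult: "recfn f ==> recfn g ==> recfn (%p. f p *. g p)"
 using recfn_comp[OF recfn_binop_tm[of TAdd "(+.)", OF tm_val.simps(4)] recfn_pair[of f g]]
  recfn_comp[OF recfn_binop_tm[of TMul "(*.)", OF tm_val.simps(5)] recfn_pair[of f g]] by simp_all

lemma dec_lt: "recfn f ==> recfn g ==> dec (%p. f p <. g p)"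
 and dec_eq: "recfn f ==> recfn g ==> dec (%p. f p = g p)"
 using dec_subst[OF dec_binrel_bfm[of Less "(<.)", OF bsat.simps(2)] recfn_pair[of f g]]
  dec_subst[OF dec_binrel_bfm[of Eq "(=)", OF bsat.simps(1)] recfn_pair[of f g]] by simp_all

lemma dec_disj: assumes "dec P" "dec Q" shows "dec (%p. P p \<or> Q p)"
 using dec_not[OF dec_conj[OF dec_not[OF assms(1)] dec_not[OF assms(2)]]] by simp

lemma dec_imp: assumes "dec P" "dec Q" shows "dec (%p. P p --> Q p)"
 using dec_disj[OF dec_not[OF assms(1)] assms(2)] by (simp only: imp_conv_disj)

lemma dec_iff: assumes "dec P" "dec Q" shows "dec (%p. P p = Q p)"
 using dec_conj[OF dec_imp[OF assms] dec_imp[OF assms(2,1)]] by (simp only: iff_conv_conj_imp)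

lemma dec_le: "recfn f ==> recfn g ==> dec (%p. f p <=. g p)"
 unfolding le_def by (intro dec_disj dec_lt dec_eq)

lemma dec_mem: "X \<in> cls M ==> recfn f ==> dec (%p. f p \<in> X)"
 using dec_subst[of "%n. n \<in> X"] by (simp add: dec_def)

lemma dec_bex:
 assumes "recfn g" "dec (%q. P (pfst q) (psnd q))"
 shows "dec (%p. EX x. x <. g p & P p x)"
proof -
 \<comment> \<open>In a bounded formula the bound has to be a term, so it first becomes a component
   of the argument; \<open>g p\<close> is substituted for it afterwards.\<close>
 let ?R = "%q. EX u v. q = <<u, v>> & (EX x. x <. v & P u x)"
 have "dec ?R"
  by (rule dec_bfm[OF assms(2) dec_True, of _ "%_. #0"
    "BExLe (TVar 1) (BExLe (TVar 2) (Conj (Eq (TVar 3) (tpair (TVar 1) (TVar 0)))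
     (BEx (TVar 0) (Mem (tpair (TVar 2) (TVar 0)) 0))))"])
   (auto simp: eval_nat_numeral intro: le_pair)
 from dec_subst[OF this recfn_pair[OF recfn_ident assms(1)]] show ?thesis by simp
qed

lemma dec_bex_le: "recfn g ==> dec (%q. P (pfst q) (psnd q)) ==> dec (%p. EX x. x <=. g p & P p x)"
 unfolding lt_Suc_le[symmetric] by (intro dec_bex recfn_add recfn_const)

lemma dec_ball:
 assumes "recfn g" "dec (%q. P (pfst q) (psnd q))" shows "dec (%p. ALL x. x <. g p --> P p x)"
 using dec_not[OF dec_bex[OF assms(1) dec_not[OF assms(2)]]] by simp

lemma dec_ball_le: "recfn g ==> dec (%q. P (pfst q) (psnd q)) ==> dec (%p. ALL x. x <=. g p --> P p x)"
 unfolding lt_Suc_le[symmetric] by (intro dec_ball recfn_add recfn_const)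

lemma dec_delta:
 assumes "dec (%q. P (pfst q) (psnd q))" "dec (%q. Q (pfst q) (psnd q))"
  and "!!n. (EX m. P n m) \<longleftrightarrow> (ALL m. Q n m)"
 shows "dec (%n. EX m. P n m)"
 by (rule dec_delta_bfm[OF assms(1,2), of _ "%_. #0" "Mem (tpair (TVar 1) (TVar 0)) 0"
    "Mem (tpair (TVar 1) (TVar 0)) 1"])
   (auto simp: assms(3))

lemma recfn_graph:
 assumes "dec (%q. psnd q = f (pfst q))" shows "recfn f"
proof -
 have "dec (%q. is_pair q & psnd q = f (pfst q))" by (intro dec_conj dec_is_pair assms)
 moreover have "(%q. is_pair q & psnd q = f (pfst q)) = (%q. EX i. q = <<i, f i>>)"
  by (auto simp: is_pair_def)
 ultimately show ?thesis by (simp add: recfn_dec)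
qed

lemma dec_const: "dec (%p. b)"
 using dec_True dec_not[OF dec_True] by (cases b) auto

lemma recfn_if: "dec P ==> recfn f ==> recfn g ==> recfn (%p. if P p then f p else g p)"
proof (rule recfn_graph)
 assume a: "dec P" "recfn f" "recfn g"
 have "dec (%q. (P (pfst q) --> psnd q = f (pfst q)) & (~ P (pfst q) --> psnd q = g (pfst q)))"
  by (intro dec_conj dec_imp dec_not dec_eq recfn_psnd recfn_pfst a recfn_comp[OF a(2) recfn_pfst]
    recfn_comp[OF a(3) recfn_pfst] dec_subst[OF a(1) recfn_pfst])
 then show "dec (%q. psnd q = (if P (pfst q) then f (pfst q) else g (pfst q)))"
  by (rule back_subst[of dec]) auto
qed

lemma recfn_Fn2:
 assumes "f \<in> Fn2" "recfn a" "recfn b" shows "recfn (%p. f (a p) (b p))"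
proof (rule recfn_graph)
 let ?X = "{<<<<i, j>>, f i j>> |i j. True}"
 have "dec (%q. <<<<a (pfst q), b (pfst q)>>, psnd q>> \<in> ?X)"
  using assms(1) unfolding Fn2_def
  by (intro dec_mem recfn_pair recfn_psnd recfn_comp[OF assms(2) recfn_pfst] recfn_comp[OF assms(3) recfn_pfst]) auto
 then show "dec (%q. psnd q = f (a (pfst q)) (b (pfst q)))" by simp
qed

lemma recfn_Fn3:
 assumes "f \<in> Fn3" "recfn a" "recfn b" "recfn c" shows "recfn (%p. f (a p) (b p) (c p))"
proof (rule recfn_graph)
 let ?X = "{<<<<<<i, j>>, k>>, f i j k>> |i j k. True}"
 have "dec (%q. <<<<<<a (pfst q), b (pfst q)>>, c (pfst q)>>, psnd q>> \<in> ?X)"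
  using assms(1) unfolding Fn3_def
  by (intro dec_mem recfn_pair recfn_psnd recfn_comp[OF assms(2) recfn_pfst]
    recfn_comp[OF assms(3) recfn_pfst] recfn_comp[OF assms(4) recfn_pfst]) auto
 then show "dec (%q. psnd q = f (a (pfst q)) (b (pfst q)) (c (pfst q)))" by simp
qed

lemma Fn2I:
 assumes "recfn (%p. f (pfst p) (psnd p))" shows "f \<in> Fn2"
proof -
 have "dec (%q. is_pair (pfst q) & (EX i. q = <<i, f (pfst i) (psnd i)>>))"
  using assms unfolding recfn_dec by (intro dec_conj dec_subst[OF dec_is_pair recfn_pfst])
 moreover have "{q. is_pair (pfst q) & (EX i. q = <<i, f (pfst i) (psnd i)>>)} = {<<<<i, j>>, f i j>> |i j. True}"
  by (auto simp: is_pair_def)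
 ultimately show ?thesis by (simp add: dec_def Fn2_def)
qed

lemma Fn3I:
 assumes "recfn (%p. f (pfst (pfst p)) (psnd (pfst p)) (psnd p))" shows "f \<in> Fn3"
proof -
 have "dec (%q. is_pair (pfst q) & is_pair (pfst (pfst q)) & (EX i. q = <<i, f (pfst (pfst i)) (psnd (pfst i)) (psnd i)>>))"
  using assms unfolding recfn_dec
  by (intro dec_conj dec_subst[OF dec_is_pair recfn_pfst] dec_subst[OF dec_is_pair recfn_comp[OF recfn_pfst recfn_pfst]])
 moreover have "{q. is_pair (pfst q) & is_pair (pfst (pfst q)) & (EX i. q = <<i, f (pfst (pfst i)) (psnd (pfst i)) (psnd i)>>)}
   = {<<<<<<i, j>>, k>>, f i j k>> |i j k. True}"
  by (auto simp: is_pair_def)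
 ultimately show ?thesis by (simp add: dec_def Fn3_def)
qed

lemmas [decs] = recfn_ident recfn_const recfn_pair recfn_comp[OF recfn_pfst] recfn_comp[OF recfn_psnd]
 recfn_add recfn_mult recfn_if dec_not dec_conj dec_disj dec_imp dec_iff dec_lt dec_le dec_eq
 dec_bex dec_bex_le dec_ball dec_ball_le dec_const dec_subst[OF dec_is_pair]

section \<open>Enumerable relations and induction\<close>

definition renum :: "('n => bool) => bool" where
 "renum P \<longleftrightarrow> (EX R. dec (%q. R (pfst q) (psnd q)) & (ALL n. P n \<longleftrightarrow> (EX m. R n m)))"

lemma renumI: "dec (%q. R (pfst q) (psnd q)) ==> (!!n. P n \<longleftrightarrow> (EX m. R n m)) ==> renum P"
 unfolding renum_def by blast

lemma renum_dec: "dec P ==> renum P"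
 by (rule renumI[of "%n m. P n"]) (simp_all add: dec_subst[OF _ recfn_pfst])

lemma renum_induct:
 assumes "renum P" "P #0" "!!n. P n ==> P (n +. #1)" shows "P n"
proof -
 obtain R where R: "dec (%q. R (pfst q) (psnd q))" "!!n. P n \<longleftrightarrow> (EX m. R n m)"
  using assms(1) unfolding renum_def by blast
 show ?thesis
  by (rule induct_bfm[of P "sets2 (%q. R (pfst q) (psnd q)) (%q. R (pfst q) (psnd q))"
     "%_. #0" "Mem (tpair (TVar 1) (TVar 0)) 0", OF _ range_sets2[OF R(1) R(1)] assms(2,3)])
    (simp add: sigma1_def R(2))
qed

lemmas dec_induct' = renum_induct[OF renum_dec]

lemma renum_subst: "renum P ==> recfn f ==> renum (%p. P (f p))"
proof -
 assume "renum P" and f: "recfn f"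
 then obtain R where R: "dec (%q. R (pfst q) (psnd q))" "!!n. P n \<longleftrightarrow> (EX m. R n m)"
  unfolding renum_def by blast
 have "dec (%q. R (f (pfst q)) (psnd q))"
  using dec_subst[OF R(1), of "%q. <<f (pfst q), psnd q>>"] recfn_comp[OF f recfn_pfst]
  by (simp add: recfn_pair recfn_psnd)
 then show ?thesis using R(2) by (rule renumI)
qed

lemma dec_rel2:
 assumes "dec (%q. R (pfst q) (psnd q))" "recfn f" "recfn g" shows "dec (%p. R (f p) (g p))"
 using dec_subst[OF assms(1) recfn_pair[OF assms(2,3)]] by simp

lemma renum_conj: assumes "renum P" "renum Q" shows "renum (%p. P p & Q p)"
proof -
 obtain R1 R2 where R: "dec (%q. R1 (pfst q) (psnd q))" "!!n. P n \<longleftrightarrow> (EX m. R1 n m)"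
  "dec (%q. R2 (pfst q) (psnd q))" "!!n. Q n \<longleftrightarrow> (EX m. R2 n m)"
  using assms unfolding renum_def by blast
 show ?thesis
 proof (rule renumI[of "%n m. R1 n (pfst m) & R2 n (psnd m)"])
  show "dec (%q. R1 (pfst q) (pfst (psnd q)) & R2 (pfst q) (psnd (psnd q)))"
   by (intro decs dec_rel2[OF R(1)] dec_rel2[OF R(3)])
  show "(P n & Q n) = (EX m. R1 n (pfst m) & R2 n (psnd m))" for n
   unfolding R(2,4) by (metis pfst_pair psnd_pair)
 qed
qed

lemma renum_ex: assumes "renum (%q. P (pfst q) (psnd q))" shows "renum (%p. EX x. P p x)"
proof -
 obtain R where R: "dec (%q. R (pfst q) (psnd q))" "!!q. P (pfst q) (psnd q) \<longleftrightarrow> (EX m. R q m)"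
  using assms unfolding renum_def by blast
 show ?thesis
 proof (rule renumI[of "%n m. R <<n, pfst m>> (psnd m)"])
  show "dec (%q. R <<pfst q, pfst (psnd q)>> (psnd (psnd q)))"
   by (intro decs dec_rel2[OF R(1)])
  have "P n x \<longleftrightarrow> (EX m. R <<n, x>> m)" for n x using R(2)[of "<<n, x>>"] by simp
  then show "(EX x. P n x) = (EX m. R <<n, pfst m>> (psnd m))" for n
   by (metis pfst_pair psnd_pair)
 qed
qed

lemma renum_disj: assumes "renum P" "renum Q" shows "renum (%p. P p \<or> Q p)"
proof -
 obtain R1 R2 where R: "dec (%q. R1 (pfst q) (psnd q))" "!!n. P n \<longleftrightarrow> (EX m. R1 n m)"
  "dec (%q. R2 (pfst q) (psnd q))" "!!n. Q n \<longleftrightarrow> (EX m. R2 n m)"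
  using assms unfolding renum_def by blast
 show ?thesis
  by (rule renumI[of "%n m. R1 n m \<or> R2 n m"]) (use R in \<open>auto intro: decs\<close>)
qed

text \<open>Bounding for a decidable relation, by Sigma-1 induction on an initial part
  \<open>c\<close> of the range; the guard \<open>c <=. b\<close> keeps the hypothesis
  applicable.\<close>

lemma collection_dec:
 assumes "dec (%q. R (pfst q) (psnd q))" "!!x. x <. b ==> EX k. R x k"
 shows "EX m. ALL x. x <. b --> (EX k. k <. m & R x k)"
proof -
 have "b <=. b --> (EX m. ALL x. x <. b --> (EX k. k <. m & R x k))"
 proof (rule renum_induct[of "%c. c <=. b --> (EX m. ALL x. x <. c --> (EX k. k <. m & R x k))"])
  have "renum (%c. ~ c <=. b \<or> (EX m. ALL x. x <. c --> (EX k. k <. m & R x k)))"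
   by (intro renum_disj renum_ex renum_dec) (intro decs dec_rel2[OF assms(1)])+
  then show "renum (%c. c <=. b --> (EX m. ALL x. x <. c --> (EX k. k <. m & R x k)))"
   by (simp only: imp_conv_disj)
  fix c assume IH: "c <=. b --> (EX m. ALL x. x <. c --> (EX k. k <. m & R x k))"
  show "c +. #1 <=. b --> (EX m. ALL x. x <. c +. #1 --> (EX k. k <. m & R x k))"
  proof
   assume c: "c +. #1 <=. b"
   then have "c <=. b" "c <. b" by (auto simp: nv_simps)
   then obtain m k where m: "!!x. x <. c ==> EX k. k <. m & R x k" and k: "R c k"
    using IH assms(2) by metis
   have "EX k'. k' <. m +. k +. #1 & R x k'" if x: "x <. c +. #1" for x
   proof (cases "x = c")
    case True
    have "k <. m +. k +. #1"
     unfolding nv_simps nv_add nv_1 using nv_nonneg[of m] by linarith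
    then show ?thesis using k True by blast
   next
    case False
    then obtain k' where "k' <. m" "R x k'" using m x by (auto simp: lt_Suc)
    moreover have "k' <. m +. k +. #1" using \<open>k' <. m\<close> nv_nonneg[of k]
     unfolding nv_simps nv_add nv_1 by linarith
    ultimately show ?thesis by blast
   qed
   then show "EX m. ALL x. x <. c +. #1 --> (EX k. k <. m & R x k)" by blast
  qed
 qed auto
 then show ?thesis by simp
qed

text \<open>\<open>collection_dec\<close> bounds the witnesses for all \<open>x\<close> at once and
  thereby moves the existential quantifier to the front.\<close>

lemma renum_ball:
 assumes "recfn g" "renum (%q. P (pfst q) (psnd q))"
 shows "renum (%p. ALL x. x <. g p --> P p x)"
proof -
 obtain R where R: "dec (%q. R (pfst q) (psnd q))" "!!q. P (pfst q) (psnd q) \<longleftrightarrow> (EX m. R q m)"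
  using assms(2) unfolding renum_def by blast
 show ?thesis
 proof (rule renumI[of "%n m. ALL x. x <. g n --> (EX k. k <. m & R <<n, x>> k)"])
  show "dec (%q. ALL x. x <. g (pfst q) --> (EX k. k <. psnd q & R <<pfst q, x>> k))"
   by (intro decs dec_rel2[OF R(1)] recfn_comp[OF assms(1)])
  have *: "P n x \<longleftrightarrow> (EX m. R <<n, x>> m)" for n x using R(2)[of "<<n, x>>"] by simp
  show "(ALL x. x <. g n --> P n x) = (EX m. ALL x. x <. g n --> (EX k. k <. m & R <<n, x>> k))" for n
  proof
   assume "ALL x. x <. g n --> P n x"
   then show "EX m. ALL x. x <. g n --> (EX k. k <. m & R <<n, x>> k)"
    by (intro collection_dec) (auto simp: * intro!: dec_rel2[OF R(1)] decs)
  qed (auto simp: *)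
 qed
qed

lemma renum_ball_le:
 "recfn g ==> renum (%q. P (pfst q) (psnd q)) ==> renum (%p. ALL x. x <=. g p --> P p x)"
 unfolding lt_Suc_le[symmetric] by (intro renum_ball recfn_add recfn_const)

lemmas [renums] = renum_conj renum_disj renum_ex renum_ball renum_ball_le

text \<open>Post's theorem inside the model.\<close>

lemma dec_renum:
 assumes "renum P" "renum (%n. ~ P n)" shows "dec P"
proof -
 obtain R1 R2 where R: "dec (%q. R1 (pfst q) (psnd q))" "!!n. P n \<longleftrightarrow> (EX m. R1 n m)"
  "dec (%q. R2 (pfst q) (psnd q))" "!!n. ~ P n \<longleftrightarrow> (EX m. R2 n m)"
  using assms unfolding renum_def by blast
 have "dec (%n. EX m. R1 n m)"
  by (rule dec_delta[OF R(1) dec_not[OF R(3)]]) (use R(2,4) in blast)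
 then show ?thesis by (simp flip: R(2))
qed

text \<open>Pi-1 induction from Sigma-1 induction by descent: that some counterexample lies exactly
  \<open>k\<close> below the given one \<open>n\<close> is Sigma-1 and passes from \<open>k\<close>
  to \<open>k +. #1\<close>; for \<open>k = n\<close> it contradicts the base case.\<close>

lemma corenum_induct:
 assumes "renum (%n. ~ P n)" "P #0" "!!n. P n ==> P (n +. #1)" shows "P n"
proof (rule ccontr)
 assume n: "~ P n"
 have "n <. n \<or> (EX j. j +. n = n & ~ P j)"
 proof (rule renum_induct[of "%k. n <. k \<or> (EX j. j +. k = n & ~ P j)"])
  show "renum (%k. n <. k \<or> (EX j. j +. k = n & ~ P j))"
   by (intro renums renum_subst[OF assms(1)] recfn_psnd; rule renum_dec; intro decs)
  fix k assume k: "n <. k \<or> (EX j. j +. k = n & ~ P j)"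
  show "n <. k +. #1 \<or> (EX j. j +. (k +. #1) = n & ~ P j)"
  proof (cases "n <. k +. #1")
   case False
   then obtain j where j: "j +. k = n" "~ P j" using k by (auto simp: lt_Suc)
   then obtain i where "j = i +. #1" using zero_or_Suc[of j] assms(2) by auto
   then show ?thesis using j assms(3)[of i] by (auto simp: add_ac')
  qed simp
 qed (use n in auto)
 then obtain j where "j +. n = n" "~ P j" by auto
 moreover from this(1) have "j = #0" by (simp add: nv_eq)
 ultimately show False using assms(2) by simp
qed

lemma corenum_less_induct:
 assumes "renum (%n. ~ P n)" "!!n. (!!m. m <. n ==> P m) ==> P n" shows "P n"
proof -
 have "ALL m. m <. n +. #1 --> P m"
 proof (rule corenum_induct[of "%n. ALL m. m <. n --> P m"])
  have "renum (%n. EX m. m <. n & ~ P m)"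
   by (intro renums renum_subst[OF assms(1)] recfn_psnd; rule renum_dec; intro decs)
  then show "renum (%n. ~ (ALL m. m <. n --> P m))" by simp
 qed (use assms(2) in \<open>auto simp: lt_Suc\<close>)
 then show ?thesis by (simp add: lt_Suc)
qed

lemma dec_less_induct:
 assumes "dec P" "!!n. (!!m. m <. n ==> P m) ==> P n" shows "P n"
 using corenum_less_induct[OF renum_dec[OF dec_not[OF assms(1)]]] assms(2) by blast

text \<open>The least number principle for Pi-1 predicates. Without a least element, the absence of
  elements below \<open>n\<close> is a Sigma-1 statement that propagates by induction.\<close>

lemma renum_least:
 assumes "renum (%n. ~ P n)" "P n" shows "EX m. P m & (ALL k. k <. m --> ~ P k)"
proof (rule ccontr)
 assume *: "~ ?thesis"
 have "ALL m. m <. n +. #1 --> ~ P m"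
 proof (rule renum_induct[of "%n. ALL m. m <. n --> ~ P m"])
  fix k assume "ALL m. m <. k --> ~ P m"
  then show "ALL m. m <. k +. #1 --> ~ P m" using * unfolding lt_Suc by blast
 next
  show "renum (%n. ALL m. m <. n --> ~ P m)"
   by (intro renums renum_subst[OF assms(1)] recfn_psnd recfn_ident)
 qed simp
 then show False using assms(2) unfolding lt_Suc by blast
qed

lemma dec_least:
 "dec P ==> P n ==> EX m. P m & (ALL k. k <. m --> ~ P k)"
 by (rule renum_least[OF renum_dec[OF dec_not]])

definition lst :: "('n => bool) => 'n" where
 "lst P = (THE m. P m & (ALL k. k <. m --> ~ P k))"

lemma lst_eq: "P m ==> (!!k. k <. m ==> ~ P k) ==> lst P = m"
 unfolding lst_def using lt_linear by (intro the_equality) blast+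

lemma lst_least:
 assumes "dec P" "P n" shows "P (lst P)" "!!k. P k ==> lst P <=. k"
proof -
 obtain m where m: "P m" "ALL k. k <. m --> ~ P k" using dec_least[OF assms] by blast
 then have "lst P = m" by (intro lst_eq) auto
 with m show "P (lst P)" "!!k. P k ==> lst P <=. k" by (auto simp flip: not_lt)
qed

lemma recfn_lst:
 assumes "dec (%q. P (pfst q) (psnd q))" "!!p. EX n. P p n" shows "recfn (%p. lst (P p))"
proof (rule recfn_graph)
 have "dec (%q. P (pfst q) (psnd q) & (ALL k. k <. psnd q --> ~ P (pfst q) k))"
  by (intro decs dec_rel2[OF assms(1)])
 moreover have "dec (P p)" for p
  using dec_subst[OF assms(1), of "%n. <<p, n>>"] by (simp add: recfn_pair recfn_ident recfn_const)
 then have "P p n & (ALL k. k <. n --> ~ P p k) \<longleftrightarrow> n = lst (P p)" for p n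
  using assms(2)[of p] lst_eq[of "P p"] lst_least[of "P p"] not_lt by metis
 ultimately show "dec (%q. psnd q = lst (P (pfst q)))" by simp
qed

end

section \<open>Goedel's beta function and recursion\<close>

context model
begin

lemma nv_num [simp]: "nv (num k) = of_nat k"
 by (induction k) auto

lemma zero_lt_one [simp]: "#0 <. #1" and zero_lt_Suc [simp]: "#0 <. n +. #1"
 by (simp flip: nv_less) (simp add: zero_lt_iff)

lemmas nv_ops = nv_simps nv_add nv_mult nv_1 nv_0 nv_num

lemma div_mod_unique:
 assumes "q *. m +. r = q' *. m +. r'" "r <. m" "r' <. m" shows "q = q' & r = r'"
proof -
 have *: False if "q <. q'" "q *. m +. r = q' *. m +. r'" "r <. m" for q q' r r'
 proof -
  have "(nv q + 1) * nv m <= nv q' * nv m" using that(1) by (intro mult_right_mono) (simp_all add: nv_Suc_le)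
  then show False using that(2,3) nv_nonneg[of r'] unfolding nv_ops by (simp add: algebra_simps)
 qed
 have "q = q'" using *[of q q' r r'] *[of q' q r' r] assms lt_linear[of q q'] by metis
 then show ?thesis using assms(1) by (simp add: nv_eq)
qed

lemma div_mod_ex: "#0 <. m ==> EX q r. b = q *. m +. r & r <. m"
proof (rule renum_induct[of "%b. EX q r. b = q *. m +. r & r <. m"])
 show "renum (%b. EX q r. b = q *. m +. r & r <. m)"
  by (intro renum_ex; rule renum_dec; intro decs)
 assume m: "#0 <. m"
 then show "EX q r. #0 = q *. m +. r & r <. m"
  by (intro exI[of _ \<zero>]) (simp add: zero_times)
 fix b assume "EX q r. b = q *. m +. r & r <. m"
 then obtain q r where qr: "b = q *. m +. r" "r <. m" by blast
 show "EX q r. b +. #1 = q *. m +. r & r <. m"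
 proof (cases "r +. #1 = m")
  case True
  have "b +. #1 = (q +. #1) *. m +. #0" by (simp add: qr(1) add_assoc' True Suc_times)
  then show ?thesis using m by blast
 next
  case False
  moreover have "r +. #1 <=. m" using qr(2) by (simp add: nv_simps(3) nv_Suc_le)
  ultimately have "r +. #1 <. m" by (simp add: le_def)
  moreover have "b +. #1 = q *. m +. (r +. #1)" by (simp add: qr(1) add_assoc')
  ultimately show ?thesis by blast
 qed
qed

definition md :: "'n => 'n => 'n" where
 "md b m = (THE r. r <. m & (EX q. b = q *. m +. r))"

definition dv :: "'n => 'n => 'n" where
 "dv b m = (THE q. EX r. r <. m & b = q *. m +. r)"

lemma md_eq: "b = q *. m +. r ==> r <. m ==> md b m = r"
 and dv_eq: "b = q *. m +. r ==> r <. m ==> dv b m = q"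
 unfolding md_def dv_def using div_mod_unique by (blast intro!: the_equality)+

lemma div_mod: assumes "#0 <. m" shows "b = dv b m *. m +. md b m" "md b m <. m"
proof -
 obtain q r where "b = q *. m +. r" "r <. m" using div_mod_ex[OF assms] by blast
 with md_eq[OF this] dv_eq[OF this] show "b = dv b m *. m +. md b m" "md b m <. m" by simp_all
qed

lemma md_0: "md b #0 = no_number" and dv_0: "dv b #0 = no_number"
 by (simp_all add: md_def dv_def no_number_def)

lemma le_mult: "#0 <. m ==> q <=. q *. m"
 using mult_left_mono[of 1 "nv m" "nv q"] by (simp add: nv_simps(3) nv_Suc_le)

lemma recfn_md: "recfn f ==> recfn g ==> recfn (%p. md (f p) (g p))"
 and recfn_dv: "recfn f ==> recfn g ==> recfn (%p. dv (f p) (g p))"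
proof -
 assume f: "recfn f" and g: "recfn g"
 have qb: "b = q *. m +. r ==> #0 <. m ==> q <=. b" for b q m r
  using le_mult[of m q] nv_nonneg[of r] unfolding nv_ops by linarith
 have 1: "y = md b m \<longleftrightarrow> (m = #0 & y = no_number) \<or> (y <. m & (EX q. q <=. b & b = q *. m +. y))" for y b m
  using md_0[of b] div_mod[of m b] md_eq[of b _ m y] qb[of b _ m y] qb[of b "dv b m" m "md b m"] zero_lt_iff[of m]
  by (metis not_lt_zero)
 have 2: "y = dv b m \<longleftrightarrow> (m = #0 & y = no_number) \<or> (EX r. r <. m & b = y *. m +. r)" for y b m
  using dv_0[of b] div_mod[of m b] dv_eq[of b y m] zero_lt_iff[of m] by (metis not_lt_zero)
 show "recfn (%p. md (f p) (g p))"
  by (rule recfn_graph, unfold 1) (intro decs recfn_comp[OF f] recfn_comp[OF g])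
 show "recfn (%p. dv (f p) (g p))"
  by (rule recfn_graph, unfold 2) (intro decs recfn_comp[OF f] recfn_comp[OF g])
qed

lemma beta_md: "beta a b i = md b (a *. (i +. #1) +. #1)"
 by (simp add: beta_def md_def)

lemma recfn_beta: "recfn f ==> recfn g ==> recfn h ==> recfn (%p. beta (f p) (g p) (h p))"
 unfolding beta_md by (intro recfn_md decs)

lemmas [decs] = recfn_md recfn_dv recfn_beta

text \<open>Congruence without subtraction: multiples of \<open>m\<close> may be added on either
  side.\<close>

definition congr :: "'n => 'n => 'n => bool" where
 "congr m x y \<longleftrightarrow> (EX s t. x +. s *. m = y +. t *. m)"

lemma congrI: "x +. s *. m = y +. t *. m ==> congr m x y"
 unfolding congr_def by blast

lemma congr_refl [simp]: "congr m x x"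
 and congr_sym: "congr m x y ==> congr m y x"
 unfolding congr_def by metis+

lemma congr_trans: assumes "congr m x y" "congr m y z" shows "congr m x z"
proof -
 obtain s t s' t' where "x +. s *. m = y +. t *. m" "y +. s' *. m = z +. t' *. m"
  using assms unfolding congr_def by blast
 then have "x +. (s +. s') *. m = z +. (t +. t') *. m" unfolding nv_ops by (simp add: algebra_simps)
 then show ?thesis by (rule congrI)
qed

lemma congr_add: assumes "congr m x y" "congr m x' y'" shows "congr m (x +. x') (y +. y')"
proof -
 obtain s t s' t' where "x +. s *. m = y +. t *. m" "x' +. s' *. m = y' +. t' *. m"
  using assms unfolding congr_def by blast
 then have "x +. x' +. (s +. s') *. m = y +. y' +. (t +. t') *. m" unfolding nv_ops by (simp add: algebra_simps)
 then show ?thesis by (rule congrI)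
qed

lemma congr_mult: assumes "congr m x y" shows "congr m (x *. z) (y *. z)"
proof -
 obtain s t where "x +. s *. m = y +. t *. m" using assms unfolding congr_def by blast
 then have "(nv x + nv s * nv m) * nv z = (nv y + nv t * nv m) * nv z" unfolding nv_ops by simp
 then have "x *. z +. s *. z *. m = y *. z +. t *. z *. m" unfolding nv_ops by (simp add: algebra_simps)
 then show ?thesis by (rule congrI)
qed

lemma congr_md: assumes "#0 <. m" "congr m x y" shows "md x m = md y m"
proof -
 obtain s t where "x +. s *. m = y +. t *. m" using assms unfolding congr_def by blast
 moreover have "nv x = nv (dv x m) * nv m + nv (md x m)" "nv y = nv (dv y m) * nv m + nv (md y m)"
  using div_mod(1)[OF assms(1), of x] div_mod(1)[OF assms(1), of y] unfolding nv_ops by simp_all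
 ultimately have "(dv x m +. s) *. m +. md x m = (dv y m +. t) *. m +. md y m"
  unfolding nv_ops by (simp add: algebra_simps)
 then show ?thesis using div_mod_unique div_mod(2)[OF assms(1)] by blast
qed

text \<open>A stand-in for the factorial. The bound \<open>c <=. a\<close> keeps the matrix
  decidable, so that Sigma-1 induction applies.\<close>

lemma common_multiple: "EX a. #0 <. a & (ALL k. k <. n --> (EX c. c <=. a & a = (k +. #1) *. c))"
proof (rule renum_induct[of "%n. EX a. #0 <. a & (ALL k. k <. n --> (EX c. c <=. a & a = (k +. #1) *. c))"])
 show "renum (%n. EX a. #0 <. a & (ALL k. k <. n --> (EX c. c <=. a & a = (k +. #1) *. c)))"
  by (intro renum_ex; rule renum_dec; intro decs)
 show "EX a. #0 <. a & (ALL k. k <. #0 --> (EX c. c <=. a & a = (k +. #1) *. c))"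
  by (intro exI[of _ \<one>]) simp
 fix n assume "EX a. #0 <. a & (ALL k. k <. n --> (EX c. c <=. a & a = (k +. #1) *. c))"
 then obtain a where a: "#0 <. a" "!!k. k <. n ==> EX c. c <=. a & a = (k +. #1) *. c" by blast
 let ?a = "a *. (n +. #1)"
 have p: "#0 <. ?a" using a(1) nv_nonneg[of n] unfolding nv_ops by (simp add: add_nonneg_pos)
 have le: "c <=. ?a" if "?a = (k +. #1) *. c" for c k
  unfolding that mult_commute'[of "k +. #1"] by (rule le_mult) (simp add: nv_ops add_nonneg_pos)
 have "EX c. c <=. ?a & ?a = (k +. #1) *. c" if k: "k <. n +. #1" for k
 proof (cases "k = n")
  case True
  then have "?a = (k +. #1) *. a" by (simp add: mult_commute')
  then show ?thesis using le by blast
 next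
  case False
  then obtain c where "a = (k +. #1) *. c" using k a(2) by (auto simp: lt_Suc)
  then have "?a = (k +. #1) *. (c *. (n +. #1))" by (simp add: mult_assoc')
  then show ?thesis using le by blast
 qed
 then show "EX a. #0 <. a & (ALL k. k <. n +. #1 --> (EX c. c <=. a & a = (k +. #1) *. c))" using p by blast
qed

lemma lt_obtain: assumes "a <. b" obtains k where "b = a +. (k +. #1)"
 using lt_imp_plus[OF assms] by blast

text \<open>Explicit inverses: modulo \<open>m = a * (j + 1) + 1\<close> the inverse of \<open>a\<close> is \<open>-(j + 1)\<close>, and
 \<open>i - j\<close> divides \<open>a\<close>.\<close>

lemma beta_moduli_coprime:
 assumes a: "!!k. k <. n ==> EX c. a = (k +. #1) *. c" and ij: "i ~= j" "i <. n" "j <. n"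
 shows "EX v. congr (a *. (j +. #1) +. #1) ((a *. (i +. #1) +. #1) *. v) #1"
proof -
 let ?m = "a *. (j +. #1) +. #1"
 consider "i <. j" | "j <. i" using lt_linear ij(1) by blast
 then show ?thesis
 proof cases
  case 1
  then obtain k where k: "j = i +. (k +. #1)" by (rule lt_obtain)
  have "k <. n" using ij(3) nv_nonneg[of i] unfolding k nv_ops by linarith
  then obtain c where c: "a = (k +. #1) *. c" using a by blast
  have ca: "nv c * (nv k + 1) = nv a" using c unfolding nv_ops by (simp add: algebra_simps)
  \<comment> \<open>Modulo \<open>?m\<close> the product \<open>a *. (j +. #1)\<close> is -1, and
    the other modulus is congruent to \<open>a *. (k +. #1)\<close> with a minus sign. The factor
    \<open>c *. (j +. #1) *. (j +. #1)\<close> inverts it up to sign, and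
    \<open>a *. (j +. #1)\<close> corrects the sign without subtraction.\<close>
  let ?v = "(a *. (j +. #1)) *. (c *. (j +. #1) *. (j +. #1))"
  let ?J = "nv j + 1" let ?A = "nv a"
  have "(?A * (nv i + 1) + 1) * (?A * ?J * (nv c * ?J * ?J)) + ((?A * ?J + 1) * (?A * ?J + 1) + 3) * (?A * ?J + 1)
    = 1 + (?A * ?J * (nv c * ?J * ?J) + 3 * (?A * ?J + 1)) * (?A * ?J + 1)"
  proof -
   have i: "nv i + 1 = ?J - (nv k + 1)" using k by (simp add: nv_ops)
   have "?A * (nv k + 1) * (?A * ?J * (nv c * ?J * ?J)) = (?A * ?J) * (?A * ?J) * ((nv c * (nv k + 1)) * ?J)"
    by (simp only: ac_simps)
   also have "\<dots> = (?A * ?J) * (?A * ?J) * (?A * ?J)" unfolding ca by simp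
   finally have e: "?A * (nv k + 1) * (?A * ?J * (nv c * ?J * ?J)) = (?A * ?J) * (?A * ?J) * (?A * ?J)" .
   have "(?A * (nv i + 1) + 1) * (?A * ?J * (nv c * ?J * ?J))
    = (?A * ?J + 1) * (?A * ?J * (nv c * ?J * ?J)) - ?A * (nv k + 1) * (?A * ?J * (nv c * ?J * ?J))"
    unfolding i by (simp add: left_diff_distrib right_diff_distrib distrib_left distrib_right)
   then show ?thesis unfolding e by (simp add: algebra_simps)
  qed
  then have "(a *. (i +. #1) +. #1) *. ?v +. (?m *. ?m +. num 3) *. ?m = #1 +. (?v +. num 3 *. ?m) *. ?m"
   unfolding nv_ops by simp
  then show ?thesis by (blast intro: congrI)
 next
  case 2
  then obtain k where k: "i = j +. (k +. #1)" by (rule lt_obtain)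
  have "k <. n" using ij(2) nv_nonneg[of j] unfolding k nv_ops by linarith
  then obtain c where c: "a = (k +. #1) *. c" using a by blast
  have ca: "nv c * (nv k + 1) = nv a" using c unfolding nv_ops by (simp add: algebra_simps)
  \<comment> \<open>Here the other modulus is congruent to \<open>a *. (k +. #1)\<close> itself, so
    no sign has to be corrected.\<close>
  let ?v = "c *. (j +. #1) *. (j +. #1)"
  let ?J = "nv j + 1" let ?A = "nv a"
  have "(?A * (nv i + 1) + 1) * (nv c * ?J * ?J) + 2 * (?A * ?J + 1)
    = 1 + ((nv c * ?J * ?J) + (?A * ?J + 1)) * (?A * ?J + 1)"
  proof -
   have i: "nv i + 1 = ?J + (nv k + 1)" using k by (simp add: nv_ops)
   have "?A * (nv k + 1) * (nv c * ?J * ?J) = ?A * ?J * ((nv c * (nv k + 1)) * ?J)"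
    by (simp only: ac_simps)
   also have "\<dots> = (?A * ?J) * (?A * ?J)" unfolding ca by simp
   finally have e: "?A * (nv k + 1) * (nv c * ?J * ?J) = (?A * ?J) * (?A * ?J)" .
   have "(?A * (nv i + 1) + 1) * (nv c * ?J * ?J)
    = (?A * ?J + 1) * (nv c * ?J * ?J) + ?A * (nv k + 1) * (nv c * ?J * ?J)"
    unfolding i by (simp add: distrib_left distrib_right)
   then show ?thesis unfolding e by (simp add: algebra_simps)
  qed
  then have "(a *. (i +. #1) +. #1) *. ?v +. num 2 *. ?m = #1 +. (?v +. ?m) *. ?m"
   unfolding nv_ops by simp
  then show ?thesis by (blast intro: congrI)
 qed
qed

text \<open>Induction on the number \<open>k\<close> of congruences solved so far. Besides the
  solution \<open>b\<close> it carries a common multiple \<open>P\<close> of the moduli already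
  treated which is invertible modulo each of the remaining ones.\<close>

lemma chinese_remainder:
 assumes m: "recfn m" and f: "recfn f" and lt: "!!i. i <. n ==> f i <. m i"
  and coprime: "!!i j. i ~= j ==> i <. n ==> j <. n ==> EX v. congr (m j) (m i *. v) #1"
 shows "EX b. ALL i. i <. n --> md b (m i) = f i"
proof -
 let ?Q = "%k b P. (ALL i. i <. k --> md b (m i) = f i & (EX c. c <=. P & P = c *. m i)) &
  (ALL j. j <. n --> j <. k \<or> (EX v s t. P *. v +. s *. m j = #1 +. t *. m j))"
 have pos: "#0 <. m i" if "i <. n" for i using lt[OF that] by (metis not_lt_zero zero_lt_iff)
 have "n <. n \<or> (EX b P. ?Q n b P)"
 proof (rule renum_induct[of "%k. n <. k \<or> (EX b P. ?Q k b P)"])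
  show "renum (%k. n <. k \<or> (EX b P. ?Q k b P))"
   by (intro renums recfn_const; (rule renum_dec)?; intro decs recfn_comp[OF m] recfn_comp[OF f])
  show "n <. #0 \<or> (EX b P. ?Q #0 b P)"
  proof (rule disjI2, rule exI[of _ \<zero>], rule exI[of _ \<one>])
   have "EX v s t. #1 *. v +. s *. m j = #1 +. t *. m j" for j
    by (rule exI[of _ \<one>]) (auto simp: one_times)
   then show "?Q #0 #0 #1" by simp
  qed
  fix k assume IH: "n <. k \<or> (EX b P. ?Q k b P)"
  show "n <. k +. #1 \<or> (EX b P. ?Q (k +. #1) b P)"
  proof (cases "n <=. k")
   case False
   then have k: "k <. n" by (simp flip: not_lt)
   then have "~ n <. k" by (simp add: nv_simps)
   then obtain b P where Q: "?Q k b P" using IH by auto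
   have "EX v. congr (m k) (P *. v) #1" using Q k unfolding congr_def by auto
   then obtain v where v: "congr (m k) (P *. v) #1" by blast
   obtain y where y: "m k = md b (m k) +. y"
    using div_mod(2)[OF pos[OF k], of b] le_imp_plus by (metis le_def)
   \<comment> \<open>\<open>y\<close> represents minus \<open>b\<close> modulo \<open>m k\<close>,
     and \<open>P *. v\<close> is 1 there; the new term turns the remainder into \<open>f k\<close>
     and is a multiple of all earlier moduli.\<close>
   let ?b = "b +. P *. v *. (y +. f k)"
   have "congr (m k) ?b (b +. #1 *. (y +. f k))"
    by (intro congr_add congr_refl congr_mult v)
   moreover have "congr (m k) (b +. #1 *. (y +. f k)) (f k)"
   proof (rule congrI)
    show "b +. #1 *. (y +. f k) +. #0 *. m k = f k +. (dv b (m k) +. #1) *. m k"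
     using div_mod(1)[OF pos[OF k], of b] y unfolding nv_ops by (simp add: algebra_simps)
   qed
   ultimately have "md ?b (m k) = md (f k) (m k)" using congr_md[OF pos[OF k]] congr_trans by blast
   also have "\<dots> = f k" using lt[OF k] by (intro md_eq[of _ \<zero>]) (simp_all add: zero_times zero_plus)
   finally have bk: "md ?b (m k) = f k" .
   have bi: "md ?b (m i) = f i" if i: "i <. k" for i
   proof -
    obtain c where "P = c *. m i" using Q i by blast
    then have "?b +. #0 *. m i = b +. (c *. v *. (y +. f k)) *. m i" unfolding nv_ops by (simp add: algebra_simps)
    then have "congr (m i) ?b b" by (rule congrI)
    then have "md ?b (m i) = md b (m i)" using congr_md pos i k lt_trans' by blast
    then show ?thesis using Q i by simp
   qed
   have P: "EX c. c <=. P *. m k & P *. m k = c *. m i" if i: "i <. k +. #1" for i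
   proof -
    have "EX c. P *. m k = c *. m i"
    proof (cases "i = k")
     case False
     then obtain c where "P = c *. m i" using Q i by (auto simp: lt_Suc)
     then have "P *. m k = (c *. m k) *. m i" unfolding nv_ops by simp
     then show ?thesis by blast
    qed blast
    moreover have "#0 <. m i" using pos i k lt_trans' by (auto simp: lt_Suc)
    ultimately show ?thesis using le_mult by metis
   qed
   have "EX v s t. P *. m k *. v +. s *. m j = #1 +. t *. m j" if j: "j <. n" "~ j <. k +. #1" for j
   proof -
    have "~ j <. k" "k ~= j" using j by (auto simp: lt_Suc)
    then obtain v where v: "congr (m j) (P *. v) #1" using Q j(1) unfolding congr_def by blast
    obtain u where u: "congr (m j) (m k *. u) #1" using coprime[OF \<open>k ~= j\<close> k j(1)] by blast
    have "congr (m j) (P *. v *. (m k *. u)) (#1 *. (m k *. u))" by (rule congr_mult[OF v])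
    then have "congr (m j) (P *. m k *. (v *. u)) #1"
     using congr_trans[OF _ u] by (simp add: one_times mult_assoc' mult_commute' ac_simps)
      (metis mult_assoc' mult_commute')
    then show ?thesis unfolding congr_def by blast
   qed
   then have "?Q (k +. #1) ?b (P *. m k)" using bk bi P by (auto simp: lt_Suc)
   then show ?thesis by blast
  qed (simp add: lt_Suc_le)
 qed
 then show ?thesis by auto
qed

text \<open>\<open>a\<close> is divisible by all positive numbers up to \<open>n +. B\<close>, where
  \<open>B\<close> bounds the values. This makes the moduli pairwise coprime and also larger than
  the values to be coded.\<close>

lemma beta_ex:
 assumes f: "recfn f" shows "EX a b. ALL i. i <. n --> beta a b i = f i"
proof -
 obtain B where B: "!!i. i <. n ==> f i <. B"
 proof -
  have "dec (%q. psnd q = f (pfst q))" by (intro decs recfn_comp[OF f])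
  from collection_dec[OF this] show thesis using that by blast
 qed
 obtain a where a: "#0 <. a" "!!k. k <. n +. B ==> EX c. c <=. a & a = (k +. #1) *. c"
  using common_multiple[of "n +. B"] by blast
 have n: "i <. n +. B" if "i <. n" for i using that nv_nonneg[of B] unfolding nv_ops by linarith
 have aB: "f i <. a *. (i +. #1) +. #1" if i: "i <. n" for i
 proof -
  have fB: "f i <. n +. B" using B[OF i] nv_nonneg[of n] unfolding nv_ops by linarith
  obtain c where c: "a = (f i +. #1) *. c" using a(2)[OF fB] by blast
  have "c ~= #0" using a(1) c by auto
  then have "f i +. #1 <=. a" unfolding c by (intro le_mult) (simp add: zero_lt_iff)
  moreover have "a <=. a *. (i +. #1)" by (intro le_mult) (simp add: nv_ops add_nonneg_pos)
  ultimately show ?thesis unfolding nv_ops by linarith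
 qed
 have "EX b. ALL i. i <. n --> md b (a *. (i +. #1) +. #1) = f i"
 proof (rule chinese_remainder)
  show "EX v. congr (a *. (j +. #1) +. #1) ((a *. (i +. #1) +. #1) *. v) #1"
   if "i ~= j" "i <. n" "j <. n" for i j
   by (rule beta_moduli_coprime[of n]) (use that a(2) n in blast)+
 qed (intro decs f aB | assumption)+
 then show ?thesis by (auto simp: beta_md)
qed

section \<open>Primitive recursion and course-of-values recursion\<close>

definition prec :: "'n => ('n => 'n => 'n) => 'n => 'n" where
 "prec c g n = (THE y. EX a b. beta a b #0 = c &
   (ALL i. i <. n --> beta a b (i +. #1) = g i (beta a b i)) & beta a b n = y)"

abbreviation is_prec :: "'n => ('n => 'n => 'n) => 'n => 'n => 'n => bool" where
 "is_prec c g n a b \<equiv> beta a b #0 = c & (ALL i. i <. n --> beta a b (i +. #1) = g i (beta a b i))"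

lemma is_prec_ex:
 assumes g: "recfn (%q. g (pfst q) (psnd q))" shows "EX a b. is_prec c g n a b"
proof (rule renum_induct[of "%n. EX a b. is_prec c g n a b"])
 have g': "recfn (%p. g (u p) (v p))" if "recfn u" "recfn v" for u v
  using recfn_comp[OF g recfn_pair[OF that]] by simp
 show "renum (%n. EX a b. is_prec c g n a b)"
  by (intro renum_ex; rule renum_dec; intro decs g')
 show "EX a b. is_prec c g #0 a b"
  using beta_ex[OF recfn_const, of "#0 +. #1" c] by (auto simp: lt_Suc)
 fix n assume "EX a b. is_prec c g n a b"
 then obtain a b where ab: "is_prec c g n a b" by blast
 let ?h = "%i. if i <=. n then beta a b i else g n (beta a b n)"
 have "recfn ?h" by (intro decs)
 then obtain a' b' where h: "!!i. i <. n +. #1 +. #1 ==> beta a' b' i = ?h i"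
  using beta_ex by blast
 have "is_prec c g (n +. #1) a' b'"
 proof (intro conjI allI impI)
  have "#0 <. n +. #1 +. #1" "#0 <=. n" by (simp_all add: nv_simps(3))
  then show "beta a' b' #0 = c" using h ab by simp
  fix i assume "i <. n +. #1"
  then have "i <=. n" by (simp add: lt_Suc_le)
  moreover then have "i <. n +. #1 +. #1" "i +. #1 <. n +. #1 +. #1" by (simp_all add: nv_ops)
  moreover have "i +. #1 <=. n \<longleftrightarrow> i <. n" by (simp add: nv_simps(3) nv_Suc_le)
  moreover have "i = n" if "~ i <. n" using that \<open>i <. n +. \<one>\<close> by (simp add: lt_Suc)
  ultimately show "beta a' b' (i +. #1) = g i (beta a' b' i)" using h ab by auto
 qed
 then show "EX a b. is_prec c g (n +. #1) a b" by blast
qed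

lemma is_prec_unique:
 assumes "is_prec c g n a b" "is_prec c g m a' b'" "n <=. m" shows "i <=. n ==> beta a b i = beta a' b' i"
proof (erule rev_mp, rule dec_induct'[of "%i. i <=. n --> beta a b i = beta a' b' i"])
 fix i assume IH: "i <=. n --> beta a b i = beta a' b' i"
 show "i +. #1 <=. n --> beta a b (i +. #1) = beta a' b' (i +. #1)"
 proof
  assume "i +. #1 <=. n"
  then have "i <. n" "i <=. n" by (simp_all add: nv_ops)
  moreover then have "i <. m" using assms(3) by (simp add: nv_ops)
  ultimately show "beta a b (i +. #1) = beta a' b' (i +. #1)" using IH assms by auto
 qed
qed (use assms in \<open>auto intro!: decs\<close>)

lemma prec_eq: assumes "is_prec c g n a b" shows "prec c g n = beta a b n"
 unfolding prec_def
proof (rule the_equality)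
 fix y assume "EX a b. beta a b #0 = c & (ALL i. i <. n --> beta a b (i +. #1) = g i (beta a b i)) & beta a b n = y"
 then obtain a' b' where "is_prec c g n a' b'" "beta a' b' n = y" by blast
 then show "y = beta a b n" using is_prec_unique[where c = c and g = g and n = n and m = n and i = n and a = a and b = b
    and a' = a' and b' = b'] assms by simp
qed (use assms in blast)

lemma prec_0 [simp]: "prec c g #0 = c"
proof -
 obtain a b where "is_prec c (%_ _. c) #0 a b" using is_prec_ex[OF recfn_const] by blast
 then have "is_prec c g #0 a b" by simp
 then show ?thesis using prec_eq[where c = c and g = g and n = \<zero> and a = a and b = b] by simp
qed

lemma prec_Suc:
 assumes g: "recfn (%q. g (pfst q) (psnd q))" shows "prec c g (n +. #1) = g n (prec c g n)"
proof -
 obtain a b where ab: "is_prec c g (n +. #1) a b" using is_prec_ex[OF g] by blast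
 then have "is_prec c g n a b" by (simp add: lt_Suc)
 then show ?thesis using ab prec_eq by (metis lt_Suc)
qed

text \<open>A run exists and all runs end in the same value, so both the graph and its complement
  can be expressed by the existence of a run; \<open>dec_renum\<close> then applies.\<close>

lemma recfn_prec:
 assumes c: "recfn c" and t: "recfn t" and g: "recfn (%q. g (pfst (pfst q)) (psnd (pfst q)) (psnd q))"
 shows "recfn (%p. prec (c p) (g p) (t p))"
proof (rule recfn_graph, rule dec_renum)
 have g': "recfn (%p. g (r p) (u p) (v p))" if "recfn u" "recfn v" "recfn r" for u v r
  using recfn_comp[OF g recfn_pair[OF recfn_pair[OF that(3,1)] that(2)]] by simp
 have gp: "recfn (%q. g p (pfst q) (psnd q))" for p by (intro g' decs)
 have gen: "y = z \<longleftrightarrow> (EX a b. I a b & y = B a b)" "y ~= z \<longleftrightarrow> (EX a b. I a b & y ~= B a b)"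
  if "!!a b. I a b ==> B a b = z" "I a0 b0" for I :: "'n => 'n => bool" and B a0 b0 and y z :: 'n
  using that by metis+
 have eq: "y = prec (c p) (g p) (t p) \<longleftrightarrow> (EX a b. is_prec (c p) (g p) (t p) a b & y = beta a b (t p))"
  "y ~= prec (c p) (g p) (t p) \<longleftrightarrow> (EX a b. is_prec (c p) (g p) (t p) a b & y ~= beta a b (t p))" for y p
 proof -
  obtain a b where ab: "is_prec (c p) (g p) (t p) a b" using is_prec_ex[OF gp] by blast
  have all: "prec (c p) (g p) (t p) = beta a b (t p)" if "is_prec (c p) (g p) (t p) a b" for a b
   using that by (rule prec_eq)
  show "y = prec (c p) (g p) (t p) \<longleftrightarrow> (EX a b. is_prec (c p) (g p) (t p) a b & y = beta a b (t p))"
   "y ~= prec (c p) (g p) (t p) \<longleftrightarrow> (EX a b. is_prec (c p) (g p) (t p) a b & y ~= beta a b (t p))"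
   by (rule gen[of "is_prec (c p) (g p) (t p)" "%a b. beta a b (t p)", OF all[symmetric] ab], assumption)+
 qed
 show "renum (%q. psnd q = prec (c (pfst q)) (g (pfst q)) (t (pfst q)))"
  unfolding eq(1) by (intro renum_ex; rule renum_dec; intro decs g' recfn_comp[OF c] recfn_comp[OF t])
 show "renum (%q. psnd q ~= prec (c (pfst q)) (g (pfst q)) (t (pfst q)))"
  unfolding eq(2) by (intro renum_ex; rule renum_dec; intro decs g' recfn_comp[OF c] recfn_comp[OF t])
qed

lemmas [decs] = recfn_prec

text \<open>Course-of-values recursion: the history up to \<open>n\<close> is kept as a code for the beta function.\<close>

definition bt :: "'n => 'n => 'n" where
 "bt w i = beta (pfst w) (psnd w) i"

text \<open>The code of the longer history is found by minimization, which avoids a formula for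
  appending to a beta code.\<close>

definition next_hist :: "('n => ('n => 'n) => 'n) => 'n => 'n => 'n" where
 "next_hist G n w = lst (%w'. (ALL i. i <. n --> bt w' i = bt w i) & bt w' n = G n (bt w))"

definition cov :: "('n => ('n => 'n) => 'n) => 'n => 'n" where
 "cov G n = G n (bt (prec #0 (next_hist G) n))"

lemma recfn_bt [decs]: "recfn f ==> recfn g ==> recfn (%p. bt (f p) (g p))"
 unfolding bt_def by (intro decs)

lemma next_hist_ex: "EX w'. (ALL i. i <. n --> bt w' i = bt w i) & bt w' n = y"
proof -
 have "recfn (%i. if i <. n then bt w i else y)" by (intro decs)
 then obtain a b where "!!i. i <. n +. #1 ==> beta a b i = (if i <. n then bt w i else y)"
  using beta_ex by blast
 then show ?thesis by (intro exI[of _ "<<a, b>>"]) (auto simp: bt_def lt_Suc)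
qed

lemma next_hist: "i <. n ==> bt (next_hist G n w) i = bt w i" "bt (next_hist G n w) n = G n (bt w)"
proof -
 obtain w' where w': "(ALL i. i <. n --> bt w' i = bt w i) & bt w' n = G n (bt w)" using next_hist_ex by blast
 have "dec (%w'. (ALL i. i <. n --> bt w' i = bt w i) & bt w' n = G n (bt w))" by (intro decs)
 from lst_least(1)[OF this, OF w']
 show "i <. n ==> bt (next_hist G n w) i = bt w i" "bt (next_hist G n w) n = G n (bt w)"
  unfolding next_hist_def by auto
qed

lemma recfn_next_hist:
 assumes G: "recfn (%q. G (pfst (pfst q)) (psnd (pfst q)) (bt (psnd q)))" and "recfn r" "recfn n" "recfn w"
 shows "recfn (%p. next_hist (G (r p)) (n p) (w p))"
proof -
 have G': "recfn (%p. G (r p) (n p) (bt (w p)))" if "recfn n" "recfn w" "recfn r" for n w r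
  using recfn_comp[OF G recfn_pair[OF recfn_pair[OF that(3,1)] that(2)]] by simp
 show ?thesis
  unfolding next_hist_def using next_hist_ex
  by (intro recfn_lst decs G' recfn_comp[OF assms(2)] recfn_comp[OF assms(3)] recfn_comp[OF assms(4)]) auto
qed

lemma recfn_cov:
 assumes G: "recfn (%q. G (pfst (pfst q)) (psnd (pfst q)) (bt (psnd q)))" and t: "recfn t"
 shows "recfn (%p. cov (G p) (t p))"
proof -
 have G': "recfn (%p. G (r p) (n p) (bt (w p)))" if "recfn n" "recfn w" "recfn r" for n w r
  using recfn_comp[OF G recfn_pair[OF recfn_pair[OF that(3,1)] that(2)]] by simp
 show ?thesis
  unfolding cov_def by (intro decs G' recfn_next_hist[OF G] t)
qed

lemma cov_eq:
 assumes G: "recfn (%q. G (pfst q) (bt (psnd q)))"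
  and local: "!!n h h'. (!!i. i <. n ==> h i = h' i) ==> G n h = G n h'"
 shows "cov G n = G n (cov G)"
proof -
 have G2: "recfn (%q. G (psnd (pfst q)) (bt (psnd q)))"
  using recfn_comp[OF G, of "%q. <<psnd (pfst q), psnd q>>"] by (simp add: decs)
 have nh: "recfn (%q. next_hist G (pfst q) (psnd q))"
  using recfn_next_hist[of "%_. G" "%_. #0" pfst psnd, OF G2 recfn_const recfn_pfst recfn_psnd] .
 have c: "recfn (%p. cov G p)" by (rule recfn_cov[of "%_. G", OF G2]) (rule recfn_ident)
 have "i <. n --> bt (prec #0 (next_hist G) n) i = cov G i" for i
 proof (rule dec_induct'[of "%n. i <. n --> bt (prec #0 (next_hist G) n) i = cov G i"])
  show "dec (%n. i <. n --> bt (prec #0 (next_hist G) n) i = cov G i)"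
   by (intro decs recfn_next_hist[of "%_. G" "%_. #0", OF G2])
  fix k assume "i <. k --> bt (prec #0 (next_hist G) k) i = cov G i"
  then show "i <. k +. #1 --> bt (prec #0 (next_hist G) (k +. #1)) i = cov G i"
   by (auto simp: lt_Suc prec_Suc[OF nh] next_hist cov_def)
 qed simp
 then have "G n (bt (prec #0 (next_hist G) n)) = G n (cov G)" by (intro local) blast
 then show ?thesis by (simp add: cov_def)
qed

end

section \<open>Sums, counting and bounded comprehension\<close>

context model
begin

lemma lt_le_trans': "a <. b ==> b <=. c ==> a <. c"
 and le_lt_trans': "a <=. b ==> b <. c ==> a <. c"
 by (auto simp: nv_simps)

lemma pow2_prec: "pow2 k = prec #1 (%i v. num 2 *. v) k"
 by (simp add: pow2_def prec_def)

lemma recfn_pow2 [decs]: "recfn f ==> recfn (%p. pow2 (f p))"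
 unfolding pow2_prec by (intro decs)

lemma pow2_0 [simp]: "pow2 #0 = #1"
 by (simp add: pow2_prec)

lemma pow2_Suc: "pow2 (k +. #1) = num 2 *. pow2 k"
 unfolding pow2_prec by (rule prec_Suc) (intro decs)

abbreviation pw :: "'n => 'n rl" where
 "pw k \<equiv> nv (pow2 k)"

lemma pw_Suc [simp]: "pw (k +. #1) = 2 * pw k"
 by (simp add: pow2_Suc)

lemma pw_ge: "nv k + 1 <= pw k"
proof -
 have "k <. pow2 k"
 proof (rule dec_induct'[of "%k. k <. pow2 k"])
  show "dec (%k. k <. pow2 k)" by (intro decs)
  fix n assume "n <. pow2 n"
  then show "n +. #1 <. pow2 (n +. #1)"
   using nv_nonneg[of n] unfolding nv_Suc_le pw_Suc nv_add nv_1 by linarith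
 qed simp
 then show ?thesis by (simp add: nv_Suc_le)
qed

lemma pw_pos [simp]: "0 < pw k" and pw_ge_1: "1 <= pw k"
 using pw_ge[of k] nv_nonneg[of k] by linarith+

lemma pw_add: "pw (k +. l) = pw k * pw l"
proof -
 have "pow2 (k +. l) = pow2 k *. pow2 l"
 proof (rule dec_induct'[of "%l. pow2 (k +. l) = pow2 k *. pow2 l"])
  show "dec (%l. pow2 (k +. l) = pow2 k *. pow2 l)" by (intro decs)
  fix n assume "pow2 (k +. n) = pow2 k *. pow2 n"
  then show "pow2 (k +. (n +. #1)) = pow2 k *. pow2 (n +. #1)"
   by (simp add: plus_Suc pow2_Suc nv_eq)
 qed (simp add: nv_eq)
 then show ?thesis by simp
qed

lemma pw_mono: "k <=. l ==> pw k <= pw l"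
 using le_imp_plus[of k l] mult_left_mono[OF pw_ge_1, of "pw k"] by (auto simp: pw_add less_imp_le)

lemma pw_strict_mono: assumes "k <. l" shows "2 * pw k <= pw l"
 using pw_mono[of "k +. #1" l] assms by (simp add: nv_simps(3) nv_Suc_le)

lemma rl_arch_pw: "0 < e ==> EX k. 1 / pw k < e"
proof -
 assume e: "0 < e"
 obtain n where "1 / e < nv n" using nv_arch by blast
 then have "1 / e < pw n" using pw_ge[of n] by linarith
 then have "1 / pw n < e" using e by (simp add: field_simps)
 then show ?thesis by blast
qed

text \<open>Values given by different approximations are compared through this lemma: it suffices to
  have the inequality up to a fixed multiple of \<open>1 / pw k\<close> for every
  \<open>k\<close>.\<close>

lemma le_if_pw: assumes "!!k. a <= b + c / pw k" shows "a <= b"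
proof (rule ccontr)
 assume "~ a <= b"
 then have ab: "0 < a - b" by simp
 show False
 proof (cases "0 < c")
  case True
  then obtain k where "1 / pw k < (a - b) / c" using rl_arch_pw[of "(a - b) / c"] ab by auto
  then have "c / pw k < a - b" using True by (simp add: field_simps)
  then show False using assms[of k] by simp
 next
  case False
  then have "c / pw #0 <= 0" by (simp add: divide_le_0_iff)
  then show False using assms[of \<zero>] ab by linarith
 qed
qed

definition nsum :: "('n => 'n) => 'n => 'n" where
 "nsum f n = prec #0 (%i v. v +. f i) n"

lemma recfn_nsum:
 "recfn (%q. f (pfst q) (psnd q)) ==> recfn t ==> recfn (%p. nsum (f p) (t p))"
 unfolding nsum_def
 using recfn_comp[of "%q. f (pfst q) (psnd q)", OF _ recfn_pfst] by (intro decs) auto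

lemma nsum_0 [simp]: "nsum f #0 = #0"
 by (simp add: nsum_def)

lemma nsum_Suc: assumes "recfn f" shows "nsum f (n +. #1) = nsum f n +. f n"
 unfolding nsum_def by (rule prec_Suc) (intro decs recfn_comp[OF assms])

definition cnt :: "('n => bool) => 'n => 'n" where
 "cnt P n = nsum (%i. if P i then #1 else #0) n"

lemma recfn_cnt:
 "dec (%q. P (pfst q) (psnd q)) ==> recfn t ==> recfn (%p. cnt (P p) (t p))"
 unfolding cnt_def by (intro recfn_nsum decs)

lemmas [decs] = recfn_nsum recfn_cnt

lemma cnt_0 [simp]: "cnt P #0 = #0"
 by (simp add: cnt_def)

lemma cnt_Suc: "dec P ==> cnt P (n +. #1) = cnt P n +. (if P n then #1 else #0)"
 unfolding cnt_def by (rule nsum_Suc) (intro decs)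

lemma nsum_mono:
 assumes "recfn f" "recfn g" "!!i. i <. n ==> f i <=. g i" shows "nsum f n <=. nsum g n"
proof -
 have "n <=. n --> nsum f n <=. nsum g n"
 proof (rule dec_induct'[of "%k. k <=. n --> nsum f k <=. nsum g k"])
  fix k assume IH: "k <=. n --> nsum f k <=. nsum g k"
  show "k +. #1 <=. n --> nsum f (k +. #1) <=. nsum g (k +. #1)"
  proof
   assume "k +. #1 <=. n"
   then have "k <. n" "k <=. n" by (simp_all add: nv_ops)
   then show "nsum f (k +. #1) <=. nsum g (k +. #1)"
    using IH assms(3)[of k] by (simp add: nsum_Suc assms nv_ops add_mono)
  qed
 qed (auto intro!: decs recfn_comp[OF assms(1)] recfn_comp[OF assms(2)])
 then show ?thesis by simp
qed

lemma cnt_mono: "dec P ==> dec Q ==> (!!i. i <. n ==> P i ==> Q i) ==> cnt P n <=. cnt Q n"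
 unfolding cnt_def by (rule nsum_mono) (auto intro!: decs simp: nv_ops)

lemma cnt_cong: "dec P ==> dec Q ==> (!!i. i <. n ==> P i \<longleftrightarrow> Q i) ==> cnt P n = cnt Q n"
 using cnt_mono[of P Q n] cnt_mono[of Q P n] by (auto simp: nv_simps)

lemma cnt_insert:
 assumes P: "dec P" and x: "~ P x"
 shows "cnt (%y. P y \<or> y = x) n = cnt P n +. (if x <. n then #1 else #0)"
proof (rule dec_induct'[of "%n. cnt (%y. P y \<or> y = x) n = cnt P n +. (if x <. n then #1 else #0)"])
 have Q: "dec (%y. P y \<or> y = x)" by (intro decs P)
 show "dec (%n. cnt (%y. P y \<or> y = x) n = cnt P n +. (if x <. n then #1 else #0))"
  by (intro decs dec_subst[OF P])
 fix n assume "cnt (%y. P y \<or> y = x) n = cnt P n +. (if x <. n then #1 else #0)"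
 then show "cnt (%y. P y \<or> y = x) (n +. #1) = cnt P (n +. #1) +. (if x <. n +. #1 then #1 else #0)"
  using x by (auto simp: cnt_Suc[OF P] cnt_Suc[OF Q] lt_Suc)
qed simp

lemma cnt_le: "dec P ==> cnt P n <=. n"
proof (rule dec_induct'[of "%n. cnt P n <=. n"])
 assume P: "dec P"
 show "dec (%n. cnt P n <=. n)" by (intro decs dec_subst[OF P])
 show "cnt P n <=. n ==> cnt P (n +. #1) <=. n +. #1" for n by (auto simp: cnt_Suc[OF P] nv_ops)
qed simp

text \<open>Strong bounding: by induction on \<open>c\<close>, arbitrarily many of the \<open>x <. b\<close> would otherwise acquire
 witnesses below some bound.\<close>

lemma strong_bounding:
 assumes R: "dec (%q. R (pfst q) (psnd q))"
 shows "EX m. ALL x. x <. b --> (EX k. R x k) --> (EX k. k <. m & R x k)"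
proof (rule ccontr)
 let ?c = "%m. cnt (%x. EX k. k <. m & R x k) b"
 have d: "dec (%x. EX k. k <. m & R x k)" for m by (intro decs dec_rel2[OF R])
 assume *: "~ ?thesis"
 have "EX m. b +. #1 <=. ?c m"
 proof (rule renum_induct[of "%c. EX m. c <=. ?c m"])
  show "renum (%c. EX m. c <=. ?c m)"
   by (intro renum_ex; rule renum_dec; intro decs dec_rel2[OF R])
  fix c assume "EX m. c <=. ?c m"
  then obtain m where m: "c <=. ?c m" by blast
  obtain x k where x: "x <. b" "R x k" "~ (EX k. k <. m & R x k)" using * by blast
  let ?m = "m +. k +. #1"
  have "m <=. ?m" "k <. ?m" using nv_nonneg[of m] nv_nonneg[of k] unfolding nv_ops by linarith+
  then have "cnt (%y. (EX k. k <. m & R y k) \<or> y = x) b <=. ?c ?m"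
   by (intro cnt_mono decs dec_rel2[OF R]) (use x(2) \<open>k <. ?m\<close> \<open>m <=. ?m\<close> lt_le_trans' in blast)
  then have "c +. #1 <=. ?c ?m" using m x(1) by (simp add: cnt_insert[OF d x(3)] nv_simps(3))
  then show "EX m. c +. #1 <=. ?c m" by blast
 qed (simp add: nv_simps)
 then obtain m where "b +. #1 <=. ?c m" by blast
 then show False using cnt_le[OF d[of m], of b] by (simp add: nv_simps(3))
qed

text \<open>Below a fixed bound all existing witnesses have a common bound, which turns the
  enumerable condition into a decidable one.\<close>

lemma bounded_comprehension:
 assumes "renum P" shows "dec (%x. x <. b & P x)"
proof -
 obtain R where R: "dec (%q. R (pfst q) (psnd q))" "!!n. P n \<longleftrightarrow> (EX m. R n m)"
  using assms unfolding renum_def by blast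
 obtain m where m: "!!x. x <. b ==> (EX k. R x k) ==> (EX k. k <. m & R x k)"
  using strong_bounding[OF R(1), of b] by blast
 have "dec (%x. x <. b & (EX k. k <. m & R x k))" by (intro decs dec_rel2[OF R(1)])
 moreover have "x <. b & (EX k. k <. m & R x k) \<longleftrightarrow> x <. b & P x" for x using m R(2) by blast
 ultimately show ?thesis by simp
qed

lemma pigeonhole:
 assumes P: "dec P" and s: "recfn s" and sP: "!!i. i <. c ==> P (s i) & s i <. n"
  and inj: "!!i j. i <. c ==> j <. c ==> s i = s j ==> i = j"
 shows "c <=. cnt P n"
proof -
 let ?Q = "%k x. EX i. i <. k & x = s i"
 have Q: "dec (?Q k)" for k by (intro decs recfn_comp[OF s])
 have "c <=. c --> cnt (?Q c) n = c"
 proof (rule dec_induct'[of "%k. k <=. c --> cnt (?Q k) n = k"])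
  show "dec (%k. k <=. c --> cnt (?Q k) n = k)" by (intro decs recfn_comp[OF s])
  have "cnt (?Q #0) n = cnt (%x. x <. #0) n" by (intro cnt_cong Q decs) simp
  also have "\<dots> = #0"
   by (rule dec_induct'[of "%n. cnt (%x. x <. #0) n = #0"], intro decs) (simp_all add: cnt_Suc decs)
  finally show "#0 <=. c --> cnt (?Q #0) n = #0" by simp
  fix k assume IH: "k <=. c --> cnt (?Q k) n = k"
  show "k +. #1 <=. c --> cnt (?Q (k +. #1)) n = k +. #1"
  proof
   assume "k +. #1 <=. c"
   then have k: "k <. c" "k <=. c" by (simp_all add: nv_ops)
   have "~ ?Q k (s k)" using inj[OF k(1)] k lt_trans' lt_irrefl' by metis
   from cnt_insert[OF Q this] have "cnt (%x. ?Q k x \<or> x = s k) n = k +. #1" using IH k sP by simp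
   moreover have "cnt (?Q (k +. #1)) n = cnt (%x. ?Q k x \<or> x = s k) n"
    by (rule cnt_cong[OF Q dec_disj[OF Q]]) (auto simp: lt_Suc intro!: decs)
   ultimately show "cnt (?Q (k +. #1)) n = k +. #1" by simp
  qed
 qed
 then have "c = cnt (?Q c) n" by simp
 also have "\<dots> <=. cnt P n" using sP by (intro cnt_mono Q P) auto
 finally show ?thesis .
qed

lemma card_ge_cnt:
 assumes P: "dec P" and "card_ge {x. Q x} c" "!!x. Q x ==> P (f x) & f x <. n" "recfn f"
  "!!x y. Q x ==> Q y ==> f x = f y ==> x = y"
 shows "c <=. cnt P n"
proof -
 obtain a b where ab: "!!i. i <. c ==> Q (beta a b i)"
  "!!i j. i <. c ==> j <. c ==> beta a b i = beta a b j ==> i = j"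
  using assms(2) unfolding card_ge_def mem_Collect_eq by metis
 show ?thesis
  by (rule pigeonhole[OF P, of "%i. f (beta a b i)"]) (use assms ab in \<open>auto intro!: recfn_comp[OF assms(4)] decs\<close>)
qed

lemma cnt_card_ge:
 assumes P: "dec P" shows "card_ge {x. P x & x <. n} (cnt P n)"
proof -
 have ex: "k <. cnt P n --> (EX x. x <. n & P x & cnt P x = k)" for k
 proof (rule dec_induct'[of "%n. k <. cnt P n --> (EX x. x <. n & P x & cnt P x = k)"])
  show "dec (%n. k <. cnt P n --> (EX x. x <. n & P x & cnt P x = k))" by (intro decs dec_subst[OF P])
 qed (auto simp: cnt_Suc[OF P] lt_Suc)
 \<comment> \<open>The element of \<open>P\<close> with exactly \<open>k\<close> predecessors in
   \<open>P\<close>; the first disjunct makes the search total for larger \<open>k\<close>.\<close>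
 let ?f = "%k. lst (%x. cnt P n <=. k \<or> x <. n & P x & cnt P x = k)"
 have "recfn ?f"
  by (intro recfn_lst decs dec_subst[OF P]) (use ex in \<open>auto simp: not_lt[symmetric]\<close>)
 then obtain a b where ab: "!!k. k <. cnt P n ==> beta a b k = ?f k" using beta_ex by blast
 have f: "?f k <. n & P (?f k) & cnt P (?f k) = k" if k: "k <. cnt P n" for k
 proof -
  obtain x where "cnt P n <=. k \<or> x <. n & P x & cnt P x = k" using ex k by blast
  then have "cnt P n <=. k \<or> ?f k <. n & P (?f k) & cnt P (?f k) = k"
   by (intro lst_least(1)[of "%x. cnt P n <=. k \<or> x <. n & P x & cnt P x = k"]) (intro decs dec_subst[OF P])
  then show ?thesis using k by (simp flip: not_lt)
 qed
 show ?thesis unfolding card_ge_def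
 proof (intro exI conjI allI impI)
  fix i j
  show "i <. cnt P n ==> beta a b i \<in> {x. P x & x <. n}" using ab f by simp
  show "i <. cnt P n & j <. cnt P n & beta a b i = beta a b j ==> i = j" using ab f by metis
 qed
qed

end

section \<open>Values of rational and real codes\<close>

context model
begin

lemma nv_pos: "n ~= #0 ==> 0 < nv n"
 using zero_lt_iff[of n] by (simp flip: nv_less)

lemma pw_neq_0 [simp]: "pw k ~= 0"
 using pw_pos[of k] by linarith

lemma rat_parts [simp]: "qpos (rat a b c) = a" "qneg (rat a b c) = b" "qden (rat a b c) = c"
 by (simp_all add: rat_def qpos_def qneg_def qden_def)

definition qv :: "'n => 'n rl" where
 "qv q = (nv (qpos q) - nv (qneg q)) / nv (qden q)"

lemma qv_rat [simp]: "qv (rat a b c) = (nv a - nv b) / nv c"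
 by (simp add: qv_def)

lemma isQ_den: "isQ q ==> 0 < nv (qden q)"
 by (auto simp: isQ_def nv_pos)

lemma isQ_rat: "isQ (rat a b c) \<longleftrightarrow> c ~= #0"
 by (auto simp: isQ_def rat_def)

lemma mult_eq_zero: "a *. b = #0 \<longleftrightarrow> a = #0 \<or> b = #0"
 by (simp add: nv_eq)

lemma isQ_ops [simp]: "isQ p ==> isQ q ==> isQ (p +\<^sub>Q q)" "isQ p ==> isQ q ==> isQ (p *\<^sub>Q q)"
 "isQ p ==> isQ (quminus p)" "isQ p ==> isQ q ==> isQ (qmax p q)" "isQ p ==> isQ (qabs p)"
 "isQ (qnat n)" "isQ (qhalf k)"
proof -
 show m: "isQ p ==> isQ (quminus p)" for p
  using isQ_den[of p] by (auto simp: quminus_def isQ_rat)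
 show "isQ p ==> isQ q ==> isQ (p +\<^sub>Q q)" "isQ p ==> isQ q ==> isQ (p *\<^sub>Q q)"
  using isQ_den[of p] isQ_den[of q] by (auto simp: qadd_def qmul_def isQ_rat mult_eq_zero)
 show mx: "isQ p ==> isQ q ==> isQ (qmax p q)" for p q by (simp add: qmax_def)
 show "isQ p ==> isQ (qabs p)" by (simp add: qabs_def mx m)
 have "pow2 k ~= #0" using pw_pos[of k] by (metis nv_0 less_irrefl)
 then show "isQ (qhalf k)" by (simp add: qhalf_def isQ_rat)
 have "#1 ~= #0" using zero_lt_one zero_lt_iff by blast
 then show "isQ (qnat n)" by (simp add: qnat_def isQ_rat)
qed

lemma qv_add [simp]: "isQ p ==> isQ q ==> qv (p +\<^sub>Q q) = qv p + qv q"
 and qv_mul [simp]: "isQ p ==> isQ q ==> qv (p *\<^sub>Q q) = qv p * qv q"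
 using isQ_den[of p] isQ_den[of q] unfolding qadd_def qmul_def qv_rat
 by (simp_all add: qv_def field_simps)

lemma qv_uminus [simp]: "qv (quminus p) = - qv p"
 by (simp add: quminus_def qv_def minus_divide_left)

lemma qle_iff: assumes "isQ p" "isQ q" shows "p \<le>\<^sub>Q q \<longleftrightarrow> qv p <= qv q"
proof -
 have d: "0 < nv (qden p)" "0 < nv (qden q)" using assms isQ_den by auto
 have "qv p <= qv q \<longleftrightarrow> (nv (qpos p) - nv (qneg p)) * nv (qden q) <= (nv (qpos q) - nv (qneg q)) * nv (qden p)"
  unfolding qv_def using d by (simp add: divide_le_eq pos_le_divide_eq field_simps)
 then show ?thesis unfolding qle_def nv_simps(3) nv_add nv_mult by (auto simp: algebra_simps)
qed

lemma qlt_iff: "isQ p ==> isQ q ==> p <\<^sub>Q q \<longleftrightarrow> qv p < qv q"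
 by (simp add: qlt_def qle_iff not_le)

lemma qv_max [simp]: "isQ p ==> isQ q ==> qv (qmax p q) = max (qv p) (qv q)"
 by (simp add: qmax_def qle_iff)

lemma qv_abs [simp]: "isQ p ==> qv (qabs p) = \<bar>qv p\<bar>"
 by (simp add: qabs_def abs_if max_def)

lemma qv_nat [simp]: "qv (qnat n) = nv n" and qv_half [simp]: "qv (qhalf k) = 1 / pw k"
 by (simp_all add: qnat_def qhalf_def)

lemma posQ_iff: "posQ q \<longleftrightarrow> isQ q & 0 < qv q"
 by (auto simp: posQ_def qlt_iff)

lemma posQ_half [simp]: "posQ (qhalf k)"
 by (simp add: posQ_iff)

lemma isQ_dec: "isQ q \<longleftrightarrow> is_pair q & is_pair (pfst q) & psnd q ~= #0"
 by (auto simp: isQ_def rat_def is_pair_def)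

lemma recfn_rat [decs]: "recfn f ==> recfn g ==> recfn h ==> recfn (%p. rat (f p) (g p) (h p))"
 unfolding rat_def by (intro decs)

lemma recfn_q1 [decs]: assumes "recfn f"
 shows "recfn (%p. qpos (f p))" "recfn (%p. qneg (f p))" "recfn (%p. qden (f p))"
  "recfn (%p. quminus (f p))" "recfn (%p. qnat (f p))" "recfn (%p. qhalf (f p))" "dec (%p. isQ (f p))"
proof -
 show a: "recfn (%p. qpos (f p))" "recfn (%p. qneg (f p))" "recfn (%p. qden (f p))"
  unfolding qpos_def qneg_def qden_def by (intro decs assms)+
 show "recfn (%p. quminus (f p))" "recfn (%p. qnat (f p))" "recfn (%p. qhalf (f p))" "dec (%p. isQ (f p))"
  unfolding quminus_def qnat_def qhalf_def isQ_dec by (intro decs assms a)+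
qed

lemma recfn_q2 [decs]: assumes "recfn f" "recfn g"
 shows "recfn (%p. f p +\<^sub>Q g p)" "recfn (%p. f p *\<^sub>Q g p)" "dec (%p. f p \<le>\<^sub>Q g p)" "dec (%p. f p <\<^sub>Q g p)"
  "recfn (%p. qmax (f p) (g p))"
proof -
 show "recfn (%p. f p +\<^sub>Q g p)" "recfn (%p. f p *\<^sub>Q g p)"
  unfolding qadd_def qmul_def by (intro decs assms)+
 show le: "dec (%p. f p \<le>\<^sub>Q g p)" unfolding qle_def by (intro decs assms)
 show "recfn (%p. qmax (f p) (g p))" unfolding qmax_def by (intro decs assms le)
 show "dec (%p. f p <\<^sub>Q g p)" unfolding qlt_def qle_def by (intro decs assms)
qed

lemma recfn_qabs [decs]: "recfn f ==> recfn (%p. qabs (f p))"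
 unfolding qabs_def by (intro decs)

definition rv :: "('n => 'n) => 'n rl" where
 "rv x = (THE r. ALL k. \<bar>qv (x k) - r\<bar> <= 1 / pw k)"

lemma is_real_iff: "is_real x \<longleftrightarrow> recfn x & (ALL k. isQ (x k)) & (ALL k j. k <=. j --> \<bar>qv (x k) - qv (x j)\<bar> <= 1 / pw k)"
proof -
 have "k <=. k +. i" for k i by (simp add: nv_simps(3))
 then show ?thesis unfolding is_real_def using le_imp_plus by (auto simp: qle_iff) blast
qed

lemma eq_if_pw: assumes "!!k. \<bar>a - b\<bar> <= c / pw k" shows "a = b"
 using le_if_pw[of "\<bar>a - b\<bar>" 0 c] assms by simp

text \<open>The limit of the rational approximations is supplied by \<open>rl_complete\<close>; its
  uniqueness makes the description in \<open>rv\<close> meaningful.\<close>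

lemma is_realD: assumes "is_real x"
 shows "recfn x" "isQ (x k)" "\<bar>qv (x k) - rv x\<bar> <= 1 / pw k"
proof -
 let ?q = "%q. (ratl_of (qpos q) - ratl_of (qneg q)) / ratl_of (qden q)"
 let ?e = "%k. 1 / ratl_of (pow2 k)"
 have p: "0 < ratl_of n \<longleftrightarrow> 0 < nv n" for n
  using of_ratl_less[of "ratl_of #0" "ratl_of n"] unfolding of_ratl_nv by (simp add: ratl_of_ops)
 have one: "of_ratl 1 = 1" using of_ratl_nv[of \<one>] unfolding ratl_of_ops by simp
 have q: "isQ q ==> of_ratl (?q q) = qv q" for q
  using isQ_den[of q] p[of "qden q"] by (simp add: of_ratl_divide of_ratl_diff of_ratl_nv qv_def)
 have e: "of_ratl (?e k) = 1 / pw k" for k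
  using p[of "pow2 k"] by (simp add: of_ratl_divide of_ratl_nv one)
 show r: "recfn x" and Q: "isQ (x k)" for k using assms by (auto simp: is_real_iff)
 have "EX r. ALL k. \<bar>of_ratl (?q (x k)) - r\<bar> <= of_ratl (?e k)"
 proof (rule rl_complete)
  fix k j assume "k <=. j"
  then show "\<bar>?q (x k) - ?q (x j)\<bar> <= ?e k"
   using assms Q unfolding of_ratl_le[symmetric] of_ratl_abs of_ratl_diff[of "?q (x k)"]
   by (simp add: q e is_real_iff del: of_ratl_le)
  show "?e j <= ?e k" using pw_mono[OF \<open>k <=. j\<close>] unfolding of_ratl_le[symmetric] e
   by (simp add: frac_le)
 next
  fix d :: "'n ratl" assume "0 < d"
  then have "0 < of_ratl d" using of_ratl_less[of 0 d] of_ratl_diff[of 0 0] by simp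
  then obtain k where "1 / pw k < of_ratl d" using rl_arch_pw by blast
  then show "EX k. ?e k < d" unfolding e[symmetric] of_ratl_less by blast
 qed
 then obtain r where r: "!!k. \<bar>qv (x k) - r\<bar> <= 1 / pw k" by (auto simp: q Q e)
 have "rv x = r"
  unfolding rv_def
 proof (rule the_equality)
  fix r' assume r': "ALL k. \<bar>qv (x k) - r'\<bar> <= 1 / pw k"
  have "2 / pw k = 2 * (1 / pw k)" for k by simp
  then have "\<bar>r' - r\<bar> <= 2 / pw k" for k using r[of k] r'[rule_format, of k] by (simp only:; linarith)
  then show "r' = r" by (rule eq_if_pw)
 qed (use r in blast)
 then show "\<bar>qv (x k) - rv x\<bar> <= 1 / pw k" using r by simp
qed

lemma rv_eqI: assumes "is_real x" "!!k. \<bar>qv (x k) - r\<bar> <= c / pw k" shows "rv x = r"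
proof (rule eq_if_pw)
 fix k
 have "\<bar>rv x - r\<bar> <= 1 / pw k + c / pw k" using is_realD(3)[OF assms(1), of k] assms(2)[of k] by linarith
 then show "\<bar>rv x - r\<bar> <= (1 + c) / pw k" by (simp add: add_divide_distrib)
qed

lemma is_realI:
 assumes "recfn x" "!!k. isQ (x k)" "!!k. \<bar>qv (x k) - r\<bar> <= 1 / (2 * pw k)"
 shows "is_real x" "rv x = r"
proof -
 show "is_real x" unfolding is_real_iff
 proof (intro conjI allI impI assms)
  fix k j assume "k <=. j"
  then have "1 / (2 * pw j) <= 1 / (2 * pw k)" by (simp add: pw_mono frac_le)
  then have "\<bar>qv (x k) - qv (x j)\<bar> <= 1 / (2 * pw k) + 1 / (2 * pw k)"
   using assms(3)[of k] assms(3)[of j] by linarith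
  then show "\<bar>qv (x k) - qv (x j)\<bar> <= 1 / pw k" by simp
 qed
 then show "rv x = r"
  by (rule rv_eqI[where c = "1 / 2"]) (use assms(3) in simp)
qed

lemma rle_iff: assumes "is_real x" "is_real y" shows "x \<le>\<^sub>R y \<longleftrightarrow> rv x <= rv y"
proof
 assume "x \<le>\<^sub>R y"
 then have *: "qv (x k) <= qv (y k) + 2 / pw k" for k
  using is_realD(2)[OF assms(1)] is_realD(2)[OF assms(2)] by (simp add: rle_def qle_iff)
 show "rv x <= rv y"
 proof (rule le_if_pw)
  fix k
  have "2 / pw k = 2 * (1 / pw k)" "4 / pw k = 4 * (1 / pw k)" by simp_all
  then show "rv x <= rv y + 4 / pw k"
   using *[of k] is_realD(3)[OF assms(1), of k] is_realD(3)[OF assms(2), of k] by linarith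
 qed
next
 assume "rv x <= rv y"
 moreover have "2 / pw k = 2 * (1 / pw k)" for k by simp
 ultimately have "qv (x k) <= qv (y k) + 2 / pw k" for k
  using is_realD(3)[OF assms(1), of k] is_realD(3)[OF assms(2), of k] by (simp only:; linarith)
 then show "x \<le>\<^sub>R y" using is_realD(2)[OF assms(1)] is_realD(2)[OF assms(2)] by (simp add: rle_def qle_iff)
qed

lemma rlt_iff: "is_real x ==> is_real y ==> x <\<^sub>R y \<longleftrightarrow> rv x < rv y"
 by (simp add: rlt_def rle_iff not_le)

lemma req_iff: assumes "is_real x" "is_real y" shows "x =\<^sub>R y \<longleftrightarrow> rv x = rv y"
proof -
 note Q = is_realD(2)[OF assms(1)] is_realD(2)[OF assms(2)]
 have "x =\<^sub>R y \<longleftrightarrow> x \<le>\<^sub>R y & y \<le>\<^sub>R x"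
  unfolding req_def rle_def using Q by (auto simp: qle_iff abs_le_iff algebra_simps)
 then show ?thesis using assms by (auto simp: rle_iff)
qed

lemma recfn_shift [decs]: "recfn f ==> recfn (%p. f (p +. c))"
 by (erule recfn_comp) (intro decs)

lemma is_real_const: "isQ q ==> is_real (rconst q)" and rv_const [simp]: "isQ q ==> rv (rconst q) = qv q"
 using is_realI[of "rconst q" "qv q"] by (simp_all add: rconst_def decs)

lemma is_real_add: assumes "is_real x" "is_real y"
 shows "is_real (x +\<^sub>R y)" "rv (x +\<^sub>R y) = rv x + rv y"
proof -
 note D = is_realD[OF assms(1)] is_realD[OF assms(2)]
 show r: "is_real (x +\<^sub>R y)" unfolding is_real_iff
 proof (intro conjI allI impI)
  show "recfn (x +\<^sub>R y)" unfolding radd_def by (intro decs D)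
  show "isQ ((x +\<^sub>R y) k)" for k using D by (simp add: radd_def)
  fix k j assume "k <=. j"
  then have "k +. #1 <=. j +. #1" by (simp add: nv_simps)
  then have "\<bar>qv (x (k +. #1)) - qv (x (j +. #1))\<bar> <= 1 / (2 * pw k)" "\<bar>qv (y (k +. #1)) - qv (y (j +. #1))\<bar> <= 1 / (2 * pw k)"
   using assms unfolding is_real_iff by fastforce+
  then have "\<bar>qv ((x +\<^sub>R y) k) - qv ((x +\<^sub>R y) j)\<bar> <= 1 / (2 * pw k) + 1 / (2 * pw k)"
   using D(2,5) by (simp add: radd_def; linarith)
  then show "\<bar>qv ((x +\<^sub>R y) k) - qv ((x +\<^sub>R y) j)\<bar> <= 1 / pw k" by simp
 qed
 show "rv (x +\<^sub>R y) = rv x + rv y"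
 proof (rule rv_eqI[OF r, where c = 1])
  fix k
  have "\<bar>qv ((x +\<^sub>R y) k) - (rv x + rv y)\<bar> <= 1 / (2 * pw k) + 1 / (2 * pw k)"
   using D(3)[of "k +. #1"] D(6)[of "k +. #1"] D(2,5) by (simp add: radd_def; linarith)
  then show "\<bar>qv ((x +\<^sub>R y) k) - (rv x + rv y)\<bar> <= 1 / pw k" by simp
 qed
qed

lemma is_real_uminus: assumes "is_real x" shows "is_real (ruminus x)" "rv (ruminus x) = - rv x"
proof -
 note D = is_realD[OF assms]
 show r: "is_real (ruminus x)"
  using assms unfolding is_real_iff ruminus_def by (auto simp: abs_minus_commute intro!: decs)
 show "rv (ruminus x) = - rv x"
  by (rule rv_eqI[OF r, where c = 1]) (use D(3) in \<open>simp add: ruminus_def abs_minus_commute\<close>)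
qed

lemma is_real_max: assumes "is_real x" "is_real y"
 shows "is_real (rmax x y)" "rv (rmax x y) = max (rv x) (rv y)"
proof -
 note D = is_realD[OF assms(1)] is_realD[OF assms(2)]
 have mx: "\<bar>max a b - max c d\<bar> <= e" if "\<bar>a - c\<bar> <= e" "\<bar>b - d\<bar> <= e" for a b c d e :: "'n rl"
  using that by (auto simp: max_def abs_le_iff)
 have "recfn (%p. x p)" "recfn (%p. y p)" using D by auto
 then show r: "is_real (rmax x y)"
  using assms unfolding is_real_iff rmax_def by (auto intro!: decs mx)
 show "rv (rmax x y) = max (rv x) (rv y)"
  by (rule rv_eqI[OF r, where c = 1]) (use D mx in \<open>simp add: rmax_def\<close>)
qed

lemma is_real_abs: assumes "is_real x" shows "is_real (rabs x)" "rv (rabs x) = \<bar>rv x\<bar>"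
proof -
 have "rabs x = rmax x (ruminus x)" by (simp add: rabs_def rmax_def ruminus_def qabs_def)
 then show "is_real (rabs x)" "rv (rabs x) = \<bar>rv x\<bar>"
  using is_real_max[OF assms is_real_uminus(1)[OF assms]] is_real_uminus[OF assms] by (simp_all add: abs_if max_def)
qed

lemma is_real_diff: assumes "is_real x" "is_real y" shows "is_real (rdiff x y)" "rv (rdiff x y) = \<bar>rv x - rv y\<bar>"
 unfolding rdiff_def using assms by (simp_all add: is_real_abs is_real_add is_real_uminus)

lemma is_real_mul: assumes "is_real x" "is_real y"
 shows "is_real (x *\<^sub>R y)" "rv (x *\<^sub>R y) = rv x * rv y"
proof -
 note D = is_realD[OF assms(1)] is_realD[OF assms(2)]
 let ?P = "%s. qabs (x #0) +\<^sub>Q qabs (y #0) +\<^sub>Q qnat (num 2) \<le>\<^sub>Q qnat (pow2 s)"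
 have P: "?P s \<longleftrightarrow> \<bar>qv (x #0)\<bar> + \<bar>qv (y #0)\<bar> + 2 <= pw s" for s using D by (simp add: qle_iff)
 obtain n where "\<bar>qv (x #0)\<bar> + \<bar>qv (y #0)\<bar> + 2 < nv n" using nv_arch by blast
 then have "?P n" unfolding P using pw_ge[of n] by linarith
 moreover have d: "dec ?P" by (intro decs)
 ultimately obtain s where s: "?P s" "!!t. t <. s ==> ~ ?P t" using dec_least by meson
 have "rmul_shift x y = s"
  unfolding rmul_shift_def Let_def using s lt_linear
  by (intro the_equality) (auto simp: le_def dest: lt_trans')
 then have m: "(x *\<^sub>R y) k = x (k +. s) *\<^sub>Q y (k +. s)" for k by (simp add: rmul_def)
 have ps: "\<bar>qv (x #0)\<bar> + \<bar>qv (y #0)\<bar> + 2 <= pw s" using s(1) P by simp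
 have x0: "\<bar>qv (x k)\<bar> <= \<bar>qv (x #0)\<bar> + 1" and y0: "\<bar>qv (y k)\<bar> <= \<bar>qv (y #0)\<bar> + 1" for k
 proof -
  have "#0 <=. k" by (simp add: nv_simps(3))
  then have "\<bar>qv (x #0) - qv (x k)\<bar> <= 1 / pw #0" "\<bar>qv (y #0) - qv (y k)\<bar> <= 1 / pw #0"
   using assms unfolding is_real_iff by blast+
  then have "\<bar>qv (x #0) - qv (x k)\<bar> <= 1" "\<bar>qv (y #0) - qv (y k)\<bar> <= 1" by simp_all
  then show "\<bar>qv (x k)\<bar> <= \<bar>qv (x #0)\<bar> + 1" "\<bar>qv (y k)\<bar> <= \<bar>qv (y #0)\<bar> + 1" by linarith+
 qed
 \<comment> \<open>One estimate serves twice, for the modulus of convergence of the product and for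
   its value. The shift \<open>s\<close> was chosen so that the sum of the two factor bounds is at
   most \<open>pw s\<close>.\<close>
 have key: "\<bar>a * b - c * d\<bar> <= 1 / pw k"
  if "\<bar>a - c\<bar> <= 1 / pw (k +. s)" "\<bar>b - d\<bar> <= 1 / pw (k +. s)" "\<bar>a\<bar> <= \<bar>qv (x #0)\<bar> + 1" "\<bar>d\<bar> <= \<bar>qv (y #0)\<bar> + 1" for a b c d k
 proof -
  have "\<bar>a * b - c * d\<bar> <= \<bar>a\<bar> * \<bar>b - d\<bar> + \<bar>a - c\<bar> * \<bar>d\<bar>"
   using abs_triangle_ineq[of "a * (b - d)" "(a - c) * d"] unfolding abs_mult[symmetric] by (simp add: algebra_simps)
  also have "\<dots> <= (\<bar>qv (x #0)\<bar> + 1) * (1 / pw (k +. s)) + 1 / pw (k +. s) * (\<bar>qv (y #0)\<bar> + 1)"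
   using that by (intro add_mono mult_mono) (auto simp: less_imp_le)
  also have "\<dots> = (\<bar>qv (x #0)\<bar> + \<bar>qv (y #0)\<bar> + 2) / pw (k +. s)" by (simp add: add_divide_distrib)
  also have "\<dots> <= pw s / pw (k +. s)" using ps by (intro divide_right_mono) (auto simp: less_imp_le)
  also have "\<dots> = 1 / pw k" by (simp add: pw_add)
  finally show ?thesis .
 qed
 show r: "is_real (x *\<^sub>R y)" unfolding is_real_iff
 proof (intro conjI allI impI)
  show "recfn (x *\<^sub>R y)" unfolding ext[OF m] by (intro decs D)
  show "isQ ((x *\<^sub>R y) k)" for k using D by (simp add: m)
  fix k j assume "k <=. j"
  then have "k +. s <=. j +. s" by (simp add: nv_simps)
  then have "\<bar>qv (x (k +. s)) - qv (x (j +. s))\<bar> <= 1 / pw (k +. s)" "\<bar>qv (y (k +. s)) - qv (y (j +. s))\<bar> <= 1 / pw (k +. s)"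
   using assms unfolding is_real_iff by blast+
  from key[OF this x0 y0] show "\<bar>qv ((x *\<^sub>R y) k) - qv ((x *\<^sub>R y) j)\<bar> <= 1 / pw k"
   using D by (simp add: m)
 qed
 have "\<bar>rv y\<bar> <= \<bar>qv (y #0)\<bar> + 1" using D(6)[of \<zero>] by simp
 then show "rv (x *\<^sub>R y) = rv x * rv y"
  using key[OF D(3) D(6) x0] D(2,5) by (intro rv_eqI[OF r, where c = 1]) (simp add: m)
qed

lemma posQ_below: "0 < e ==> EX q. posQ q & qv q < e"
 using rl_arch_pw posQ_half by (metis qv_half)

text \<open>The positive rationals of the model are coinitial among the positive reals, so a
  monotone condition may use real errors.\<close>

lemma all_posQ:
 assumes "!!e e'. P e ==> e <= e' ==> P e'"
 shows "(ALL q. posQ q --> P (qv q)) \<longleftrightarrow> (\<forall>e>0. P e)"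
proof
 assume *: "ALL q. posQ q --> P (qv q)"
 show "\<forall>e>0. P e"
 proof (intro allI impI)
  fix e :: "'n rl" assume "0 < e"
  then obtain q where "posQ q" "qv q < e" using posQ_below by blast
  then show "P e" using * assms less_imp_le by blast
 qed
qed (simp add: posQ_iff)

lemma rcauchy_iff:
 assumes "!!n. is_real (y n)"
 shows "rcauchy y \<longleftrightarrow> (\<forall>e>0. EX N. ALL m n. N <=. m & N <=. n --> \<bar>rv (y m) - rv (y n)\<bar> < e)"
proof -
 have "rcauchy y \<longleftrightarrow> (ALL q. posQ q --> (EX N. ALL m n. N <=. m & N <=. n --> \<bar>rv (y m) - rv (y n)\<bar> < qv q))"
  unfolding rcauchy_def using assms by (auto simp: rlt_iff is_real_diff is_real_const posQ_iff)
 also have "\<dots> \<longleftrightarrow> (\<forall>e>0. EX N. ALL m n. N <=. m & N <=. n --> \<bar>rv (y m) - rv (y n)\<bar> < e)"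
  by (rule all_posQ) (meson less_le_trans)
 finally show ?thesis .
qed

lemma rlim_iff:
 assumes "!!n. is_real (y n)" "is_real z"
 shows "rlim y z \<longleftrightarrow> (\<forall>e>0. EX N. ALL n. N <=. n --> \<bar>rv (y n) - rv z\<bar> < e)"
proof -
 have "rlim y z \<longleftrightarrow> (ALL q. posQ q --> (EX N. ALL n. N <=. n --> \<bar>rv (y n) - rv z\<bar> < qv q))"
  unfolding rlim_def using assms by (auto simp: rlt_iff is_real_diff is_real_const posQ_iff)
 also have "\<dots> \<longleftrightarrow> (\<forall>e>0. EX N. ALL n. N <=. n --> \<bar>rv (y n) - rv z\<bar> < e)"
  by (rule all_posQ) (meson less_le_trans)
 finally show ?thesis .
qed

text \<open>The complexity estimate behind all later inductions: weak inequalities between values or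
  integrals are negations of Sigma-1 statements and fall under
  \<open>corenum_induct\<close>.\<close>

lemma renum_rv_less:
 assumes "recfn (%q. X (pfst q) (psnd q))" "recfn (%q. Y (pfst q) (psnd q))" "!!p. is_real (X p)" "!!p. is_real (Y p)"
 shows "renum (%p. rv (X p) < rv (Y p))"
proof -
 have "renum (%p. EX k. ~ Y p k \<le>\<^sub>Q X p k +\<^sub>Q (qhalf k +\<^sub>Q qhalf k))"
  by (intro renum_ex renum_dec decs assms)
 moreover have "rv (X p) < rv (Y p) \<longleftrightarrow> (EX k. ~ Y p k \<le>\<^sub>Q X p k +\<^sub>Q (qhalf k +\<^sub>Q qhalf k))" for p
  using rlt_iff[OF assms(3,4), of p p] by (auto simp: rlt_def rle_def)
 ultimately show ?thesis by simp
qed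

end

section \<open>Test functions\<close>

context model
begin

lemma lt_pair: assumes "i ~= #0" shows "j <. <<i, j>>"
proof -
 have "nv i + nv j <= (nv i + nv j) * (nv i + nv j)" using nv_le_square[of "i +. j"] by simp
 then show ?thesis
  using nv_pos[OF assms] unfolding pair_def nv_simps nv_add nv_mult by linarith
qed

lemma num_eq [simp]: "num j = num k \<longleftrightarrow> j = k"
 by (simp add: nv_eq)

lemma num_neq_zero: "k ~= 0 ==> num k ~= #0"
 by (simp add: nv_eq)

lemma test_code_lt:
 "f <. tadd f g" "g <. tadd f g" "f <. tmul f g" "g <. tmul f g" "f <. tmax f g" "g <. tmax f g"
 unfolding tadd_def tmul_def tmax_def
 by (rule le_lt_trans'[OF le_pair(1) lt_pair] le_lt_trans'[OF le_pair(2) lt_pair]; simp add: num_neq_zero del: num.simps)+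

lemma recfn_test [decs]:
 "recfn f ==> recfn (%p. tconst (f p))" "recfn f ==> recfn (%p. tdist (f p))"
 "recfn f ==> recfn g ==> recfn (%p. tadd (f p) (g p))"
 "recfn f ==> recfn g ==> recfn (%p. tmul (f p) (g p))"
 "recfn f ==> recfn g ==> recfn (%p. tmax (f p) (g p))"
 unfolding tconst_def tdist_def tadd_def tmul_def tmax_def by (intro decs; assumption)+

lemma recfn_test' [decs]:
 "recfn f ==> recfn g ==> recfn (%p. tsub (f p) (g p))" "recfn f ==> recfn (%p. tabs (f p))"
 unfolding tsub_def tabs_def by (intro decs; assumption)+

definition test_junk :: "'n set => 'n => bool" where
 "test_junk A c \<longleftrightarrow> (ALL q. isQ q --> c ~= tconst q) & (\<forall>a\<in>A. c ~= tdist a) &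
   (ALL f g. c ~= tadd f g & c ~= tmul f g & c ~= tmax f g)"

text \<open>Structural induction on codes. As codes may be nonstandard it is course-of-values
  induction inside the model, which is available for Pi-1 statements.\<close>

lemma test_induct:
 assumes "renum (%c. ~ P c)"
  and "!!q. isQ q ==> P (tconst q)" "!!a. a \<in> A ==> P (tdist a)"
  and "!!f g. P f ==> P g ==> P (tadd f g)" "!!f g. P f ==> P g ==> P (tmul f g)"
   "!!f g. P f ==> P g ==> P (tmax f g)"
  and "!!c. test_junk A c ==> P c"
 shows "P c"
proof (rule corenum_less_induct[OF assms(1)])
 fix c assume "!!m. m <. c ==> P m"
 then show "P c" using assms(2-) test_code_lt unfolding test_junk_def by metis
qed

definition test_rec :: "'n set => ('n => 'n) => ('n => 'n) => ('n => 'n => 'n) => ('n => 'n => 'n) =>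
  ('n => 'n => 'n) => 'n => 'n => ('n => 'n) => 'n" where
 "test_rec A C D p m x z c h =
  (if is_pair c & pfst c = num 0 & isQ (psnd c) then C (psnd c)
   else if is_pair c & pfst c = num 1 & psnd c \<in> A then D (psnd c)
   else if is_pair c & is_pair (psnd c) & pfst c = num 2 then p (h (pfst (psnd c))) (h (psnd (psnd c)))
   else if is_pair c & is_pair (psnd c) & pfst c = num 3 then m (h (pfst (psnd c))) (h (psnd (psnd c)))
   else if is_pair c & is_pair (psnd c) & pfst c = num 4 then x (h (pfst (psnd c))) (h (psnd (psnd c)))
   else z)"

lemma test_rec_local:
 assumes "!!i. i <. c ==> h i = h' i"
 shows "test_rec A C D p m x z c h = test_rec A C D p m x z c h'"
proof -
 have "h (pfst (psnd c)) = h' (pfst (psnd c)) & h (psnd (psnd c)) = h' (psnd (psnd c))"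
  if c: "is_pair c" "is_pair (psnd c)" "pfst c ~= num 0"
 proof -
  obtain i f g where ifg: "c = <<i, <<f, g>>>>" using c(1,2) by (auto simp: is_pair_def)
  with c(3) have i: "i ~= #0" by simp
  show ?thesis using assms le_lt_trans'[OF le_pair(1) lt_pair[OF i]] le_lt_trans'[OF le_pair(2) lt_pair[OF i]]
   by (simp add: ifg)
 qed
 then show ?thesis unfolding test_rec_def by (auto simp del: num.simps)
qed

lemma dec_subset: "A \<in> cls M ==> recfn f ==> dec (%p. f p \<in> A)"
 by (rule dec_mem)

text \<open>The value of a test function computed from rational values \<open>D a\<close> for the distances, and
 a common bound for the absolute value of the test function and for its Lipschitz constant with
 respect to these rationals.\<close>

definition tv :: "'n set => ('n => 'n) => 'n => 'n" where
 "tv A D = cov (test_rec A (%q. q) D (+\<^sub>Q) (*\<^sub>Q) qmax (qnat #0))"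

definition tb :: "'n set => 'n => 'n => 'n" where
 "tb A B = cov (test_rec A (%q. qpos q +. qneg q) (%a. B) (+.) (%u v. num 2 *. u *. v) (+.) #0)"

lemma recfn_tv:
 assumes A: "A \<in> cls M" and D: "recfn (%q. D (pfst q) (psnd q))" and "recfn t"
 shows "recfn (%p. tv A (D p) (t p))"
proof -
 have D': "recfn (%p. D (f p) (g p))" if "recfn f" "recfn g" for f g
  using recfn_comp[OF D recfn_pair[OF that]] by simp
 show ?thesis unfolding tv_def
  by (rule recfn_cov[OF _ assms(3)]) (unfold test_rec_def, intro decs dec_subset[OF A] D')
qed

lemma recfn_tb:
 assumes A: "A \<in> cls M" and "recfn t" shows "recfn (%p. tb A B (t p))"
 unfolding tb_def
 by (rule recfn_cov[OF _ assms(2)]) (unfold test_rec_def, intro decs dec_subset[OF A])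

lemma tv_eq: assumes A: "A \<in> cls M" and D: "recfn D"
 shows "tv A D c = test_rec A (%q. q) D (+\<^sub>Q) (*\<^sub>Q) qmax (qnat #0) c (tv A D)"
 unfolding tv_def
 by (rule cov_eq[OF _ test_rec_local]) (unfold test_rec_def, intro decs dec_subset[OF A] recfn_comp[OF D], assumption)

lemma tb_eq: assumes A: "A \<in> cls M"
 shows "tb A B c = test_rec A (%q. qpos q +. qneg q) (%a. B) (+.) (%u v. num 2 *. u *. v) (+.) #0 c (tb A B)"
 unfolding tb_def
 by (rule cov_eq[OF _ test_rec_local]) (unfold test_rec_def, intro decs dec_subset[OF A], assumption)

lemma test_rec_simps:
 "isQ q ==> test_rec A C D p m x z (tconst q) h = C q"
 "a \<in> A ==> test_rec A C D p m x z (tdist a) h = D a"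
 "test_rec A C D p m x z (tadd f g) h = p (h f) (h g)"
 "test_rec A C D p m x z (tmul f g) h = m (h f) (h g)"
 "test_rec A C D p m x z (tmax f g) h = x (h f) (h g)"
 by (simp_all add: test_rec_def tconst_def tdist_def tadd_def tmul_def tmax_def del: num.simps)

lemma test_rec_junk: "test_junk A c ==> test_rec A C D p m x z c h = z"
 unfolding test_junk_def test_rec_def tconst_def tdist_def tadd_def tmul_def tmax_def is_pair_def
 by (auto simp del: num.simps)

lemma tv_simps: assumes "A \<in> cls M" "recfn D"
 shows "isQ q ==> tv A D (tconst q) = q" "a \<in> A ==> tv A D (tdist a) = D a"
  "tv A D (tadd f g) = tv A D f +\<^sub>Q tv A D g" "tv A D (tmul f g) = tv A D f *\<^sub>Q tv A D g"
  "tv A D (tmax f g) = qmax (tv A D f) (tv A D g)" "test_junk A c ==> tv A D c = qnat #0"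
 by (subst tv_eq[OF assms], simp add: test_rec_simps test_rec_junk)+

lemma tb_simps: assumes "A \<in> cls M"
 shows "isQ q ==> tb A B (tconst q) = qpos q +. qneg q" "a \<in> A ==> tb A B (tdist a) = B"
  "tb A B (tadd f g) = tb A B f +. tb A B g" "tb A B (tmul f g) = num 2 *. tb A B f *. tb A B g"
  "tb A B (tmax f g) = tb A B f +. tb A B g" "test_junk A c ==> tb A B c = #0"
 by (subst tb_eq[OF assms], simp add: test_rec_simps test_rec_junk)+

lemma tv_isQ:
 assumes A: "A \<in> cls M" and D: "recfn D" and Q: "!!a. a \<in> A ==> isQ (D a)" shows "isQ (tv A D c)"
proof (rule test_induct[where P = "%c. isQ (tv A D c)" and A = A])
 show "renum (%c. ~ isQ (tv A D c))"
  by (intro renum_dec decs recfn_tv[where D = "%_. D"] A recfn_comp[OF D])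
qed (simp_all add: tv_simps[OF A D] Q)

lemma qv_bound: assumes "isQ q" shows "\<bar>qv q\<bar> <= nv (qpos q) + nv (qneg q)"
proof -
 have "1 <= nv (qden q)" using isQ_den[OF assms] nv_Suc_le[of \<zero> "qden q"] by (simp flip: nv_less)
 moreover have "\<bar>nv (qpos q) - nv (qneg q)\<bar> <= nv (qpos q) + nv (qneg q)"
  using nv_nonneg[of "qpos q"] nv_nonneg[of "qneg q"] by linarith
 ultimately have "\<bar>nv (qpos q) - nv (qneg q)\<bar> <= (nv (qpos q) + nv (qneg q)) * nv (qden q)"
  using mult_left_mono[of 1 "nv (qden q)" "nv (qpos q) + nv (qneg q)"] by simp
 then show ?thesis using isQ_den[OF assms] by (simp add: qv_def abs_divide divide_le_eq)
qed

lemma tv_bound: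
 assumes A: "A \<in> cls M" and D: "recfn D" and Q: "!!a. a \<in> A ==> isQ (D a)"
  and B: "!!a. a \<in> A ==> \<bar>qv (D a)\<bar> <= nv B"
 shows "\<bar>qv (tv A D c)\<bar> <= nv (tb A B c)"
proof -
 note iQ = tv_isQ[OF A D Q]
 have "qabs (tv A D c) \<le>\<^sub>Q qnat (tb A B c)"
 proof (rule test_induct[where P = "%c. qabs (tv A D c) \<le>\<^sub>Q qnat (tb A B c)" and A = A])
  show "renum (%c. ~ qabs (tv A D c) \<le>\<^sub>Q qnat (tb A B c))"
   by (intro renum_dec decs recfn_tv[where D = "%_. D"] recfn_tb A recfn_comp[OF D])
  fix f g assume "qabs (tv A D f) \<le>\<^sub>Q qnat (tb A B f)" "qabs (tv A D g) \<le>\<^sub>Q qnat (tb A B g)"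
  then have fg: "\<bar>qv (tv A D f)\<bar> <= nv (tb A B f)" "\<bar>qv (tv A D g)\<bar> <= nv (tb A B g)"
   by (simp_all add: qle_iff iQ)
  show "qabs (tv A D (tadd f g)) \<le>\<^sub>Q qnat (tb A B (tadd f g))"
   using fg by (simp add: tv_simps[OF A D] tb_simps[OF A] qle_iff iQ; linarith)
  show "qabs (tv A D (tmax f g)) \<le>\<^sub>Q qnat (tb A B (tmax f g))"
   using fg by (simp add: tv_simps[OF A D] tb_simps[OF A] qle_iff iQ max_def; linarith)
  have "\<bar>qv (tv A D f)\<bar> * \<bar>qv (tv A D g)\<bar> <= nv (tb A B f) * nv (tb A B g)" using fg by (intro mult_mono) auto
  moreover have "0 <= nv (tb A B f) * nv (tb A B g)" by simp
  ultimately have "\<bar>qv (tv A D f)\<bar> * \<bar>qv (tv A D g)\<bar> <= 2 * (nv (tb A B f) * nv (tb A B g))" by linarith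
  then show "qabs (tv A D (tmul f g)) \<le>\<^sub>Q qnat (tb A B (tmul f g))"
   by (simp add: tv_simps[OF A D] tb_simps[OF A] qle_iff iQ abs_mult mult.assoc)
 qed (use B qv_bound in \<open>auto simp: tv_simps[OF A D] tb_simps[OF A] qle_iff iQ Q\<close>)
 then show ?thesis by (simp add: qle_iff iQ)
qed

text \<open>The two terms of the product rule account for the factor 2 in \<open>tb\<close>, and
  \<open>1 <= nv B\<close> covers the distance functions, whose Lipschitz constant is 1.\<close>

lemma tv_lipschitz:
 assumes A: "A \<in> cls M" and D: "recfn D" "!!a. a \<in> A ==> isQ (D a)" "!!a. a \<in> A ==> \<bar>qv (D a)\<bar> <= nv B"
  and D': "recfn D'" "!!a. a \<in> A ==> isQ (D' a)" "!!a. a \<in> A ==> \<bar>qv (D' a)\<bar> <= nv B"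
  and e: "isQ e" "0 <= qv e" "!!a. a \<in> A ==> \<bar>qv (D a) - qv (D' a)\<bar> <= qv e" and B: "1 <= nv B"
 shows "\<bar>qv (tv A D c) - qv (tv A D' c)\<bar> <= nv (tb A B c) * qv e"
proof -
 note iQ = tv_isQ[OF A D(1,2)] tv_isQ[OF A D'(1,2)]
 let ?P = "%c. qabs (tv A D c +\<^sub>Q quminus (tv A D' c)) \<le>\<^sub>Q qnat (tb A B c) *\<^sub>Q e"
 have P: "?P c \<longleftrightarrow> \<bar>qv (tv A D c) - qv (tv A D' c)\<bar> <= nv (tb A B c) * qv e" for c
  by (simp add: qle_iff iQ e)
 have "?P c"
 proof (rule test_induct[where P = ?P and A = A])
  show "renum (%c. ~ ?P c)"
   by (intro renum_dec decs recfn_tv[where D = "%_. D"] recfn_tv[where D = "%_. D'"] recfn_tb A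
     recfn_comp[OF D(1)] recfn_comp[OF D'(1)])
  fix f g assume "?P f" "?P g"
  then have fg: "\<bar>qv (tv A D f) - qv (tv A D' f)\<bar> <= nv (tb A B f) * qv e"
   "\<bar>qv (tv A D g) - qv (tv A D' g)\<bar> <= nv (tb A B g) * qv e" by (simp_all add: P)
  show "?P (tadd f g)"
   using fg unfolding P by (simp add: tv_simps[OF A] D D' tb_simps[OF A] iQ distrib_right; linarith)
  show "?P (tmax f g)"
   using fg unfolding P by (simp add: tv_simps[OF A] D D' tb_simps[OF A] iQ distrib_right max_def; linarith)
  let ?f = "qv (tv A D f)" let ?f' = "qv (tv A D' f)" let ?g = "qv (tv A D g)" let ?g' = "qv (tv A D' g)"
  have "\<bar>?f * ?g - ?f' * ?g'\<bar> <= \<bar>?f\<bar> * \<bar>?g - ?g'\<bar> + \<bar>?f - ?f'\<bar> * \<bar>?g'\<bar>"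
   using abs_triangle_ineq[of "?f * (?g - ?g')" "(?f - ?f') * ?g'"] unfolding abs_mult[symmetric]
   by (simp add: algebra_simps)
  also have "\<dots> <= nv (tb A B f) * (nv (tb A B g) * qv e) + (nv (tb A B f) * qv e) * nv (tb A B g)"
   using fg tv_bound[OF A D, of f] tv_bound[OF A D', of g] e(2) by (intro add_mono mult_mono) auto
  finally show "?P (tmul f g)"
   unfolding P by (simp add: tv_simps[OF A] D D' tb_simps[OF A] iQ algebra_simps)
 next
  fix a assume a: "a \<in> A"
  have "\<bar>qv (D a) - qv (D' a)\<bar> <= 1 * qv e" using e(3)[OF a] by simp
  also have "\<dots> <= nv B * qv e" using B e(2) by (rule mult_right_mono)
  finally show "?P (tdist a)" unfolding P using a by (simp add: tv_simps[OF A] D D' tb_simps[OF A])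
 qed (use e(2) in \<open>simp_all add: tv_simps[OF A] D D' tb_simps[OF A] qle_iff e(1)\<close>)
 then show ?thesis by (simp only: P)
qed

end

section \<open>Points and their distances\<close>

locale cspace = model M for M :: "'n l2_struct" (structure) +
 fixes A :: "'n set" and d :: "'n => 'n => 'n => 'n"
 assumes compact: "compact_space A d"
begin

abbreviation pt :: "('n => 'n) => bool" where
 "pt \<equiv> point A d"

abbreviation ideal :: "'n => 'n => 'n" where
 "ideal a \<equiv> %_. a"

definition dst :: "('n => 'n) => ('n => 'n) => 'n rl" where
 "dst x y = rv (dist d x y)"

lemma metric: "metric_code A d"
 using compact by (simp add: compact_space_def)

lemma A_cls: "A \<in> cls M" and A_ne: "A ~= {}" and d_Fn3: "d \<in> Fn3"
 using metric by (auto simp: metric_code_def)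

lemma d_real: "a \<in> A ==> b \<in> A ==> is_real (d a b)"
 using metric by (auto simp: metric_code_def)

lemma d_metric: assumes "a \<in> A" "b \<in> A" "c \<in> A"
 shows "0 <= rv (d a b)" "rv (d a b) = rv (d b a)" "rv (d a a) = 0" "rv (d a c) <= rv (d a b) + rv (d b c)"
proof -
 have m: "rconst (qnat #0) \<le>\<^sub>R d a b" "d a b =\<^sub>R d b a" "d a a =\<^sub>R rconst (qnat #0)" "d a c \<le>\<^sub>R d a b +\<^sub>R d b c"
  using metric assms unfolding metric_code_def by blast+
 show "0 <= rv (d a b)" "rv (d a b) = rv (d b a)" "rv (d a a) = 0" "rv (d a c) <= rv (d a b) + rv (d b c)"
  using m assms by (simp_all add: rle_iff req_iff is_real_const is_real_add d_real)
qed

lemma recfn_d [decs]: "recfn f ==> recfn g ==> recfn h ==> recfn (%p. d (f p) (g p) (h p))"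
 by (rule recfn_Fn3[OF d_Fn3])

lemma ptD: "pt x ==> recfn x" "pt x ==> x k \<in> A"
 "pt x ==> i <=. j ==> rv (d (x i) (x j)) <= 1 / pw i"
proof -
 show r: "recfn x" and A: "x k \<in> A" if "pt x" for k using that by (auto simp: point_def)
 assume x: "pt x" and ij: "i <=. j"
 show "rv (d (x i) (x j)) <= 1 / pw i"
 proof (cases "i = j")
  case True
  then show ?thesis using d_metric(3)[of "x i" "x i" "x i"] A[OF x] by (simp add: less_imp_le)
 next
  case False
  then have "d (x i) (x j) \<le>\<^sub>R rconst (qhalf i)" using x ij by (auto simp: point_def le_def)
  then show ?thesis using A[OF x] d_real by (simp add: rle_iff is_real_const)
 qed
qed

lemma pt_ideal [simp]: "a \<in> A ==> pt (ideal a)"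
 by (simp add: point_def recfn_const rle_iff d_real is_real_const d_metric less_imp_le)

lemma pt_diff: assumes "pt x" "pt y" "i <=. j"
 shows "\<bar>rv (d (x i) (y i)) - rv (d (x j) (y j))\<bar> <= 2 / pw i"
proof -
 note A = ptD(2)[OF assms(1)] ptD(2)[OF assms(2)]
 have "rv (d (x i) (x j)) <= 1 / pw i" "rv (d (y i) (y j)) <= 1 / pw i" using ptD(3) assms by blast+
 moreover have "rv (d (x i) (y i)) <= rv (d (x i) (x j)) + rv (d (x j) (y j)) + rv (d (y j) (y i))"
  using d_metric(4)[of "x i" "x j" "y i"] d_metric(4)[of "x j" "y j" "y i"] A by fastforce
 moreover have "rv (d (x j) (y j)) <= rv (d (x j) (x i)) + rv (d (x i) (y i)) + rv (d (y i) (y j))"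
  using d_metric(4)[of "x j" "x i" "y j"] d_metric(4)[of "x i" "y i" "y j"] A by fastforce
 moreover have "rv (d (y j) (y i)) = rv (d (y i) (y j))" "rv (d (x j) (x i)) = rv (d (x i) (x j))"
  using d_metric(2) A by blast+
 moreover have "2 / pw i = 2 * (1 / pw i)" by simp
 ultimately show ?thesis by (simp only:; linarith)
qed

lemma pw_add3: "pw (k +. num 3) = 8 * pw k"
proof -
 have "pw (num 3) = 8" by (simp add: eval_nat_numeral pow2_Suc)
 then show ?thesis by (simp only: pw_add)
qed

lemma dist_approx: assumes "pt x" "pt y"
 shows "isQ (dist d x y k)" "\<bar>qv (dist d x y k) - rv (d (x (k +. num 3)) (y (k +. num 3)))\<bar> <= 1 / (8 * pw k)"
 using is_realD[OF d_real[OF ptD(2)[OF assms(1)] ptD(2)[OF assms(2)]]]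
 unfolding dist_def pw_add3[symmetric] by auto

lemma is_real_dist: assumes "pt x" "pt y" shows "is_real (dist d x y)"
 unfolding is_real_iff
proof (intro conjI allI impI dist_approx assms)
 show "recfn (dist d x y)" unfolding dist_def by (intro decs ptD(1) assms)
 fix k j assume kj: "k <=. j"
 then have "k +. num 3 <=. j +. num 3" by (simp add: nv_simps(3) del: num.simps)
 from pt_diff[OF assms this] have "\<bar>rv (d (x (k +. num 3)) (y (k +. num 3))) - rv (d (x (j +. num 3)) (y (j +. num 3)))\<bar> <= 2 / (8 * pw k)"
  by (simp only: pw_add3)
 moreover have "1 / (8 * pw j) <= 1 / (8 * pw k)" using pw_mono[OF kj] by (simp add: frac_le)
 moreover have "2 / (8 * pw k) = 2 * (1 / (8 * pw k))" "1 / pw k = 8 * (1 / (8 * pw k))" "0 <= 1 / (8 * pw k)"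
  by (simp_all add: less_imp_le)
 ultimately show "\<bar>qv (dist d x y k) - qv (dist d x y j)\<bar> <= 1 / pw k"
  using dist_approx(2)[OF assms, of k] dist_approx(2)[OF assms, of j] by linarith
qed

lemma dst_approx: assumes "pt x" "pt y" shows "\<bar>rv (d (x n) (y n)) - dst x y\<bar> <= 2 / pw n"
proof (rule le_if_pw)
 fix k
 let ?m = "n +. k +. num 3" let ?l = "n +. k"
 have le: "n <=. ?m" "k <=. ?l" by (simp_all add: nv_simps(3) del: num.simps)
 have 1: "1 / pw ?l <= 1 / pw k" using pw_mono[OF le(2)] by (simp add: frac_le)
 have 2: "1 / (8 * pw ?l) <= 1 / pw ?l" by (simp add: frac_le)
 have "\<bar>qv (dist d x y ?l) - dst x y\<bar> <= 1 / pw ?l" unfolding dst_def by (rule is_realD(3)[OF is_real_dist[OF assms]])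
 then have "\<bar>rv (d (x n) (y n)) - dst x y\<bar> <= 2 / pw n + 2 * (1 / pw k)"
  using pt_diff[OF assms le(1)] dist_approx(2)[OF assms, of ?l] 1 2 by linarith
 then show "\<bar>rv (d (x n) (y n)) - dst x y\<bar> <= 2 / pw n + 2 / pw k" by simp
qed

lemma dst_ideal: "a \<in> A ==> b \<in> A ==> dst (ideal a) (ideal b) = rv (d a b)"
 using eq_if_pw[of "rv (d a b)" "dst (ideal a) (ideal b)" 2] dst_approx[of "ideal a" "ideal b"] by simp

lemma dst_metric: assumes "pt x" "pt y" "pt z"
 shows "0 <= dst x y" "dst x y = dst y x" "dst x x = 0" "dst x z <= dst x y + dst y z"
proof -
 note A = ptD(2)[OF assms(1)] ptD(2)[OF assms(2)] ptD(2)[OF assms(3)]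
 note ap = dst_approx[OF assms(1,2)] dst_approx[OF assms(2,1)] dst_approx[OF assms(1,1)] dst_approx[OF assms(2,3)]
  dst_approx[OF assms(1,3)]
 have "0 <= dst x y + 2 / pw n" for n using ap(1)[of n] d_metric(1)[OF A(1)[of n] A(2)[of n]] A(3) by fastforce
 then show "0 <= dst x y" by (rule le_if_pw)
 have "\<bar>dst x y - dst y x\<bar> <= 4 / pw n" for n
  using ap(1,2)[of n] d_metric(2)[OF A(1)[of n] A(2)[of n] A(3)[of n]]
  by (simp only: flip: mult_2[of 2, simplified]; linarith)
 then show "dst x y = dst y x" by (rule eq_if_pw)
 have "\<bar>dst x x - 0\<bar> <= 2 / pw n" for n using ap(3)[of n] d_metric(3)[OF A(1)[of n] A(1)[of n] A(1)[of n]] by simp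
 then show "dst x x = 0" by (rule eq_if_pw)
 have "dst x z <= dst x y + dst y z + 6 / pw n" for n
 proof -
  have "6 / pw n = 3 * (2 / pw n)" by simp
  then show ?thesis using ap(1,4,5)[of n] d_metric(4)[OF A(1)[of n] A(2)[of n] A(3)[of n]] by linarith
 qed
 then show "dst x z <= dst x y + dst y z" by (rule le_if_pw)
qed

lemma dst_ideal_pt: assumes "pt x" shows "dst (ideal (x n)) x <= 1 / pw n"
proof (rule le_if_pw)
 fix k
 have "n <=. n +. k" "k <=. n +. k" by (simp_all add: nv_simps(3))
 then have "rv (d (x n) (x (n +. k))) <= 1 / pw n" "2 / pw (n +. k) <= 2 / pw k"
  using ptD(3)[OF assms] pw_mono by (auto simp: frac_le)
 then show "dst (ideal (x n)) x <= 1 / pw n + 2 / pw k"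
  using dst_approx[of "ideal (x n)" x "n +. k"] ptD(2)[OF assms] assms by simp
qed

end

section \<open>Integration of test functions\<close>

context model
begin

abbreviation tone :: 'n where "tone \<equiv> tconst (qnat #1)"

abbreviation tzero :: 'n where "tzero \<equiv> tconst (qnat #0)"

definition tmin :: "'n => 'n => 'n" where
 "tmin f g = tsub tzero (tmax (tsub tzero f) (tsub tzero g))"

definition tclamp :: "'n => 'n" where
 "tclamp f = tmax tzero (tmin tone f)"

definition tsum :: "('n => 'n) => 'n => 'n" where
 "tsum f n = prec tzero (%i v. tadd v (f i)) n"

definition tmaxs :: "('n => 'n) => 'n => 'n" where
 "tmaxs f n = prec tzero (%i v. tmax v (f i)) n"

end

context cspace
begin

lemma nets: obtains p l where "p \<in> Fn3" "recfn l" "!!j i. i <=. l j ==> pt (p j i)"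
 "!!z j. pt z ==> EX i. i <=. l j & dst (p j i) z < 1 / pw j"
proof -
 obtain p l where p: "p \<in> Fn3" "recfn l" "!!j i. i <=. l j ==> pt (p j i)"
  "!!z j. pt z ==> EX i. i <=. l j & dist d (p j i) z <\<^sub>R rconst (qhalf j)"
  using compact unfolding compact_space_def by blast
 have "EX i. i <=. l j & dst (p j i) z < 1 / pw j" if z: "pt z" for z j
  using p(4)[OF z, of j] p(3) z by (auto simp: rlt_iff is_real_dist is_real_const dst_def)
 then show thesis using that p by blast
qed

text \<open>Every point is within 1 of the net of level 0. That net has boundedly many members, and
  \<open>collection_dec\<close> bounds their distances from a fixed ideal point.\<close>

lemma bounded_dst: "EX B. ALL x y. pt x --> pt y --> dst x y <= nv B"
proof -
 obtain p l where p: "p \<in> Fn3" "recfn l" "!!j i. i <=. l j ==> pt (p j i)"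
  "!!z j. pt z ==> EX i. i <=. l j & dst (p j i) z < 1 / pw j" using nets by blast
 obtain a where a: "a \<in> A" using A_ne by blast
 let ?q = "%i. dist d (p #0 i) (ideal a) #0"
 have "dec (%q. psnd q = qpos (?q (pfst q)))"
  unfolding dist_def by (intro decs recfn_Fn3[OF p(1)])
 from collection_dec[OF this, of "l #0 +. #1"] obtain m where m: "!!i. i <. l #0 +. #1 ==> qpos (?q i) <. m"
  by auto
 have *: "dst z (ideal a) <= nv m + 2" if z: "pt z" for z
 proof -
  obtain i where i: "i <=. l #0" "dst (p #0 i) z < 1" using p(4)[OF z, of \<zero>] by auto
  note pi = p(3)[OF i(1)]
  have "\<bar>qv (?q i) - dst (p #0 i) (ideal a)\<bar> <= 1"
   unfolding dst_def using is_realD(3)[OF is_real_dist[OF pi pt_ideal[OF a]], of \<zero>] by simp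
  moreover have "qv (?q i) <= nv (qpos (?q i))"
  proof -
   have Q: "isQ (?q i)" using dist_approx(1)[OF pi pt_ideal[OF a]] .
   have "1 <= nv (qden (?q i))" using isQ_den[OF Q] nv_Suc_le[of \<zero>] by (simp flip: nv_less)
   then have "nv (qpos (?q i)) <= nv (qpos (?q i)) * nv (qden (?q i))"
    using mult_left_mono[of 1 "nv (qden (?q i))" "nv (qpos (?q i))"] by simp
   then show ?thesis using isQ_den[OF Q] unfolding qv_def
    by (simp add: divide_le_eq, insert nv_nonneg[of "qneg (?q i)"], linarith)
  qed
  moreover have "nv (qpos (?q i)) <= nv m" proof -
   have "qpos (?q i) <. m" using m[of i] i(1) by (simp add: lt_Suc_le)
   then show ?thesis by (simp flip: nv_less)
  qed
  moreover have "dst z (ideal a) <= dst (p #0 i) z + dst (p #0 i) (ideal a)"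
   using dst_metric(2)[OF z pi z] dst_metric(4)[OF z pi pt_ideal[OF a]] by simp
  ultimately show ?thesis using i(2) by linarith
 qed
 have "dst x y <= nv (m +. m +. num 4)" if "pt x" "pt y" for x y
  using *[OF that(1)] *[OF that(2)] dst_metric(4)[OF that(1) pt_ideal[OF a] that(2)]
   dst_metric(2)[OF that(2) pt_ideal[OF a] that(2)] by simp
 then show ?thesis by blast
qed

text \<open>The additional 1 makes room for the error of rational approximations to distances and
  ensures \<open>1 <= nv diam\<close>.\<close>

definition diam :: 'n where
 "diam = (SOME B. ALL x y. pt x --> pt y --> dst x y <= nv B) +. #1"

definition lip :: "'n => 'n" where
 "lip = tb A diam"

lemma dst_diam: "pt x ==> pt y ==> dst x y + 1 <= nv diam"
 using someI_ex[OF bounded_dst] unfolding diam_def by auto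

lemma diam_ge_1: "1 <= nv diam"
 by (simp add: diam_def)

lemma recfn_lip [decs]: "recfn f ==> recfn (%p. lip (f p))"
 unfolding lip_def by (rule recfn_tb[OF A_cls])

definition dd :: "('n => 'n) => 'n => 'n => 'n" where
 "dd x n a = dist d (ideal a) x n"

lemma recfn_dd: assumes "pt x" "recfn f" "recfn g" shows "recfn (%p. dd x (f p) (g p))"
 unfolding dd_def dist_def by (intro decs recfn_comp[OF ptD(1)[OF assms(1)]] assms)

lemma dd_props: assumes "pt x" "a \<in> A"
 shows "isQ (dd x n a)" "\<bar>qv (dd x n a)\<bar> <= nv diam" "\<bar>qv (dd x n a) - dst (ideal a) x\<bar> <= 1 / pw n"
  "n <=. m ==> \<bar>qv (dd x n a) - qv (dd x m a)\<bar> <= 1 / pw n"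
proof -
 note r = is_real_dist[OF pt_ideal[OF assms(2)] assms(1)]
 show "isQ (dd x n a)" "n <=. m ==> \<bar>qv (dd x n a) - qv (dd x m a)\<bar> <= 1 / pw n"
  using r unfolding is_real_iff dd_def by blast+
 show ap: "\<bar>qv (dd x n a) - dst (ideal a) x\<bar> <= 1 / pw n"
  unfolding dd_def dst_def by (rule is_realD(3)[OF r])
 have "1 / pw n <= 1" using pw_ge_1[of n] by simp
 then show "\<bar>qv (dd x n a)\<bar> <= nv diam"
  using ap dst_diam[OF pt_ideal[OF assms(2)] assms(1)] dst_metric(1)[OF pt_ideal[OF assms(2)] assms(1) assms(1)]
  by linarith
qed

lemma tv_dd_isQ: "pt x ==> isQ (tv A (dd x n) c)"
 using tv_isQ[OF A_cls recfn_dd[OF _ recfn_const recfn_ident]] dd_props(1) by blast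

lemma tv_dd_bound: "pt x ==> \<bar>qv (tv A (dd x n) c)\<bar> <= nv (lip c)"
 unfolding lip_def
 using tv_bound[OF A_cls recfn_dd[OF _ recfn_const recfn_ident]] dd_props(1,2) by blast

lemma tv_dd_diff:
 assumes "pt x" "pt y" "isQ e" "0 <= qv e" "!!a. a \<in> A ==> \<bar>qv (dd x n a) - qv (dd y m a)\<bar> <= qv e"
 shows "\<bar>qv (tv A (dd x n) c) - qv (tv A (dd y m) c)\<bar> <= nv (lip c) * qv e"
 unfolding lip_def
 using assms dd_props(1,2) diam_ge_1
 by (intro tv_lipschitz[OF A_cls] recfn_dd[OF _ recfn_const recfn_ident]) auto

lemma tv_dd_cauchy: "pt x ==> n <=. m ==> \<bar>qv (tv A (dd x n) c) - qv (tv A (dd x m) c)\<bar> <= nv (lip c) / pw n"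
 using tv_dd_diff[of x x "qhalf n" n m c] dd_props(4) by (simp add: less_imp_le)

text \<open>Evaluation with rational distances. Since \<open>lip c\<close> is at most its own power
  of two, raising the precision by \<open>lip c\<close> brings the error down to
  \<open>1 / pw k\<close>.\<close>

definition cev :: "('n => 'n) => 'n => 'n => 'n" where
 "cev x c k = tv A (dd x (k +. lip c)) c"

lemma lip_pw: "nv (lip c) / pw (k +. lip c) <= 1 / pw k"
proof -
 have "nv (lip c) <= pw (lip c)" using pw_ge[of "lip c"] by linarith
 then have "nv (lip c) / (pw k * pw (lip c)) <= pw (lip c) / (pw k * pw (lip c))"
  by (intro divide_right_mono) (simp_all add: less_imp_le)
 then show ?thesis by (simp add: pw_add)
qed

lemma is_real_cev: assumes "pt x" shows "is_real (cev x c)"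
 unfolding is_real_iff
proof (intro conjI allI impI)
 show "recfn (cev x c)" unfolding cev_def
  by (intro recfn_tv[OF A_cls, of "%k. dd x (k +. lip c)"] decs recfn_dd[OF assms])
 show "isQ (cev x c k)" for k unfolding cev_def by (rule tv_dd_isQ[OF assms])
 fix k j assume "k <=. j"
 then have "k +. lip c <=. j +. lip c" by (simp add: nv_simps)
 from tv_dd_cauchy[OF assms this] lip_pw
 show "\<bar>qv (cev x c k) - qv (cev x c j)\<bar> <= 1 / pw k" unfolding cev_def by (rule order_trans)
qed

lemma cev_approx: assumes "pt x" shows "\<bar>qv (tv A (dd x n) c) - rv (cev x c)\<bar> <= nv (lip c) / pw n"
proof (rule le_if_pw)
 fix k
 let ?k = "k +. n"
 have "n <=. ?k +. lip c" "k <=. ?k" by (simp_all add: nv_simps(3))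
 then have "\<bar>qv (tv A (dd x n) c) - qv (cev x c ?k)\<bar> <= nv (lip c) / pw n" "1 / pw ?k <= 1 / pw k"
  unfolding cev_def using tv_dd_cauchy[OF assms] pw_mono by (blast, simp add: frac_le)
 then show "\<bar>qv (tv A (dd x n) c) - rv (cev x c)\<bar> <= nv (lip c) / pw n + 1 / pw k"
  using is_realD(3)[OF is_real_cev[OF assms, of c], of ?k] by linarith
qed

lemma cev_eqI:
 assumes "pt x" "!!n. \<bar>qv (tv A (dd x n) c) - r\<bar> <= C / pw n" shows "rv (cev x c) = r"
proof (rule eq_if_pw)
 fix n
 show "\<bar>rv (cev x c) - r\<bar> <= (nv (lip c) + C) / pw n"
  using cev_approx[OF assms(1), of n c] assms(2)[of n] unfolding add_divide_distrib by linarith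
qed

lemma mult_approx:
 fixes a b :: "'n rl"
 assumes "\<bar>a' - a\<bar> <= C / pw n" "\<bar>b' - b\<bar> <= D / pw n" "\<bar>a'\<bar> <= E" "\<bar>b\<bar> <= F"
 shows "\<bar>a' * b' - a * b\<bar> <= (E * D + C * F) / pw n"
proof -
 have "\<bar>a' * b' - a * b\<bar> <= \<bar>a'\<bar> * \<bar>b' - b\<bar> + \<bar>a' - a\<bar> * \<bar>b\<bar>"
  using abs_triangle_ineq[of "a' * (b' - b)" "(a' - a) * b"] unfolding abs_mult[symmetric] by (simp add: algebra_simps)
 also have "\<dots> <= E * (D / pw n) + C / pw n * F"
  using assms by (intro add_mono mult_mono) (auto intro: order_trans[OF abs_ge_zero])
 finally show ?thesis by (simp add: add_divide_distrib)
qed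

text \<open>The recursion equations hold for the rational approximations \<open>tv\<close>, and
  these approach the values with errors of order \<open>1 / pw n\<close>; hence the equations hold
  in the limit. This gives the existence of the evaluation chosen in \<open>tval\<close>.\<close>

lemma is_eval_cev: assumes x: "pt x" shows "is_eval A d x (cev x)"
proof -
 note tvs = tv_simps[OF A_cls recfn_dd[OF x recfn_const recfn_ident]]
 note Q = tv_dd_isQ[OF x]
 note ap = cev_approx[OF x]
 have F: "cev x \<in> Fn2"
  by (rule Fn2I, unfold cev_def)
   (intro recfn_tv[OF A_cls, of "%p. dd x (psnd p +. lip (pfst p))"] decs recfn_dd[OF x])
 have c: "rv (cev x (tconst q)) = qv q" if "isQ q" for q
  by (rule cev_eqI[OF x, where C = 0]) (simp add: tvs that)
 have dt: "rv (cev x (tdist a)) = dst (ideal a) x" if "a \<in> A" for a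
  by (rule cev_eqI[OF x, where C = 1]) (use dd_props(3)[OF x that] in \<open>simp add: tvs that\<close>)
 have ad: "rv (cev x (tadd f g)) = rv (cev x f) + rv (cev x g)" for f g
 proof (rule cev_eqI[OF x])
  fix n show "\<bar>qv (tv A (dd x n) (tadd f g)) - (rv (cev x f) + rv (cev x g))\<bar> <= (nv (lip f) + nv (lip g)) / pw n"
   using ap[of n f] ap[of n g] unfolding add_divide_distrib tvs qv_add[OF Q Q] by linarith
 qed
 have mx: "rv (cev x (tmax f g)) = max (rv (cev x f)) (rv (cev x g))" for f g
 proof (rule cev_eqI[OF x])
  fix n
  have "0 <= nv (lip f) / pw n" "0 <= nv (lip g) / pw n" by (simp_all add: less_imp_le)
  then show "\<bar>qv (tv A (dd x n) (tmax f g)) - max (rv (cev x f)) (rv (cev x g))\<bar> <= (nv (lip f) + nv (lip g)) / pw n"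
   using ap[of n f] ap[of n g] unfolding add_divide_distrib tvs qv_max[OF Q Q] max_def by (simp; linarith)
 qed
 have bd: "\<bar>rv (cev x f)\<bar> <= nv (lip f) + nv (lip f)" for f
  using ap[of \<zero> f] tv_dd_bound[OF x, of \<zero> f] by simp
 have ml: "rv (cev x (tmul f g)) = rv (cev x f) * rv (cev x g)" for f g
 proof (rule cev_eqI[OF x])
  fix n show "\<bar>qv (tv A (dd x n) (tmul f g)) - (rv (cev x f) * rv (cev x g))\<bar>
    <= (nv (lip f) * nv (lip g) + nv (lip f) * (nv (lip g) + nv (lip g))) / pw n"
   using mult_approx[OF ap[of n f] ap[of n g] tv_dd_bound[OF x] bd] by (simp add: tvs Q)
 qed
 have jk: "rv (cev x c) = 0" if "test_junk A c" for c
  by (rule cev_eqI[OF x, where C = 0]) (simp add: tvs that)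
 note R = is_real_cev[OF x] is_real_const is_real_dist x is_real_add is_real_mul is_real_max
 show ?thesis
  unfolding is_eval_def test_junk_def[symmetric]
  using F c dt ad mx ml jk R by (simp add: req_iff dst_def)
qed

definition ev :: "('n => 'n) => 'n => 'n rl" where
 "ev x c = rv (tval A d x c)"

lemma is_eval_tval: "pt x ==> is_eval A d x (tval A d x)"
 unfolding tval_def using is_eval_cev by (metis someI_ex)

lemma is_real_tval: "pt x ==> is_real (tval A d x c)"
 and tval_Fn2: "pt x ==> tval A d x \<in> Fn2"
 using is_eval_tval unfolding is_eval_def by blast+

lemma ev_simps: assumes x: "pt x"
 shows "isQ q ==> ev x (tconst q) = qv q" "a \<in> A ==> ev x (tdist a) = dst (ideal a) x"
  "ev x (tadd f g) = ev x f + ev x g" "ev x (tmul f g) = ev x f * ev x g" "ev x (tmax f g) = max (ev x f) (ev x g)"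
  "test_junk A c ==> ev x c = 0"
proof -
 note R = is_real_tval[OF x] is_real_const is_real_dist x is_real_add is_real_mul is_real_max
 show "isQ q ==> ev x (tconst q) = qv q" "a \<in> A ==> ev x (tdist a) = dst (ideal a) x"
  "ev x (tadd f g) = ev x f + ev x g" "ev x (tmul f g) = ev x f * ev x g" "ev x (tmax f g) = max (ev x f) (ev x g)"
  "test_junk A c ==> ev x c = 0"
  using is_eval_tval[OF x] R unfolding is_eval_def test_junk_def[symmetric] by (simp_all add: req_iff ev_def dst_def)
qed

lemma renum_ev_less [renums]: assumes x: "pt x" "recfn f" "recfn g" shows "renum (%p. ev x (f p) < ev x (g p))"
 unfolding ev_def
 by (intro renum_rv_less is_real_tval x recfn_Fn2[OF tval_Fn2] decs recfn_comp[OF x(2)] recfn_comp[OF x(3)])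

text \<open>Uniqueness of evaluations: inequality of two reals is Sigma-1, so induction over the
  codes is available.\<close>

lemma ev_cev: assumes x: "pt x" shows "ev x c = rv (cev x c)"
proof -
 have F: "cev x \<in> Fn2" using is_eval_cev[OF x] by (simp add: is_eval_def)
 have "renum (%c. ev x c < rv (cev x c) \<or> rv (cev x c) < ev x c)"
  unfolding ev_def
  by (intro renum_disj renum_rv_less is_real_tval is_real_cev x recfn_Fn2[OF tval_Fn2] recfn_Fn2[OF F] decs)
 then have r: "renum (%c. ~ ev x c = rv (cev x c))" by (simp add: neq_iff)
 have s: "isQ q ==> rv (cev x (tconst q)) = qv q" "a \<in> A ==> rv (cev x (tdist a)) = dst (ideal a) x"
  "rv (cev x (tadd f g)) = rv (cev x f) + rv (cev x g)" "rv (cev x (tmul f g)) = rv (cev x f) * rv (cev x g)"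
  "rv (cev x (tmax f g)) = max (rv (cev x f)) (rv (cev x g))" "test_junk A c ==> rv (cev x c) = 0" for q a f g c
  using is_eval_cev[OF x] unfolding is_eval_def test_junk_def[symmetric]
  by (simp_all add: req_iff dst_def is_real_cev x is_real_const is_real_dist is_real_add is_real_mul is_real_max)
 show ?thesis
  by (rule test_induct[where P = "%c. ev x c = rv (cev x c)" and A = A, OF r]) (simp_all add: s ev_simps x)
qed

lemma ev_approx: "pt x ==> \<bar>qv (tv A (dd x n) c) - ev x c\<bar> <= nv (lip c) / pw n"
 by (simp add: ev_cev cev_approx)

lemma ev_bound: assumes "pt x" shows "\<bar>ev x c\<bar> <= nv (lip c)"
proof (rule le_if_pw)
 fix n show "\<bar>ev x c\<bar> <= nv (lip c) + nv (lip c) / pw n"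
  using ev_approx[OF assms, of n c] tv_dd_bound[OF assms, of n c] by linarith
qed

lemma ev_lipschitz: assumes x: "pt x" and y: "pt y" shows "\<bar>ev x c - ev y c\<bar> <= nv (lip c) * dst x y"
proof (rule le_if_pw)
 fix n
 let ?e = "dist d x y n +\<^sub>Q (qhalf n +\<^sub>Q (qhalf n +\<^sub>Q qhalf n))"
 have Q: "isQ (dist d x y n)" by (rule dist_approx(1)[OF x y])
 have e: "qv ?e = qv (dist d x y n) + 3 / pw n" using Q by simp
 have ap: "\<bar>qv (dist d x y n) - dst x y\<bar> <= 1 / pw n" unfolding dst_def by (rule is_realD(3)[OF is_real_dist[OF x y]])
 have t: "3 / pw n = 3 * (1 / pw n)" "4 / pw n = 4 * (1 / pw n)" "0 <= 1 / pw n" by (simp_all add: less_imp_le)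
 have *: "\<bar>qv (dd x n a) - qv (dd y n a)\<bar> <= qv ?e" if a: "a \<in> A" for a
  using dd_props(3)[OF x a, of n] dd_props(3)[OF y a, of n] ap t
   dst_metric(4)[OF pt_ideal[OF a] x y] dst_metric(4)[OF pt_ideal[OF a] y x] dst_metric(2)[OF x y x]
  unfolding e by linarith
 have "0 <= qv ?e" using ap t dst_metric(1)[OF x y x] unfolding e by linarith
 then have "\<bar>qv (tv A (dd x n) c) - qv (tv A (dd y n) c)\<bar> <= nv (lip c) * qv ?e"
  using * Q by (intro tv_dd_diff x y) simp_all
 also have "\<dots> <= nv (lip c) * (dst x y + 4 / pw n)"
  using ap t unfolding e by (intro mult_left_mono nv_nonneg) linarith
 finally have "\<bar>qv (tv A (dd x n) c) - qv (tv A (dd y n) c)\<bar> <= nv (lip c) * dst x y + 4 * (nv (lip c) / pw n)"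
  by (simp add: distrib_left mult.commute)
 moreover have "(6 * nv (lip c)) / pw n = 6 * (nv (lip c) / pw n)" by simp
 ultimately show "\<bar>ev x c - ev y c\<bar> <= nv (lip c) * dst x y + (6 * nv (lip c)) / pw n"
  using ev_approx[OF x, of n c] ev_approx[OF y, of n c] by linarith
qed

lemma ev_ideal_approx: assumes "pt x" shows "\<bar>ev (ideal (x n)) c - ev x c\<bar> <= nv (lip c) / pw n"
proof -
 have "\<bar>ev (ideal (x n)) c - ev x c\<bar> <= nv (lip c) * dst (ideal (x n)) x"
  using assms ptD(2) by (intro ev_lipschitz) auto
 also have "\<dots> <= nv (lip c) * (1 / pw n)" using dst_ideal_pt[OF assms] by (intro mult_left_mono) auto
 finally show ?thesis by simp
qed

lemma ev_le_dense: assumes "!!a. a \<in> A ==> ev (ideal a) f <= r" "pt x" shows "ev x f <= r"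
proof (rule le_if_pw)
 fix n show "ev x f <= r + nv (lip f) / pw n"
  using ev_ideal_approx[OF assms(2), of n f] assms(1)[OF ptD(2)[OF assms(2), of n]] by linarith
qed

text \<open>\<open>tval\<close> is chosen separately for each point. Enumerability uniformly in the
  ideal point therefore goes through the explicit \<open>cev\<close>.\<close>

lemma renum_ev_ideal:
 assumes "recfn a" "recfn f" "recfn g" "!!p. a p \<in> A"
 shows "renum (%p. ev (ideal (a p)) (f p) < ev (ideal (a p)) (g p))"
proof -
 have F: "recfn (%q. cev (ideal (a (pfst q))) (f (pfst q)) (psnd q))" if "recfn f" for f
  unfolding cev_def
  by (intro recfn_tv[OF A_cls, of "%q. dd (ideal (a (pfst q))) (psnd q +. lip (f (pfst q)))"] decs
    recfn_comp[OF that] recfn_comp[OF assms(1)]) (unfold dd_def dist_def, intro decs recfn_comp[OF that] recfn_comp[OF assms(1)])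
 show ?thesis
  using assms(4) by (simp only: ev_cev pt_ideal) (intro renum_rv_less F assms is_real_cev pt_ideal)
qed

lemma recfn_tmin [decs]: "recfn f ==> recfn g ==> recfn (%p. tmin (f p) (g p))"
 unfolding tmin_def by (intro decs)

lemma recfn_tclamp [decs]: "recfn f ==> recfn (%p. tclamp (f p))"
 unfolding tclamp_def by (intro decs)

lemma ev_const [simp]: "pt x ==> isQ q ==> ev x (tconst q) = qv q"
 and ev_add [simp]: "pt x ==> ev x (tadd f g) = ev x f + ev x g"
 and ev_mul [simp]: "pt x ==> ev x (tmul f g) = ev x f * ev x g"
 and ev_max [simp]: "pt x ==> ev x (tmax f g) = max (ev x f) (ev x g)"
 and ev_dist: "pt x ==> a \<in> A ==> ev x (tdist a) = dst (ideal a) x"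
 by (simp_all add: ev_simps)

lemma ev_sub [simp]: "pt x ==> ev x (tsub f g) = ev x f - ev x g"
 by (simp add: tsub_def)

lemma ev_abs [simp]: "pt x ==> ev x (tabs f) = \<bar>ev x f\<bar>"
 by (simp add: tabs_def abs_if max_def)

lemma ev_min [simp]: "pt x ==> ev x (tmin f g) = min (ev x f) (ev x g)"
 by (simp add: tmin_def min_def max_def)

lemma ev_clamp [simp]: "pt x ==> ev x (tclamp f) = max 0 (min 1 (ev x f))"
 by (simp add: tclamp_def)

lemma recfn_tsum [decs]:
 assumes "recfn (%q. f (pfst q) (psnd q))" "recfn t" shows "recfn (%p. tsum (f p) (t p))"
 unfolding tsum_def using recfn_comp[OF assms(1) recfn_pair, of "%q. pfst (pfst q)" "%q. psnd (pfst q)"]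
 by (intro decs assms) (simp add: decs)

lemma tsum_Suc: assumes "recfn f" shows "tsum f (n +. #1) = tadd (tsum f n) (f n)"
 unfolding tsum_def by (rule prec_Suc) (intro decs recfn_comp[OF assms])

lemma ev_tsum: assumes "recfn f" "pt x"
 shows "ev x (tsum f #0) = 0" "ev x (tsum f (n +. #1)) = ev x (tsum f n) + ev x (f n)"
 using assms by (simp add: tsum_def, simp add: tsum_Suc)

lemma recfn_tmaxs [decs]:
 assumes "recfn (%q. f (pfst q) (psnd q))" "recfn t" shows "recfn (%p. tmaxs (f p) (t p))"
 unfolding tmaxs_def using recfn_comp[OF assms(1) recfn_pair, of "%q. pfst (pfst q)" "%q. psnd (pfst q)"]
 by (intro decs assms) (simp add: decs)

lemma ev_tmaxs: assumes "recfn f" "pt x"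
 shows "ev x (tmaxs f #0) = 0" "ev x (tmaxs f (n +. #1)) = max (ev x (tmaxs f n)) (ev x (f n))"
proof -
 have "tmaxs f (n +. #1) = tmax (tmaxs f n) (f n)"
  unfolding tmaxs_def by (rule prec_Suc) (intro decs recfn_comp[OF assms(1)])
 then show "ev x (tmaxs f #0) = 0" "ev x (tmaxs f (n +. #1)) = max (ev x (tmaxs f n)) (ev x (f n))"
  using assms by (simp_all add: tmaxs_def)
qed

lemma ev_le_induct:
 assumes "pt x" "recfn f" "recfn g" "ev x (f #0) <= ev x (g #0)"
  "!!n. ev x (f n) <= ev x (g n) ==> ev x (f (n +. #1)) <= ev x (g (n +. #1))"
 shows "ev x (f n) <= ev x (g n)"
 by (rule corenum_induct[of "%n. ev x (f n) <= ev x (g n)"])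
  (use renum_ev_less[OF assms(1,3,2)] assms(4,5) in \<open>simp_all add: not_le\<close>)

lemma ev_tmaxs_ge: assumes f: "recfn f" and x: "pt x" and k: "k <. n" shows "ev x (f k) <= ev x (tmaxs f n)"
proof -
 obtain m where n: "n = k +. (m +. #1)" using lt_obtain[OF k] .
 have "ev x (f k) <= ev x (tmaxs f (k +. (m +. #1)))"
  by (rule ev_le_induct[OF x, of "%m. f k" "%m. tmaxs f (k +. (m +. #1))"])
   (auto intro!: decs recfn_comp[OF f] simp: plus_Suc ev_tmaxs[OF f x] zero_plus)
 then show ?thesis by (simp add: n)
qed

lemma ev_tmaxs_attained:
 assumes f: "recfn f" and x: "pt x" and r: "!!k. k <. n ==> ev x (f k) <= ev x r" "0 <= ev x r"
 shows "ev x (tmaxs f n) <= ev x r"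
proof -
 have *: "renum (%m. m <=. n & ev x r < ev x (tmaxs f m))"
  by (intro renum_conj renum_dec[OF dec_le] renum_ev_less x decs recfn_comp[OF f])
 have "n <=. n --> ev x (tmaxs f n) <= ev x r"
 proof (rule corenum_induct[of "%m. m <=. n --> ev x (tmaxs f m) <= ev x r"])
  fix m assume IH: "m <=. n --> ev x (tmaxs f m) <= ev x r"
  show "m +. #1 <=. n --> ev x (tmaxs f (m +. #1)) <= ev x r"
  proof
   assume "m +. #1 <=. n"
   then have "m <. n" "m <=. n" by (simp_all add: nv_ops)
   then show "ev x (tmaxs f (m +. #1)) <= ev x r" using IH r(1) by (simp add: ev_tmaxs[OF f x])
  qed
 qed (use r * in \<open>simp_all add: ev_tmaxs[OF f x] not_le\<close>)
 then show ?thesis by simp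
qed

end

section \<open>The integral as a positive linear functional\<close>

locale mspace = cspace M A d for M :: "'n l2_struct" (structure) and A d +
 fixes I :: "'n => 'n => 'n"
 assumes measure: "is_measure A d I"
begin

definition iv :: "'n => 'n rl" where
 "iv f = rv (I f)"

lemma I_Fn2: "I \<in> Fn2" and I_real: "is_real (I f)"
 using measure by (auto simp: is_measure_def)

lemma iv_add [simp]: "iv (tadd f g) = iv f + iv g"
 and iv_scale: "isQ q ==> iv (tmul (tconst q) f) = qv q * iv f"
 and iv_one [simp]: "iv tone = 1"
 using measure unfolding is_measure_def
 by (auto simp: iv_def req_iff is_real_add is_real_mul is_real_const)

lemma iv_nonneg: assumes "!!x. pt x ==> 0 <= ev x f" shows "0 <= iv f"
proof -
 have "ALL x. pt x --> rconst (qnat #0) \<le>\<^sub>R tval A d x f"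
  using assms by (simp add: rle_iff is_real_const is_real_tval ev_def)
 then have "rconst (qnat #0) \<le>\<^sub>R I f" using measure by (simp add: is_measure_def)
 then show ?thesis by (simp add: rle_iff is_real_const I_real iv_def)
qed

lemma iv_sub [simp]: "iv (tsub f g) = iv f - iv g"
 by (simp add: tsub_def iv_scale)

lemma iv_mono: "(!!x. pt x ==> ev x f <= ev x g) ==> iv f <= iv g"
 using iv_nonneg[of "tsub g f"] by simp

lemma iv_cong: "(!!x. pt x ==> ev x f = ev x g) ==> iv f = iv g"
 by (intro antisym iv_mono) auto

lemma iv_const: assumes "isQ q" shows "iv (tconst q) = qv q"
proof -
 have "iv (tconst q) = iv (tmul (tconst q) tone)" using assms by (intro iv_cong) simp
 then show ?thesis using assms by (simp add: iv_scale)
qed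

lemma renum_iv_less [renums]: assumes "recfn f" "recfn g" shows "renum (%p. iv (f p) < iv (g p))"
 unfolding iv_def
 by (intro renum_rv_less I_real recfn_Fn2[OF I_Fn2] decs recfn_comp[OF assms(1)] recfn_comp[OF assms(2)])

lemma iv_le_induct:
 assumes "recfn f" "recfn g" "iv (f #0) <= iv (g #0)"
  "!!n. iv (f n) <= iv (g n) ==> iv (f (n +. #1)) <= iv (g (n +. #1))"
 shows "iv (f n) <= iv (g n)"
 by (rule corenum_induct[of "%n. iv (f n) <= iv (g n)"])
  (use renum_iv_less[OF assms(2,1)] assms(3,4) in \<open>simp_all add: not_le\<close>)

lemma iv_tsum: assumes "recfn f"
 shows "iv (tsum f #0) = 0" "iv (tsum f (n +. #1)) = iv (tsum f n) + iv (f n)"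
 using assms by (simp_all add: tsum_Suc) (simp add: tsum_def iv_const)

lemma unit_valued_iff: "unit_valued A d h \<longleftrightarrow> (ALL x. pt x --> 0 <= ev x h & ev x h <= 1)"
 unfolding unit_valued_def ev_def
 by (intro all_cong) (simp add: rle_iff is_real_const is_real_tval)

lemma measure_less_iff:
 assumes e: "isQ e"
 shows "measure_less A d I G e \<longleftrightarrow> (EX q. isQ q & qv q < qv e & (ALL h. (ALL x. pt x --> 0 <= ev x h & ev x h <= 1) &
   (ALL x. pt x & x \<notin> G --> ev x h = 0) --> iv h <= qv q))"
proof -
 have 1: "(ALL x. pt x & x \<notin> G --> tval A d x h =\<^sub>R rconst (qnat #0)) \<longleftrightarrow> (ALL x. pt x & x \<notin> G --> ev x h = 0)" for h
  unfolding ev_def by (intro all_cong) (simp add: req_iff is_real_const is_real_tval)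
 have 2: "I h \<le>\<^sub>R rconst q \<longleftrightarrow> iv h <= qv q" if "isQ q" for h q
  using that by (simp add: rle_iff is_real_const I_real iv_def)
 show ?thesis
  unfolding measure_less_def unit_valued_iff 1 using e by (auto simp: qlt_iff 2)
qed

end

section \<open>Binary strings\<close>

context model
begin

abbreviation dbl :: "'n => 'n => 'n" where
 "dbl s b \<equiv> num 2 *. s +. b"

lemma lt_one [simp]: "b <. #1 \<longleftrightarrow> b = #0"
 using lt_Suc[of b \<zero>] by (simp add: zero_plus)

lemma one_neq_zero [simp]: "#1 ~= #0"
 by (simp add: nv_eq)

lemma num_two: "num 2 = #1 +. #1"
 by (simp add: nv_eq del: num.simps)

lemma lt_two: "b <. num 2 \<longleftrightarrow> b = #0 \<or> b = #1"
 unfolding num_two lt_Suc by simp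

lemma dbl_eq: "b <. num 2 ==> c <. num 2 ==> dbl s b = dbl t c \<longleftrightarrow> s = t & b = c"
 using div_mod_unique[of s "num 2" b t c] by (auto simp: mult_commute')

lemma dbl_cases: obtains s b where "t = dbl s b" "b <. num 2"
proof -
 have "#0 <. num 2" by (simp add: nv_ops del: num.simps)
 then show thesis using div_mod[of "num 2" t] that by (metis mult_commute')
qed

lemma dec_string_length [decs]: "recfn f ==> recfn g ==> dec (%p. string_length (f p) (g p))"
 unfolding string_length_def by (intro decs)

lemma string_length_unique: assumes "string_length s n" "string_length s m" shows "n = m"
proof -
 have False if "n <. m" "string_length s n" "string_length s m" for n m
 proof -
  have "pw (n +. #1) <= pw m" using pw_strict_mono[OF that(1)] by simp
  then show False using that(2,3) unfolding string_length_def nv_simps by linarith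
 qed
 then show ?thesis using assms lt_linear by blast
qed

lemma string_length_one: "string_length #1 #0"
 by (simp add: string_length_def nv_ops del: num.simps)

lemma string_length_0: "string_length s #0 \<longleftrightarrow> s = #1"
 unfolding string_length_def pow2_0 pow2_Suc times_one lt_two by auto

lemma string_length_dbl: assumes "b <. num 2" shows "string_length (dbl s b) (n +. #1) \<longleftrightarrow> string_length s n"
proof -
 have b: "nv b <= 1" using assms by (auto simp: lt_two)
 have 1: "2 * pw n <= 2 * nv s + nv b \<longleftrightarrow> pw n <= nv s"
 proof
  assume *: "2 * pw n <= 2 * nv s + nv b"
  show "pw n <= nv s"
  proof (rule ccontr)
   assume "~ pw n <= nv s"
   then have "nv s + 1 <= pw n" by (simp add: not_le nv_less nv_Suc_le)
   then show False using * b by linarith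
  qed
 qed (use nv_nonneg[of b] in linarith)
 have 2: "2 * nv s + nv b < 2 * (2 * pw n) \<longleftrightarrow> nv s < 2 * pw n"
 proof
  assume "nv s < 2 * pw n"
  then have "nv s + 1 <= 2 * pw n" using nv_Suc_le[of s "pow2 (n +. #1)"] by (simp flip: nv_less)
  then show "2 * nv s + nv b < 2 * (2 * pw n)" using b by linarith
 qed (use nv_nonneg[of b] in linarith)
 show ?thesis unfolding string_length_def nv_simps nv_add nv_mult nv_num pw_Suc using 1 2 by simp
qed

lemma string_length_nonzero: "string_length s n ==> s ~= #0"
 unfolding string_length_def nv_simps using pw_pos[of n] by (auto simp: le_def)

lemma string_length_cases:
 assumes "string_length t (n +. #1)" obtains s b where "t = dbl s b" "b <. num 2" "string_length s n"
 using dbl_cases[of t] string_length_dbl assms by metis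

lemma string_length_ex: "s ~= #0 ==> EX n. n <. s & string_length s n"
proof -
 assume s: "s ~= #0"
 have d: "dec (%m. s <. pow2 m)" by (intro decs)
 have "s <. pow2 s" using pw_ge[of s] by (simp add: nv_simps)
 from dec_least[OF d this] obtain m where m: "s <. pow2 m" "!!k. k <. m ==> ~ s <. pow2 k" by blast
 have "m ~= #0" using m(1) s by auto
 then obtain n where n: "m = n +. #1" using zero_or_Suc by blast
 have "string_length s n" unfolding string_length_def using m n by (simp add: lt_Suc not_lt)
 moreover from this have "n <. s" using pw_ge[of n] unfolding string_length_def nv_simps by linarith
 ultimately show ?thesis by blast
qed

lemma prefix_dec: "prefix s t \<longleftrightarrow> s ~= #0 & (EX k. k <=. t & (EX v. v <=. t & v <. pow2 k & t = s *. pow2 k +. v))"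
proof -
 have "k <=. t & v <=. t" if "s ~= #0" "t = s *. pow2 k +. v" for k v
 proof -
  have "1 <= nv s" using that(1) zero_lt_iff[of s] by (simp add: nv_Suc_le)
  then have "pw k <= nv s * pw k" using mult_right_mono[of 1 "nv s" "pw k"] by (simp add: less_imp_le)
  then show ?thesis using pw_ge[of k] pw_pos[of k] nv_nonneg[of v] unfolding that(2) nv_simps nv_add nv_mult by linarith
 qed
 then show ?thesis unfolding prefix_def by blast
qed

lemma dec_prefix [decs]: "recfn f ==> recfn g ==> dec (%p. prefix (f p) (g p))"
proof -
 assume f: "recfn f" and g: "recfn g"
 show ?thesis unfolding prefix_dec by (intro decs f g recfn_comp[OF f] recfn_comp[OF g])
qed

lemma prefix_refl: "s ~= #0 ==> prefix s s"
 unfolding prefix_def by (intro conjI exI[of _ \<zero>]) (simp_all add: times_one)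

lemma prefix_dbl: assumes b: "b <. num 2" shows "prefix r (dbl s b) \<longleftrightarrow> r ~= #0 & (r = dbl s b \<or> prefix r s)"
proof
 assume "prefix r (dbl s b)"
 then obtain k v where kv: "r ~= #0" "v <. pow2 k" "dbl s b = r *. pow2 k +. v" unfolding prefix_def by blast
 show "r ~= #0 & (r = dbl s b \<or> prefix r s)"
 proof (cases "k = #0")
  case True
  then have "v = #0" using kv(2) lt_Suc[of v \<zero>] by (simp add: zero_plus)
  then show ?thesis using kv True by (simp add: times_one)
 next
  case False
  then obtain j where j: "k = j +. #1" using zero_or_Suc by blast
  obtain v' c where v: "v = dbl v' c" "c <. num 2" by (rule dbl_cases)
  have "dbl s b = dbl (r *. pow2 j +. v') c" using kv(3) unfolding j v pow2_Suc nv_ops by (simp add: algebra_simps)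
  then have "s = r *. pow2 j +. v'" using b v(2) by (simp add: dbl_eq)
  moreover have "v' <. pow2 j" using kv(2) nv_nonneg[of c] unfolding v j nv_simps pw_Suc nv_add nv_mult nv_num by (simp; linarith)
  ultimately show ?thesis using kv(1) unfolding prefix_def by blast
 qed
next
 assume r: "r ~= #0 & (r = dbl s b \<or> prefix r s)"
 show "prefix r (dbl s b)"
 proof (cases "r = dbl s b")
  case True then show ?thesis using r prefix_refl by blast
 next
  case False
  then obtain k v where kv: "v <. pow2 k" "s = r *. pow2 k +. v" using r unfolding prefix_def by blast
  have "dbl v b <. pow2 (k +. #1)"
  proof -
   have "nv v + 1 <= pw k" using kv(1) by (simp add: nv_Suc_le)
   then show ?thesis using b unfolding nv_simps pw_Suc nv_add nv_mult nv_num by simp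
  qed
  moreover have "dbl s b = r *. pow2 (k +. #1) +. dbl v b"
   unfolding kv(2) pow2_Suc nv_ops by (simp add: algebra_simps)
  ultimately show ?thesis using r unfolding prefix_def by blast
 qed
qed

lemma prefix_trans: assumes "prefix r s" "prefix s t" shows "prefix r t"
proof -
 obtain k v l w where *: "r ~= #0" "v <. pow2 k" "s = r *. pow2 k +. v" "w <. pow2 l" "t = s *. pow2 l +. w"
  using assms unfolding prefix_def by blast
 have "(nv v + 1) * pw l <= pw k * pw l" using *(2) by (intro mult_right_mono) (simp_all add: nv_Suc_le less_imp_le)
 then have "v *. pow2 l +. w <. pow2 (k +. l)"
  using *(4) unfolding nv_simps pw_add nv_add nv_mult by (simp add: algebra_simps)
 moreover have "t = r *. pow2 (k +. l) +. (v *. pow2 l +. w)"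
  unfolding *(5) *(3) nv_eq nv_add nv_mult pw_add by (simp add: algebra_simps)
 ultimately show ?thesis using *(1) unfolding prefix_def by blast
qed

lemma prefix_le: "prefix r s ==> r <=. s"
proof -
 assume "prefix r s"
 then obtain k v where s: "s = r *. pow2 k +. v" unfolding prefix_def by blast
 have "nv r <= nv r * pw k" using mult_left_mono[OF pw_ge_1[of k] nv_nonneg[of r]] by simp
 then show ?thesis using nv_nonneg[of v] unfolding s nv_simps nv_add nv_mult by linarith
qed

lemma dec_string_bit [decs]: "recfn f ==> recfn g ==> recfn h ==> dec (%p. string_bit (f p) (g p) (h p))"
proof -
 assume f: "recfn f" and g: "recfn g" and h: "recfn h"
 have "p <=. s" if "prefix (dbl p b) s" for p b s
  using prefix_le[OF that] nv_nonneg[of p] nv_nonneg[of b] unfolding nv_simps nv_add nv_mult nv_num by (simp; linarith)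
 then have *: "string_bit s i b \<longleftrightarrow> (b = #0 \<or> b = #1) & (EX p. p <=. s & string_length p i & prefix (dbl p b) s)" for s i b
  unfolding string_bit_def by blast
 show ?thesis unfolding * by (intro decs f g h recfn_comp[OF f] recfn_comp[OF g] recfn_comp[OF h])
qed

lemma string_bit_lt: assumes "string_bit s i b" "string_length s n" shows "i <. n"
proof -
 obtain p where p: "b <. num 2" "string_length p i" "prefix (dbl p b) s"
  using assms(1) unfolding string_bit_def lt_two by blast
 have "string_length (dbl p b) (i +. #1)" using p by (simp add: string_length_dbl)
 then have "pow2 (i +. #1) <=. s" using prefix_le[OF p(3)] le_trans' unfolding string_length_def by blast
 then have *: "pw (i +. #1) < pw (n +. #1)" using assms(2) unfolding string_length_def nv_simps by linarith
 show ?thesis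
 proof (rule ccontr)
  assume "~ i <. n"
  then have "n +. #1 <=. i +. #1" by (simp add: nv_simps)
  then show False using pw_mono * by fastforce
 qed
qed

lemma string_bit_dbl:
 assumes s: "string_length s n" and b: "b <. num 2"
 shows "string_bit (dbl s b) i c \<longleftrightarrow> (if i = n then c = b else string_bit s i c)"
proof (cases "c <. num 2")
 case False
 then show ?thesis using b unfolding string_bit_def lt_two by auto
next
 case c: True
 have nz: "dbl p c ~= #0" if "string_length p i" for p
  using string_length_nonzero that string_length_dbl[OF c] by blast
 have "string_bit (dbl s b) i c \<longleftrightarrow> (EX p. string_length p i & (p = s & c = b \<or> prefix (dbl p c) s))"
  unfolding string_bit_def using c nz by (auto simp: prefix_dbl[OF b] dbl_eq[OF c b] lt_two)
 also have "\<dots> \<longleftrightarrow> (i = n & c = b) \<or> string_bit s i c"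
  unfolding string_bit_def using c s string_length_unique by (auto simp: lt_two)
 also have "\<dots> \<longleftrightarrow> (if i = n then c = b else string_bit s i c)"
  using string_bit_lt[OF _ s, of n c] by auto
 finally show ?thesis .
qed

lemma string_bit_zero: "~ string_bit #0 i b"
 using prefix_le[of _ \<zero>] unfolding string_bit_def prefix_def by auto

lemma string_bit_unique: assumes "string_bit s i b" "string_bit s i c" shows "b = c"
proof -
 have *: "ALL s. s <. pow2 (n +. #1) --> string_length s n --> ~ (string_bit s i #0 & string_bit s i #1)" for n
 proof (rule dec_induct'[of "%n. ALL s. s <. pow2 (n +. #1) --> string_length s n --> ~ (string_bit s i #0 & string_bit s i #1)"])
  fix n assume IH: "ALL s. s <. pow2 (n +. #1) --> string_length s n --> ~ (string_bit s i #0 & string_bit s i #1)"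
  have "~ (string_bit t i #0 & string_bit t i #1)" if t: "string_length t (n +. #1)" for t
  proof -
   obtain s b where s: "t = dbl s b" "b <. num 2" "string_length s n" using string_length_cases[OF t] .
   then have "~ (string_bit s i #0 & string_bit s i #1)" using IH by (auto simp: string_length_def)
   then show ?thesis using s by (auto simp: string_bit_dbl split: if_splits)
  qed
  then show "ALL s. s <. pow2 (n +. #1 +. #1) --> string_length s (n +. #1) --> ~ (string_bit s i #0 & string_bit s i #1)" by blast
 qed (use string_bit_lt in \<open>force intro!: decs\<close>)+
 have "s ~= #0" using assms string_bit_zero by blast
 then obtain n where "string_length s n" using string_length_ex by blast
 then have "~ (string_bit s i #0 & string_bit s i #1)" using * by (auto simp: string_length_def)
 moreover have "b = #0 \<or> b = #1" "c = #0 \<or> c = #1" using assms unfolding string_bit_def by auto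
 ultimately show ?thesis using assms by auto
qed

definition seg :: "('n => bool) => 'n => 'n" where
 "seg X n = prec #1 (%i v. dbl v (if X i then #1 else #0)) n"

lemma recfn_seg: assumes "dec X" "recfn f" shows "recfn (%p. seg X (f p))"
 unfolding seg_def by (intro decs dec_subst[OF assms(1)] recfn_comp[OF assms(2)] assms)

lemma seg_0 [simp]: "seg X #0 = #1"
 by (simp add: seg_def)

lemma seg_Suc: assumes "dec X" shows "seg X (n +. #1) = dbl (seg X n) (if X n then #1 else #0)"
 unfolding seg_def by (rule prec_Suc) (intro decs dec_subst[OF assms])

lemma bit_lt_two: "(if b then #1 else #0) <. num 2"
 by (simp add: lt_two)

lemma seg_length: assumes X: "dec X" shows "string_length (seg X n) n"
proof (rule dec_induct'[of "%n. string_length (seg X n) n"])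
 show "dec (%n. string_length (seg X n) n)" by (intro decs recfn_seg X)
qed (simp_all add: string_length_0 seg_Suc[OF X] string_length_dbl[OF bit_lt_two])

lemma seg_bit: assumes X: "dec X" shows "i <. n ==> string_bit (seg X n) i (if X i then #1 else #0)"
proof (erule rev_mp, rule dec_induct'[of "%n. i <. n --> string_bit (seg X n) i (if X i then #1 else #0)"])
 show "dec (%n. i <. n --> string_bit (seg X n) i (if X i then #1 else #0))" by (intro decs recfn_seg X)
 fix n assume "i <. n --> string_bit (seg X n) i (if X i then #1 else #0)"
 then show "i <. n +. #1 --> string_bit (seg X (n +. #1)) i (if X i then #1 else #0)"
  by (simp add: seg_Suc[OF X] string_bit_dbl[OF seg_length[OF X] bit_lt_two] lt_Suc)
qed simp

lemma seg_unique: assumes X: "dec X"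
 shows "string_length s n ==> (!!i. i <. n ==> string_bit s i (if X i then #1 else #0)) ==> s = seg X n"
proof -
 let ?P = "%n. ALL s. s <. pow2 (n +. #1) --> string_length s n --> (ALL i. i <. n --> string_bit s i (if X i then #1 else #0)) --> s = seg X n"
 assume a: "string_length s n" "!!i. i <. n ==> string_bit s i (if X i then #1 else #0)"
 have "?P n"
 proof (rule dec_induct'[of ?P])
  show "dec ?P" by (intro decs recfn_seg X dec_subst[OF X])
  show "?P #0" by (simp add: string_length_0)
  fix n assume IH: "?P n"
  show "?P (n +. #1)"
  proof (intro allI impI)
   fix t assume t: "string_length t (n +. #1)" "ALL i. i <. n +. #1 --> string_bit t i (if X i then #1 else #0)"
   obtain s b where s: "t = dbl s b" "b <. num 2" "string_length s n" using string_length_cases[OF t(1)] .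
   note bt = t(2)[unfolded s(1) string_bit_dbl[OF s(3,2)] lt_Suc]
   have "string_bit s i (if X i then #1 else #0)" if "i <. n" for i
    using bt[rule_format, of i] that by (auto split: if_splits)
   moreover have "s <. pow2 (n +. #1)" using s(3) by (simp add: string_length_def)
   ultimately have "s = seg X n" using IH s(3) by blast
   then show "t = seg X (n +. #1)" using bt[rule_format, of n] by (simp add: s(1) seg_Suc[OF X])
  qed
 qed
 moreover have "s <. pow2 (n +. #1)" using a(1) by (simp add: string_length_def)
 ultimately show ?thesis using a by blast
qed

lemma segment_of_seg: assumes X: "dec (%i. i \<in> X)" shows "segment_of s X \<longleftrightarrow> (EX n. s = seg (%i. i \<in> X) n)"
 unfolding segment_of_def using seg_unique[OF X] seg_length[OF X] seg_bit[OF X] by blast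

text \<open>Intended for the jump: the set need not belong to \<open>cls\<close>, but each of its
  initial segments is coded by a number, by bounded comprehension.\<close>

lemma segment_of_renum_ex:
 assumes "renum (%i. i \<in> X)" shows "EX s. string_length s n & segment_of s X"
proof -
 have d: "dec (%i. i <. n & i \<in> X)" by (rule bounded_comprehension[OF assms])
 let ?s = "seg (%i. i <. n & i \<in> X) n"
 have "string_bit ?s i (if i \<in> X then #1 else #0)" if "i <. n" for i using seg_bit[OF d that] that by simp
 then show ?thesis using seg_length[OF d] unfolding segment_of_def by blast
qed

lemma segment_of_bit:
 assumes "segment_of s X" "string_bit s i b" shows "b = (if i \<in> X then #1 else #0)"
proof -
 obtain n where n: "string_length s n" "!!i. i <. n ==> string_bit s i (if i \<in> X then #1 else #0)"
  using assms(1) unfolding segment_of_def by blast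
 then show ?thesis using string_bit_lt[OF assms(2) n(1)] string_bit_unique[OF assms(2)] by blast
qed

section \<open>Computations\<close>

lemma justified_mono:
 "justified s H e x y ==> (!!f u v. H f u v ==> H' f u v) ==> justified s H' e x y"
 unfolding justified_def by (elim disjE exE conjE) (simp_all del: num.simps, blast+)

lemma justified_unique:
 assumes "justified s H e x y" "justified s' H' e x y'"
  and H: "!!f u v v'. H f u v ==> H' f u v' ==> v = v'"
  and s: "!!i b b'. string_bit s i b ==> string_bit s' i b' ==> b = b'"
 shows "y = y'"
proof (cases "EX f. e = <<num 4, f>>")
 case True
 then obtain f where e: "e = <<num 4, f>>" by blast
 have 1: "H f <<x, y>> #0 & (ALL k. k <. y --> (EX z. z ~= #0 & H f <<x, k>> z))"
  using assms(1) unfolding justified_def e by (simp del: num.simps)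
 have 2: "H' f <<x, y'>> #0 & (ALL k. k <. y' --> (EX z. z ~= #0 & H' f <<x, k>> z))"
  using assms(2) unfolding justified_def e by (simp del: num.simps)
 show ?thesis using 1 2 H lt_linear[of y y'] by metis
next
 case False
 then show ?thesis
  using assms(1,2) H s unfolding justified_def
  by (elim disjE exE conjE) (simp_all del: num.simps, (blast | metis Suc_inject Suc_neq_zero)+)
qed

definition derives :: "'n => 'n => 'n => 'n => bool" where
 "derives s a b l \<longleftrightarrow> (ALL i. i <. l --> (EX e' x' y'. beta a b i = <<e', <<x', y'>>>> &
    justified s (%f u v. EX j. j <. i & beta a b j = <<f, <<u, v>>>>) e' x' y'))"

definition has_fact :: "'n => 'n => 'n => 'n => 'n => 'n => bool" where
 "has_fact a b l e x y \<longleftrightarrow> (EX i. i <. l & beta a b i = <<e, <<x, y>>>>)"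

lemma phi_iff: "phi s e x y \<longleftrightarrow> (EX a b l. derives s a b l & has_fact a b l e x y)"
 by (simp add: phi_def derives_def has_fact_def)

lemma derives_justified:
 assumes "derives s a b l" "i <. l" "beta a b i = <<e, <<x, y>>>>"
 shows "justified s (has_fact a b i) e x y"
 using assms unfolding derives_def has_fact_def by fastforce

lemma phi_justified: assumes "phi s e x y" shows "justified s (phi s) e x y"
proof -
 obtain a b l i where d: "derives s a b l" and i: "i <. l" "beta a b i = <<e, <<x, y>>>>"
  using assms unfolding phi_iff has_fact_def by blast
 have "phi s f u v" if "has_fact a b i f u v" for f u v
  using that d lt_trans'[OF _ i(1)] unfolding phi_iff has_fact_def by blast
 then show ?thesis using justified_mono[OF derives_justified[OF d i]] by blast
qed

text \<open>The two oracle strings only have to be compatible, since computations from a jump may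
  use initial segments of different lengths. Induction runs over the positions of the first
  derivation.\<close>

lemma phi_unique:
 assumes "phi s e x y" "phi s' e x y'" "!!i b b'. string_bit s i b ==> string_bit s' i b' ==> b = b'"
 shows "y = y'"
proof -
 obtain a b l i where d: "derives s a b l" and i: "i <. l" "beta a b i = <<e, <<x, y>>>>"
  using assms(1) unfolding phi_iff has_fact_def by blast
 obtain a' b' l' i' where d': "derives s' a' b' l'" and i': "i' <. l'" "beta a' b' i' = <<e, <<x, y'>>>>"
  using assms(2) unfolding phi_iff has_fact_def by blast
 let ?P = "%i. i <. l --> (ALL j. j <. l' --> pfst (beta a b i) = pfst (beta a' b' j) -->
  pfst (psnd (beta a b i)) = pfst (psnd (beta a' b' j)) --> psnd (psnd (beta a b i)) = psnd (psnd (beta a' b' j)))"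
 have "?P i"
 proof (rule dec_less_induct[of ?P])
  show "dec ?P" by (intro decs)
  fix i assume IH: "!!m. m <. i ==> ?P m"
  show "?P i"
  proof (intro impI allI)
   fix j assume il: "i <. l" and jl: "j <. l'" and eq: "pfst (beta a b i) = pfst (beta a' b' j)"
    "pfst (psnd (beta a b i)) = pfst (psnd (beta a' b' j))"
   obtain e x y where b: "beta a b i = <<e, <<x, y>>>>" using d il unfolding derives_def by blast
   obtain e' x' y' where b': "beta a' b' j = <<e', <<x', y'>>>>" using d' jl unfolding derives_def by blast
   have ex: "e' = e" "x' = x" using eq by (simp_all add: b b')
   have "v = v'" if hf1: "has_fact a b i f u v" and hf2: "has_fact a' b' j f u v'" for f u v v'
   proof -
    obtain m where m: "m <. i" "beta a b m = <<f, <<u, v>>>>" using hf1 unfolding has_fact_def by blast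
    obtain m' where m': "m' <. j" "beta a' b' m' = <<f, <<u, v'>>>>" using hf2 unfolding has_fact_def by blast
    show ?thesis using IH[OF m(1)] lt_trans'[OF m(1) il] lt_trans'[OF m'(1) jl] m(2) m'(2) by auto
   qed
   from justified_unique[OF derives_justified[OF d il b] derives_justified[OF d' jl b'[unfolded ex]] this assms(3)]
   show "psnd (psnd (beta a b i)) = psnd (psnd (beta a' b' j))" by (simp add: b b')
  qed
 qed
 then show ?thesis using i i' by auto
qed

lemma derives_append:
 assumes d: "derives s a b l" and j: "justified s (has_fact a b l) e x y"
 shows "EX a' b'. derives s a' b' (l +. #1) & has_fact a' b' (l +. #1) e x y &
  (ALL f u v. has_fact a b l f u v --> has_fact a' b' (l +. #1) f u v)"
proof -
 have "recfn (%i. if i <. l then beta a b i else <<e, <<x, y>>>>)" by (intro decs)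
 then obtain a' b' where ab: "!!i. i <. l +. #1 ==> beta a' b' i = (if i <. l then beta a b i else <<e, <<x, y>>>>)"
  using beta_ex by blast
 have old: "beta a' b' i = beta a b i" if "i <. l" for i using ab that by (simp add: lt_Suc)
 have new: "beta a' b' l = <<e, <<x, y>>>>" using ab by (simp add: lt_Suc)
 have "derives s a' b' (l +. #1)"
  unfolding derives_def
 proof (intro allI impI)
  fix i assume i: "i <. l +. #1"
  have H: "has_fact a b i f u v ==> EX j. j <. i & beta a' b' j = <<f, <<u, v>>>>" for f u v
   using i old lt_trans' unfolding has_fact_def lt_Suc by metis
  show "EX e' x' y'. beta a' b' i = <<e', <<x', y'>>>> & justified s (%f u v. EX j. j <. i & beta a' b' j = <<f, <<u, v>>>>) e' x' y'"
  proof (cases "i = l")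
   case True
   have "justified s (%f u v. EX j. j <. i & beta a' b' j = <<f, <<u, v>>>>) e x y"
    by (rule justified_mono[OF j]) (use H True in blast)
   then show ?thesis using new True by simp
  next
   case False
   then have il: "i <. l" using i by (simp add: lt_Suc)
   then obtain e' x' y' where b: "beta a b i = <<e', <<x', y'>>>>" using d unfolding derives_def by blast
   have "justified s (%f u v. EX j. j <. i & beta a' b' j = <<f, <<u, v>>>>) e' x' y'"
    by (rule justified_mono[OF derives_justified[OF d il b]]) (rule H)
   then show ?thesis using old[OF il] b by simp
  qed
 qed
 moreover have "has_fact a' b' (l +. #1) e x y" using new unfolding has_fact_def lt_Suc by blast
 moreover have "has_fact a' b' (l +. #1) f u v" if "has_fact a b l f u v" for f u v
  using that old unfolding has_fact_def lt_Suc by metis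
 ultimately show ?thesis by blast
qed

lemma phi_basic: assumes "justified s (%_ _ _. False) e x y" shows "phi s e x y"
proof -
 have "derives s #0 #0 #0" by (simp add: derives_def)
 moreover have "justified s (has_fact #0 #0 #0) e x y" using justified_mono[OF assms] by blast
 ultimately show ?thesis using derives_append unfolding phi_iff by blast
qed

text \<open>The facts of a second derivation are appended to the first one by induction on its length.\<close>

lemma derives_merge:
 assumes d: "derives s a b l" and d': "derives s a' b' l'"
 shows "EX a'' b'' l''. derives s a'' b'' l'' & (ALL i. i <. l --> (EX j. j <. l'' & beta a'' b'' j = beta a b i)) &
  (ALL i. i <. l' --> (EX j. j <. l'' & beta a'' b'' j = beta a' b' i))"
proof -
 \<comment> \<open>\<open>?m i\<close> is the difference \<open>i - l\<close>. The sequences are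
   concatenated, and facts that precede each other in the second one still do so after the
   shift.\<close>
 let ?m = "%i. lst (%k. i <=. l +. k)"
 have ex: "EX k. i <=. l +. k" for i
  by (rule exI[of _ i]) (use nv_nonneg[of l] in \<open>unfold nv_simps nv_add, linarith\<close>)
 have m: "?m (l +. j) = j" for j
  by (rule lst_eq) (auto simp: nv_simps not_less nv_nonneg)
 have "recfn ?m" by (intro recfn_lst decs ex)
 then have "recfn (%i. if i <. l then beta a b i else beta a' b' (?m i))" by (intro decs)
 then obtain a'' b'' where ab: "!!i. i <. l +. l' ==> beta a'' b'' i = (if i <. l then beta a b i else beta a' b' (?m i))"
  using beta_ex by blast
 have 1: "i <. l +. l'" "beta a'' b'' i = beta a b i" if "i <. l" for i
 proof -
  show "i <. l +. l'" using that nv_nonneg[of l'] unfolding nv_simps nv_add by linarith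
  then show "beta a'' b'' i = beta a b i" using ab that by simp
 qed
 have 2: "l +. i <. l +. l'" "beta a'' b'' (l +. i) = beta a' b' i" if "i <. l'" for i
 proof -
  show *: "l +. i <. l +. l'" using that by (simp add: nv_simps)
  have "~ l +. i <. l" using nv_nonneg[of i] unfolding nv_simps nv_add by linarith
  then show "beta a'' b'' (l +. i) = beta a' b' i" using ab[OF *] m by simp
 qed
 have "derives s a'' b'' (l +. l')"
  unfolding derives_def
 proof (intro allI impI)
  fix i assume i: "i <. l +. l'"
  show "EX e' x' y'. beta a'' b'' i = <<e', <<x', y'>>>> & justified s (%f u v. EX j. j <. i & beta a'' b'' j = <<f, <<u, v>>>>) e' x' y'"
  proof (cases "i <. l")
   case True
   obtain e' x' y' where b: "beta a b i = <<e', <<x', y'>>>>" using d True unfolding derives_def by blast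
   have H: "has_fact a b i f u v ==> EX j. j <. i & beta a'' b'' j = <<f, <<u, v>>>>" for f u v
    using 1 lt_trans'[OF _ True] unfolding has_fact_def by metis
   have "justified s (%f u v. EX j. j <. i & beta a'' b'' j = <<f, <<u, v>>>>) e' x' y'"
    by (rule justified_mono[OF derives_justified[OF d True b]]) (rule H)
   then show ?thesis using 1[OF True] b by simp
  next
   case False
   then obtain j where j: "i = l +. j" using le_imp_plus not_lt by blast
   then have jl: "j <. l'" using i by (simp add: nv_simps)
   obtain e' x' y' where b: "beta a' b' j = <<e', <<x', y'>>>>" using d' jl unfolding derives_def by blast
   have H: "EX j. j <. i & beta a'' b'' j = <<f, <<u, v>>>>" if h: "has_fact a' b' j f u v" for f u v
   proof -
    obtain k where k: "k <. j" "beta a' b' k = <<f, <<u, v>>>>" using h unfolding has_fact_def by blast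
    have "l +. k <. i" using k(1) by (simp add: j nv_simps)
    then show ?thesis using 2(2)[OF lt_trans'[OF k(1) jl]] k(2) by metis
   qed
   have "justified s (%f u v. EX j. j <. i & beta a'' b'' j = <<f, <<u, v>>>>) e' x' y'"
    by (rule justified_mono[OF derives_justified[OF d' jl b]]) (rule H)
   then show ?thesis using 2(2)[OF jl] b by (simp add: j)
  qed
 qed
 then show ?thesis using 1 2 by metis
qed

lemma phi_two:
 assumes "phi s e1 x1 y1" "phi s e2 x2 y2" "!!H. H e1 x1 y1 ==> H e2 x2 y2 ==> justified s H e x y"
 shows "phi s e x y"
proof -
 obtain a b l a' b' l' where d: "derives s a b l" "has_fact a b l e1 x1 y1" and d': "derives s a' b' l'" "has_fact a' b' l' e2 x2 y2"
  using assms(1,2) unfolding phi_iff by blast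
 obtain a'' b'' l'' where m: "derives s a'' b'' l''" "ALL i. i <. l --> (EX j. j <. l'' & beta a'' b'' j = beta a b i)"
  "ALL i. i <. l' --> (EX j. j <. l'' & beta a'' b'' j = beta a' b' i)"
  using derives_merge[OF d(1) d'(1)] by blast
 have "has_fact a'' b'' l'' e1 x1 y1" "has_fact a'' b'' l'' e2 x2 y2"
  using m d(2) d'(2) unfolding has_fact_def by metis+
 then have "justified s (has_fact a'' b'' l'') e x y" by (rule assms(3))
 from derives_append[OF m(1) this] show ?thesis unfolding phi_iff by blast
qed

lemma phi_zero: "phi s <<num 0, num 0>> x #0"
 and phi_succ: "phi s <<num 0, num 1>> x (x +. #1)"
 and phi_ident: "phi s <<num 0, num 2>> x x"
 and phi_fst: "phi s <<num 0, num 3>> <<x, y>> x"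
 and phi_snd: "phi s <<num 0, num 4>> <<x, y>> y"
 by (rule phi_basic; unfold justified_def; simp del: num.simps)+

lemma phi_comp: "phi s g x z ==> phi s f z y ==> phi s <<num 1, <<f, g>>>> x y"
 by (erule (1) phi_two) (unfold justified_def, simp del: num.simps, blast)

lemma phi_pair: "phi s f x u ==> phi s g x v ==> phi s <<num 2, <<f, g>>>> x <<u, v>>"
 by (erule (1) phi_two) (unfold justified_def, simp del: num.simps)

lemma phi_rec_0: "phi s f a y ==> phi s <<num 3, <<f, g>>>> <<a, #0>> y"
 by (erule phi_two[OF _ phi_zero]) (unfold justified_def, simp del: num.simps)

lemma phi_rec_Suc: "phi s <<num 3, <<f, g>>>> <<a, n>> z ==> phi s g <<a, <<n, z>>>> y ==>
  phi s <<num 3, <<f, g>>>> <<a, n +. #1>> y"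
 by (erule (1) phi_two) (unfold justified_def, simp del: num.simps, blast)

lemma phi_oracle: "phi s <<num 0, num 5>> x y \<longleftrightarrow> string_bit s x y"
proof
 assume "phi s <<num 0, num 5>> x y"
 from phi_justified[OF this] show "string_bit s x y" unfolding justified_def by (simp del: num.simps)
next
 assume "string_bit s x y"
 then show "phi s <<num 0, num 5>> x y" by (intro phi_basic) (unfold justified_def, simp del: num.simps)
qed

lemma phi_comp_iff: "phi s <<num 1, <<f, g>>>> x y \<longleftrightarrow> (EX z. phi s g x z & phi s f z y)"
proof
 assume "phi s <<num 1, <<f, g>>>> x y"
 from phi_justified[OF this] show "EX z. phi s g x z & phi s f z y" unfolding justified_def by (simp del: num.simps)
qed (blast intro: phi_comp)

lemma phi_search_imp: "phi s <<num 4, <<num 0, num 5>>>> x y ==> string_bit s <<x, y>> #0"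
proof -
 assume "phi s <<num 4, <<num 0, num 5>>>> x y"
 from phi_justified[OF this] show ?thesis unfolding justified_def phi_oracle[symmetric] by (simp del: num.simps)
qed

text \<open>The derivation is written down explicitly: one oracle query for each candidate up to
  \<open>y\<close>, after which the minimization is justified.\<close>

lemma phi_search:
 assumes y: "string_bit s <<x, y>> #0" "!!k. k <. y ==> string_bit s <<x, k>> #1"
 shows "phi s <<num 4, <<num 0, num 5>>>> x y"
proof -
 let ?f = "%i. <<<<num 0, num 5>>, <<<<x, i>>, if i <. y then #1 else #0>>>>"
 have "recfn ?f" by (intro decs)
 then obtain a b where ab: "!!i. i <. y +. #1 ==> beta a b i = ?f i" using beta_ex by blast
 have "derives s a b (y +. #1)"
  unfolding derives_def
 proof (intro allI impI)
  fix i assume i: "i <. y +. #1"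
  have "string_bit s <<x, i>> (if i <. y then #1 else #0)" using y i by (auto simp: lt_Suc)
  then show "EX e' x' y'. beta a b i = <<e', <<x', y'>>>> & justified s (%f u v. EX j. j <. i & beta a b j = <<f, <<u, v>>>>) e' x' y'"
   unfolding ab[OF i] justified_def by (simp del: num.simps)
 qed
 moreover have "justified s (has_fact a b (y +. #1)) <<num 4, <<num 0, num 5>>>> x y"
 proof -
  have f: "has_fact a b (y +. #1) <<num 0, num 5>> <<x, i>> (if i <. y then #1 else #0)" if "i <. y +. #1" for i
   using ab that unfolding has_fact_def by blast
  have "has_fact a b (y +. #1) <<num 0, num 5>> <<x, y>> #0" using f[of y] by (simp add: lt_Suc del: num.simps)
  moreover have "EX z. z ~= #0 & has_fact a b (y +. #1) <<num 0, num 5>> <<x, k>> z" if "k <. y" for k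
   using f[of k] that by (intro exI[of _ \<one>]) (simp add: lt_Suc del: num.simps)
  ultimately show ?thesis unfolding justified_def by (simp del: num.simps)
 qed
 ultimately show ?thesis using derives_append unfolding phi_iff by blast
qed

text \<open>An index of the constant function with value \<open>k\<close>. It is obtained by
  internal recursion because \<open>k\<close> may be nonstandard.\<close>

definition const_index :: "'n => 'n" where
 "const_index k = prec <<num 0, num 0>> (%i v. <<num 1, <<<<num 0, num 1>>, v>>>>) k"

lemma const_index_Suc: "const_index (k +. #1) = <<num 1, <<<<num 0, num 1>>, const_index k>>>>"
 unfolding const_index_def by (rule prec_Suc) (intro decs)

lemma renum_justified:
 assumes H: "renum (%q. H (pfst q) (pfst (psnd q)) (pfst (psnd (psnd q))) (psnd (psnd (psnd q))))"
  and r: "recfn s" "recfn e" "recfn x" "recfn y"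
 shows "renum (%p. justified (s p) (H p) (e p) (x p) (y p))"
proof -
 have hs: "renum (%p. H (a p) (f p) (u p) (v p))" if "recfn a" "recfn f" "recfn u" "recfn v" for a f u v
  using renum_subst[OF H, of "%p. <<a p, <<f p, <<u p, v p>>>>>>"] by (simp add: recfn_pair that)
 define J where "J = (%q s e x y. justified s (H q) e x y)"
 let ?q = pfst and ?s = "%p. pfst (pfst (psnd p))" and ?e = "%p. psnd (pfst (psnd p))"
 let ?x = "%p. pfst (psnd (psnd p))" and ?y = "%p. psnd (psnd (psnd p))"
 have "renum (%p. J (?q p) (?s p) (?e p) (?x p) (?y p))"
  unfolding J_def justified_def
  apply (intro renum_disj)
  apply (rule renum_dec, intro decs; fail)
  apply (rule renum_dec, intro decs; fail)
  apply (rule renum_dec, intro decs; fail)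
  apply (intro renum_ex renum_conj; rule renum_dec, intro decs; fail)
  apply (intro renum_ex renum_conj; rule renum_dec, intro decs; fail)
  apply (rule renum_dec, intro decs; fail)
  apply (intro renum_ex renum_conj; ((rule hs; intro decs; fail) | (rule renum_dec, intro decs; fail)))
  apply (intro renum_ex renum_conj; ((rule hs; intro decs; fail) | (rule renum_dec, intro decs; fail)))
  apply (intro renum_ex renum_conj; ((rule hs; intro decs; fail) | (rule renum_dec, intro decs; fail)))
  apply (intro renum_ex renum_conj; ((rule hs; intro decs; fail) | (rule renum_dec, intro decs; fail)))
  apply (intro renum_ex renum_conj renum_ball; ((rule hs; intro decs; fail) | (rule renum_dec, intro decs; fail) | (intro decs;fail)))
  done
 from renum_subst[OF this, of "%p. <<p, <<<<s p, e p>>, <<x p, y p>>>>>>"]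
 show ?thesis by (simp add: J_def recfn_pair recfn_ident r)
qed
lemma renum_phi: assumes "recfn s" "recfn e" "recfn x" "recfn y" shows "renum (%p. phi (s p) (e p) (x p) (y p))"
proof -
 have "renum (%p. phi (pfst (pfst p)) (psnd (pfst p)) (pfst (psnd p)) (psnd (psnd p)))"
  unfolding phi_def
  apply (rule renums)+
   apply (intro decs)
   apply (rule renums)+
   apply (rule renum_dec, intro decs; fail)
   apply (rule renum_justified; (rule renum_dec)?; intro decs; fail)
  apply (rule renum_ex, rule renum_dec, intro decs; fail)
  done
 from renum_subst[OF this, of "%p. <<<<s p, e p>>, <<x p, y p>>>>"]
 show ?thesis by (simp add: recfn_pair assms)
qed

lemma const_index_0: "const_index #0 = <<num 0, num 0>>"
 by (simp add: const_index_def del: num.simps)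

lemma recfn_const_index: "recfn f ==> recfn (%p. const_index (f p))"
 unfolding const_index_def by (intro decs)

lemma phi_const: "phi s (const_index k) x k"
proof (rule renum_induct[of "%k. phi s (const_index k) x k"])
 show "renum (%k. phi s (const_index k) x k)" by (intro renum_phi decs recfn_const_index)
 show "phi s (const_index #0) x #0" unfolding const_index_0 by (rule phi_zero)
 show "phi s (const_index k) x k ==> phi s (const_index (k +. #1)) x (k +. #1)" for k
  unfolding const_index_Suc by (rule phi_comp[OF _ phi_succ])
qed

lemma segment_of_string_bit:
 assumes "segment_of s X" "string_length s n" "i <. n" shows "string_bit s i (if i \<in> X then #1 else #0)"
 using assms string_length_unique unfolding segment_of_def by blast

section \<open>Paths through recursively enumerable trees\<close>

text \<open>An instance of the s-m-n theorem: passing from \<open>s\<close> to the index of the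
  constant function \<open>s\<close> is itself computable, by an index that does not depend on the
  oracle. The function \<open>g\<close> carries out one step of the recursion.\<close>

lemma phi_const_index: "EX C. ALL t s. phi t C s (const_index s)"
proof -
 define one_pair where "one_pair = (%k. <<num 2, <<const_index (num 1), k>>>>)"
 define g where "g = one_pair <<num 2, <<const_index <<num 0, num 1>>, <<num 1, <<<<num 0, num 4>>, <<num 0, num 4>>>>>>>>>>"
 have g: "phi t g <<a, <<n, z>>>> <<num 1, <<<<num 0, num 1>>, z>>>>" for t a n z
  unfolding g_def one_pair_def by (intro phi_pair phi_const phi_comp[OF phi_snd] phi_snd)
 let ?P = "<<num 3, <<const_index <<num 0, num 0>>, g>>>>"
 have "phi t ?P <<#0, s>> (const_index s)" for t s
 proof (rule renum_induct[of "%s. phi t ?P <<#0, s>> (const_index s)"])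
  show "renum (%s. phi t ?P <<#0, s>> (const_index s))" by (intro renum_phi decs recfn_const_index)
  show "phi t ?P <<#0, #0>> (const_index #0)" unfolding const_index_0 by (rule phi_rec_0[OF phi_const])
  show "phi t ?P <<#0, s +. #1>> (const_index (s +. #1))" if "phi t ?P <<#0, s>> (const_index s)" for s
   unfolding const_index_Suc by (rule phi_rec_Suc[OF that g])
 qed
 \<comment> \<open>Primitive recursion expects a pair of a parameter and the recursion argument, so
   \<open>s\<close> is first paired with a dummy parameter 0.\<close>
 then have "phi t <<num 1, <<?P, <<num 2, <<<<num 0, num 0>>, <<num 0, num 2>>>>>>>>>> s (const_index s)" for t s
  by (rule phi_comp[OF phi_pair[OF phi_zero phi_ident]])
 then show ?thesis by blast
qed

lemma renum_jump: assumes "X \<in> cls M" shows "renum (%e. e \<in> jump X)"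
proof -
 have X: "dec (%i. i \<in> X)" using assms by (simp add: dec_def)
 show ?thesis unfolding jump_def mem_Collect_eq segment_of_seg[OF X]
  by (intro renums renum_phi recfn_seg X decs; (rule renum_dec)?; intro decs recfn_seg X)
qed

text \<open>Such a tree is many-one reducible to the jump of a set, by way of the indices of the functions
 which ignore their argument and search for a witness for a given string.\<close>

lemma renum_tree_path:
 assumes W: two_WWKL and r: "renum (%s. s \<in> T)" and T: "binary_tree T" "!!n. \<exists>s\<in>T. string_length s n"
  and \<delta>: "posQ \<delta>" "!!n. EX c. card_ge {s \<in> T. string_length s n} c & \<delta> *\<^sub>Q qnat (pow2 n) <\<^sub>Q qnat c"
 shows "\<exists>Z\<in>cls M. ALL s. segment_of s Z --> s \<in> T"
proof -
 obtain R where R: "dec (%q. R (pfst q) (psnd q))" and TR: "!!s. s \<in> T \<longleftrightarrow> (EX m. R s m)"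
  using r unfolding renum_def by blast
 \<comment> \<open>The oracle is the complement of the matrix because the search of
   \<open>phi_search\<close> stops at the first bit 0.\<close>
 define X where "X = {q. ~ R (pfst q) (psnd q)}"
 have dX: "dec (%q. q \<in> X)" unfolding X_def mem_Collect_eq by (intro dec_not R)
 then have X: "X \<in> cls M" by (simp add: dec_def)
 define u where "u = <<num 4, <<num 0, num 5>>>>"
 define j where "j = (%s. <<num 1, <<u, const_index s>>>>)"
 have j: "j s \<in> jump X \<longleftrightarrow> s \<in> T" for s
 proof
  assume "j s \<in> jump X"
  then obtain \<sigma> y where \<sigma>: "segment_of \<sigma> X" "phi \<sigma> (j s) #0 y" unfolding jump_def by blast
  then obtain z where z: "phi \<sigma> (const_index s) #0 z" "phi \<sigma> u z y" unfolding j_def phi_comp_iff by blast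
  have "z = s" by (rule phi_unique[OF z(1) phi_const string_bit_unique])
  then have "string_bit \<sigma> <<s, y>> #0" using z(2) phi_search_imp unfolding u_def by blast
  from segment_of_bit[OF \<sigma>(1) this] have "<<s, y>> \<notin> X" using one_neq_zero by (auto split: if_splits simp del: one_neq_zero)
  then show "s \<in> T" unfolding TR X_def by auto
 next
  assume "s \<in> T"
  then obtain m0 where "R s m0" unfolding TR by blast
  have dR: "dec (%m. R s m)" using dec_subst[OF R recfn_pair[OF recfn_const recfn_ident]] by simp
  obtain m where m: "R s m" "!!k. k <. m ==> ~ R s k" using dec_least[OF dR \<open>R s m0\<close>] by blast
  let ?\<sigma> = "seg (%i. i \<in> X) (<<s, m>> +. #1)"
  have "phi ?\<sigma> u s m"
   unfolding u_def
  proof (rule phi_search)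
   show "string_bit ?\<sigma> <<s, m>> #0" using seg_bit[OF dX, of "<<s, m>>"] m(1) by (auto simp: X_def lt_Suc)
   fix k assume k: "k <. m"
   have "<<s, k>> <. <<s, m>> +. #1" 
   proof -
    have "nv s + nv k <= nv s + nv m" using k by (simp add: nv_simps)
    then have "(nv s + nv k) * (nv s + nv k) <= (nv s + nv m) * (nv s + nv m)"
     by (intro mult_mono) (simp_all add: nv_nonneg add_nonneg_nonneg)
    then show ?thesis unfolding nv_simps pair_def nv_add nv_mult nv_1 by linarith
   qed
   then show "string_bit ?\<sigma> <<s, k>> #1" using seg_bit[OF dX, of "<<s, k>>"] m(2)[OF k] by (auto simp: X_def)
  qed
  then have "phi ?\<sigma> (j s) #0 m" unfolding j_def by (rule phi_comp[OF phi_const])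
  moreover have "segment_of ?\<sigma> X" using segment_of_seg[OF dX] by blast
  ultimately show "j s \<in> jump X" unfolding jump_def by blast
 qed
 obtain C where C: "!!t s. phi t C s (const_index s)" using phi_const_index by blast
 define J where "J = <<num 2, <<const_index (num 1), <<num 2, <<const_index u, C>>>>>>>>"
 have J: "phi t J s (j s)" for t s
  unfolding J_def j_def by (intro phi_pair phi_const C)
 \<comment> \<open>By the preceding equivalence, membership of \<open>s\<close> in the tree amounts
   to a single oracle query at \<open>j s\<close>.\<close>
 define e where "e = <<num 1, <<<<num 0, num 5>>, J>>>>"
 have e: "phi_jump X e s y \<longleftrightarrow> y = (if s \<in> T then #1 else #0)" for s y
 proof
  assume "phi_jump X e s y"
  then obtain \<tau> z where \<tau>: "segment_of \<tau> (jump X)" "phi \<tau> J s z" "string_bit \<tau> z y"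
   unfolding phi_jump_def e_def phi_comp_iff phi_oracle by blast
  have "z = j s" by (rule phi_unique[OF \<tau>(2) J string_bit_unique])
  then show "y = (if s \<in> T then #1 else #0)" using segment_of_bit[OF \<tau>(1,3)] by (simp add: j)
 next
  assume y: "y = (if s \<in> T then #1 else #0)"
  obtain \<tau> where \<tau>: "string_length \<tau> (j s +. #1)" "segment_of \<tau> (jump X)"
   using segment_of_renum_ex[OF renum_jump[OF X]] by blast
  have "string_bit \<tau> (j s) y" using segment_of_string_bit[OF \<tau>(2,1), of "j s"] by (simp add: j y lt_Suc)
  then have "phi \<tau> e s y" unfolding e_def phi_comp_iff phi_oracle using J by blast
  then show "phi_jump X e s y" unfolding phi_jump_def using \<tau>(2) by blast
 qed
 have "T = {s. phi_jump X e s #1}" "ALL s. phi_jump X e s #0 \<or> phi_jump X e s #1" by (auto simp: e)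
 moreover have "ALL n. \<exists>s\<in>T. string_length s n" using T(2) by blast
 moreover have "\<exists>\<delta>. posQ \<delta> & (ALL n. EX c. card_ge {s \<in> T. string_length s n} c & \<delta> *\<^sub>Q qnat (pow2 n) <\<^sub>Q qnat c)"
  using \<delta> by blast
 ultimately show ?thesis using W[unfolded two_WWKL_def, rule_format, of X e T] X T(1) by blast
qed

end

section \<open>Recursion on strings\<close>

context model
begin

definition half :: "'n => 'n" where "half s = dv s (num 2)"
definition lastbit :: "'n => 'n" where "lastbit s = md s (num 2)"

lemma half_dbl [simp]: "b <. num 2 ==> half (dbl s b) = s" and lastbit_dbl [simp]: "b <. num 2 ==> lastbit (dbl s b) = b"
 unfolding half_def lastbit_def by (rule dv_eq md_eq; simp add: mult_commute')+

lemma recfn_half [decs]: "recfn f ==> recfn (%p. half (f p))" and recfn_lastbit [decs]: "recfn f ==> recfn (%p. lastbit (f p))"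
 unfolding half_def lastbit_def by (intro decs; assumption)+

lemma dbl_half: "s = dbl (half s) (lastbit s)" and lastbit_lt: "lastbit s <. num 2"
 using dbl_cases[of s] by (metis half_dbl lastbit_dbl)+

lemma zero_lt_two [simp]: "#0 <. num 2" "#1 <. num 2"
 by (auto simp: lt_two)

lemma dbl_le_one: "b <. num 2 ==> dbl s b <=. #1 \<longleftrightarrow> s = #0"
proof
 assume *: "dbl s b <=. #1"
 show "s = #0"
 proof (rule ccontr)
  assume "s ~= #0"
  then have "1 <= nv s" using zero_lt_iff[of s] by (simp add: nv_Suc_le)
  then show False using * nv_nonneg[of b] unfolding nv_simps nv_add nv_mult nv_num nv_1 by (simp; linarith)
 qed
next
 assume "b <. num 2" "s = #0"
 then show "dbl s b <=. #1" by (auto simp: lt_two zero_plus zero_times le_def simp del: num.simps)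
qed

lemma lt_dbl: "s ~= #0 ==> s <. dbl s b"
 using nv_pos[of s] nv_nonneg[of b] unfolding nv_simps nv_add nv_mult nv_num by (simp; linarith)

lemma string_induct:
 assumes "renum (%s. ~ P s)" "P #1" "!!s b. s ~= #0 ==> b <. num 2 ==> P s ==> P (dbl s b)"
 shows "s ~= #0 ==> P s"
proof -
 assume s: "s ~= #0"
 have "s ~= #0 --> P s"
 proof (rule corenum_less_induct[of "%s. s ~= #0 --> P s"])
  have "renum (%s. s ~= #0 & ~ P s)" by (intro renum_conj assms(1) renum_dec decs)
  then show "renum (%s. ~ (s ~= #0 --> P s))" by simp
  fix s assume IH: "!!t. t <. s ==> t ~= #0 --> P t"
  show "s ~= #0 --> P s"
  proof
   assume "s ~= #0"
   obtain t b where t: "s = dbl t b" "b <. num 2" by (rule dbl_cases)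
   show "P s"
   proof (cases "t = #0")
    case True
    then have "s = #1" using t \<open>s ~= \<zero>\<close> by (auto simp: lt_two zero_plus)
    then show ?thesis using assms(2) by simp
   next
    case False
    then show ?thesis using IH[of t] lt_dbl[of t b] assms(3) t by blast
   qed
  qed
 qed
 then show "P s" using s by blast
qed

definition srec :: "'n => ('n => 'n => 'n => 'n) => 'n => 'n" where
 "srec c g s = cov (%s h. if s <=. #1 then c else g (half s) (lastbit s) (h (half s))) s"

lemma
 assumes g: "recfn (%q. g (pfst (pfst q)) (psnd (pfst q)) (psnd q))"
 shows recfn_srec: "recfn f ==> recfn (%p. srec c g (f p))"
  and srec_one: "srec c g #1 = c"
  and srec_dbl: "s ~= #0 ==> b <. num 2 ==> srec c g (dbl s b) = g s b (srec c g s)"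
proof -
 let ?G = "%s h. if s <=. #1 then c else g (half s) (lastbit s) (h (half s))"
 have g': "recfn (%q. g (a q) (b q) (e q))" if "recfn a" "recfn b" "recfn e" for a b e
  using recfn_comp[OF g recfn_pair[OF recfn_pair[OF that(1,2)] that(3)]] by simp
 have r: "recfn (%q. ?G (pfst q) (bt (psnd q)))" by (intro decs g')
 have eq: "srec c g s = ?G s (srec c g)" for s
  unfolding srec_def
 proof (rule cov_eq[OF r])
  fix n h h' assume h: "!!i. i <. n ==> h i = (h' i :: 'n)"
  show "?G n h = ?G n h'"
  proof (cases "n <=. #1")
   case False
   have "half n ~= #0" using False dbl_le_one[OF lastbit_lt, of "half n" n] dbl_half[of n] by simp
   then have "half n <. n" using lt_dbl[of "half n" "lastbit n"] dbl_half[of n] by simp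
   then show ?thesis using h by simp
  qed simp
 qed
 show "srec c g #1 = c" using eq[of \<one>] by simp
 show "s ~= #0 ==> b <. num 2 ==> srec c g (dbl s b) = g s b (srec c g s)"
  using eq[of "dbl s b"] by (simp add: dbl_le_one del: num.simps)
 have "recfn (%q. ?G (psnd (pfst q)) (bt (psnd q)))" by (intro decs g')
 then show "recfn f ==> recfn (%p. srec c g (f p))" unfolding srec_def by (rule recfn_cov)
qed

definition len :: "'n => 'n" where
 "len s = lst (%n. s <. pow2 (n +. #1))"

lemma recfn_len [decs]: "recfn f ==> recfn (%p. len (f p))"
proof -
 assume f: "recfn f"
 have "EX n. f p <. pow2 (n +. #1)" for p
  using pw_ge[of "f p"] pw_pos[of "f p"] by (intro exI[of _ "f p"]) (unfold nv_simps pw_Suc, linarith)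
 then show ?thesis unfolding len_def by (intro recfn_lst decs recfn_comp[OF f])
qed

lemma len_eq: assumes "string_length s n" shows "len s = n"
 unfolding len_def
proof (rule lst_eq)
 show "s <. pow2 (n +. #1)" using assms by (simp add: string_length_def)
 fix k assume "k <. n"
 then have "pow2 (k +. #1) <=. s" using pw_strict_mono[of k n] assms unfolding string_length_def nv_simps pw_Suc by linarith
 then show "~ s <. pow2 (k +. #1)" by (simp add: not_lt)
qed

lemma string_length_len: "s ~= #0 ==> string_length s (len s)"
 using string_length_ex len_eq by metis

lemma len_one [simp]: "len #1 = #0" and len_dbl: "s ~= #0 ==> b <. num 2 ==> len (dbl s b) = len s +. #1"
 using len_eq[OF string_length_one] len_eq string_length_dbl string_length_len by blast+

text \<open>Sums over all strings of length \<open>n\<close> can thereby be written as sums over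
  \<open>i <. pow2 n\<close>.\<close>

lemma string_length_plus: "string_length s n \<longleftrightarrow> (EX i. i <. pow2 n & s = pow2 n +. i)"
proof
 assume s: "string_length s n"
 then obtain i where i: "s = pow2 n +. i" using le_imp_plus unfolding string_length_def by blast
 have "i <. pow2 n" using s unfolding string_length_def i nv_simps nv_add pw_Suc by linarith
 then show "EX i. i <. pow2 n & s = pow2 n +. i" using i by blast
next
 assume "EX i. i <. pow2 n & s = pow2 n +. i"
 then obtain i where i: "i <. pow2 n" "s = pow2 n +. i" by blast
 then show "string_length s n" using nv_nonneg[of i] unfolding string_length_def nv_simps i(2) nv_add pw_Suc by linarith
qed

lemma len_plus: "i <. pow2 n ==> len (pow2 n +. i) = n" "i <. pow2 n ==> pow2 n +. i ~= #0"
 using len_eq string_length_plus string_length_nonzero by blast+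

lemma plus_dbl: "pow2 (n +. #1) +. dbl i b = dbl (pow2 n +. i) b"
 unfolding nv_eq nv_add nv_mult pw_Suc nv_num by (simp add: algebra_simps)

lemma dbl_lt_pow2: assumes "b <. num 2" shows "dbl i b <. pow2 (n +. #1) \<longleftrightarrow> i <. pow2 n"
 using string_length_dbl[OF assms, of "pow2 n +. i" n] unfolding string_length_def nv_simps nv_add nv_mult pw_Suc nv_num
 using nv_nonneg[of i] nv_nonneg[of b] pw_pos[of n] by auto

lemma string_length_shift:
 assumes "string_length r n" "w <. pow2 q" shows "string_length (r *. pow2 q +. w) (n +. q)"
proof -
 have "pw n * pw q <= nv r * pw q" using assms(1) unfolding string_length_def nv_simps by (intro mult_right_mono) simp_all
 moreover have "(nv r + 1) * pw q <= (2 * pw n) * pw q"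
  using assms(1) unfolding string_length_def nv_Suc_le pw_Suc by (intro mult_right_mono) simp_all
 moreover have "pow2 (n +. q +. #1) = num 2 *. pow2 (n +. q)" by (rule pow2_Suc)
 ultimately show ?thesis using assms(2) nv_nonneg[of w]
  unfolding string_length_def nv_simps nv_add nv_mult pw_Suc pw_add by (simp add: algebra_simps; linarith)
qed

definition mn :: "'n => 'n => 'n" where "mn a b = (if a <=. b then a else b)"
definition monus :: "'n => 'n => 'n" where "monus a b = lst (%y. a <=. b +. y)"

lemma nv_mn [simp]: "nv (mn a b) = min (nv a) (nv b)"
 unfolding mn_def by (auto simp: nv_simps min_def simp del: nv_eq)

lemma monus_eq: "monus (b +. y) b = y"
 unfolding monus_def by (rule lst_eq) (auto simp: nv_simps not_le)

lemma nv_monus: "b <=. a ==> nv (monus a b) = nv a - nv b"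
 using le_imp_plus[of b a] monus_eq by fastforce

lemma recfn_mn [decs]: "recfn f ==> recfn g ==> recfn (%p. mn (f p) (g p))"
 unfolding mn_def by (intro decs)

lemma recfn_monus [decs]: "recfn f ==> recfn g ==> recfn (%p. monus (f p) (g p))"
proof -
 assume f: "recfn f" and g: "recfn g"
 have "EX n. f p <=. g p +. n" for p
  using nv_nonneg[of "g p"] by (intro exI[of _ "f p"]) (unfold nv_simps nv_add, linarith)
 then show ?thesis unfolding monus_def by (intro recfn_lst decs recfn_comp[OF f] recfn_comp[OF g])
qed

section \<open>Sums over strings of given length\<close>

lemma nsum_add:
 assumes "recfn f" "recfn g" "recfn h" "!!i. h i = f i +. g i" shows "nsum h n = nsum f n +. nsum g n"
proof (rule dec_induct'[of "%n. nsum h n = nsum f n +. nsum g n"])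
 show "dec (%n. nsum h n = nsum f n +. nsum g n)" by (intro decs recfn_comp[OF assms(1)] recfn_comp[OF assms(2)] recfn_comp[OF assms(3)])
 show "nsum h #0 = nsum f #0 +. nsum g #0" by simp
 show "nsum h n = nsum f n +. nsum g n ==> nsum h (n +. #1) = nsum f (n +. #1) +. nsum g (n +. #1)" for n
  by (simp add: nsum_Suc assms add_ac')
qed

text \<open>Passes from the total width of the intervals of one level to that of the next; the 6 is
  the loss per string found in \<open>wd_split\<close>.\<close>

lemma nsum_dbl_ge:
 assumes f: "recfn f" and g: "recfn g" and fg: "!!i. i <. n ==> num 4 *. f i <=. g (dbl i #0) +. g (dbl i #1) +. num 6"
 shows "num 4 *. nsum f n <=. nsum g (num 2 *. n) +. num 6 *. n"
proof -
 have "n <=. n --> num 4 *. nsum f n <=. nsum g (num 2 *. n) +. num 6 *. n"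
 proof (rule dec_induct'[of "%m. m <=. n --> num 4 *. nsum f m <=. nsum g (num 2 *. m) +. num 6 *. m"])
  show "dec (%m. m <=. n --> num 4 *. nsum f m <=. nsum g (num 2 *. m) +. num 6 *. m)"
   by (intro decs recfn_comp[OF f] recfn_comp[OF g])
  show "#0 <=. n --> num 4 *. nsum f #0 <=. nsum g (num 2 *. #0) +. num 6 *. #0"
   by (simp add: nv_simps del: num.simps)
  fix m assume IH: "m <=. n --> num 4 *. nsum f m <=. nsum g (num 2 *. m) +. num 6 *. m"
  show "m +. #1 <=. n --> num 4 *. nsum f (m +. #1) <=. nsum g (num 2 *. (m +. #1)) +. num 6 *. (m +. #1)"
  proof
   assume "m +. #1 <=. n"
   then have m: "m <. n" by (simp add: lt_Suc_le[symmetric] nv_ops)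
   then have IH': "num 4 *. nsum f m <=. nsum g (num 2 *. m) +. num 6 *. m" using IH by (simp add: le_def)
   have e: "num 2 *. (m +. #1) = num 2 *. m +. #1 +. #1" "dbl m #0 = num 2 *. m"
    unfolding nv_eq nv_add nv_mult nv_num by simp_all
   have "nsum g (num 2 *. (m +. #1)) = nsum g (num 2 *. m) +. g (dbl m #0) +. g (dbl m #1)"
    unfolding e nsum_Suc[OF g] ..
   then show "num 4 *. nsum f (m +. #1) <=. nsum g (num 2 *. (m +. #1)) +. num 6 *. (m +. #1)"
    using IH' fg[OF m] unfolding nsum_Suc[OF f] nv_simps nv_add nv_mult nv_num nv_1 by (simp add: algebra_simps; linarith)
  qed
 qed
 then show ?thesis by simp
qed

lemma cnt_arg_mono: assumes P: "dec P" and "a <=. b" shows "cnt P a <=. cnt P b"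
proof -
 obtain c where b: "b = a +. c" using assms(2) le_imp_plus by blast
 have "cnt P a <=. cnt P (a +. c)"
 proof (rule dec_induct'[of "%c. cnt P a <=. cnt P (a +. c)"])
  show "dec (%c. cnt P a <=. cnt P (a +. c))" by (intro decs dec_subst[OF P])
  fix c assume "cnt P a <=. cnt P (a +. c)"
  moreover have "cnt P (a +. c) <=. cnt P (a +. c) +. (if P (a +. c) then #1 else #0)"
   by (simp add: nv_simps(3))
  ultimately have "cnt P a <=. cnt P (a +. c +. #1)"
   unfolding cnt_Suc[OF P] by (rule le_trans')
  then show "cnt P a <=. cnt P (a +. (c +. #1))" by (simp add: add_assoc')
 qed simp
 then show ?thesis by (simp add: b)
qed

lemma cnt_interval:
 assumes P: "dec P" and i: "!!i. i <. w ==> P (a +. i)" shows "cnt P (a +. w) = cnt P a +. w"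
proof -
 have "w <=. w --> cnt P (a +. w) = cnt P a +. w"
 proof (rule dec_induct'[of "%c. c <=. w --> cnt P (a +. c) = cnt P a +. c"])
  show "dec (%c. c <=. w --> cnt P (a +. c) = cnt P a +. c)" by (intro decs dec_subst[OF P])
  fix c assume IH: "c <=. w --> cnt P (a +. c) = cnt P a +. c"
  show "c +. #1 <=. w --> cnt P (a +. (c +. #1)) = cnt P a +. (c +. #1)"
  proof
   assume "c +. #1 <=. w"
   then have c: "c <. w" by (simp add: lt_Suc_le[symmetric] nv_ops)
   then have "cnt P (a +. c) = cnt P a +. c" using IH by (simp add: le_def)
   then show "cnt P (a +. (c +. #1)) = cnt P a +. (c +. #1)"
    using i[OF c] cnt_Suc[OF P, of "a +. c"] by (simp add: add_assoc'[symmetric])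
  qed
 qed simp
 then show ?thesis by simp
qed

lemma cnt_add_le:
 assumes P: "dec P" shows "cnt P (a +. w) <=. cnt P a +. w"
proof (rule dec_induct'[of "%w. cnt P (a +. w) <=. cnt P a +. w"])
 show "dec (%w. cnt P (a +. w) <=. cnt P a +. w)" by (intro decs dec_subst[OF P])
 fix c assume "cnt P (a +. c) <=. cnt P a +. c"
 then show "cnt P (a +. (c +. #1)) <=. cnt P a +. (c +. #1)"
  using cnt_Suc[OF P, of "a +. c"] by (auto simp: add_assoc'[symmetric] nv_simps(3))
qed simp

lemma cnt_empty_add:
 assumes P: "dec P" and i: "!!i. i <. w ==> ~ P (a +. i)" shows "cnt P (a +. w) = cnt P a"
proof -
 have "w <=. w --> cnt P (a +. w) = cnt P a"
 proof (rule dec_induct'[of "%c. c <=. w --> cnt P (a +. c) = cnt P a"])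
  show "dec (%c. c <=. w --> cnt P (a +. c) = cnt P a)" by (intro decs dec_subst[OF P])
  fix c assume IH: "c <=. w --> cnt P (a +. c) = cnt P a"
  show "c +. #1 <=. w --> cnt P (a +. (c +. #1)) = cnt P a"
  proof
   assume "c +. #1 <=. w"
   then have c: "c <. w" by (simp add: lt_Suc_le[symmetric] nv_ops)
   then have "cnt P (a +. c) = cnt P a" using IH by (simp add: le_def)
   then show "cnt P (a +. (c +. #1)) = cnt P a"
    using i[OF c] cnt_Suc[OF P, of "a +. c"] by (simp add: add_assoc'[symmetric])
  qed
 qed simp
 then show ?thesis by simp
qed

text \<open>Converts a count of interval units into a count of dyadic strings: a block of
  \<open>B\<close> consecutive numbers contributes at most \<open>B\<close>, and nothing unless it
  meets \<open>P\<close>.\<close>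

lemma cnt_blocks:
 assumes P: "dec P" and Q: "dec Q" and PQ: "!!q w. w <. B ==> P (q *. B +. w) ==> Q q"
 shows "cnt P (m *. B) <=. cnt Q m *. B"
proof (rule dec_induct'[of "%m. cnt P (m *. B) <=. cnt Q m *. B"])
 show "dec (%m. cnt P (m *. B) <=. cnt Q m *. B)" by (intro decs dec_subst[OF P] dec_subst[OF Q])
 show "cnt P (#0 *. B) <=. cnt Q #0 *. B" by (simp add: zero_times)
 fix m assume IH: "cnt P (m *. B) <=. cnt Q m *. B"
 have e: "(m +. #1) *. B = m *. B +. B" unfolding nv_eq nv_add nv_mult nv_1 by (simp add: algebra_simps)
 show "cnt P ((m +. #1) *. B) <=. cnt Q (m +. #1) *. B"
 proof (cases "Q m")
  case True
  then show ?thesis using IH cnt_add_le[OF P, of "m *. B" B]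
   unfolding e cnt_Suc[OF Q] nv_simps nv_add nv_mult by (simp add: algebra_simps; linarith)
 next
  case False
  then have "cnt P (m *. B +. B) = cnt P (m *. B)" using PQ by (intro cnt_empty_add[OF P]) blast
  then show ?thesis using IH False by (simp add: e cnt_Suc[OF Q])
 qed
qed

lemma cnt_shift:
 assumes P: "dec P" and Q: "dec Q" and PQ: "!!i. i <. n ==> Q i ==> P (a +. i)"
 shows "cnt Q n <=. cnt P (a +. n)"
proof -
 have "n <=. n --> cnt Q n <=. cnt P (a +. n)"
 proof (rule dec_induct'[of "%m. m <=. n --> cnt Q m <=. cnt P (a +. m)"])
  show "dec (%m. m <=. n --> cnt Q m <=. cnt P (a +. m))" by (intro decs dec_subst[OF P] dec_subst[OF Q])
  show "#0 <=. n --> cnt Q #0 <=. cnt P (a +. #0)" by (simp add: nv_simps(3))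
  fix m assume IH: "m <=. n --> cnt Q m <=. cnt P (a +. m)"
  show "m +. #1 <=. n --> cnt Q (m +. #1) <=. cnt P (a +. (m +. #1))"
  proof
   assume "m +. #1 <=. n"
   then have m: "m <. n" by (simp add: lt_Suc_le[symmetric] nv_ops)
   then have "cnt Q m <=. cnt P (a +. m)" using IH by (simp add: le_def)
   then show "cnt Q (m +. #1) <=. cnt P (a +. (m +. #1))"
    using PQ[OF m] cnt_Suc[OF P, of "a +. m"] cnt_Suc[OF Q, of m] nv_nonneg[of "cnt Q m"]
    by (auto simp: add_assoc'[symmetric] nv_simps(3) split: if_splits)
  qed
 qed
 then show ?thesis by simp
qed

end

context cspace
begin

lemma ev_eq_induct:
 assumes "pt x" "recfn f" "recfn g" "ev x (f #0) = ev x (g #0)"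
  "!!n. ev x (f n) = ev x (g n) ==> ev x (f (n +. #1)) = ev x (g (n +. #1))"
 shows "ev x (f n) = ev x (g n)"
proof (rule corenum_induct[of "%n. ev x (f n) = ev x (g n)"])
 have "renum (%n. ev x (f n) < ev x (g n) \<or> ev x (g n) < ev x (f n))" by (intro renums assms)
 then show "renum (%n. ev x (f n) ~= ev x (g n))" by (simp add: neq_iff)
qed (use assms in auto)

end

section \<open>Splitting a measure along binary strings\<close>

text \<open>The budget of the mass \<open>4 q\<close>: one \<open>q\<close> goes because witnesses
  exceed only the level \<open>q\<close>, at most three halves of \<open>q\<close> go to rounding,
  kept small by the guard digits \<open>k\<close>; what remains still exceeds the density
  \<open>q\<close> wanted for the tree.\<close>

locale splitting = mspace M A d I for M :: "'n l2_struct" (structure) and A d I +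
 fixes u :: "'n => 'n" and \<rho> :: "'n => bool" and q k :: 'n and p :: "'n => 'n => 'n => 'n" and l :: "'n => 'n"
 assumes u: "recfn u" and \<rho>: "renum (%t. ~ \<rho> t)" and q: "isQ q" "0 < qv q" and k: "4 / pw k <= qv q"
  and mass: "!!L. EX g. (ALL x. pt x --> ev x g <= 1) & (ALL t. t <. L --> \<rho> t --> (ALL x. pt x --> ev x g <= ev x (u t))) & 4 * qv q <= iv g"
  and net: "p \<in> Fn3" "recfn l" "!!j i. i <=. l j ==> pt (p j i)"
   "!!z j. pt z ==> EX i. i <=. l j & dst (p j i) z < 1 / pw j"
begin

text \<open>The weights \<open>wt s\<close> of the strings of length \<open>n\<close> form a partition of unity; bit \<open><<j, i>>\<close> tells
 whether a point is near the \<open>i\<close>-th point of the \<open>j\<close>-th net.  At scale \<open>2\<^sup>k\<close> times \<open>4\<^sup>n\<close> the string \<open>s\<close> gets the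
 interval of the \<open>wd s\<close> numbers from \<open>al s\<close> on.  Rounding loses a bounded number of units per
 string, hence altogether only a fraction of order \<open>2\<^sup>-\<^sup>k\<close>.\<close>

definition psi :: "'n => 'n" where
 "psi t = (if psnd t <=. l (pfst t)
   then tclamp (tsub (tconst (qnat (num 3))) (tmul (tconst (qnat (pow2 (pfst t)))) (tdist (p (pfst t) (psnd t) (pfst t)))))
   else tzero)"

definition wt :: "'n => 'n" where
 "wt = srec tone (%s b v. tmul v (if b = #0 then psi (len s) else tsub tone (psi (len s))))"

definition sc :: "'n => 'n" where
 "sc n = pow2 (k +. (n +. n))"

text \<open>An integer lower estimate of the measure of the piece in units of \<open>1 / sc\<close>.
  The approximation read off from \<open>I\<close> is at most one unit wrong; with the allowance of
  2, \<open>lo s\<close> lies below the measure by at most 3 units.\<close>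

definition lo :: "'n => 'n" where
 "lo s = lst (%y. I (wt s) (k +. (len s +. len s)) *\<^sub>Q qnat (sc (len s)) \<le>\<^sub>Q qnat (y +. num 2))"

text \<open>One level rescales by 4. The left child takes as much of the interval as its estimate
  permits, the right child starts immediately behind it, and what is left over is lost. The minima
  keep children inside the parent and below their own measure.\<close>

definition iw_next :: "'n => 'n => 'n => 'n" where
 "iw_next s b v = (if b = #0 then <<num 4 *. pfst v, mn (num 4 *. psnd v) (lo (dbl s #0))>>
   else <<num 4 *. pfst v +. mn (num 4 *. psnd v) (lo (dbl s #0)),
      mn (monus (num 4 *. psnd v) (mn (num 4 *. psnd v) (lo (dbl s #0)))) (lo (dbl s #1))>>)"

definition iw :: "'n => 'n" where
 "iw = srec <<#0, lo #1>> iw_next"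

definition al :: "'n => 'n" where "al s = pfst (iw s)"
definition wd :: "'n => 'n" where "wd s = psnd (iw s)"

lemma recfn_p [decs]: "recfn f ==> recfn g ==> recfn h ==> recfn (%r. p (f r) (g r) (h r))"
 by (rule recfn_Fn3[OF net(1)])

lemma recfn_l [decs]: "recfn f ==> recfn (%r. l (f r))"
 by (rule recfn_comp[OF net(2)])

lemma recfn_I [decs]: "recfn f ==> recfn g ==> recfn (%r. I (f r) (g r))"
 by (rule recfn_Fn2[OF I_Fn2])

lemma recfn_psi [decs]: "recfn f ==> recfn (%r. psi (f r))"
proof -
 have "recfn psi" unfolding psi_def by (intro decs)
 then show "recfn f ==> recfn (%r. psi (f r))" by (rule recfn_comp)
qed

lemma wt_step: "recfn (%q. tmul (psnd q) (if psnd (pfst q) = #0 then psi (len (pfst (pfst q))) else tsub tone (psi (len (pfst (pfst q))))))"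
 by (intro decs)

lemma recfn_wt [decs]: "recfn f ==> recfn (%r. wt (f r))"
 unfolding wt_def by (rule recfn_srec[OF wt_step])

lemma wt_one: "wt #1 = tone"
 unfolding wt_def by (rule srec_one[OF wt_step])

lemma wt_dbl: "s ~= #0 ==> b <. num 2 ==> wt (dbl s b) = tmul (wt s) (if b = #0 then psi (len s) else tsub tone (psi (len s)))"
 unfolding wt_def by (rule srec_dbl[OF wt_step])

lemma net_A: "i <=. l j ==> p j i n \<in> A"
 using ptD(2)[OF net(3)] .

text \<open>The function is 1 up to distance \<open>2 / pw j\<close> and 0 from
  \<open>3 / pw j\<close> on. The ideal point \<open>p j i j\<close> is within
  \<open>1 / pw j\<close> of the net point, so every point that close to the net point gets the
  value 1.\<close>

lemma ev_psi:
 assumes x: "pt x" and i: "i <=. l j"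
 shows "ev x (psi <<j, i>>) = max 0 (min 1 (3 - pw j * dst (ideal (p j i j)) x))"
 using x i net_A[OF i, of j] by (simp add: psi_def ev_dist del: num.simps)

lemma psi_unit: "pt x ==> 0 <= ev x (psi t)" "pt x ==> ev x (psi t) <= 1"
 by (simp_all add: psi_def)

lemma ev_wt_dbl:
 assumes "pt x" "s ~= #0"
 shows "ev x (wt (dbl s #0)) = ev x (wt s) * ev x (psi (len s))"
  "ev x (wt (dbl s #1)) = ev x (wt s) * (1 - ev x (psi (len s)))"
 unfolding wt_dbl[OF assms(2) zero_lt_two(1)] wt_dbl[OF assms(2) zero_lt_two(2)] using assms(1) by simp_all

lemma wt_nonneg: assumes x: "pt x" shows "s ~= #0 ==> 0 <= ev x (wt s)"
proof (erule string_induct[rotated 3])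
 have "renum (%s. ev x (wt s) < ev x tzero)" by (intro renums decs x)
 then show "renum (%s. ~ 0 <= ev x (wt s))" using x by (simp add: not_le)
 show "0 <= ev x (wt #1)" using x by (simp add: wt_one)
 fix s b assume s: "s ~= #0" "b <. num 2" "0 <= ev x (wt s)"
 then show "0 <= ev x (wt (dbl s b))"
  using psi_unit[OF x, of "len s"] ev_wt_dbl[OF x s(1)] by (auto simp: lt_two simp del: num.simps)
qed

lemma wt_le: assumes x: "pt x" and s: "s ~= #0" and b: "b <. num 2" shows "ev x (wt (dbl s b)) <= ev x (wt s)"
 using wt_nonneg[OF x s] psi_unit[OF x, of "len s"] ev_wt_dbl[OF x s] b
 by (auto simp: lt_two mult_left_le simp del: num.simps)

lemma wt_sum: assumes x: "pt x" shows "ev x (tsum (%i. wt (pow2 n +. i)) (pow2 n)) = 1"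
proof -
 have "ev x (tsum (%i. wt (pow2 n +. i)) (pow2 n)) = ev x tone"
 proof (rule ev_eq_induct[OF x, of "%n. tsum (%i. wt (pow2 n +. i)) (pow2 n)" "%n. tone"])
  show "recfn (%n. tsum (%i. wt (pow2 n +. i)) (pow2 n))" "recfn (%n. tone)" by (intro decs)+
  have "tsum (%i. wt (pow2 #0 +. i)) (#0 +. #1) = tadd tzero (wt (pow2 #0 +. #0))"
   by (subst tsum_Suc) (intro decs, simp add: tsum_def)
  then show "ev x (tsum (%i. wt (pow2 #0 +. i)) (pow2 #0)) = ev x tone" using x by (simp add: wt_one zero_plus)
  fix n
  \<comment> \<open>The first \<open>2 m\<close> children carry the same total weight as the first
    \<open>m\<close> parents, because the two children of a string share its weight.\<close>
  let ?f = "%m. tsum (%i. wt (pow2 (n +. #1) +. i)) (num 2 *. m)" and ?g = "tsum (%i. wt (pow2 n +. i))"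
  have r: "recfn (%i. wt (pow2 (n +. #1) +. i))" "recfn (%i. wt (pow2 n +. i))" by (intro decs)+
  have "ev x (?f m) = ev x (?g m)" for m
  proof (rule ev_eq_induct[OF x, of ?f ?g])
   show "recfn ?f" "recfn ?g" by (intro decs)+
   have "num 2 *. #0 = #0" by (simp add: nv_eq del: num.simps)
   then show "ev x (?f #0) = ev x (?g #0)" by (simp add: ev_tsum[OF r(1) x] ev_tsum[OF r(2) x] del: num.simps)
   fix m assume IH: "ev x (?f m) = ev x (?g m)"
   have e: "num 2 *. (m +. #1) = num 2 *. m +. #1 +. #1" "dbl m #0 = num 2 *. m"
    unfolding nv_eq nv_add nv_mult nv_num by simp_all
   have "pow2 n +. m ~= #0" using pw_pos[of n] nv_nonneg[of m] unfolding nv_simps nv_add nv_0 by linarith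
   then have "ev x (wt (pow2 (n +. #1) +. dbl m #0)) + ev x (wt (pow2 (n +. #1) +. dbl m #1)) = ev x (wt (pow2 n +. m))"
    unfolding plus_dbl ev_wt_dbl[OF x \<open>pow2 n +. m ~= \<zero>\<close>] by (simp add: algebra_simps)
   then show "ev x (?f (m +. #1)) = ev x (?g (m +. #1))"
    unfolding e ev_tsum[OF r(1) x] ev_tsum[OF r(2) x] IH by linarith
  qed
  then show "ev x (tsum (%i. wt (pow2 n +. i)) (pow2 n)) = ev x tone ==>
   ev x (tsum (%i. wt (pow2 (n +. #1) +. i)) (pow2 (n +. #1))) = ev x tone" by (simp add: pow2_Suc del: num.simps)
 qed
 then show ?thesis using x by simp
qed

lemma nv_sc: "nv (sc n) = pw k * (pw n * pw n)" and sc_pos: "0 < nv (sc n)"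
 by (simp_all add: sc_def pw_add)

lemma recfn_sc [decs]: "recfn f ==> recfn (%r. sc (f r))"
 unfolding sc_def by (intro decs)

lemma lo_ex: "EX y. I (wt s) (k +. (len s +. len s)) *\<^sub>Q qnat (sc (len s)) \<le>\<^sub>Q qnat (y +. num 2)"
proof -
 let ?Q = "I (wt s) (k +. (len s +. len s))"
 have Q: "isQ ?Q" using is_realD(2)[OF I_real] .
 obtain y where y: "qv ?Q * nv (sc (len s)) <= nv y" using nv_arch by (meson less_imp_le)
 have "qv (?Q *\<^sub>Q qnat (sc (len s))) <= qv (qnat (y +. num 2))" using y Q by (simp del: num.simps)
 then show ?thesis using Q by (auto simp: qle_iff simp del: num.simps)
qed

lemma recfn_lo [decs]: "recfn f ==> recfn (%r. lo (f r))"
proof -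
 have "recfn lo" unfolding lo_def by (intro recfn_lst decs lo_ex)
 then show "recfn f ==> recfn (%r. lo (f r))" by (rule recfn_comp)
qed

lemma lo_bounds:
 assumes s: "s ~= #0" shows "nv (lo s) <= iv (wt s) * nv (sc (len s))" "iv (wt s) * nv (sc (len s)) <= nv (lo s) + 3"
proof -
 let ?n = "k +. (len s +. len s)"
 let ?Q = "I (wt s) ?n" and ?S = "nv (sc (len s))"
 let ?P = "%y. ?Q *\<^sub>Q qnat (sc (len s)) \<le>\<^sub>Q qnat (y +. num 2)"
 have Q: "isQ ?Q" using is_realD(2)[OF I_real] .
 have P: "?P y \<longleftrightarrow> qv ?Q * ?S <= nv y + 2" for y using Q by (simp add: qle_iff del: num.simps)
 have d: "dec ?P" by (intro decs)
 obtain y0 where "?P y0" using lo_ex by blast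
 note l = lst_least[OF d this, folded lo_def]
 have S: "?S = pw ?n" by (simp add: sc_def)
 have "\<bar>qv ?Q - iv (wt s)\<bar> <= 1 / pw ?n" unfolding iv_def using is_realD(3)[OF I_real] .
 then have "\<bar>qv ?Q - iv (wt s)\<bar> * ?S <= 1 / pw ?n * ?S" by (rule mult_right_mono) simp
 then have "\<bar>(qv ?Q - iv (wt s)) * ?S\<bar> <= 1" by (simp add: abs_mult S)
 then have a: "qv ?Q * ?S <= iv (wt s) * ?S + 1" "iv (wt s) * ?S <= qv ?Q * ?S + 1" by (simp_all add: algebra_simps abs_le_iff)
 show "iv (wt s) * ?S <= nv (lo s) + 3" using l(1) a(2) unfolding P by linarith
 have v: "0 <= iv (wt s) * ?S" using iv_nonneg[of "wt s"] wt_nonneg s by simp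
 show "nv (lo s) <= iv (wt s) * ?S"
 proof (cases "lo s = #0")
  case False
  then obtain y where y: "lo s = y +. #1" using zero_or_Suc by blast
  have "~ ?P y" using l(2)[of y] y by (auto simp: nv_simps)
  then show ?thesis using a(1) unfolding P y nv_add nv_1 by linarith
 qed (use v in simp)
qed

lemma iw_step: "recfn (%q. iw_next (pfst (pfst q)) (psnd (pfst q)) (psnd q))"
 unfolding iw_next_def by (intro decs)

lemma recfn_al [decs]: "recfn f ==> recfn (%r. al (f r))" and recfn_wd [decs]: "recfn f ==> recfn (%r. wd (f r))"
 unfolding al_def wd_def iw_def by (intro decs recfn_srec[OF iw_step]; assumption)+

lemma al_one: "al #1 = #0" and wd_one: "wd #1 = lo #1"
 by (simp_all add: al_def wd_def iw_def srec_one[OF iw_step])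

lemma al_dbl:
 assumes "s ~= #0"
 shows "nv (al (dbl s #0)) = 4 * nv (al s)" "nv (wd (dbl s #0)) = min (4 * nv (wd s)) (nv (lo (dbl s #0)))"
  "nv (al (dbl s #1)) = 4 * nv (al s) + nv (wd (dbl s #0))"
  "nv (wd (dbl s #1)) = min (4 * nv (wd s) - nv (wd (dbl s #0))) (nv (lo (dbl s #1)))"
proof -
 have m: "mn (num 4 *. wd s) (lo (dbl s #0)) <=. num 4 *. wd s" by (simp add: nv_simps(3) del: num.simps)
 have e: "iw (dbl s b) = iw_next s b (iw s)" if "b <. num 2" for b
  unfolding iw_def by (rule srec_dbl[OF iw_step assms that])
 show "nv (al (dbl s #0)) = 4 * nv (al s)" "nv (wd (dbl s #0)) = min (4 * nv (wd s)) (nv (lo (dbl s #0)))"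
  "nv (al (dbl s #1)) = 4 * nv (al s) + nv (wd (dbl s #0))"
  "nv (wd (dbl s #1)) = min (4 * nv (wd s) - nv (wd (dbl s #0))) (nv (lo (dbl s #1)))"
  unfolding al_def wd_def e[OF zero_lt_two(1)] e[OF zero_lt_two(2)] iw_next_def
  using nv_monus[OF m] by (simp_all add: wd_def del: num.simps)
qed

lemma wd_le_lo: "s ~= #0 ==> wd s <=. lo s"
proof (erule string_induct[rotated 3])
 show "renum (%s. ~ wd s <=. lo s)" by (intro renum_dec decs)
 show "wd #1 <=. lo #1" by (simp add: wd_one)
 show "wd (dbl s b) <=. lo (dbl s b)" if "s ~= #0" "b <. num 2" for s b
  using that(2) al_dbl[OF that(1)] unfolding lt_two nv_simps(3) by auto
qed

lemma wd_le: "s ~= #0 ==> nv (wd s) <= iv (wt s) * nv (sc (len s))"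
 using wd_le_lo[of s] lo_bounds(1)[of s] unfolding nv_simps(3) by linarith

text \<open>The integral is additive, so in the new scale the exact shares of the children add up to
  four times the share of \<open>s\<close>, which is at least \<open>4 * nv (wd s)\<close>. Each
  estimate falls short by at most 3 units, hence the 6.\<close>

lemma wd_split:
 assumes s: "s ~= #0"
 shows "nv (wd (dbl s #0)) + nv (wd (dbl s #1)) <= 4 * nv (wd s)" "4 * nv (wd s) <= nv (wd (dbl s #0)) + nv (wd (dbl s #1)) + 6"
proof -
 show "nv (wd (dbl s #0)) + nv (wd (dbl s #1)) <= 4 * nv (wd s)" using al_dbl[OF s] by linarith
 have nz: "dbl s b ~= #0" for b using lt_dbl[OF s, of b] by auto
 have S: "nv (sc (len (dbl s b))) = 4 * nv (sc (len s))" if "b <. num 2" for b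
  by (simp add: len_dbl[OF s that] nv_sc)
 have "iv (wt (dbl s #0)) + iv (wt (dbl s #1)) = iv (wt s)"
  unfolding iv_add[symmetric]
 proof (rule iv_cong)
  fix x assume x: "pt x"
  show "ev x (tadd (wt (dbl s #0)) (wt (dbl s #1))) = ev x (wt s)"
   unfolding ev_add[OF x] ev_wt_dbl[OF x s] by (simp add: algebra_simps)
 qed
 moreover have alg: "a + b = v ==> a * (4 * r) + b * (4 * r) = 4 * (v * r)" for a b v r :: "'n rl"
  by (auto simp: algebra_simps)
 ultimately have "iv (wt (dbl s #0)) * (4 * nv (sc (len s))) + iv (wt (dbl s #1)) * (4 * nv (sc (len s))) = 4 * (iv (wt s) * nv (sc (len s)))"
  by blast
 then have "4 * nv (wd s) <= nv (lo (dbl s #0)) + nv (lo (dbl s #1)) + 6"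
  using lo_bounds(2)[OF nz[of \<zero>]] lo_bounds(2)[OF nz[of \<one>]] wd_le[OF s] unfolding S[OF zero_lt_two(1)] S[OF zero_lt_two(2)] by linarith
 then show "4 * nv (wd s) <= nv (wd (dbl s #0)) + nv (wd (dbl s #1)) + 6"
  using al_dbl(2,4)[OF s] nv_nonneg[of "lo (dbl s #1)"] by linarith
qed

lemma interval_dbl:
 assumes s: "s ~= #0" and b: "b <. num 2"
 shows "4 * nv (al s) <= nv (al (dbl s b))" "nv (al (dbl s b)) + nv (wd (dbl s b)) <= 4 * (nv (al s) + nv (wd s))"
 using b al_dbl[OF s] wd_split(1)[OF s] nv_nonneg[of "wd (dbl s #0)"] nv_nonneg[of "wd (dbl s #1)"]
 unfolding lt_two by auto

lemma interval_bound: "s ~= #0 ==> al s +. wd s <=. sc (len s)"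
proof (erule string_induct[rotated 3])
 show "renum (%s. ~ al s +. wd s <=. sc (len s))" by (intro renum_dec decs)
 have "nv (lo #1) <= nv (sc (len #1))" using lo_bounds(1)[of \<one>] by (simp add: wt_one)
 then show "al #1 +. wd #1 <=. sc (len #1)" unfolding al_one wd_one nv_simps by simp
 show "al (dbl s b) +. wd (dbl s b) <=. sc (len (dbl s b))" if "s ~= #0" "b <. num 2" "al s +. wd s <=. sc (len s)" for s b
  using interval_dbl(2)[OF that(1,2)] that(3) unfolding len_dbl[OF that(1,2)] nv_simps(3) nv_add nv_sc by simp
qed

text \<open>Neighbouring strings come first: siblings are placed one behind the other, and
  neighbours with different parents inherit the order of the parents. A second induction chains the
  neighbours together.\<close>

lemma intervals_ordered:
 assumes "i <. j" "j <. pow2 n" shows "al (pow2 n +. i) +. wd (pow2 n +. i) <=. al (pow2 n +. j)"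
proof -
 let ?E = "%n. ALL i. i <. pow2 n --> i +. #1 <. pow2 n --> al (pow2 n +. i) +. wd (pow2 n +. i) <=. al (pow2 n +. (i +. #1))"
 have E: "?E n"
 proof (rule dec_induct'[of ?E])
  show "dec ?E" by (intro decs)
  show "?E #0" by (simp add: zero_plus)
  fix n assume IH: "?E n"
  show "?E (n +. #1)"
  proof (intro allI impI)
   fix i assume i: "i <. pow2 (n +. #1)" "i +. #1 <. pow2 (n +. #1)"
   obtain a b where a: "i = dbl a b" "b <. num 2" by (rule dbl_cases)
   have an: "a <. pow2 n" using i(1) a dbl_lt_pow2 by blast
   have nz: "pow2 n +. a ~= #0" by (rule len_plus(2)[OF an])
   show "al (pow2 (n +. #1) +. i) +. wd (pow2 (n +. #1) +. i) <=. al (pow2 (n +. #1) +. (i +. #1))"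
   proof (cases "b = #0")
    case True
    then have e: "i +. #1 = dbl a #1" by (simp add: a)
    show ?thesis using al_dbl[OF nz] unfolding e unfolding a True plus_dbl nv_simps(3) nv_add by linarith
   next
    case False
    then have b: "b = #1" using a(2) by (simp add: lt_two)
    have e: "i +. #1 = dbl (a +. #1) #0" unfolding a b nv_eq nv_add nv_mult nv_num by simp
    have a1: "a +. #1 <. pow2 n" using i(2) dbl_lt_pow2[OF zero_lt_two(1), of "a +. #1" n] unfolding e by blast
    have "nv (al (pow2 n +. a)) + nv (wd (pow2 n +. a)) <= nv (al (pow2 n +. (a +. #1)))"
     using IH an a1 unfolding nv_simps(3) nv_add by blast
    then have "nv (al (dbl (pow2 n +. a) #1)) + nv (wd (dbl (pow2 n +. a) #1)) <= nv (al (dbl (pow2 n +. (a +. #1)) #0))"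
     unfolding al_dbl(1)[OF len_plus(2)[OF a1]] using order_trans[OF interval_dbl(2)[OF nz zero_lt_two(2)]] by simp
    then show ?thesis unfolding e unfolding a b plus_dbl nv_simps(3) nv_add .
   qed
  qed
 qed
 obtain m where j: "j = i +. (m +. #1)" using lt_obtain[OF assms(1)] .
 have "i +. (m +. #1) <. pow2 n --> al (pow2 n +. i) +. wd (pow2 n +. i) <=. al (pow2 n +. (i +. (m +. #1)))"
 proof (rule dec_induct'[of "%m. i +. (m +. #1) <. pow2 n --> al (pow2 n +. i) +. wd (pow2 n +. i) <=. al (pow2 n +. (i +. (m +. #1)))"])
  show "dec (%m. i +. (m +. #1) <. pow2 n --> al (pow2 n +. i) +. wd (pow2 n +. i) <=. al (pow2 n +. (i +. (m +. #1))))" by (intro decs)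
  have lt: "x <. x +. #1" for x by (simp add: lt_Suc)
  show "i +. (#0 +. #1) <. pow2 n --> al (pow2 n +. i) +. wd (pow2 n +. i) <=. al (pow2 n +. (i +. (#0 +. #1)))"
   using E lt_trans'[OF lt, of i "pow2 n"] by (simp add: zero_plus)
  fix m assume IH: "i +. (m +. #1) <. pow2 n --> al (pow2 n +. i) +. wd (pow2 n +. i) <=. al (pow2 n +. (i +. (m +. #1)))"
  show "i +. (m +. #1 +. #1) <. pow2 n --> al (pow2 n +. i) +. wd (pow2 n +. i) <=. al (pow2 n +. (i +. (m +. #1 +. #1)))"
  proof
   let ?j = "i +. (m +. #1)"
   assume "i +. (m +. #1 +. #1) <. pow2 n"
   then have j1: "?j +. #1 <. pow2 n" by (simp add: add_assoc')
   then have j0: "?j <. pow2 n" using lt_trans'[OF lt] by blast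
   have "al (pow2 n +. ?j) +. wd (pow2 n +. ?j) <=. al (pow2 n +. (?j +. #1))" using E j0 j1 by blast
   then have "al (pow2 n +. i) +. wd (pow2 n +. i) <=. al (pow2 n +. (?j +. #1))"
    using IH[rule_format, OF j0] nv_nonneg[of "wd (pow2 n +. ?j)"] unfolding nv_simps(3) nv_add by linarith
   then show "al (pow2 n +. i) +. wd (pow2 n +. i) <=. al (pow2 n +. (i +. (m +. #1 +. #1)))" by (simp add: add_assoc')
  qed
 qed
 then show ?thesis using assms(2) by (simp add: j)
qed

text \<open>\<open>s *. pow2 j +. w\<close> runs through the descendants of \<open>s\<close> that
  are \<open>j\<close> bits longer; each bit refines the interval scale by 4, whence the squares.
  The first part concerns numbers only, the second is a Pi-1 induction about values.\<close>

lemma extension: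
 assumes s: "s ~= #0"
 shows "ALL w. w <. pow2 j --> s *. pow2 j +. w ~= #0 & al s *. (pow2 j *. pow2 j) <=. al (s *. pow2 j +. w) &
  al (s *. pow2 j +. w) +. wd (s *. pow2 j +. w) <=. (al s +. wd s) *. (pow2 j *. pow2 j)"
  (is "?P j")
  and "pt x ==> w <. pow2 j ==> ev x (wt (s *. pow2 j +. w)) <= ev x (wt s)"
proof -
 have split: "EX v b. v <. pow2 j & b <. num 2 & s *. pow2 (j +. #1) +. w = dbl (s *. pow2 j +. v) b" if w: "w <. pow2 (j +. #1)" for j w
 proof -
  obtain v b where v: "w = dbl v b" "b <. num 2" by (rule dbl_cases)
  have "v <. pow2 j" using w v dbl_lt_pow2 by blast
  moreover have "s *. pow2 (j +. #1) +. w = dbl (s *. pow2 j +. v) b"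
   unfolding v pow2_Suc nv_ops by (simp add: algebra_simps)
  ultimately show ?thesis using v(2) by blast
 qed
 have z: "w <. pow2 #0 \<longleftrightarrow> w = #0" for w by simp
 have P: "?P j" for j
 proof (rule dec_induct'[of ?P])
  show "dec ?P" by (intro decs)
  show "?P #0" using s unfolding z by (simp add: times_one)
  fix j assume IH: "?P j"
  show "?P (j +. #1)"
  proof (rule allI, rule impI)
   fix w assume "w <. pow2 (j +. #1)"
   then obtain v b where v: "v <. pow2 j" "b <. num 2" and e: "s *. pow2 (j +. #1) +. w = dbl (s *. pow2 j +. v) b"
    using split by blast
   let ?t = "s *. pow2 j +. v"
   have t: "?t ~= #0" "nv (al s) * (pw j * pw j) <= nv (al ?t)" "nv (al ?t) + nv (wd ?t) <= (nv (al s) + nv (wd s)) * (pw j * pw j)"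
    using IH v(1) unfolding nv_simps(3) nv_add nv_mult by auto
   show "s *. pow2 (j +. #1) +. w ~= #0 & al s *. (pow2 (j +. #1) *. pow2 (j +. #1)) <=. al (s *. pow2 (j +. #1) +. w) &
    al (s *. pow2 (j +. #1) +. w) +. wd (s *. pow2 (j +. #1) +. w) <=. (al s +. wd s) *. (pow2 (j +. #1) *. pow2 (j +. #1))"
    unfolding e
   proof (intro conjI)
    show "dbl ?t b ~= #0" using lt_dbl[OF t(1), of b] by auto
    show "al s *. (pow2 (j +. #1) *. pow2 (j +. #1)) <=. al (dbl ?t b)"
     using t(2) interval_dbl(1)[OF t(1) v(2)] unfolding nv_simps(3) nv_add nv_mult pw_Suc by (simp add: algebra_simps)
    show "al (dbl ?t b) +. wd (dbl ?t b) <=. (al s +. wd s) *. (pow2 (j +. #1) *. pow2 (j +. #1))"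
     using t(3) interval_dbl(2)[OF t(1) v(2)] unfolding nv_simps(3) nv_add nv_mult pw_Suc by (simp add: algebra_simps)
   qed
  qed
 qed
 then show "?P j" .
 assume x: "pt x" and "w <. pow2 j"
 have "ALL w. w <. pow2 j --> ev x (wt (s *. pow2 j +. w)) <= ev x (wt s)"
 proof (rule corenum_induct[of "%j. ALL w. w <. pow2 j --> ev x (wt (s *. pow2 j +. w)) <= ev x (wt s)"])
  have "renum (%j. EX w. w <. pow2 j & ev x (wt s) < ev x (wt (s *. pow2 j +. w)))"
   by (intro renum_ex renum_conj renum_ev_less x; (rule renum_dec)?; intro decs)
  then show "renum (%j. ~ (ALL w. w <. pow2 j --> ev x (wt (s *. pow2 j +. w)) <= ev x (wt s)))" by (simp add: not_le)
  show "ALL w. w <. pow2 #0 --> ev x (wt (s *. pow2 #0 +. w)) <= ev x (wt s)" unfolding z by (simp add: times_one)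
  fix j assume IH: "ALL w. w <. pow2 j --> ev x (wt (s *. pow2 j +. w)) <= ev x (wt s)"
  show "ALL w. w <. pow2 (j +. #1) --> ev x (wt (s *. pow2 (j +. #1) +. w)) <= ev x (wt s)"
  proof (intro allI impI)
   fix w assume "w <. pow2 (j +. #1)"
   then obtain v b where v: "v <. pow2 j" "b <. num 2" and e: "s *. pow2 (j +. #1) +. w = dbl (s *. pow2 j +. v) b"
    using split by blast
   show "ev x (wt (s *. pow2 (j +. #1) +. w)) <= ev x (wt s)"
    unfolding e using wt_le[OF x _ v(2), of "s *. pow2 j +. v"] P v(1) IH by force
  qed
 qed
 then show "ev x (wt (s *. pow2 j +. w)) <= ev x (wt s)" using \<open>w <. pow2 j\<close> by blast
qed

end

section \<open>Pieces with witnesses and the tree of their intervals\<close>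

context splitting
begin

definition some_A :: 'n where "some_A = (SOME a. a \<in> A)"
text \<open>A total retraction onto \<open>A\<close>, which allows witnesses to be sought among all
  numbers.\<close>

definition proj_A :: "'n => 'n" where "proj_A a = (if a \<in> A then a else some_A)"

lemma proj_A: "proj_A a \<in> A"
 using A_ne by (auto simp: proj_A_def some_A_def some_in_eq)

lemma recfn_proj_A [decs]: "recfn f ==> recfn (%r. proj_A (f r))"
 unfolding proj_A_def by (intro decs dec_mem[OF A_cls])

text \<open>The length of the string is also the number of conditions tested on it. Strict
  inequalities and the refutation of the Pi-1 property \<open>\<rho>\<close> keep this
  Sigma-1.\<close>

definition good_at :: "'n => 'n => bool" where
 "good_at s a \<longleftrightarrow> ev (ideal a) tzero < ev (ideal a) (wt s) &
   (ALL t. t <. len s --> ~ \<rho> t \<or> ev (ideal a) (tconst q) < ev (ideal a) (u t))"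

definition good :: "'n => bool" where
 "good s \<longleftrightarrow> (EX a. good_at s (proj_A a))"

lemma renum_good: assumes f: "recfn f" shows "renum (%r. good (f r))"
proof -
 have "renum good"
  unfolding good_def good_at_def
  by (intro renum_ex renum_conj renum_ball renum_disj renum_ev_ideal renum_subst[OF \<rho>] proj_A decs recfn_comp[OF u])
 then show ?thesis by (rule renum_subst[OF _ f])
qed

text \<open>Let \<open>F\<close> be the sum of the weights without witness and \<open>g\<close> come
  from \<open>mass\<close>. At each ideal point \<open>g + (1 - q) * F <= 1\<close>: where
  \<open>g\<close> is at most \<open>q\<close> because \<open>F <= 1\<close>, and elsewhere because
  the point witnesses every piece of positive weight, so that \<open>F = 0\<close>. Integration
  gives \<open>(1 - q) * iv F <= 1 - 4 * q\<close>.\<close>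

lemma good_bound:
 assumes G: "dec G" "!!i. i <. pow2 n ==> G i \<longleftrightarrow> good (pow2 n +. i)"
 shows "iv (tsum (%i. if G i then tzero else wt (pow2 n +. i)) (pow2 n)) <= 1 - 3 * qv q"
proof -
 let ?b = "%i. if G i then tzero else wt (pow2 n +. i)" and ?w = "%i. wt (pow2 n +. i)"
 let ?F = "tsum ?b (pow2 n)"
 have rb: "recfn ?b" and rw: "recfn ?w" by (intro decs G)+
 have F1: "ev x ?F <= 1" if x: "pt x" for x
 proof -
  have "ev x (tsum ?b m) <= ev x (tsum ?w m)" for m
  proof (rule ev_le_induct[OF x, of "tsum ?b" "tsum ?w"])
   show "recfn (tsum ?b)" "recfn (tsum ?w)" by (intro decs dec_subst[OF G(1)])+
   show "ev x (tsum ?b #0) <= ev x (tsum ?w #0)" by (simp add: ev_tsum[OF rb x] ev_tsum[OF rw x])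
   fix m assume IH: "ev x (tsum ?b m) <= ev x (tsum ?w m)"
   have "pow2 n +. m ~= #0" using pw_pos[of n] nv_nonneg[of m] unfolding nv_simps nv_add nv_0 by linarith
   then have "ev x (?b m) <= ev x (?w m)" using wt_nonneg[OF x] x by simp
   then show "ev x (tsum ?b (m +. #1)) <= ev x (tsum ?w (m +. #1))"
    using IH unfolding ev_tsum[OF rb x] ev_tsum[OF rw x] by linarith
  qed
  from this[of "pow2 n"] show ?thesis unfolding wt_sum[OF x] .
 qed
 obtain g where g: "!!x. pt x ==> ev x g <= 1" "!!t x. t <. n ==> \<rho> t ==> pt x ==> ev x g <= ev x (u t)" "4 * qv q <= iv g"
  using mass[of n] by blast
 have F0: "ev x ?F = 0" if x: "pt x" and z: "!!i. i <. pow2 n ==> ev x (?b i) <= 0" for x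
 proof -
  have le: "m <=. pow2 n --> ev x (tsum ?b m) <= ev x tzero" for m
  proof (rule corenum_induct[of "%m. m <=. pow2 n --> ev x (tsum ?b m) <= ev x tzero"])
   have "renum (%m. m <=. pow2 n & ev x tzero < ev x (tsum ?b m))"
    by (intro renum_conj renum_ev_less x; (rule renum_dec)?; intro decs dec_subst[OF G(1)])
   then show "renum (%m. ~ (m <=. pow2 n --> ev x (tsum ?b m) <= ev x tzero))" by (simp add: not_le)
   show "#0 <=. pow2 n --> ev x (tsum ?b #0) <= ev x tzero" using x by (simp add: ev_tsum[OF rb x])
   fix m assume IH: "m <=. pow2 n --> ev x (tsum ?b m) <= ev x tzero"
   show "m +. #1 <=. pow2 n --> ev x (tsum ?b (m +. #1)) <= ev x tzero"
   proof
    assume "m +. #1 <=. pow2 n"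
    then have m: "m <. pow2 n" by (simp add: lt_Suc_le[symmetric] nv_ops)
    then show "ev x (tsum ?b (m +. #1)) <= ev x tzero"
     using IH z[OF m] x unfolding ev_tsum[OF rb x] by (simp add: le_def)
   qed
  qed
  have "0 <= ev x (tsum ?b m)" for m
  proof -
   have "ev x tzero <= ev x (tsum ?b m)"
   proof (rule ev_le_induct[OF x, of "%_. tzero" "tsum ?b"])
    show "recfn (%_. tzero)" "recfn (tsum ?b)" by (intro decs dec_subst[OF G(1)])+
    show "ev x tzero <= ev x (tsum ?b #0)" using x by (simp add: ev_tsum[OF rb x])
    fix m assume IH: "ev x tzero <= ev x (tsum ?b m)"
    have "pow2 n +. m ~= #0" using pw_pos[of n] nv_nonneg[of m] unfolding nv_simps nv_add nv_0 by linarith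
    then have "0 <= ev x (?b m)" using wt_nonneg[OF x] x by simp
    then show "ev x tzero <= ev x (tsum ?b (m +. #1))" using IH unfolding ev_tsum[OF rb x] by linarith
   qed
   then show ?thesis using x by simp
  qed
  then show ?thesis using le[of "pow2 n"] x by (simp add: order_antisym)
 qed
 let ?r = "tconst (qnat #1 +\<^sub>Q quminus q)"
 have q1: "4 * qv q <= 1"
  using g(3) iv_mono[of g tone] g(1) by simp
 have "ev (ideal a) (tadd g (tmul ?r ?F)) <= 1" if a: "a \<in> A" for a
 proof -
  let ?x = "ideal a"
  have x: "pt ?x" using a by simp
  have e: "ev ?x (tadd g (tmul ?r ?F)) = ev ?x g + (1 - qv q) * ev ?x ?F" using x q by simp
  show ?thesis
  proof (cases "ev ?x g <= qv q")
   case True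
   have "(1 - qv q) * ev ?x ?F <= (1 - qv q) * 1" using F1[OF x] q1 q(2) by (intro mult_left_mono) linarith+
   from add_mono[OF True this] show ?thesis unfolding e by simp
  next
   case False
   have "ev ?x (?b i) <= 0" if i: "i <. pow2 n" for i
   proof (cases "G i")
    case False
    then have "~ good_at (pow2 n +. i) (proj_A a)" using G(2)[OF i] unfolding good_def by blast
    then have ng: "~ good_at (pow2 n +. i) a" using a by (simp add: proj_A_def)
    have "ev ?x (tconst q) < ev ?x (u t)" if "t <. n" "\<rho> t" for t
     using g(2)[OF that x] \<open>~ ev ?x g <= qv q\<close> x q by simp
    then show ?thesis using ng x False unfolding good_at_def len_plus(1)[OF i] by auto
   qed (use x in simp)
   then have "ev ?x ?F = 0" by (rule F0[OF x])
   then show ?thesis unfolding e using g(1)[OF x] by simp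
  qed
 qed
 then have "ev x (tadd g (tmul ?r ?F)) <= ev x tone" if "pt x" for x
  using ev_le_dense[of "tadd g (tmul ?r ?F)" 1 x] that by simp
 then have "iv (tadd g (tmul ?r ?F)) <= iv tone" by (rule iv_mono)
 then have "iv (tadd g (tmul ?r ?F)) <= 1" unfolding iv_one .
 then have "iv g + (1 - qv q) * iv ?F <= 1" using q by (simp add: iv_scale)
 then have *: "(1 - qv q) * iv ?F <= 1 - 4 * qv q" using g(3) by linarith
 show ?thesis
 proof (rule ccontr)
  assume "~ ?thesis"
  then have "(1 - qv q) * (1 - 3 * qv q) < (1 - qv q) * iv ?F" using q1 q(2) by (intro mult_strict_left_mono) linarith+
  moreover have "(1 - qv q) * (1 - 3 * qv q) = 1 - 4 * qv q + 3 * (qv q * qv q)" by (simp add: algebra_simps)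
  moreover have "0 <= qv q * qv q" by simp
  ultimately show False using * by linarith
 qed
qed

text \<open>The loss starts with 3 and from level \<open>n\<close> to the next is multiplied by 4
  and increased by \<open>6 * pw n\<close>. The solution of this recursion is
  \<open>6 * (pw n * pw n) - 3 * pw n\<close>.\<close>

lemma wd_total: "nv (sc n) + 3 * pw n <= nv (nsum (%i. wd (pow2 n +. i)) (pow2 n)) + 6 * (pw n * pw n)"
proof -
 let ?P = "%n. sc n +. num 3 *. pow2 n <=. nsum (%i. wd (pow2 n +. i)) (pow2 n) +. num 6 *. (pow2 n *. pow2 n)"
 have "?P n"
 proof (rule dec_induct'[of ?P])
  show "dec ?P" by (intro decs)
  have r: "recfn (%i. wd (pow2 n +. i))" for n by (intro decs)
  have "nsum (%i. wd (pow2 #0 +. i)) (#0 +. #1) = wd #1" unfolding nsum_Suc[OF r] by (simp add: zero_plus)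
  then have b: "nsum (%i. wd (pow2 #0 +. i)) (pow2 #0) = lo #1" by (simp add: zero_plus wd_one)
  show "?P #0" unfolding b nv_simps nv_add nv_mult
   using lo_bounds(2)[of \<one>] by (simp add: wt_one)
  fix n assume IH: "?P n"
  let ?S = "nsum (%i. wd (pow2 n +. i)) (pow2 n)" and ?S' = "nsum (%i. wd (pow2 (n +. #1) +. i)) (pow2 (n +. #1))"
  have "num 4 *. ?S <=. nsum (%i. wd (pow2 (n +. #1) +. i)) (num 2 *. pow2 n) +. num 6 *. pow2 n"
  proof (rule nsum_dbl_ge[OF r r])
   fix i assume i: "i <. pow2 n"
   show "num 4 *. wd (pow2 n +. i) <=. wd (pow2 (n +. #1) +. dbl i #0) +. wd (pow2 (n +. #1) +. dbl i #1) +. num 6"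
    using wd_split(2)[OF len_plus(2)[OF i]] unfolding plus_dbl nv_simps(3) nv_add nv_mult nv_num by simp
  qed
  then have "4 * nv ?S <= nv ?S' + 6 * pw n" unfolding pow2_Suc[symmetric] nv_simps(3) nv_add nv_mult nv_num by simp
  then show "?P (n +. #1)" using IH unfolding nv_simps(3) nv_add nv_mult nv_num nv_sc pw_Suc by (simp add: algebra_simps)
 qed
 then show ?thesis unfolding nv_simps(3) nv_add nv_mult nv_num by simp
qed

lemma good_total:
 assumes G: "dec G" "!!i. i <. pow2 n ==> G i \<longleftrightarrow> good (pow2 n +. i)"
 shows "3 / 2 * qv q * nv (sc n) <= nv (nsum (%i. if G i then wd (pow2 n +. i) else #0) (pow2 n))"
proof -
 let ?w = "%i. wd (pow2 n +. i)"
 let ?g = "%i. if G i then ?w i else #0" and ?b = "%i. if G i then #0 else ?w i"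
 let ?t = "%i. if G i then tzero else wt (pow2 n +. i)"
 have r: "recfn ?w" "recfn ?g" "recfn ?b" "recfn ?t" by (intro decs G)+
 have sum: "nsum ?w (pow2 n) = nsum ?g (pow2 n) +. nsum ?b (pow2 n)"
  by (rule nsum_add[OF r(2,3,1)]) (simp add: zero_plus)
 have b: "m <=. pow2 n --> iv (tconst (qnat (nsum ?b m))) <= iv (tmul (tconst (qnat (sc n))) (tsum ?t m))" for m
 proof (rule corenum_induct[of "%m. m <=. pow2 n --> iv (tconst (qnat (nsum ?b m))) <= iv (tmul (tconst (qnat (sc n))) (tsum ?t m))"])
  have "renum (%m. m <=. pow2 n & iv (tmul (tconst (qnat (sc n))) (tsum ?t m)) < iv (tconst (qnat (nsum ?b m))))"
   by (intro renum_conj renum_iv_less; (rule renum_dec)?; intro decs dec_subst[OF G(1)])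
  then show "renum (%m. ~ (m <=. pow2 n --> iv (tconst (qnat (nsum ?b m))) <= iv (tmul (tconst (qnat (sc n))) (tsum ?t m))))"
   by (simp add: not_le)
  show "#0 <=. pow2 n --> iv (tconst (qnat (nsum ?b #0))) <= iv (tmul (tconst (qnat (sc n))) (tsum ?t #0))"
   by (simp add: iv_const iv_scale iv_tsum[OF r(4)])
  fix m assume IH: "m <=. pow2 n --> iv (tconst (qnat (nsum ?b m))) <= iv (tmul (tconst (qnat (sc n))) (tsum ?t m))"
  show "m +. #1 <=. pow2 n --> iv (tconst (qnat (nsum ?b (m +. #1)))) <= iv (tmul (tconst (qnat (sc n))) (tsum ?t (m +. #1)))"
  proof
   assume "m +. #1 <=. pow2 n"
   then have m: "m <. pow2 n" by (simp add: lt_Suc_le[symmetric] nv_ops)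
   then have IH': "nv (nsum ?b m) <= nv (sc n) * iv (tsum ?t m)" using IH by (simp add: le_def iv_const iv_scale)
   have "nv (?b m) <= nv (sc n) * iv (?t m)"
    using wd_le[OF len_plus(2)[OF m]] by (simp add: len_plus(1)[OF m] iv_const mult.commute)
   then show "iv (tconst (qnat (nsum ?b (m +. #1)))) <= iv (tmul (tconst (qnat (sc n))) (tsum ?t (m +. #1)))"
    using IH' unfolding iv_const[OF isQ_ops(6)] iv_scale[OF isQ_ops(6)] qv_nat nsum_Suc[OF r(3)] iv_tsum[OF r(4)] nv_add
    by (simp only: distrib_left)
  qed
 qed
 have "nv (nsum ?b (pow2 n)) <= nv (sc n) * iv (tsum ?t (pow2 n))" using b[of "pow2 n"] by (simp add: iv_const iv_scale)
 also have "\<dots> <= nv (sc n) * (1 - 3 * qv q)" by (intro mult_left_mono good_bound[OF G]) (simp_all add: less_imp_le[OF sc_pos])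
 finally have 1: "nv (nsum ?b (pow2 n)) <= nv (sc n) - 3 * qv q * nv (sc n)" by (simp add: algebra_simps)
 \<comment> \<open>This is where the number \<open>k\<close> of guard digits makes the loss from
   \<open>wd_total\<close> small relative to the scale.\<close>
 have "6 * (pw n * pw n) <= 3 / 2 * qv q * nv (sc n)"
 proof -
  have "4 <= qv q * pw k" using k by (simp add: divide_le_eq)
  then have "4 * (pw n * pw n) <= qv q * pw k * (pw n * pw n)" by (intro mult_right_mono) simp_all
  then show ?thesis unfolding nv_sc by (simp add: mult.assoc)
 qed
 moreover have "nv (nsum ?w (pow2 n)) = nv (nsum ?g (pow2 n)) + nv (nsum ?b (pow2 n))" unfolding sum by simp
 ultimately show ?thesis using wd_total[of n] 1 pw_pos[of n] by linarith
qed

text \<open>A unit \<open>v\<close> on level \<open>n\<close> becomes the string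
  \<open>sc n +. v\<close> of length \<open>k +. (n +. n)\<close>, that is, a dyadic subinterval.
  The prefixes of the units occupied by good strings of all lengths form the tree.\<close>

definition tree :: "'n set" where
 "tree = {r. EX s v. good s & s ~= #0 & al s <=. v & v <. al s +. wd s & prefix r (sc (len s) +. v)}"

lemma binary_tree: "binary_tree tree"
proof -
 have "t ~= #0" if "t \<in> tree" for t using that unfolding tree_def prefix_def by blast
 moreover have "s \<in> tree" if "t \<in> tree" "prefix s t" for s t using that prefix_trans unfolding tree_def by blast
 ultimately show ?thesis unfolding binary_tree_def by blast
qed

lemma renum_tree: "renum (%r. r \<in> tree)"
 unfolding tree_def mem_Collect_eq by (intro renum_ex renum_conj renum_good decs; (rule renum_dec)?; intro decs)

lemma tree_count: "EX c. card_ge {r \<in> tree. string_length r n} c & q *\<^sub>Q qnat (pow2 n) <\<^sub>Q qnat c"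
proof -
 have G0: "dec (%i. i <. pow2 n & good (pow2 n +. i))" by (intro bounded_comprehension renum_good decs)
 define G where "G = (%i. i <. pow2 n & good (pow2 n +. i))"
 have G: "dec G" "!!i. i <. pow2 n ==> G i \<longleftrightarrow> good (pow2 n +. i)" using G0 by (auto simp: G_def)
 let ?w = "%i. wd (pow2 n +. i)" and ?a = "%i. al (pow2 n +. i)"
 let ?g = "%i. if G i then ?w i else #0"
 have rg: "recfn ?g" by (intro decs G)
 define P where "P = (%v. EX i. i <. pow2 n & G i & ?a i <=. v & v <. ?a i +. ?w i)"
 have P: "dec P" unfolding P_def by (intro decs dec_subst[OF G(1)])
 \<comment> \<open>The units of good intervals are counted from left to right; the order of the
   intervals prevents double counting.\<close>
 have cP: "i <. pow2 n --> nsum ?g (i +. #1) <=. cnt P (?a i +. ?w i)" for i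
 proof (rule dec_induct'[of "%i. i <. pow2 n --> nsum ?g (i +. #1) <=. cnt P (?a i +. ?w i)"])
  show "dec (%i. i <. pow2 n --> nsum ?g (i +. #1) <=. cnt P (?a i +. ?w i))" by (intro decs dec_subst[OF G(1)] dec_subst[OF P])
  have c: "cnt P (?a i) +. ?g i <=. cnt P (?a i +. ?w i)" if i: "i <. pow2 n" for i
  proof (cases "G i")
   case True
   have "P (?a i +. j)" if "j <. ?w i" for j
   proof -
    have "?a i <=. ?a i +. j" "?a i +. j <. ?a i +. ?w i" using that nv_nonneg[of j] unfolding nv_simps nv_add by linarith+
    then show ?thesis unfolding P_def using i True by blast
   qed
   then show ?thesis using cnt_interval[OF P] True by simp
  next
   case False
   have "?a i <=. ?a i +. ?w i" using nv_nonneg[of "?w i"] unfolding nv_simps nv_add by linarith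
   then show ?thesis using False cnt_arg_mono[OF P] by simp
  qed
  show "#0 <. pow2 n --> nsum ?g (#0 +. #1) <=. cnt P (?a #0 +. ?w #0)"
  proof
   assume "#0 <. pow2 n"
   have e: "nsum ?g (#0 +. #1) = ?g #0" using nsum_Suc[OF rg, of \<zero>] by (simp add: zero_plus)
   show "nsum ?g (#0 +. #1) <=. cnt P (?a #0 +. ?w #0)"
    using c[OF \<open>\<zero> <. pow2 n\<close>] nv_nonneg[of "cnt P (?a #0)"] unfolding e nv_simps(3) nv_add by linarith
  qed
  fix i assume IH: "i <. pow2 n --> nsum ?g (i +. #1) <=. cnt P (?a i +. ?w i)"
  show "i +. #1 <. pow2 n --> nsum ?g (i +. #1 +. #1) <=. cnt P (?a (i +. #1) +. ?w (i +. #1))"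
  proof
   assume i1: "i +. #1 <. pow2 n"
   have lt: "i <. i +. #1" by (simp add: lt_Suc)
   have "cnt P (?a i +. ?w i) <=. cnt P (?a (i +. #1))" by (rule cnt_arg_mono[OF P intervals_ordered[OF lt i1]])
   then show "nsum ?g (i +. #1 +. #1) <=. cnt P (?a (i +. #1) +. ?w (i +. #1))"
    using IH lt_trans'[OF lt i1] c[OF i1] unfolding nsum_Suc[OF rg, of "i +. #1"] nv_simps(3) nv_add by auto
  qed
 qed
 have le_sc: "cnt P (?a i +. ?w i) <=. cnt P (sc n)" if "i <. pow2 n" for i
  using cnt_arg_mono[OF P interval_bound[OF len_plus(2)[OF that]]] by (simp add: len_plus(1)[OF that])
 have "nsum ?g (pow2 n) <=. cnt P (sc n)"
 proof -
  have "pow2 n ~= #0" using pw_pos[of n] unfolding nv_simps by (auto simp: less_le)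
  then obtain i where i: "pow2 n = i +. #1" using zero_or_Suc by blast
  then have il: "i <. pow2 n" by (simp add: lt_Suc)
  show ?thesis using le_trans'[OF cP[rule_format, OF il] le_sc[OF il]] unfolding i[symmetric] .
 qed
 \<comment> \<open>Since \<open>sc n = pow2 n *. B\<close>, a string of length \<open>n\<close>
   stands for a block of \<open>B\<close> units, and division by \<open>B\<close> turns counts of
   units into counts of strings.\<close>
 define B where "B = pow2 (k +. n)"
 have sB: "sc n = pow2 n *. B" unfolding B_def nv_eq nv_sc nv_mult pw_add by (simp add: algebra_simps)
 define Q where "Q = (%i. EX w. w <. B & P (i *. B +. w))"
 have Q: "dec Q" unfolding Q_def by (intro decs dec_subst[OF P])
 have cQ: "cnt P (pow2 n *. B) <=. cnt Q (pow2 n) *. B" by (rule cnt_blocks[OF P Q]) (auto simp: Q_def)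
 define R where "R = (%r. EX i. i <=. r & r = pow2 n +. i & i <. pow2 n & Q i)"
 have R: "dec R" unfolding R_def by (intro decs dec_subst[OF Q])
 let ?c = "cnt R (pow2 n +. pow2 n)"
 have cR: "cnt Q (pow2 n) <=. ?c"
 proof (rule cnt_shift[OF R Q])
  show "R (pow2 n +. i)" if "i <. pow2 n" "Q i" for i
   unfolding R_def using that by (intro exI[of _ i]) (simp add: nv_simps(3))
 qed
 have "3 / 2 * qv q * nv (sc n) <= nv (cnt Q (pow2 n)) * nv B"
  using good_total[OF G] \<open>nsum ?g (pow2 n) <=. cnt P (sc n)\<close> cQ unfolding sB[symmetric] nv_simps(3) nv_mult by linarith
 then have "(3 / 2 * qv q * pw n) * nv B <= nv (cnt Q (pow2 n)) * nv B" unfolding sB nv_mult by (simp add: algebra_simps)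
 then have "3 / 2 * qv q * pw n <= nv (cnt Q (pow2 n))" by (simp add: B_def)
 moreover have "0 < qv q * pw n" using q(2) by simp
 ultimately have lt: "qv q * pw n < nv ?c" using cR unfolding nv_simps(3) by linarith
 have "card_ge {r. R r & r <. pow2 n +. pow2 n} ?c" by (rule cnt_card_ge[OF R])
 moreover have "{r. R r & r <. pow2 n +. pow2 n} \<subseteq> {r \<in> tree. string_length r n}"
 proof (safe)
  fix r assume "R r"
  then obtain i w j where i: "r = pow2 n +. i" "i <. pow2 n" and w: "w <. B" and j: "j <. pow2 n" "G j"
   "?a j <=. i *. B +. w" "i *. B +. w <. ?a j +. ?w j" unfolding R_def Q_def P_def by blast
  show "string_length r n" unfolding string_length_plus using i by blast
  have "sc n +. (i *. B +. w) = r *. B +. w" unfolding i sB nv_eq nv_add nv_mult by (simp add: algebra_simps)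
  then have "prefix r (sc (len (pow2 n +. j)) +. (i *. B +. w))"
   unfolding len_plus(1)[OF j(1)] prefix_def i(1) using len_plus(2)[OF i(2)] w unfolding B_def by blast
  then show "r \<in> tree" unfolding tree_def using j len_plus(2)[OF j(1)] G(2) by blast
 qed
 ultimately have "card_ge {r \<in> tree. string_length r n} ?c" unfolding card_ge_def by blast
 moreover have "q *\<^sub>Q qnat (pow2 n) <\<^sub>Q qnat ?c" using lt q by (simp add: qlt_iff)
 ultimately show ?thesis by blast
qed

end

context model
begin

lemma seg_prefix: assumes X: "dec X" and "a <=. b" shows "prefix (seg X a) (seg X b)"
proof -
 obtain c where b: "b = a +. c" using assms(2) le_imp_plus by blast
 have nz: "seg X n ~= #0" for n using string_length_nonzero[OF seg_length[OF X]] .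
 have "prefix (seg X a) (seg X (a +. c))"
 proof (rule dec_induct'[of "%c. prefix (seg X a) (seg X (a +. c))"])
  show "dec (%c. prefix (seg X a) (seg X (a +. c)))" by (intro decs recfn_seg X)
  show "prefix (seg X a) (seg X (a +. #0))" using prefix_refl[OF nz] by simp
  show "prefix (seg X a) (seg X (a +. c)) ==> prefix (seg X a) (seg X (a +. (c +. #1)))" for c
   using seg_Suc[OF X, of "a +. c"] by (simp add: prefix_dbl[OF bit_lt_two] nz flip: add_assoc' del: num.simps)
 qed
 then show ?thesis by (simp add: b)
qed

end

section \<open>The point singled out by a path\<close>

context splitting
begin

text \<open>The unit given by the first \<open>k +. (n +. n)\<close> bits of the path lies in the
  interval of exactly one string \<open>sg n\<close> of length \<open>n\<close>. Since the path
  stays in the tree, for every \<open>n\<close> one ideal point has positive weight for all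
  \<open>sg i\<close> with \<open>i <=. n\<close> and meets the first \<open>n\<close> conditions.
  The bits of these strings tell which net points such witnesses are near, and these net points
  converge.\<close>

lemma path_point:
 assumes Z: "Z \<in> cls M" and path: "!!s. segment_of s Z ==> s \<in> tree"
 shows "EX x. pt x & (ALL t. \<rho> t --> qv q <= ev x (u t))"
proof -
 have dZ: "dec (%i. i \<in> Z)" using Z by (simp add: dec_def)
 define z where "z = (%n. seg (%i. i \<in> Z) (k +. (n +. n)))"
 define v where "v = (%n. monus (z n) (sc n))"
 have rz: "recfn z" unfolding z_def by (intro recfn_seg dZ decs)
 have rv': "recfn v" unfolding v_def by (intro decs rz)
 have zl: "string_length (z n) (k +. (n +. n))" for n unfolding z_def by (rule seg_length[OF dZ])
 have zv: "z n = sc n +. v n" for n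
 proof -
  obtain i where "z n = sc n +. i" using zl[of n] unfolding string_length_plus sc_def by blast
  then show ?thesis by (simp add: v_def monus_eq)
 qed
 have ztree: "z n \<in> tree" for n using path segment_of_seg[OF dZ] unfolding z_def by blast
 define J where "J = (%n s. string_length s n & al s <=. v n & v n <. al s +. wd s)"
 have J_unique: "s = s'" if s: "J n s" and s': "J n s'" for n s s'
 proof -
  obtain i where i: "i <. pow2 n" "s = pow2 n +. i" using s unfolding J_def string_length_plus by blast
  obtain i' where i': "i' <. pow2 n" "s' = pow2 n +. i'" using s' unfolding J_def string_length_plus by blast
  have False if "i <. i'"
   using intervals_ordered[OF that i'(1)] s s' unfolding J_def i i' nv_simps(2,3) by linarith
  moreover have False if "i' <. i"
   using intervals_ordered[OF that i(1)] s s' unfolding J_def i i' nv_simps(2,3) by linarith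
  ultimately show ?thesis using lt_linear[of i i'] i i' by blast
 qed
 \<comment> \<open>The string \<open>s\<close> found by the tree may be longer than
   \<open>n\<close>. Comparison of lengths gives \<open>len s = n +. j\<close>, and its ancestor of
   length \<open>n\<close> owns the unit \<open>v n\<close>, because going up \<open>j\<close>
   levels divides positions by the square of \<open>pow2 j\<close>.\<close>
 have ext: "EX j s' w. len s = n +. j & s = s' *. pow2 j +. w & w <. pow2 j & J n s'"
  if s: "s ~= #0" and vv: "al s <=. vv" "vv <. al s +. wd s" and pre: "prefix (z n) (sc (len s) +. vv)" for s vv n
 proof -
  let ?m = "len s"
  have "vv <. sc ?m" using vv(2) interval_bound[OF s] lt_le_trans' by blast
  then have l1: "string_length (sc ?m +. vv) (k +. (?m +. ?m))" unfolding string_length_plus sc_def by blast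
  obtain qq w' where qq: "w' <. pow2 qq" "sc ?m +. vv = z n *. pow2 qq +. w'" using pre unfolding prefix_def by blast
  have "k +. (?m +. ?m) = k +. (n +. n) +. qq"
   using string_length_unique[OF l1] string_length_shift[OF zl qq(1)] unfolding qq(2) by blast
  then have mq: "2 * nv ?m = 2 * nv n + nv qq" unfolding nv_simps nv_add by simp
  then have "n <=. ?m" using nv_nonneg[of qq] unfolding nv_simps by linarith
  then obtain j where j: "?m = n +. j" using le_imp_plus by blast
  have qj: "qq = j +. j" using mq unfolding j nv_eq nv_add by simp
  have pj: "#0 <. pow2 j" using pw_pos[of j] unfolding nv_simps by simp
  let ?s' = "dv s (pow2 j)" and ?w = "md s (pow2 j)"
  have sw: "s = ?s' *. pow2 j +. ?w" "?w <. pow2 j" using div_mod[OF pj, of s] by blast+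
  have sl: "pw n * pw j <= nv s" "nv s < 2 * (pw n * pw j)"
   using string_length_len[OF s] unfolding j string_length_def nv_simps pw_Suc unfolding pw_add by auto
  have se: "nv s = nv ?s' * pw j + nv ?w" "nv ?w < pw j" using arg_cong[OF sw(1), of nv] sw(2) unfolding nv_simps by simp_all
  have "pw n * pw j < (nv ?s' + 1) * pw j" using sl se by (simp add: algebra_simps)
  then have "pw n < nv ?s' + 1" by simp
  then have 1: "pow2 n <=. ?s'" unfolding lt_Suc_le[symmetric] nv_simps by simp
  have "nv ?s' * pw j < 2 * pw n * pw j" using sl se nv_nonneg[of ?w] by linarith
  then have "nv ?s' < 2 * pw n" by simp
  then have l': "string_length ?s' n" using 1 unfolding string_length_def nv_simps pw_Suc by simp
  have E: "nv (al ?s') * (pw j * pw j) <= nv (al s)" "nv (al s) + nv (wd s) <= (nv (al ?s') + nv (wd ?s')) * (pw j * pw j)"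
   using extension(1)[OF string_length_nonzero[OF l'], of j] sw unfolding nv_simps(3) nv_add nv_mult by auto
  have "nv (sc ?m) + nv vv = (nv (sc n) + nv (v n)) * pw qq + nv w'"
   using arg_cong[OF qq(2), of nv] by (simp add: zv)
  then have ve: "nv vv = nv (v n) * (pw j * pw j) + nv w'" unfolding j qj nv_sc pw_add by (simp add: algebra_simps)
  have w': "nv w' < pw j * pw j" using qq(1) unfolding qj nv_simps pw_add .
  have "nv (al ?s') * (pw j * pw j) < (nv (v n) + 1) * (pw j * pw j)"
   using E(1) vv(1) ve w' unfolding nv_simps by (simp add: algebra_simps; linarith)
  then have "nv (al ?s') < nv (v n) + 1" by (simp add: mult_less_cancel_right)
  then have "al ?s' <=. v n" unfolding lt_Suc_le[symmetric] nv_simps by simp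
  moreover have "nv (v n) * (pw j * pw j) < (nv (al ?s') + nv (wd ?s')) * (pw j * pw j)"
   using E(2) vv(2) ve nv_nonneg[of w'] unfolding nv_simps nv_add by linarith
  then have "v n <. al ?s' +. wd ?s'" unfolding nv_simps by (simp add: mult_less_cancel_right)
  ultimately have "J n ?s'" using l' unfolding J_def by blast
  then show ?thesis using j sw by blast
 qed
 have wit: "EX s vv. good s & s ~= #0 & al s <=. vv & vv <. al s +. wd s & prefix (z n) (sc (len s) +. vv)" for n
  using ztree[of n] unfolding tree_def by blast
 have Jex: "EX s. J n s" for n using wit[of n] ext by blast
 define sg where "sg = (%n. lst (J n))"
 have dJ: "dec (%p. J (f p) (g p))" if "recfn f" "recfn g" for f g
  unfolding J_def by (intro decs that recfn_comp[OF rv'] recfn_comp[OF that(1)])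
 have rsg: "recfn sg" unfolding sg_def by (intro recfn_lst Jex dJ decs)
 have Jsg: "J n (sg n)" for n
 proof -
  obtain s where "J n s" using Jex by blast
  moreover have "dec (J n)" using dJ[OF recfn_const recfn_ident] .
  ultimately show ?thesis unfolding sg_def using lst_least(1) by blast
 qed
 have main: "EX a. a \<in> A & (ALL i. i <=. n --> 0 < ev (ideal a) (wt (sg i))) & (ALL t. t <. n --> \<rho> t --> qv q < ev (ideal a) (u t))" for n
 proof -
  obtain s vv where s: "good s" "s ~= #0" "al s <=. vv" "vv <. al s +. wd s" "prefix (z n) (sc (len s) +. vv)" using wit by blast
  obtain a0 where a0: "good_at s (proj_A a0)" using s(1) unfolding good_def by blast
  let ?a = "proj_A a0"
  have x: "pt (ideal ?a)" using proj_A by simp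
  have "0 < ev (ideal ?a) (wt (sg i))" if "i <=. n" for i
  proof -
   have "k +. (i +. i) <=. k +. (n +. n)" using that by (simp add: nv_simps(3))
   then have "prefix (z i) (z n)" unfolding z_def by (rule seg_prefix[OF dZ])
   then obtain j s' w where w: "s = s' *. pow2 j +. w" "w <. pow2 j" "J i s'"
    using ext[OF s(2-4) prefix_trans[OF _ s(5)]] by blast
   have "s' = sg i" using J_unique[OF w(3) Jsg] .
   moreover have "ev (ideal ?a) (wt s) <= ev (ideal ?a) (wt s')"
    unfolding w(1) using w(3) string_length_nonzero unfolding J_def by (intro extension(2) x w(2)) blast
   ultimately show ?thesis using a0 x unfolding good_at_def by simp
  qed
  moreover have "qv q < ev (ideal ?a) (u t)" if t: "t <. n" "\<rho> t" for t
  proof -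
   obtain j where "len s = n +. j" using ext[OF s(2-5)] by blast
   then have "nv (len s) = nv n + nv j" by simp
   then have "t <. len s" using t(1) nv_nonneg[of j] unfolding nv_simps by linarith
   then show ?thesis using a0 t(2) x q unfolding good_at_def by auto
  qed
  ultimately show ?thesis using proj_A by blast
 qed
 \<comment> \<open>The weight of a child contains the factor \<open>psi t\<close> for bit 0 and
   \<open>1 - psi t\<close> for bit 1, so positive weight excludes one extreme value of
   \<open>psi t\<close>.\<close>
 have bit: "if lastbit (sg (t +. #1)) = #0 then 0 < ev x (psi t) else ev x (psi t) < 1"
  if x: "pt x" and pos: "0 < ev x (wt (sg (t +. #1)))" for x t
 proof -
  obtain s b where s: "sg (t +. #1) = dbl s b" "b <. num 2" "string_length s t"
   using string_length_cases Jsg[of "t +. #1"] unfolding J_def by metis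
  note e = ev_wt_dbl[OF x string_length_nonzero[OF s(3)]]
  have l: "len s = t" by (rule len_eq[OF s(3)])
  have "0 <= ev x (wt s)" using wt_nonneg[OF x string_length_nonzero[OF s(3)]] .
  then show ?thesis using pos s(2) e psi_unit[OF x, of t] unfolding s(1) lastbit_dbl[OF s(2)] lt_two l
   by (auto simp: zero_less_mult_iff simp del: num.simps)
 qed
 \<comment> \<open>The first member of the \<open>j\<close>-th net with bit 0. There is one: a net
   member within \<open>1 / pw j\<close> of a witness has \<open>psi\<close> equal to 1 there, which
   excludes bit 1.\<close>
 define B where "B = (%j. lst (%i. i <=. l j & lastbit (sg (<<j, i>> +. #1)) = #0))"
 have Bex: "EX i. i <=. l j & lastbit (sg (<<j, i>> +. #1)) = #0" for j
 proof -
  let ?n = "<<j, l j>> +. #1"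
  obtain a where a: "a \<in> A" "!!i. i <=. ?n ==> 0 < ev (ideal a) (wt (sg i))" using main[of ?n] by blast
  have x: "pt (ideal a)" using a(1) by simp
  obtain i where i: "i <=. l j" "dst (p j i) (ideal a) < 1 / pw j" using net(4)[OF x] by blast
  have "<<j, i>> +. #1 <=. ?n"
  proof -
   have "(nv j + nv i) * (nv j + nv i) <= (nv j + nv (l j)) * (nv j + nv (l j))"
    using i(1) by (intro mult_mono) (simp_all add: nv_simps(3) nv_nonneg add_nonneg_nonneg)
   then show ?thesis unfolding nv_simps(3) pair_def nv_add nv_mult nv_1 by linarith
  qed
  from bit[OF x a(2)[OF this]] have b: "if lastbit (sg (<<j, i>> +. #1)) = #0 then True else ev (ideal a) (psi <<j, i>>) < 1" by (simp split: if_splits)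
  have "dst (ideal (p j i j)) (ideal a) <= dst (ideal (p j i j)) (p j i) + dst (p j i) (ideal a)"
   using dst_metric(4) net(3)[OF i(1)] x net_A[OF i(1)] pt_ideal by blast
  then have "dst (ideal (p j i j)) (ideal a) <= 2 * (1 / pw j)" using dst_ideal_pt[OF net(3)[OF i(1)], of j] i(2) by linarith
  then have "pw j * dst (ideal (p j i j)) (ideal a) <= 2" by (simp add: divide_simps mult.commute)
  then have "ev (ideal a) (psi <<j, i>>) = 1" unfolding ev_psi[OF x i(1)] by (simp add: min_def max_def)
  then show ?thesis using i(1) b by (auto split: if_splits)
 qed
 have rB: "recfn B" unfolding B_def by (intro recfn_lst Bex decs recfn_comp[OF rsg])
 have B: "B j <=. l j" "lastbit (sg (<<j, B j>> +. #1)) = #0" for j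
 proof -
  have "dec (%i. i <=. l j & lastbit (sg (<<j, i>> +. #1)) = #0)" by (intro decs recfn_comp[OF rsg])
  then have "B j <=. l j & lastbit (sg (<<j, B j>> +. #1)) = #0" unfolding B_def using lst_least(1) Bex[of j] by blast
  then show "B j <=. l j" "lastbit (sg (<<j, B j>> +. #1)) = #0" by blast+
 qed
 \<comment> \<open>After the shift by 3 a witness is within \<open>3 / 8 * (1 / pw j)\<close> of the
   chosen ideal point, and twice this stays below the modulus demanded of points.\<close>
 define x where "x = (%j. p (j +. num 3) (B (j +. num 3)) (j +. num 3))"
 have xA: "x j \<in> A" for j unfolding x_def by (rule net_A[OF B(1)])
 have close: "dst (ideal (x j)) (ideal a) <= 3 / 8 * (1 / pw j)"
  if a: "a \<in> A" "!!i. i <=. n ==> 0 < ev (ideal a) (wt (sg i))" and n: "<<j +. num 3, B (j +. num 3)>> +. #1 <=. n" for j a n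
 proof -
  let ?j = "j +. num 3"
  have y: "pt (ideal a)" using a(1) by simp
  have "0 < ev (ideal a) (psi <<?j, B ?j>>)" using bit[OF y a(2)[OF n]] B(2) by (simp del: num.simps)
  then have "0 < 3 - pw ?j * dst (ideal (x j)) (ideal a)"
   unfolding ev_psi[OF y B(1)] x_def by (simp add: max_def min_def split: if_splits del: num.simps)
  then have "pw j * (8 * dst (ideal (x j)) (ideal a)) <= 3" by (simp add: pw_add3 del: num.simps)
  then show ?thesis by (simp add: field_simps)
 qed
 have x: "pt x"
  unfolding point_def
 proof (intro conjI allI impI xA)
  show "recfn x" unfolding x_def by (intro decs recfn_comp[OF rB])
  fix i j assume ij: "i <. j"
  let ?n = "(<<i +. num 3, B (i +. num 3)>> +. #1) +. (<<j +. num 3, B (j +. num 3)>> +. #1)"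
  obtain a where a: "a \<in> A" "!!i. i <=. ?n ==> 0 < ev (ideal a) (wt (sg i))" using main[of ?n] by blast
  have le: "b <=. b +. c" "c <=. b +. c" for b c using nv_nonneg[of b] nv_nonneg[of c] unfolding nv_simps nv_add by linarith+
  have pa: "pt (ideal a)" "pt (ideal (x i))" "pt (ideal (x j))" using a(1) xA by simp_all
  have "dst (ideal (x i)) (ideal (x j)) <= dst (ideal (x i)) (ideal a) + dst (ideal (x j)) (ideal a)"
   using dst_metric(4)[OF pa(2) pa(1) pa(3)] dst_metric(2)[OF pa(1,3) pa(1)] by simp
  also have "\<dots> <= 3 / 8 * (1 / pw i) + 3 / 8 * (1 / pw j)"
  proof (rule add_mono)
   show "dst (ideal (x i)) (ideal a) <= 3 / 8 * (1 / pw i)"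
    by (rule close[where n = ?n]) (use a le in blast)+
   show "dst (ideal (x j)) (ideal a) <= 3 / 8 * (1 / pw j)"
    by (rule close[where n = ?n]) (use a le in blast)+
  qed
  also have "1 / pw j <= 1 / pw i" using pw_mono[of i j] ij by (simp add: le_def divide_simps)
  then have "3 / 8 * (1 / pw i) + 3 / 8 * (1 / pw j) <= 1 / pw i"
   using pw_pos[of i] zero_less_divide_1_iff[of "pw i"] by linarith
  finally have "rv (d (x i) (x j)) <= 1 / pw i" using dst_ideal[OF xA xA] by simp
  then show "d (x i) (x j) \<le>\<^sub>R rconst (qhalf i)"
   using d_real[OF xA xA] by (simp add: rle_iff is_real_const)
 qed
 have "qv q <= ev x (u t)" if t: "\<rho> t" for t
 proof (rule le_if_pw)
  fix j
  let ?n = "(<<j +. num 3, B (j +. num 3)>> +. #1) +. (t +. #1)"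
  obtain a where a: "a \<in> A" "!!i. i <=. ?n ==> 0 < ev (ideal a) (wt (sg i))" "t <. ?n ==> qv q < ev (ideal a) (u t)"
   using main[of ?n] t by blast
  have n: "<<j +. num 3, B (j +. num 3)>> +. #1 <=. ?n" "t <. ?n"
   using nv_nonneg[of t] nv_nonneg[of "<<j +. num 3, B (j +. num 3)>>"] unfolding nv_simps nv_add nv_1 by linarith+
  have pa: "pt (ideal a)" "pt (ideal (x j))" using a(1) xA by simp_all
  have "dst x (ideal a) <= dst x (ideal (x j)) + dst (ideal (x j)) (ideal a)" by (rule dst_metric(4)[OF x pa(2,1)])
  also have "\<dots> <= 1 / pw j + 3 / 8 * (1 / pw j)"
   using dst_ideal_pt[OF x, of j] close[OF a(1,2) n(1)] dst_metric(2)[OF x pa(2) x] by simp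
  finally have "dst x (ideal a) <= 2 / pw j" using zero_less_divide_1_iff[of "pw j"] pw_pos[of j] by (simp add: field_simps)
  then have "nv (lip (u t)) * dst x (ideal a) <= nv (lip (u t)) * (2 / pw j)" by (intro mult_left_mono nv_nonneg)
  then show "qv q <= ev x (u t) + nv (lip (u t)) * 2 / pw j"
   using ev_lipschitz[OF x pa(1), of "u t"] a(3)[OF n(2)] by (simp add: abs_le_iff; linarith)
 qed
 then show ?thesis using x by blast
qed

end

context mspace
begin

theorem two_WWKL_point:
 assumes W: two_WWKL and u: "recfn u" and \<rho>: "renum (%t. ~ \<rho> t)" and q: "isQ q" "0 < qv q"
  and mass: "!!L. EX g. (ALL x. pt x --> ev x g <= 1) & (ALL t. t <. L --> \<rho> t --> (ALL x. pt x --> ev x g <= ev x (u t))) & 4 * qv q <= iv g"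
 shows "EX x. pt x & (ALL t. \<rho> t --> qv q <= ev x (u t))"
proof -
 obtain p l where net: "p \<in> Fn3" "recfn l" "!!j i. i <=. l j ==> pt (p j i)"
  "!!z j. pt z ==> EX i. i <=. l j & dst (p j i) z < 1 / pw j" using nets by blast
 obtain k where "1 / pw k < qv q / 4" using rl_arch_pw[of "qv q / 4"] q(2) by auto
 then have k: "4 / pw k <= qv q" by (simp add: field_simps)
 interpret splitting M A d I u \<rho> q k p l
  by unfold_locales (rule u \<rho> q k mass net | assumption)+
 have qp: "posQ q" using q by (simp add: posQ_iff)
 have ne: "\<exists>s\<in>tree. string_length s n" for n
 proof -
  obtain c where c: "card_ge {r \<in> tree. string_length r n} c" "q *\<^sub>Q qnat (pow2 n) <\<^sub>Q qnat c" using tree_count by blast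
  have "0 < qv q * pw n" using q by simp
  moreover have "qv q * pw n < nv c" using c(2) q by (simp add: qlt_iff)
  ultimately have "0 < nv c" by (rule less_trans)
  then have "#0 <. c" unfolding nv_simps by simp
  then show ?thesis using c(1) unfolding card_ge_def by blast
 qed
 have "\<exists>Z\<in>cls M. ALL s. segment_of s Z --> s \<in> tree"
  by (rule renum_tree_path[OF W renum_tree binary_tree ne qp tree_count])
 then show ?thesis using path_point by blast
qed

end

section \<open>Points in the limit superior of open sets\<close>

context mspace
begin

text \<open>Bounds the measure of an open set by the integrals of functions increasing to 1 on it.
  If \<open>iv h\<close> exceeded \<open>r\<close> by more than \<open>4 q\<close>, compactness
  would give a point with \<open>h - v t >= q\<close> for all \<open>t\<close>; there
  \<open>h\<close> is positive, so some \<open>v m\<close> reaches 1 although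
  \<open>h <= 1\<close>.\<close>

lemma open_measure:
 assumes W: two_WWKL and v: "recfn v" "!!x m. pt x ==> 0 <= ev x (v m)" "!!m n x. pt x ==> m <=. n ==> ev x (v m) <= ev x (v n)"
  and r: "!!m. iv (v m) <= r" and h: "!!x. pt x ==> ev x h <= 1"
  and hv: "!!x. pt x ==> 0 < ev x h ==> EX m. 1 <= ev x (v m)"
 shows "iv h <= r"
proof (rule ccontr)
 assume "~ iv h <= r"
 then obtain q where q: "posQ q" "qv q < (iv h - r) / 4" using posQ_below[of "(iv h - r) / 4"] by auto
 then have q': "isQ q" "0 < qv q" by (simp_all add: posQ_iff)
 have "EX x. pt x & (ALL t. True --> qv q <= ev x (tsub h (v t)))"
 proof (rule two_WWKL_point[OF W, of "%t. tsub h (v t)" "%_. True"])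
  show "recfn (%t. tsub h (v t))" by (intro decs v(1))
  show "renum (%t. ~ True)" by (intro renum_dec decs)
  show "EX g. (ALL x. pt x --> ev x g <= 1) & (ALL t. t <. L --> True --> (ALL x. pt x --> ev x g <= ev x (tsub h (v t)))) & 4 * qv q <= iv g" for L
  proof (intro exI[of _ "tsub h (v L)"] conjI allI impI)
   fix x assume x: "pt x"
   show "ev x (tsub h (v L)) <= 1" using h[OF x] v(2)[OF x, of L] x by simp
   fix t assume "t <. L"
   then show "ev x (tsub h (v L)) <= ev x (tsub h (v t))" using v(3)[OF x, of t L] x by (simp add: le_def)
  qed (use q r[of L] in \<open>simp; linarith\<close>)
 qed (use q' in auto)
 then obtain x where x: "pt x" "!!t. qv q <= ev x h - ev x (v t)" by auto
 then have "0 < ev x h" using q'(2) v(2)[OF x(1), of \<zero>] x(2)[of \<zero>] by linarith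
 then obtain m where "1 <= ev x (v m)" using hv[OF x(1)] by blast
 then show False using x(2)[of m] h[OF x(1)] q'(2) by linarith
qed

text \<open>An index \<open>m\<close> with \<open>\<rho> j m\<close> captures the integral of
  \<open>v j\<close> up to \<open>e j\<close>, so \<open>v j m\<close> stands for the possibly
  missing supremum. The compactness principle is applied to \<open>v j m - w n\<close> for all such
  \<open>j\<close> and \<open>m\<close> and all \<open>n\<close>.\<close>

lemma limsup_point:
 assumes W: two_WWKL and v: "recfn (%p. v (pfst p) (psnd p))" "!!x n m. pt x ==> 0 <= ev x (v n m)" "!!x n m. pt x ==> ev x (v n m) <= 1"
   "!!m m' n x. pt x ==> m <=. m' ==> ev x (v n m) <= ev x (v n m')"
   "!!m n n' x. pt x ==> n <=. n' ==> ev x (v n' m) <= ev x (v n m)"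
  and w: "recfn w" "!!x n. pt x ==> 0 <= ev x (w n)" "!!m n x. pt x ==> m <=. n ==> ev x (w m) <= ev x (w n)"
   "!!n. iv (w n) <= qv lam / 4"
  and lam: "posQ lam" and vl: "!!n. EX m. qv lam / 2 < iv (v n m)"
 shows "EX x r. pt x & r < 1 & (ALL n. EX m. 0 < ev x (v n m)) & (ALL n. ev x (w n) <= r)"
proof -
 have l: "isQ lam" "0 < qv lam" using lam by (simp_all add: posQ_iff)
 obtain q where q: "posQ q" "qv q < qv lam / 32" using posQ_below[of "qv lam / 32"] l by auto
 then have q': "isQ q" "0 < qv q" by (simp_all add: posQ_iff)
 have rv2: "recfn (%p. v (f p) (g p))" if "recfn f" "recfn g" for f g
  using recfn_comp[OF v(1) recfn_pair[OF that]] by simp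
 \<comment> \<open>The \<open>e j\<close> add up to at most \<open>lam / 8\<close>. Of
   \<open>lam / 2\<close> from \<open>vl\<close>, after subtracting also \<open>lam / 4\<close> for
   \<open>w\<close>, there remains \<open>lam / 8\<close>, and this exceeds
   \<open>4 q\<close>.\<close>
 define e where "e = (%j. lam *\<^sub>Q qhalf (j +. num 4))"
 have pw4: "pw (j +. num 4) = 16 * pw j" for j
 proof -
  have "j +. num 4 = j +. #1 +. #1 +. #1 +. #1" unfolding nv_eq nv_add nv_num by simp
  then show ?thesis by simp
 qed
 have e: "isQ (e j)" "qv (e j) = qv lam / (16 * pw j)" for j using l by (simp_all add: e_def pw4 del: num.simps)
 define \<rho> where "\<rho> = (%j m. ALL m'. m <=. m' --> iv (v j m') <= iv (tadd (v j m) (tconst (e j))))"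
 have re: "recfn e" unfolding e_def by (intro decs)
 have "renum (%t. EX m'. psnd t <=. m' & iv (tadd (v (pfst t) (psnd t)) (tconst (e (pfst t)))) < iv (v (pfst t) m'))"
  by (intro renum_ex renum_conj renum_iv_less; (rule renum_dec)?; intro decs rv2 recfn_comp[OF re])
 then have \<rho>: "renum (%t. ~ \<rho> (pfst t) (psnd t))" by (simp add: \<rho>_def not_le)
 \<comment> \<open>Without such an index the integral of \<open>v j\<close> could be raised by
   \<open>e j\<close> again and again and would exceed 1.\<close>
 have \<rho>_ex: "EX m. \<rho> j m" for j
 proof (rule ccontr)
  assume no: "~ (EX m. \<rho> j m)"
  have P: "EX m. iv (tconst (qnat k *\<^sub>Q e j)) < iv (tadd (v j m) (tconst (e j)))" for k
  proof (rule renum_induct[of "%k. EX m. iv (tconst (qnat k *\<^sub>Q e j)) < iv (tadd (v j m) (tconst (e j)))"])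
   show "renum (%k. EX m. iv (tconst (qnat k *\<^sub>Q e j)) < iv (tadd (v j m) (tconst (e j))))"
    by (intro renum_ex renum_iv_less decs rv2)
   have "0 <= iv (v j #0)" using v(2) by (rule iv_nonneg)
   then show "EX m. iv (tconst (qnat #0 *\<^sub>Q e j)) < iv (tadd (v j m) (tconst (e j)))"
    using e[of j] l(2) by (intro exI[of _ \<zero>]) (simp add: iv_const add_nonneg_pos)
   fix k assume "EX m. iv (tconst (qnat k *\<^sub>Q e j)) < iv (tadd (v j m) (tconst (e j)))"
   then obtain m where m: "nv k * qv (e j) < iv (v j m) + qv (e j)" using e(1)[of j] by (auto simp: iv_const)
   have "~ \<rho> j m" using no by blast
   then obtain m' where "iv (v j m) + qv (e j) < iv (v j m')" using e(1)[of j] by (auto simp: \<rho>_def not_le iv_const)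
   then show "EX m. iv (tconst (qnat (k +. #1) *\<^sub>Q e j)) < iv (tadd (v j m) (tconst (e j)))"
    using m e(1)[of j] by (intro exI[of _ m']) (simp add: iv_const algebra_simps)
  qed
  have ep: "0 < qv (e j)" using e l by simp
  obtain k where k: "(1 + qv (e j)) / qv (e j) < nv k" using nv_arch by blast
  obtain m where "nv k * qv (e j) < iv (v j m) + qv (e j)" using P[of k] e(1)[of j] by (auto simp: iv_const)
  moreover have "iv (v j m) <= 1" using iv_mono[of "v j m" tone] v(3) by simp
  moreover have "1 + qv (e j) < nv k * qv (e j)" using k ep by (simp add: divide_less_eq)
  ultimately show False by linarith
 qed
 let ?u = "%t. tsub (v (pfst (pfst t)) (psnd (pfst t))) (w (psnd t))"
 let ?\<rho> = "%t. is_pair t & is_pair (pfst t) & \<rho> (pfst (pfst t)) (psnd (pfst t))"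
 have "EX x. pt x & (ALL t. ?\<rho> t --> qv q <= ev x (?u t))"
 proof (rule two_WWKL_point[OF W, of ?u ?\<rho>])
  show "recfn ?u" by (intro decs rv2 recfn_comp[OF w(1)])
  have "renum (%t. ~ is_pair t \<or> ~ is_pair (pfst t) \<or> ~ \<rho> (pfst (pfst t)) (psnd (pfst t)))"
   by (intro renum_disj renum_subst[OF \<rho> recfn_pfst]; rule renum_dec; intro decs)
  then show "renum (%t. ~ ?\<rho> t)" by simp
  fix L
  obtain m0 where m0: "qv lam / 2 < iv (v L m0)" using vl by blast
  define ms where "ms = m0 +. L"
  have le: "m0 <=. ms" "L <=. ms" using nv_nonneg[of m0] nv_nonneg[of L] unfolding ms_def nv_simps nv_add by linarith+
  have msL: "qv lam / 2 < iv (v L ms)" using m0 iv_mono[of "v L m0" "v L ms"] v(4) le(1) by fastforce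
  \<comment> \<open>\<open>\<rho>\<close> is only Pi-1; bounded comprehension decides it on the
    codes below \<open>L\<close>, so that \<open>mu\<close> exists as a function of the
    model.\<close>
  define C where "C = (%t. ~ (t <. L & ~ \<rho> (pfst t) (psnd t)))"
  have C: "dec C" unfolding C_def by (intro dec_not bounded_comprehension \<rho>)
  define D where "D = (%j m. <<j, m>> <. L & C <<j, m>>)"
  have D: "dec (%q. D (pfst q) (psnd q))" unfolding D_def
   by (rule dec_conj[OF _ dec_subst[OF C]]) (intro decs)+
  have D_iff: "D j m \<longleftrightarrow> <<j, m>> <. L & \<rho> j m" for j m unfolding D_def C_def by auto
  \<comment> \<open>The least index known to be adequate for \<open>j\<close>, with
    \<open>ms\<close> as default. In either case passing from \<open>mu j\<close> to
    \<open>ms\<close> adds at most \<open>e j\<close> to the integral of \<open>v j\<close>.\<close>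
  define mu where "mu = (%j. lst (%m. D j m \<or> m = ms))"
  have dDj: "dec (%m. D j m \<or> m = ms)" for j
   using dec_subst[OF D recfn_pair[OF recfn_const[of j] recfn_ident]] by (intro dec_disj decs) simp
  have rmu: "recfn mu" unfolding mu_def by (intro recfn_lst decs D exI[of _ ms] disjI2 refl)
  have mu1: "D j (mu j) \<or> mu j = ms" and mu2: "D j k \<or> k = ms ==> mu j <=. k" for j k
   using lst_least[OF dDj[of j], of ms] unfolding mu_def by blast+
  have mule: "mu j <=. ms" for j by (rule mu2) simp
  let ?t = "%j. tsub (v j ms) (v j (mu j))"
  have rt: "recfn ?t" by (intro decs rv2 rmu)
  have t0: "0 <= ev x (?t j)" if "pt x" for x j using v(4)[OF that mule] that by simp
  \<comment> \<open>The sum compensates for the growth of each \<open>v j\<close> between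
    \<open>mu j\<close> and \<open>ms\<close>, and monotonicity lets \<open>L\<close> replace the
    smaller indices; so this single function lies below all conditions with code below
    \<open>L\<close>.\<close>
  let ?g = "tsub (tsub (v L ms) (tsum ?t L)) (w L)"
  have tsum0: "0 <= ev x (tsum ?t n)" if x: "pt x" for x n
  proof -
   have "ev x tzero <= ev x (tsum ?t n)"
   proof (rule ev_le_induct[OF x, of "%_. tzero" "tsum ?t"])
    show "recfn (%_. tzero)" "recfn (tsum ?t)" by (intro decs rv2 recfn_comp[OF rmu])+
    show "ev x tzero <= ev x (tsum ?t (n +. #1))" if "ev x tzero <= ev x (tsum ?t n)" for n
     using that t0[OF x, of n] x unfolding ev_tsum[OF rt x] by simp
   qed (simp add: x ev_tsum[OF rt x])
   then show ?thesis using x by simp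
  qed
  have tsum_ge: "ev x (?t j) <= ev x (tsum ?t n)" if x: "pt x" and j: "j <. n" for x j n
  proof -
   have "j <. n --> ev x (?t j) <= ev x (tsum ?t n)"
   proof (rule corenum_induct[of "%n. j <. n --> ev x (?t j) <= ev x (tsum ?t n)"])
    have "renum (%n. j <. n & ev x (tsum ?t n) < ev x (?t j))"
     by (intro renum_conj renum_ev_less x; (rule renum_dec)?; intro decs rv2 recfn_comp[OF rmu])
    then show "renum (%n. ~ (j <. n --> ev x (?t j) <= ev x (tsum ?t n)))" by (simp add: not_le)
    show "j <. n +. #1 --> ev x (?t j) <= ev x (tsum ?t (n +. #1))" if "j <. n --> ev x (?t j) <= ev x (tsum ?t n)" for n
    proof
     assume "j <. n +. #1"
     then consider "j <. n" | "j = n" unfolding lt_Suc by blast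
     then show "ev x (?t j) <= ev x (tsum ?t (n +. #1))"
     proof cases
      case 1
      then show ?thesis using that t0[OF x, of n] unfolding ev_tsum(2)[OF rt x] by linarith
     next
      case 2
      then show ?thesis using tsum0[OF x, of n] unfolding ev_tsum(2)[OF rt x] by simp
     qed
    qed
   qed simp
   then show ?thesis using j by blast
  qed
  have ivt: "iv (?t j) <= qv (e j)" for j
  proof (cases "mu j = ms")
   case True
   then show ?thesis using e[of j] l(2) by simp
  next
   case False
   then have "\<rho> j (mu j)" using mu1[of j] unfolding D_iff by blast
   then have "iv (v j ms) <= iv (v j (mu j)) + qv (e j)"
    using mule[of j] unfolding \<rho>_def iv_add iv_const[OF e(1)] by blast
   then show ?thesis by simp
  qed
  have "iv (tsum ?t n) <= iv (tsub (tconst (lam *\<^sub>Q qhalf (num 3))) (tconst (lam *\<^sub>Q qhalf (n +. num 3))))" for n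
  proof (rule iv_le_induct[of "tsum ?t" "%n. tsub (tconst (lam *\<^sub>Q qhalf (num 3))) (tconst (lam *\<^sub>Q qhalf (n +. num 3)))"])
   show "recfn (tsum ?t)" "recfn (%n. tsub (tconst (lam *\<^sub>Q qhalf (num 3))) (tconst (lam *\<^sub>Q qhalf (n +. num 3))))"
    by (intro decs rv2 recfn_comp[OF rmu])+
   show "iv (tsum ?t #0) <= iv (tsub (tconst (lam *\<^sub>Q qhalf (num 3))) (tconst (lam *\<^sub>Q qhalf (#0 +. num 3))))"
    unfolding zero_plus iv_sub iv_tsum[OF rt] by simp
   fix n assume IH: "iv (tsum ?t n) <= iv (tsub (tconst (lam *\<^sub>Q qhalf (num 3))) (tconst (lam *\<^sub>Q qhalf (n +. num 3))))"
   have p: "pw (n +. num 3) = 8 * pw n" "pw (n +. #1 +. num 3) = 16 * pw n" unfolding pw_add3 by simp_all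
   have "qv lam / (16 * pw n) + qv lam / (16 * pw n) = qv lam / (8 * pw n)" by (simp add: field_simps)
   then show "iv (tsum ?t (n +. #1)) <= iv (tsub (tconst (lam *\<^sub>Q qhalf (num 3))) (tconst (lam *\<^sub>Q qhalf (n +. #1 +. num 3))))"
    using IH ivt[of n] l(1) unfolding iv_tsum[OF rt] iv_sub e(2) by (simp add: iv_const p del: num.simps)
  qed
  then have ivs: "iv (tsum ?t L) <= iv (tsub (tconst (lam *\<^sub>Q qhalf (num 3))) (tconst (lam *\<^sub>Q qhalf (L +. num 3))))" .
  have p3: "pw (num 3) = 8" using pw_add3[of \<zero>] by (simp add: zero_plus del: num.simps)
  have "0 <= qv lam / pw (L +. num 3)" using l(2) by simp
  then have ivs: "iv (tsum ?t L) <= qv lam / 8" using ivs l(1) by (simp add: iv_const p3 del: num.simps)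
  show "EX g. (ALL x. pt x --> ev x g <= 1) & (ALL t. t <. L --> ?\<rho> t --> (ALL x. pt x --> ev x g <= ev x (?u t))) & 4 * qv q <= iv g"
  proof (intro exI[of _ ?g] conjI allI impI)
   fix x assume x: "pt x"
   show "ev x ?g <= 1" using v(3)[OF x, of L ms] tsum0[OF x, of L] w(2)[OF x, of L] x by simp
   fix t assume t: "t <. L" "?\<rho> t"
   obtain j m n where jm: "t = <<<<j, m>>, n>>" using t(2) unfolding is_pair_def by auto
   have lt: "<<j, m>> <. L" "n <. L" using le_lt_trans'[OF le_pair(1) t(1)[unfolded jm]] le_lt_trans'[OF le_pair(2) t(1)[unfolded jm]] .
   have jl: "j <. L" using le_lt_trans'[OF le_pair(1) lt(1)] .
   have "D j m" using t(2) lt(1) unfolding D_iff jm by simp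
   then have "mu j <=. m" by (intro mu2) blast
   then have "ev x (v j (mu j)) <= ev x (v j m)" by (rule v(4)[OF x])
   moreover have "ev x (v L ms) <= ev x (v j ms)" using v(5)[OF x] jl unfolding le_def by blast
   moreover have "ev x (v j ms) - ev x (v j (mu j)) <= ev x (tsum ?t L)" using tsum_ge[OF x jl] x by simp
   moreover have "ev x (w n) <= ev x (w L)" using w(3)[OF x] lt(2) unfolding le_def by blast
   ultimately show "ev x ?g <= ev x (?u t)" unfolding jm using x by simp
  next
   show "4 * qv q <= iv ?g" using msL ivs w(4)[of L] q(2) unfolding iv_sub by linarith
  qed
 qed (use q' in auto)
 then obtain x where x: "pt x" "!!t. ?\<rho> t ==> qv q <= ev x (?u t)" by blast
 have X: "qv q <= ev x (v j m) - ev x (w n)" if "\<rho> j m" for j m n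
  using x(2)[of "<<<<j, m>>, n>>"] that x(1) by simp
 have "EX m. 0 < ev x (v n m)" for n
 proof -
  obtain m where "\<rho> n m" using \<rho>_ex by blast
  then show ?thesis using X[of n m \<zero>] w(2)[OF x(1), of \<zero>] q'(2) by (intro exI[of _ m]) linarith
 qed
 moreover have "ev x (w n) <= 1 - qv q" for n
 proof -
  obtain m where "\<rho> #0 m" using \<rho>_ex by blast
  then show ?thesis using X[of \<zero> m n] v(3)[OF x(1), of \<zero> m] by linarith
 qed
 ultimately show ?thesis using x(1) q'(2) by (intro exI[of _ x] exI[of _ "1 - qv q"]) simp
qed

end

section \<open>Test functions approximating open sets and oscillation sets\<close>

context cspace
begin

lemma tmaxs_nonneg: assumes f: "recfn f" and x: "pt x" shows "0 <= ev x (tmaxs f n)"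
proof -
 have "ev x tzero <= ev x (tmaxs f n)"
 proof (rule ev_le_induct[OF x, of "%_. tzero" "tmaxs f"])
  show "recfn (%_. tzero)" "recfn (tmaxs f)" by (intro decs recfn_comp[OF f])+
 qed (auto simp: ev_tmaxs[OF f x] x)
 then show ?thesis using x by simp
qed

lemma tmaxs_mono:
 assumes f: "recfn f" and g: "recfn g" and x: "pt x" and fg: "!!k. k <. m ==> ev x (f k) <= ev x (g k)" and mn: "m <=. n"
 shows "ev x (tmaxs f m) <= ev x (tmaxs g n)"
proof (rule ev_tmaxs_attained[OF f x _ tmaxs_nonneg[OF g x]])
 fix k assume k: "k <. m"
 then show "ev x (f k) <= ev x (tmaxs g n)" using fg[OF k] ev_tmaxs_ge[OF g x lt_le_trans'[OF k mn]] by linarith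
qed

lemma tmaxs_pos:
 assumes f: "recfn f" and x: "pt x" and pos: "0 < ev x (tmaxs f n)" shows "EX k. k <. n & 0 < ev x (f k)"
proof (rule ccontr)
 assume *: "~ (EX k. k <. n & 0 < ev x (f k))"
 have "ev x (tmaxs f n) <= ev x tzero"
  by (rule ev_tmaxs_attained[OF f x]) (use * x in \<open>auto simp: not_less\<close>)
 then show False using pos x by simp
qed

lemma tmaxs_gt:
 assumes f: "recfn f" and x: "pt x" and e: "isQ e" "0 <= qv e" and pos: "qv e < ev x (tmaxs f n)"
 shows "EX k. k <. n & qv e < ev x (f k)"
proof (rule ccontr)
 assume *: "~ (EX k. k <. n & qv e < ev x (f k))"
 have "ev x (tmaxs f n) <= ev x (tconst e)"
  by (rule ev_tmaxs_attained[OF f x]) (use * x e in \<open>auto simp: not_less\<close>)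
 then show False using pos x e by simp
qed

lemma tsum_mono:
 assumes f: "recfn f" and g: "recfn g" and x: "pt x" and fg: "!!k. ev x (f k) <= ev x (g k)"
  and g0: "!!k. 0 <= ev x (g k)" and mn: "m <=. n"
 shows "ev x (tsum f m) <= ev x (tsum g n)"
proof -
 have r: "recfn (%i. tsum f i)" "recfn (%i. tsum g i)" by (intro decs recfn_comp[OF f] recfn_comp[OF g])+
 have 1: "ev x (tsum f m) <= ev x (tsum g m)"
  by (rule ev_le_induct[OF x, of "tsum f" "tsum g"]) (use fg in \<open>auto simp: ev_tsum[OF f x] ev_tsum[OF g x] r add_mono\<close>)
 obtain c where n: "n = m +. c" using mn le_imp_plus by blast
 have "ev x (tsum g m) <= ev x (tsum g (m +. c))"
 proof (rule ev_le_induct[OF x, of "%_. tsum g m" "%c. tsum g (m +. c)"])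
  show "recfn (%_. tsum g m)" "recfn (%c. tsum g (m +. c))" by (intro decs recfn_comp[OF g])+
  show "ev x (tsum g m) <= ev x (tsum g (m +. (c +. #1)))" if "ev x (tsum g m) <= ev x (tsum g (m +. c))" for c
   using that g0[of "m +. c"] ev_tsum(2)[OF g x, of "m +. c"] by (simp add: add_assoc'[symmetric])
 qed simp
 then show ?thesis using 1 n by simp
qed

lemma tsum_ge:
 assumes f: "recfn f" and x: "pt x" and f0: "!!k. 0 <= ev x (f k)" shows "0 <= ev x (tsum f n)" "k <. n ==> ev x (f k) <= ev x (tsum f n)"
proof -
 have nn: "0 <= ev x (tsum f n)" for n
  using tsum_mono[OF f f x order_refl f0, of \<zero> n] ev_tsum(1)[OF f x] by (simp add: nv_simps(3) nv_nonneg)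
 then show "0 <= ev x (tsum f n)" .
 assume "k <. n"
 then have "nv k + 1 <= nv n" unfolding nv_Suc_le .
 then have "k +. #1 <=. n" unfolding nv_simps(3) nv_add nv_1 .
 then have "ev x (tsum f (k +. #1)) <= ev x (tsum f n)" by (intro tsum_mono[OF f f x order_refl f0])
 then show "ev x (f k) <= ev x (tsum f n)" using nn[of k] unfolding ev_tsum(2)[OF f x] by linarith
qed

definition ball_code :: "'n set => 'n => bool" where
 "ball_code U t \<longleftrightarrow> t \<in> U & is_pair t & is_pair (psnd t) & pfst (psnd t) \<in> A & isQ (psnd (psnd t)) & qnat #0 <\<^sub>Q psnd (psnd t)"

definition gap :: "'n set => 'n => 'n" where
 "gap U t = (if ball_code U t then tsub (tconst (psnd (psnd t))) (tdist (pfst (psnd t))) else tzero)"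

text \<open>Increases with \<open>n\<close> to the indicator function of the open set coded by
  \<open>U\<close>.\<close>

definition bump :: "'n set => 'n => 'n" where
 "bump U n = tclamp (tmul (tconst (qnat n)) (tmaxs (gap U) n))"

lemma recfn_gap: "U \<in> cls M ==> recfn (gap U)"
 unfolding gap_def ball_code_def by (intro decs dec_mem A_cls; assumption)

lemma recfn_bump: assumes U: "U \<in> cls M" shows "recfn (bump U)"
 unfolding bump_def by (intro decs recfn_comp[OF recfn_gap[OF U]])

lemma mem_open_iff: assumes x: "pt x" shows "x \<in> open_set A d U \<longleftrightarrow> (EX t. 0 < ev x (gap U t))"
proof
 assume "x \<in> open_set A d U"
 then obtain n a r where *: "<<n, <<a, r>>>> \<in> U" "a \<in> A" "posQ r" "dist d (%_. a) x <\<^sub>R rconst r" unfolding open_set_def by blast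
 then have "dst (ideal a) x < qv r"
  using rlt_iff[OF is_real_dist[OF pt_ideal[OF *(2)] x]] by (simp add: dst_def is_real_const posQ_iff)
 then show "EX t. 0 < ev x (gap U t)" using *(1-3) x
  by (intro exI[of _ "<<n, <<a, r>>>>"]) (simp add: gap_def ball_code_def posQ_def ev_dist)
next
 assume "EX t. 0 < ev x (gap U t)"
 then obtain t where t: "0 < ev x (gap U t)" by blast
 have b: "ball_code U t" using t x by (auto simp: gap_def split: if_splits)
 then obtain n a r where e: "t = <<n, <<a, r>>>>" unfolding ball_code_def is_pair_def by auto
 have *: "<<n, <<a, r>>>> \<in> U" "a \<in> A" "posQ r" using b unfolding ball_code_def e posQ_def by simp_all
 have "dst (ideal a) x < qv r" using t b *(2,3) x by (simp add: gap_def e ev_dist posQ_iff)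
 then have "dist d (%_. a) x <\<^sub>R rconst r"
  using rlt_iff[OF is_real_dist[OF pt_ideal[OF *(2)] x]] *(3) by (simp add: dst_def is_real_const posQ_iff)
 then show "x \<in> open_set A d U" using x * unfolding open_set_def by blast
qed

lemma bump_unit: "pt x ==> 0 <= ev x (bump U n)" "pt x ==> ev x (bump U n) <= 1"
 by (simp_all add: bump_def)

lemma bump_mono:
 assumes U: "U \<in> cls M" and x: "pt x" and mn: "m <=. n" shows "ev x (bump U m) <= ev x (bump U n)"
proof -
 have "nv m * ev x (tmaxs (gap U) m) <= nv n * ev x (tmaxs (gap U) n)"
  using mn by (intro mult_mono tmaxs_mono recfn_gap U x tmaxs_nonneg) (simp_all add: nv_simps(3) nv_nonneg)
 then show ?thesis using x by (simp add: bump_def min_def max_def)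
qed

lemma bump_open: assumes U: "U \<in> cls M" and x: "pt x" and pos: "0 < ev x (bump U n)" shows "x \<in> open_set A d U"
proof -
 have "0 < nv n * ev x (tmaxs (gap U) n)" using pos x by (auto simp: bump_def min_def max_def split: if_splits)
 then have "0 < ev x (tmaxs (gap U) n)" using nv_nonneg[of n] by (auto simp: zero_less_mult_iff)
 then show ?thesis unfolding mem_open_iff[OF x] using tmaxs_pos[OF recfn_gap[OF U] x] by blast
qed

lemma bump_one: assumes U: "U \<in> cls M" and x: "pt x" "x \<in> open_set A d U" shows "EX n. 1 <= ev x (bump U n)"
proof -
 obtain t where t: "0 < ev x (gap U t)" using x(2) mem_open_iff[OF x(1)] by blast
 obtain N where N: "1 / ev x (gap U t) < nv N" using nv_arch by blast
 let ?n = "N +. (t +. #1)"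
 have "t <. ?n" using nv_nonneg[of N] unfolding nv_simps nv_add nv_1 by linarith
 then have "ev x (gap U t) <= ev x (tmaxs (gap U) ?n)" by (rule ev_tmaxs_ge[OF recfn_gap[OF U] x(1)])
 then have "nv N * ev x (gap U t) <= nv ?n * ev x (tmaxs (gap U) ?n)"
  using t by (intro mult_mono) (simp_all add: nv_nonneg add_nonneg_nonneg)
 moreover have "1 <= nv N * ev x (gap U t)" using N t by (simp add: divide_less_eq)
 ultimately have "1 <= nv ?n * ev x (tmaxs (gap U) ?n)" by linarith
 then have "1 <= ev x (bump U ?n)" using x(1) unfolding bump_def ev_clamp[OF x(1)] ev_mul[OF x(1)] by (simp del: nv_add)
 then show ?thesis by blast
qed

text \<open>A continuous substitute for the indicator of the set where two of the functions from
  index \<open>n\<close> on differ by more than \<open>e\<close>. Only pairs with code below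
  \<open>m\<close> are inspected; the value is 1 as soon as one of them exceeds \<open>e\<close> by
  \<open>1 / nv N\<close>.\<close>

definition osc :: "('n => 'n) => 'n => 'n => 'n => 'n => 'n" where
 "osc f e N n m = tclamp (tmul (tconst (qnat N)) (tsub
   (tmaxs (%t. if n <=. pfst t & n <=. psnd t then tabs (tsub (f (pfst t)) (f (psnd t))) else tzero) m) (tconst e)))"

lemma recfn_osc: assumes f: "recfn f" and "recfn a" "recfn b" shows "recfn (%p. osc f e N (a p) (b p))"
 unfolding osc_def by (intro decs recfn_comp[OF f] recfn_comp[OF assms(2)] assms)

lemma osc_unit: "pt x ==> 0 <= ev x (osc f e N n m)" "pt x ==> ev x (osc f e N n m) <= 1"
 by (simp_all add: osc_def)

lemma osc_mono:
 assumes f: "recfn f" and x: "pt x" and "n' <=. n" "m <=. m'" and e: "isQ e"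
 shows "ev x (osc f e N n m) <= ev x (osc f e N n' m')"
proof -
 let ?t = "%n t. if n <=. pfst t & n <=. psnd t then tabs (tsub (f (pfst t)) (f (psnd t))) else tzero"
 have "ev x (tmaxs (?t n) m) <= ev x (tmaxs (?t n') m')"
  using le_trans'[OF assms(3)] assms(4) x by (intro tmaxs_mono decs recfn_comp[OF f] x) auto
 then have "nv N * (ev x (tmaxs (?t n) m) - qv e) <= nv N * (ev x (tmaxs (?t n') m') - qv e)"
  by (intro mult_left_mono nv_nonneg) simp
 then show ?thesis using x e by (simp add: osc_def min_def max_def)
qed

lemma osc_pos:
 assumes f: "recfn f" and x: "pt x" and e: "isQ e" "0 <= qv e" and pos: "0 < ev x (osc f e N n m)"
 shows "EX a b. n <=. a & n <=. b & qv e < \<bar>ev x (f a) - ev x (f b)\<bar>"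
proof -
 let ?t = "%t. if n <=. pfst t & n <=. psnd t then tabs (tsub (f (pfst t)) (f (psnd t))) else tzero"
 have "0 < nv N * (ev x (tmaxs ?t m) - qv e)" using pos x e by (auto simp: osc_def min_def max_def split: if_splits)
 then have "qv e < ev x (tmaxs ?t m)" using nv_nonneg[of N] by (auto simp: zero_less_mult_iff)
 have r: "recfn ?t" by (intro decs recfn_comp[OF f])
 obtain t where "qv e < ev x (?t t)" using tmaxs_gt[OF r x e \<open>qv e < ev x (tmaxs ?t m)\<close>] by blast
 then show ?thesis using x e by (auto split: if_splits)
qed

lemma osc_one:
 assumes f: "recfn f" and x: "pt x" and e: "isQ e" and ab: "n <=. a" "n <=. b" "<<a, b>> <. m"
  and N: "1 <= nv N * (\<bar>ev x (f a) - ev x (f b)\<bar> - qv e)"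
 shows "1 <= ev x (osc f e N n m)"
proof -
 let ?t = "%t. if n <=. pfst t & n <=. psnd t then tabs (tsub (f (pfst t)) (f (psnd t))) else tzero"
 have r: "recfn ?t" by (intro decs recfn_comp[OF f])
 have "\<bar>ev x (f a) - ev x (f b)\<bar> <= ev x (tmaxs ?t m)" using ev_tmaxs_ge[OF r x ab(3)] ab x by simp
 then have "nv N * (\<bar>ev x (f a) - ev x (f b)\<bar> - qv e) <= nv N * (ev x (tmaxs ?t m) - qv e)"
  by (intro mult_left_mono nv_nonneg) simp
 then show ?thesis using N x e by (simp add: osc_def)
qed

end

section \<open>Almost uniform convergence\<close>

context mspace
begin

lemma bump_measure:
 assumes U: "U \<in> cls M" and e: "isQ e" and "measure_less A d I (open_set A d U) e"
 shows "iv (bump U n) <= qv e"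
proof -
 obtain q where q: "qv q < qv e" "!!h. (ALL x. pt x --> 0 <= ev x h & ev x h <= 1) ==>
   (ALL x. pt x & x \<notin> open_set A d U --> ev x h = 0) ==> iv h <= qv q"
  using assms(3) unfolding measure_less_iff[OF e] by blast
 have "iv (bump U n) <= qv q"
 proof (rule q(2); intro allI impI)
  fix x assume "pt x & x \<notin> open_set A d U"
  then show "ev x (bump U n) = 0" using bump_open[OF U, of x n] bump_unit(1)[of x U n] by fastforce
 qed (simp add: bump_unit)
 then show ?thesis using q(1) by simp
qed

lemma section_cls: assumes "G \<in> cls M" shows "section_at G i \<in> cls M"
proof -
 have "dec (%m. <<m, i>> \<in> G)" by (intro dec_mem[OF assms] decs)
 then show ?thesis by (simp add: dec_def section_at_def)
qed

lemma rcauchy_tval: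
 "pt x ==> rcauchy (%n. tval A d x (f n)) \<longleftrightarrow> (\<forall>e>0. EX N. ALL m n. N <=. m & N <=. n --> \<bar>ev x (f m) - ev x (f n)\<bar> < e)"
 using rcauchy_iff[of "%n. tval A d x (f n)"] is_real_tval[of x] by (simp add: ev_def)

lemma osc_set_iff:
 assumes x: "pt x" and e: "isQ e"
 shows "rconst e <\<^sub>R rdiff (tval A d x (f m)) (tval A d x (f m')) \<longleftrightarrow> qv e < \<bar>ev x (f m) - ev x (f m')\<bar>"
 using rlt_iff[OF is_real_const[OF e] is_real_diff(1)[OF is_real_tval[OF x] is_real_tval[OF x]]]
  is_real_diff(2)[OF is_real_tval[OF x] is_real_tval[OF x]] e by (simp add: ev_def)

text \<open>If no \<open>n\<close> works, the oscillation functions from each \<open>n\<close> on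
  reach integrals above \<open>lam / 2\<close>, while a cover of the null set has measure at most
  \<open>lam / 4\<close>. \<open>limsup_point\<close> yields a point outside the cover at which the
  sequence oscillates beyond every index.\<close>

theorem two_WWKL_imp_almost_uniform:
 assumes W: two_WWKL and f: "recfn f" and ae: "almost_every A d I (%x. rcauchy (%n. tval A d x (f n)))"
 shows "almost_uniformly_cauchy A d I f"
proof (rule ccontr)
 let ?S = "%e n. {x. pt x & (EX m m'. n <=. m & n <=. m' & rconst e <\<^sub>R rdiff (tval A d x (f m)) (tval A d x (f m')))}"
 assume "~ almost_uniformly_cauchy A d I f"
 then obtain lam eps where le: "posQ lam" "posQ eps" and nm: "!!n. ~ measure_less A d I (?S eps n) lam"
  unfolding almost_uniformly_cauchy_def by blast
 have l: "isQ lam" "0 < qv lam" and ep: "isQ eps" "0 < qv eps" using le by (simp_all add: posQ_iff)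
 have p1: "pw #1 = 2" using pw_Suc[of \<zero>] by (simp add: zero_plus)
 \<comment> \<open>Half of \<open>eps\<close>, combined with \<open>2 <= nv N * qv eps\<close>:
   where the sequence oscillates by more than \<open>eps\<close>, some \<open>osc f e N n m\<close>
   reaches 1, as \<open>open_measure\<close> requires.\<close>
 define e where "e = eps *\<^sub>Q qhalf #1"
 have e: "isQ e" "qv e = qv eps / 2" using ep by (simp_all add: e_def p1)
 obtain N where N: "2 / qv eps < nv N" using nv_arch by blast
 then have N: "2 <= nv N * qv eps" using ep by (simp add: divide_less_eq)
 obtain G i where G: "G \<in> cls M" "measure_less A d I (open_set A d (section_at G i)) (lam *\<^sub>Q qhalf (#1 +. #1))"
  and C: "!!x. pt x ==> x \<notin> open_set A d (section_at G i) ==> rcauchy (%n. tval A d x (f n))"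
 proof -
  have "posQ (lam *\<^sub>Q qhalf (#1 +. #1))" using l by (simp add: posQ_iff)
  then show thesis using ae that unfolding almost_every_def by blast
 qed
 let ?U = "section_at G i"
 have U: "?U \<in> cls M" by (rule section_cls[OF G(1)])
 let ?v = "osc f e N"
 have "EX x r. pt x & r < 1 & (ALL n. EX m. 0 < ev x (?v n m)) & (ALL n. ev x (bump ?U n) <= r)"
 proof (rule limsup_point[OF W, of ?v "bump ?U" lam])
  show "recfn (%p. ?v (pfst p) (psnd p))" by (intro recfn_osc f decs)
  show "recfn (bump ?U)" by (rule recfn_bump[OF U])
  show "iv (bump ?U n) <= qv lam / 4" for n
   using bump_measure[OF U _ G(2), of n] l by (simp add: p1)
  show "EX m. qv lam / 2 < iv (?v n m)" for n
  proof (rule ccontr)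
   \<comment> \<open>Otherwise \<open>open_measure\<close> would bound by \<open>lam / 2\<close> the
     integral of every admissible test function vanishing outside the oscillation set, against the
     choice of \<open>lam\<close>.\<close>
   assume "~ (EX m. qv lam / 2 < iv (?v n m))"
   then have small: "iv (?v n m) <= qv lam / 2" for m by (simp add: not_less)
   have "measure_less A d I (?S eps n) lam"
    unfolding measure_less_iff[OF l(1)]
   proof (intro exI[of _ "lam *\<^sub>Q qhalf #1"] conjI allI impI)
    fix h assume h: "(ALL x. pt x --> 0 <= ev x h & ev x h <= 1) & (ALL x. pt x & x \<notin> ?S eps n --> ev x h = 0)"
    have "iv h <= qv lam / 2"
    proof (rule open_measure[OF W, of "?v n"])
     show "recfn (?v n)" by (intro recfn_osc f decs)
     fix x assume x: "pt x" "0 < ev x h"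
     then have "x \<in> ?S eps n" using h by force
     then obtain a b where ab: "n <=. a" "n <=. b" and "rconst eps <\<^sub>R rdiff (tval A d x (f a)) (tval A d x (f b))"
      unfolding mem_Collect_eq by (elim conjE exE)
     from this(3) have ab3: "qv eps < \<bar>ev x (f a) - ev x (f b)\<bar>" unfolding osc_set_iff[OF x(1) ep(1)] .
     have "nv N * (qv eps / 2) <= nv N * (\<bar>ev x (f a) - ev x (f b)\<bar> - qv e)"
      using ab3 e by (intro mult_left_mono nv_nonneg) simp
     then have "1 <= nv N * (\<bar>ev x (f a) - ev x (f b)\<bar> - qv e)" using N by simp
     then have "1 <= ev x (?v n (<<a, b>> +. #1))"
      by (intro osc_one[OF f x(1) e(1) ab(1,2)]) (simp_all add: lt_Suc)
     then show "EX m. 1 <= ev x (?v n m)" by blast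
    qed (use osc_unit osc_mono[OF f] e small h in auto)
    then show "iv h <= qv (lam *\<^sub>Q qhalf #1)" using l by (simp add: p1)
   qed (use l in \<open>simp_all add: p1\<close>)
   then show False using nm by blast
  qed
 qed (use osc_unit osc_mono[OF f] e bump_unit bump_mono[OF U] le in auto)
 then obtain x r where x: "pt x" "r < 1" "!!n. EX m. 0 < ev x (?v n m)" "!!n. ev x (bump ?U n) <= r" by blast
 have "x \<notin> open_set A d ?U"
 proof
  assume "x \<in> open_set A d ?U"
  from bump_one[OF U x(1) this] obtain n where "1 <= ev x (bump ?U n)" by blast
  then show False using x(2) x(4)[of n] by linarith
 qed
 then obtain n where n: "!!a b. n <=. a ==> n <=. b ==> \<bar>ev x (f a) - ev x (f b)\<bar> < qv e"
  using C[OF x(1)] ep e(2) unfolding rcauchy_tval[OF x(1)] by (metis half_gt_zero)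
 obtain m where "0 < ev x (?v n m)" using x(3) by blast
 then obtain a b where "n <=. a" "n <=. b" "qv e < \<bar>ev x (f a) - ev x (f b)\<bar>"
  using osc_pos[OF f x(1) e(1)] e(2) ep by force
 then show False using n[of a b] by linarith
qed

end

section \<open>Dominated convergence\<close>

context mspace
begin

lemma l1_name_iff: "l1_name I h \<longleftrightarrow> recfn h & (ALL k j. k <=. j --> iv (tabs (tsub (h k) (h j))) < 1 / pw k)"
 unfolding l1_name_def iv_def using rlt_iff[OF I_real is_real_const] by simp

lemma l1_integral:
 assumes "l1_name I h" shows "is_real (l1_integral I h)" "\<bar>rv (l1_integral I h) - iv (h k)\<bar> <= 1 / pw k"
proof -
 have h: "recfn h" "!!k j. k <=. j ==> iv (tabs (tsub (h k) (h j))) < 1 / pw k" using assms by (auto simp: l1_name_iff)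
 have diff: "\<bar>iv (h k) - iv (h j)\<bar> <= 1 / pw k" if "k <=. j" for k j
 proof -
  have "iv (h k) - iv (h j) <= iv (tabs (tsub (h k) (h j)))" unfolding iv_sub[symmetric] by (rule iv_mono) simp
  moreover have "iv (h j) - iv (h k) <= iv (tabs (tsub (h k) (h j)))" unfolding iv_sub[symmetric] by (rule iv_mono) simp
  ultimately show ?thesis using h(2)[OF that] by linarith
 qed
 let ?q = "l1_integral I h"
 have p2: "pw (k +. num 2) = 4 * pw k" for k
  using pw_Suc[of "k +. #1"] by (simp add: num_two add_assoc'[symmetric] del: num.simps)
 have Q: "isQ (?q k)" for k unfolding l1_integral_def using is_realD(2)[OF I_real] .
 have q: "\<bar>qv (?q k) - iv (h (k +. num 2))\<bar> <= 1 / 4 * (1 / pw k)" for k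
  using is_realD(3)[OF I_real, of "h (k +. num 2)" "k +. num 2"] unfolding l1_integral_def iv_def p2 by simp
 show real: "is_real ?q"
  unfolding is_real_iff
 proof (intro conjI allI impI Q)
  show "recfn ?q" unfolding l1_integral_def by (intro recfn_Fn2[OF I_Fn2] decs recfn_comp[OF h(1)])
  fix k j assume kj: "k <=. j"
  then have "\<bar>iv (h (k +. num 2)) - iv (h (j +. num 2))\<bar> <= 1 / 4 * (1 / pw k)"
   using diff[of "k +. num 2" "j +. num 2"] unfolding p2 by (simp add: nv_simps(3))
  moreover have "1 / pw j <= 1 / pw k" using pw_mono[OF kj] by (simp add: divide_simps)
  moreover have "0 < 1 / pw k" by simp
  ultimately show "\<bar>qv (?q k) - qv (?q j)\<bar> <= 1 / pw k" using q[of k] q[of j] by linarith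
 qed
 have "\<bar>rv ?q - iv (h k)\<bar> <= 1 / pw k + 2 / pw i" for i
 proof -
  let ?j = "k +. i"
  have "k <=. ?j +. num 2" "i <=. ?j" using nv_nonneg[of i] nv_nonneg[of k] unfolding nv_simps nv_add nv_num of_nat_numeral by linarith+
  then have "\<bar>iv (h k) - iv (h (?j +. num 2))\<bar> <= 1 / pw k" "1 / pw ?j <= 1 / pw i"
   using diff pw_mono by (simp_all add: divide_simps)
  moreover have "\<bar>qv (?q ?j) - rv ?q\<bar> <= 1 / pw ?j" by (rule is_realD(3)[OF real])
  moreover have "0 < 1 / pw i" "2 / pw i = 2 * (1 / pw i)" by simp_all
  ultimately show ?thesis using q[of ?j] by linarith
 qed
 then show "\<bar>rv ?q - iv (h k)\<bar> <= 1 / pw k" by (rule le_if_pw)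
qed

lemma l1_dominated_iff:
 "l1_dominated I f g \<longleftrightarrow> (\<forall>e>0. EX N. ALL k. N <=. k --> iv (tmax (tsub (tabs (f k)) (g k)) tzero) < e)"
proof -
 have n: "0 <= rv (I (tmax (tsub (tabs (f k)) (g k)) tzero))" for k
  using iv_nonneg[of "tmax (tsub (tabs (f k)) (g k)) tzero"] unfolding iv_def by simp
 have "rlim (%k. I (tmax (tsub (tabs (f k)) (g k)) tzero)) (rconst (qnat #0)) \<longleftrightarrow>
  (\<forall>e>0. EX N. ALL k. N <=. k --> \<bar>rv (I (tmax (tsub (tabs (f k)) (g k)) tzero)) - rv (rconst (qnat #0))\<bar> < e)"
  by (rule rlim_iff[OF I_real is_real_const]) simp
 then show ?thesis unfolding l1_dominated_def iv_def by (simp add: abs_of_nonneg[OF n])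
qed

lemma geometric_sum:
 assumes t: "recfn t" and c: "isQ c" and le: "!!i. iv (t i) <= qv c / pw (j +. i)" and c0: "0 <= qv c"
 shows "iv (tsum t n) <= 2 * qv c / pw j"
proof -
 let ?g = "%n. tconst ((c +\<^sub>Q c) *\<^sub>Q (qhalf j +\<^sub>Q quminus (qhalf (j +. n))))"
 have g: "iv (?g n) = 2 * qv c * (1 / pw j - 1 / pw (j +. n))" for n
  using c by (simp add: iv_const)
 have "iv (tsum t n) <= iv (?g n)"
 proof (rule iv_le_induct[of "tsum t" ?g])
  show "recfn (tsum t)" "recfn ?g" by (intro decs recfn_comp[OF t])+
  show "iv (tsum t #0) <= iv (?g #0)" unfolding g iv_tsum[OF t] by simp
  fix n assume IH: "iv (tsum t n) <= iv (?g n)"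
  have "qv c / pw (j +. n) = 2 * qv c * (1 / pw (j +. n) - 1 / pw (j +. (n +. #1)))"
   by (simp add: add_assoc'[symmetric] field_simps)
  then show "iv (tsum t (n +. #1)) <= iv (?g (n +. #1))"
   using IH le[of n] unfolding g iv_tsum[OF t] by (simp add: algebra_simps)
 qed
 also have "\<dots> <= 2 * qv c * (1 / pw j)"
  unfolding g using c0 by (intro mult_left_mono) simp_all
 finally show ?thesis by simp
qed

text \<open>Each \<open>f n\<close> is replaced by a test function \<open>f' n\<close> from its
  name. If the integrals are not Cauchy, two late \<open>f'\<close> differ by \<open>30 eps\<close>
  in mean; as their parts above \<open>B\<close> are negligible, an oscillation function has
  integral at least \<open>11 lam\<close>. The point from \<open>limsup_point\<close> avoids the
  null set, and smallness of \<open>S\<close> there keeps the values of \<open>f n\<close> near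
  those of \<open>f' n\<close>.\<close>

theorem two_WWKL_imp_dct:
 assumes W: two_WWKL and g: "l1_name I g" and f: "f \<in> Fn2" "!!n. l1_name I (f n)" and dom: "!!n. l1_dominated I (f n) g"
  and ae: "almost_every A d I (l1_cauchy_at A d f)"
 shows "rcauchy (%n. l1_integral I (f n))"
proof (rule ccontr)
 let ?F = "%n. rv (l1_integral I (f n))"
 assume "~ rcauchy (%n. l1_integral I (f n))"
 then obtain e0 where e0: "0 < e0" "!!N. EX m n. N <=. m & N <=. n & e0 <= \<bar>?F m - ?F n\<bar>"
  unfolding rcauchy_iff[OF l1_integral(1)[OF f(2)]] by (meson not_less)
 obtain eps where eps: "posQ eps" "qv eps < e0 / 32" using posQ_below[of "e0 / 32"] e0(1) by auto
 then have ep: "isQ eps" "0 < qv eps" by (simp_all add: posQ_iff)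
 let ?E = "qv eps"
 have rf: "recfn (%p. f (a p) (b p))" if "recfn a" "recfn b" for a b by (rule recfn_Fn2[OF f(1) that])
 have fL: "iv (tabs (tsub (f n k) (f n j))) < 1 / pw k" if "k <=. j" for n k j using f(2)[of n] that unfolding l1_name_iff by blast
 have gL: "iv (tabs (tsub (g k) (g j))) < 1 / pw k" if "k <=. j" for k j using g that unfolding l1_name_iff by blast
 obtain K where K: "1 / pw K < ?E" using rl_arch_pw[OF ep(2)] by blast
 \<comment> \<open>Bounds \<open>g K\<close>, which is close to the dominating function in mean. By
   \<open>tail\<close> the excess of any \<open>f' n\<close> over \<open>B\<close> then has integral
   at most \<open>3 eps\<close>.\<close>
 define B where "B = lip (g K) +. #1"
 have B: "1 <= nv B" "\<bar>ev x (g K)\<bar> <= nv B" if "pt x" for x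
  using nv_nonneg[of "lip (g K)"] ev_bound[OF that, of "g K"] unfolding B_def nv_add nv_1 by linarith+
 obtain a0 where "a0 \<in> A" using A_ne by blast
 then have B1: "1 <= nv B" using B(1)[OF pt_ideal] by blast
 then have Bnz: "B ~= #0" by auto
 obtain N where "1 / ?E < nv N" using nv_arch by blast
 then have N: "1 <= nv N * ?E" using ep by (simp add: divide_less_eq)
 \<comment> \<open>With \<open>4 <= nv C * qv eps\<close>, a point where \<open>C\<close> times
   \<open>S\<close> stays below 1 has \<open>S\<close> at most \<open>eps / 4\<close>.\<close>
 define C where "C = num 4 *. N"
 have C: "4 <= nv C * ?E" "0 < nv C" using N unfolding C_def by (simp_all del: num.simps) (auto simp: zero_less_mult_iff nv_nonneg less_le)
 define lam where "lam = eps *\<^sub>Q rat #1 #0 B"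
 have lam: "isQ lam" "qv lam = ?E / nv B" using ep Bnz by (simp_all add: lam_def isQ_rat)
 have lam0: "0 < qv lam" using ep B1 unfolding lam(2) by (intro divide_pos_pos) linarith+
 obtain k0 where k0': "1 / pw k0 < min ?E (qv lam / (32 * nv C))"
  using rl_arch_pw[of "min ?E (qv lam / (32 * nv C))"] ep lam0 C(2) by auto
 then have k0: "1 / pw k0 < ?E" "1 / pw k0 < qv lam / (32 * nv C)" by simp_all
 have k0C: "nv C * (4 / pw k0) <= qv lam / 8" using k0(2) C(2) by (simp add: field_simps)
 define f' where "f' = (%n. f n (k0 +. n))"
 have rf': "recfn f'" unfolding f'_def by (intro rf decs)
 have le: "a <=. a +. b" "b <=. a +. b" for a b using nv_nonneg[of a] nv_nonneg[of b] unfolding nv_simps nv_add by linarith+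
 have pk: "1 / pw (k0 +. n) <= 1 / pw k0" for n using pw_mono[OF le(1)[of k0 n]] by (simp add: divide_simps)
 have F': "\<bar>?F n - iv (f' n)\<bar> <= ?E" for n
  using l1_integral(2)[OF f(2), of n "k0 +. n"] pk[of n] k0(1) unfolding f'_def by linarith
 have tail: "iv (tmax (tsub (tabs (f' n)) (tconst (qnat B))) tzero) <= 3 * ?E" for n
 proof -
  obtain k1 where k1: "!!k. k1 <=. k ==> iv (tmax (tsub (tabs (f n k)) (g k)) tzero) < ?E"
   using dom[of n] ep(2) unfolding l1_dominated_iff by blast
  let ?k = "k1 +. (K +. (k0 +. n))"
  have k: "k1 <=. ?k" "K <=. ?k" "k0 +. n <=. ?k" using le le_trans' by blast+
  let ?h = "tadd (tmax (tsub (tabs (f n ?k)) (g ?k)) tzero) (tadd (tabs (tsub (f n (k0 +. n)) (f n ?k))) (tabs (tsub (g K) (g ?k))))"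
  have ar: "\<bar>c\<bar> <= b ==> max (\<bar>a\<bar> - b) 0 <= max (\<bar>a'\<bar> - e) 0 + (\<bar>a - a'\<bar> + \<bar>c - e\<bar>)" for a a' b c e :: "'n rl"
   by linarith
  have "iv (tmax (tsub (tabs (f' n)) (tconst (qnat B))) tzero) <= iv ?h"
  proof (rule iv_mono)
   fix x assume x: "pt x"
   show "ev x (tmax (tsub (tabs (f' n)) (tconst (qnat B))) tzero) <= ev x ?h"
    using ar[OF B(2)[OF x]] x unfolding f'_def by simp
  qed
  then show ?thesis using k1[OF k(1)] fL[OF k(3), of n] gL[OF k(2)] pk[of n] k0(1) K unfolding iv_add by linarith
 qed
 obtain G i where G: "G \<in> cls M" "measure_less A d I (open_set A d (section_at G i)) (lam *\<^sub>Q qhalf (num 3))"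
  and Ch: "!!x. pt x ==> x \<notin> open_set A d (section_at G i) ==> l1_cauchy_at A d f x"
 proof -
  have "posQ (lam *\<^sub>Q qhalf (num 3))" using lam(1) lam0 by (simp add: posQ_iff del: num.simps)
  then show thesis using ae that unfolding almost_every_def by blast
 qed
 let ?U = "section_at G i"
 have U: "?U \<in> cls M" by (rule section_cls[OF G(1)])
 define st where "st = (%n i. tabs (tsub (f n (k0 +. n +. i)) (f n (k0 +. n +. i +. #1))))"
 have rst: "recfn (%p. st (a p) (b p))" if "recfn a" "recfn b" for a b unfolding st_def by (intro decs rf that)
 have st0: "0 <= ev x (st n i)" if "pt x" for x n i using that by (simp add: st_def)
 \<comment> \<open>Collects the increments of all names from the terms \<open>f' n\<close> on. Two
   geometric sums bound its integral by \<open>4 / pw k0\<close>, while its value at a point bounds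
   there how far each name moves away from \<open>f' n\<close>.\<close>
 define S where "S = (%m. tsum (%n. tsum (st n) m) m)"
 have rS: "recfn S" unfolding S_def by (intro decs rst)
 have rin: "recfn (%n. tsum (st n) m)" "recfn (st n)" for m n by (intro decs rst)+
 have in0: "0 <= ev x (tsum (st n) m)" if "pt x" for x n m by (rule tsum_ge(1)[OF rin(2) that st0[OF that]])
 have S0: "0 <= ev x (S m)" if "pt x" for x m unfolding S_def by (rule tsum_ge(1)[OF rin(1) that in0[OF that]])
 have Smono: "ev x (S m) <= ev x (S n)" if x: "pt x" and mn: "m <=. n" for x m n
  unfolding S_def by (intro tsum_mono rin x mn order_refl st0 in0)
 have Sge: "ev x (tsum (st n) m) <= ev x (S m)" if x: "pt x" and nm: "n <. m" for x n m
  unfolding S_def by (rule tsum_ge(2)[OF rin(1) x in0[OF x] nm])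
 have Si: "iv (S m) <= 4 / pw k0" for m
 proof -
  have 1: "iv (st n i) <= qv (qnat #1) / pw (k0 +. n +. i)" for n i
   using fL[of "k0 +. n +. i" "k0 +. n +. i +. #1" n] le(1) unfolding st_def by (simp add: less_imp_le)
  have "iv (tsum (st n) m) <= qv (qnat (num 2)) / pw (k0 +. n)" for n
   by (rule order_trans[OF geometric_sum[OF rin(2) _ 1]]) (simp_all del: num.simps)
  from geometric_sum[OF rin(1) _ this] show ?thesis unfolding S_def by (rule order_trans) (simp_all del: num.simps)
 qed
 define w where "w = (%m. tadd (bump ?U m) (tmul (tconst (qnat C)) (S m)))"
 let ?v = "osc f' eps N"
 have "EX x r. pt x & r < 1 & (ALL n. EX m. 0 < ev x (?v n m)) & (ALL n. ev x (w n) <= r)"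
 proof (rule limsup_point[OF W, of ?v w lam])
  show "recfn (%p. ?v (pfst p) (psnd p))" by (intro recfn_osc rf' decs)
  show "recfn w" unfolding w_def by (intro decs recfn_bump[OF U] rS)
  show "0 <= ev x (w n)" if "pt x" for x n
   using that bump_unit(1)[OF that, of ?U n] S0[OF that, of n] by (simp add: w_def nv_nonneg)
  show "ev x (w m) <= ev x (w n)" if "pt x" "m <=. n" for m n x
   using that bump_mono[OF U that] Smono[OF that] by (simp add: w_def add_mono mult_left_mono nv_nonneg)
  show "iv (w n) <= qv lam / 4" for n
  proof -
   have p3: "pw (num 3) = 8" using pw_add3[of \<zero>] by (simp add: zero_plus del: num.simps)
   have "iv (bump ?U n) <= qv (lam *\<^sub>Q qhalf (num 3))" by (rule bump_measure[OF U _ G(2)]) (use lam in simp)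
   then have "iv (bump ?U n) <= qv lam / 8" using lam by (simp add: p3 del: num.simps)
   moreover have "nv C * iv (S n) <= nv C * (4 / pw k0)" by (intro mult_left_mono Si nv_nonneg)
   ultimately show ?thesis using k0C unfolding w_def iv_add by (simp add: iv_scale)
  qed
  show "EX m. qv lam / 2 < iv (?v n m)" for n
  proof -
   obtain a b where ab: "n <=. a" "n <=. b" "e0 <= \<bar>?F a - ?F b\<bar>" using e0(2) by blast
   let ?m = "<<a, b>> +. #1" and ?D = "tabs (tsub (f' a) (f' b))"
   let ?p = "%n. tmax (tsub (tabs (f' n)) (tconst (qnat B))) tzero"
   let ?h = "tadd (tadd (tconst (eps +\<^sub>Q eps)) (tmul (tconst (qnat (num 2 *. B))) (?v n ?m))) (tadd (?p a) (?p b))"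
   have d1: "iv (f' a) - iv (f' b) <= iv ?D" unfolding iv_sub[symmetric] by (rule iv_mono) simp
   have d2: "iv (f' b) - iv (f' a) <= iv ?D" unfolding iv_sub[symmetric] by (rule iv_mono) simp
   have "30 * ?E <= iv ?D" using d1 d2 ab(3) F'[of a] F'[of b] eps(2) by linarith
   also have "iv ?D <= iv ?h"
   proof (rule iv_mono)
    fix x assume x: "pt x"
    have v0: "0 <= ev x (?v n ?m)" using osc_unit(1)[OF x] .
    have Bv: "0 <= nv B * ev x (?v n ?m)" using v0 nv_nonneg[of B] by simp
    show "ev x ?D <= ev x ?h"
    proof (cases "\<bar>ev x (f' a) - ev x (f' b)\<bar> < 2 * ?E")
     case True
     then show ?thesis using x ep Bv by (simp del: num.simps)
    next
     case False
     then have "nv N * ?E <= nv N * (\<bar>ev x (f' a) - ev x (f' b)\<bar> - ?E)" by (intro mult_left_mono nv_nonneg) simp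
     then have "1 <= ev x (?v n ?m)"
      using N by (intro osc_one[OF rf' x ep(1) ab(1,2)]) (simp_all add: lt_Suc)
     then have "nv B * 1 <= nv B * ev x (?v n ?m)" by (intro mult_left_mono nv_nonneg)
     moreover have "b <= v ==> 0 <= e ==> \<bar>a - a'\<bar> <= e + 2 * v + (max (\<bar>a\<bar> - b) 0 + max (\<bar>a'\<bar> - b) 0)" for a a' b v e :: "'n rl"
      by linarith
     from this[of "nv B" "nv B * ev x (?v n ?m)" "?E + ?E" "ev x (f' a)" "ev x (f' b)"]
     show ?thesis using calculation x ep by (simp add: mult.assoc del: num.simps)
    qed
   qed
   also have "iv ?h = 2 * ?E + 2 * nv B * iv (?v n ?m) + (iv (?p a) + iv (?p b))"
    using ep by (simp add: iv_const iv_scale del: num.simps)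
   also have "\<dots> <= 8 * ?E + 2 * nv B * iv (?v n ?m)" using tail[of a] tail[of b] by linarith
   finally have "11 * ?E <= nv B * iv (?v n ?m)" by linarith
   then have "11 * ?E / nv B <= iv (?v n ?m)" using B1 by (simp add: divide_le_eq mult.commute)
   moreover have "11 * ?E / nv B = 11 * qv lam" by (simp add: lam(2))
   ultimately have "qv lam / 2 < iv (?v n ?m)" using lam0 by linarith
   then show ?thesis by blast
  qed
 qed (use osc_unit osc_mono[OF rf'] ep lam lam0 in \<open>auto simp: posQ_iff\<close>)
 then obtain x r where x: "pt x" "r < 1" "!!n. EX m. 0 < ev x (?v n m)" "!!n. ev x (w n) <= r" by blast
 have w: "ev x (bump ?U n) + nv C * ev x (S n) < 1" for n using x(2) x(4)[of n] x(1) by (simp add: w_def)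
 have CS: "0 <= nv C * ev x (S n)" for n using S0[OF x(1)] nv_nonneg[of C] by simp
 have "x \<notin> open_set A d ?U"
 proof
  assume "x \<in> open_set A d ?U"
  from bump_one[OF U x(1) this] obtain n where "1 <= ev x (bump ?U n)" by blast
  then show False using w[of n] CS[of n] by linarith
 qed
 from Ch[OF x(1) this] have Cx: "l1_cauchy_at A d f x" .
 have Sx: "ev x (S m) <= ?E / 4" for m
 proof -
  have "nv C * ev x (S m) <= nv C * (?E / 4)" using w[of m] bump_unit(1)[OF x(1), of ?U m] C(1) by linarith
  then show ?thesis using C(2) by simp
 qed
 have near: "\<bar>ev x (f n (k0 +. n +. i)) - ev x (f' n)\<bar> <= ?E / 4" for n i
 proof -
  let ?T = "%i. tabs (tsub (f n (k0 +. n +. i)) (f' n))"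
  have "ev x (?T i) <= ev x (tsum (st n) i)"
  proof (rule ev_le_induct[OF x(1), of ?T "tsum (st n)"])
   show "recfn ?T" "recfn (tsum (st n))" unfolding f'_def by (intro decs rf rst)+
   show "ev x (?T #0) <= ev x (tsum (st n) #0)" unfolding ev_tsum[OF rin(2) x(1)] f'_def using x(1) by simp
   show "ev x (?T (i +. #1)) <= ev x (tsum (st n) (i +. #1))" if "ev x (?T i) <= ev x (tsum (st n) i)" for i
   proof -
    have s: "ev x (st n i) = \<bar>ev x (f n (k0 +. n +. i)) - ev x (f n (k0 +. n +. i +. #1))\<bar>"
     using x(1) by (simp add: st_def)
    have e: "k0 +. n +. (i +. #1) = k0 +. n +. i +. #1" unfolding nv_eq nv_add by simp
    show ?thesis using that s unfolding ev_tsum(2)[OF rin(2) x(1)] ev_abs[OF x(1)] ev_sub[OF x(1)] e by linarith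
   qed
  qed
  also have "\<dots> <= ev x (tsum (st n) (i +. (n +. #1)))"
   by (intro tsum_mono rin x order_refl st0 le)
  also have "\<dots> <= ev x (S (i +. (n +. #1)))"
   by (rule Sge[OF x(1)]) (use nv_nonneg[of i] in \<open>unfold nv_simps nv_add nv_1; linarith\<close>)
  also have "\<dots> <= ?E / 4" by (rule Sx)
  finally show ?thesis using x(1) by simp
 qed
 have value_near: "\<bar>rv y - ev x (f' n)\<bar> < 3 * ?E / 8" if y: "l1_value A d (f n) x y" for n y
 proof -
  have "is_real y" "rlim (%k. tval A d x (f n k)) y" using y unfolding l1_value_def by blast+
  then have "\<forall>e>0. EX N. ALL k. N <=. k --> \<bar>ev x (f n k) - rv y\<bar> < e"
   using rlim_iff[of "%k. tval A d x (f n k)" y] is_real_tval[OF x(1)] by (simp add: ev_def)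
  then obtain N where N: "!!k. N <=. k ==> \<bar>ev x (f n k) - rv y\<bar> < ?E / 8" using ep(2) by (meson divide_pos_pos zero_less_numeral)
  show ?thesis using N[OF le(2), of "k0 +. n"] near[of n N] by linarith
 qed
 \<comment> \<open>A quarter of \<open>eps\<close> for the Cauchy condition and twice
   \<open>3 / 8\<close> from \<open>value_near\<close> add up to \<open>eps\<close>, the amount
   exceeded by the oscillation of \<open>f'\<close>.\<close>
 have p2: "posQ (eps *\<^sub>Q qhalf (#1 +. #1))" "qv (eps *\<^sub>Q qhalf (#1 +. #1)) = ?E / 4"
  using ep pw_Suc[of \<zero>] by (simp_all add: posQ_iff zero_plus)
 obtain n where n: "!!a b y z. n <=. a ==> n <=. b ==> l1_value A d (f a) x y ==> l1_value A d (f b) x z ==>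
   rdiff y z <\<^sub>R rconst (eps *\<^sub>Q qhalf (#1 +. #1))"
  using Cx p2(1) unfolding l1_cauchy_at_def by meson
 obtain m where "0 < ev x (?v n m)" using x(3) by blast
 then obtain a b where ab: "n <=. a" "n <=. b" "?E < \<bar>ev x (f' a) - ev x (f' b)\<bar>"
  using osc_pos[OF rf' x(1) ep(1)] ep(2) by force
 obtain y z where yz: "l1_value A d (f a) x y" "l1_value A d (f b) x z" using Cx unfolding l1_cauchy_at_def by blast
 have r: "is_real y" "is_real z" using yz unfolding l1_value_def by blast+
 have "rdiff y z <\<^sub>R rconst (eps *\<^sub>Q qhalf (#1 +. #1))" by (rule n[OF ab(1,2) yz])
 then have "\<bar>rv y - rv z\<bar> < ?E / 4"
  using rlt_iff[OF is_real_diff(1)[OF r] is_real_const, of "eps *\<^sub>Q qhalf (#1 +. #1)"] is_real_diff(2)[OF r] p2 by (simp add: posQ_iff)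
 then show False using value_near[OF yz(1)] value_near[OF yz(2)] ab(3) by linarith
qed

end

section \<open>Bounded convergence\<close>

context mspace
begin

lemma unit_valued_dest: assumes "unit_valued A d h" "pt x" shows "0 <= ev x h" "ev x h <= 1"
 using assms unfolding unit_valued_iff by blast+

lemma almost_every_I: assumes "!!x. pt x ==> P x" shows "almost_every A d I P"
proof -
 have "dec (%_. False)" by (intro decs)
 then have e: "{} \<in> cls M" by (simp add: dec_def)
 have "open_set A d (section_at {} i) = {}" for i by (simp add: open_set_def section_at_def)
 moreover have "measure_less A d I {} e" if "posQ e" for e
 proof -
  have "isQ e" "0 < qv e" using that by (simp_all add: posQ_iff)
  moreover have "iv h <= 0" if "ALL x. pt x & x \<notin> {} --> ev x h = 0" for h
   using iv_mono[of h tzero] that by (simp add: iv_const)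
  ultimately show ?thesis unfolding measure_less_iff[OF \<open>isQ e\<close>] by (intro exI[of _ "qnat #0"]) auto
 qed
 ultimately show ?thesis unfolding almost_every_def using e assms by (intro bexI[of _ "{}"]) auto
qed

lemma rcauchy_I: "rcauchy (%n. I (f n)) \<longleftrightarrow> (\<forall>e>0. EX N. ALL m n. N <=. m & N <=. n --> \<bar>iv (f m) - iv (f n)\<bar> < e)"
 unfolding rcauchy_iff[OF I_real] iv_def ..

lemma almost_uniform_imp_bounded:
 assumes uv: "!!n. unit_valued A d (f n)" and au: "almost_uniformly_cauchy A d I f"
 shows "rcauchy (%n. I (f n))"
 unfolding rcauchy_I
proof (intro allI impI)
 fix e :: "'n rl" assume e: "0 < e"
 obtain k where k: "1 / pw k < e / 4" using rl_arch_pw[of "e / 4"] e by auto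
 let ?S = "%n. {x. pt x & (EX m m'. n <=. m & n <=. m' & rconst (qhalf k) <\<^sub>R rdiff (tval A d x (f m)) (tval A d x (f m')))}"
 obtain n where "measure_less A d I (?S n) (qhalf k)" using au unfolding almost_uniformly_cauchy_def by (meson posQ_half)
 then obtain q where q: "qv q < 1 / pw k" "!!h. (ALL x. pt x --> 0 <= ev x h & ev x h <= 1) ==>
   (ALL x. pt x & x \<notin> ?S n --> ev x h = 0) ==> iv h <= qv q"
  using measure_less_iff[of "qhalf k" "?S n"] by auto
 have "\<bar>iv (f m) - iv (f m')\<bar> < e" if m: "n <=. m" "n <=. m'" for m m'
 proof -
  let ?D = "tabs (tsub (f m) (f m'))"
  \<comment> \<open>This function vanishes where the difference is at most \<open>1 / pw k\<close>,
    in particular outside \<open>?S n\<close>, and is 1 from \<open>2 / pw k\<close> on; so it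
    bounds the difference up to \<open>2 / pw k\<close>.\<close>
  let ?h = "tclamp (tmul (tconst (qnat (pow2 k))) (tsub ?D (tconst (qhalf k))))"
  have "iv ?h <= qv q"
  proof (rule q(2); intro allI impI)
   fix x assume x: "pt x & x \<notin> ?S n"
   then have "~ rconst (qhalf k) <\<^sub>R rdiff (tval A d x (f m)) (tval A d x (f m'))" using m by blast
   then have "~ qv (qhalf k) < \<bar>ev x (f m) - ev x (f m')\<bar>" using osc_set_iff[of x "qhalf k" f m m'] x by simp
   then have "pw k * (\<bar>ev x (f m) - ev x (f m')\<bar> - 1 / pw k) <= 0" by (intro mult_nonneg_nonpos) simp_all
   then show "ev x ?h = 0" using x by simp
  qed simp
  have "iv ?D <= iv (tadd (tadd (tconst (qhalf k)) (tconst (qhalf k))) ?h)"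
  proof (rule iv_mono)
   fix x assume x: "pt x"
   let ?d = "\<bar>ev x (f m) - ev x (f m')\<bar>"
   have e: "ev x ?D = ?d" "ev x (tadd (tadd (tconst (qhalf k)) (tconst (qhalf k))) ?h) = 2 * (1 / pw k) + ev x ?h"
    using x unfolding ev_add[OF x] ev_const[OF x isQ_ops(7)] qv_half by simp_all
   have d1: "?d <= 1" using unit_valued_dest[OF uv x, of m] unit_valued_dest[OF uv x, of m'] by linarith
   show "ev x ?D <= ev x (tadd (tadd (tconst (qhalf k)) (tconst (qhalf k))) ?h)"
   proof (cases "?d <= 2 * (1 / pw k)")
    case True
    moreover have "0 <= ev x ?h" unfolding ev_clamp[OF x] by simp
    ultimately show ?thesis unfolding e by linarith
   next
    case False
    then have "pw k * (1 / pw k) <= pw k * (?d - 1 / pw k)" by (intro mult_left_mono) simp_all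
    then have "1 <= pw k * (?d - 1 / pw k)" by simp
    then have "1 <= ev x ?h" using x by simp
    moreover have "0 < 1 / pw k" by simp
    ultimately show ?thesis unfolding e using d1 by linarith
   qed
  qed
  then have "iv ?D < 3 * (1 / pw k)" using \<open>iv ?h <= qv q\<close> q(1) unfolding iv_add by (simp add: iv_const)
  moreover have "iv (f m) - iv (f m') <= iv ?D" unfolding iv_sub[symmetric] by (rule iv_mono) simp
  moreover have "iv (f m') - iv (f m) <= iv ?D" unfolding iv_sub[symmetric] by (rule iv_mono) simp
  ultimately show ?thesis using k by linarith
 qed
 then show "EX N. ALL m n. N <=. m & N <=. n --> \<bar>iv (f m) - iv (f n)\<bar> < e" by blast
qed

text \<open>A test function enters L1 through its constant name and the constant 1 dominates, which
  makes bounded convergence an instance of dominated convergence.\<close>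

lemma constant_names:
 assumes f: "recfn f" and uv: "!!n. unit_valued A d (f n)"
  and c: "ALL x. pt x --> rcauchy (%n. tval A d x (f n))"
 shows "l1_name I (%_. tone)" "(%n k. f n) \<in> Fn2" "l1_name I (%_. f n)" "l1_dominated I (%_. f n) (%_. tone)"
  "pt x ==> l1_cauchy_at A d (%n k. f n) x" "rcauchy (%n. l1_integral I (%_. f n)) ==> rcauchy (%n. I (f n))"
proof -
 have name: "l1_name I (%_. h)" for h
 proof -
  have "iv (tabs (tsub h h)) = iv tzero" by (rule iv_cong) simp
  then show ?thesis unfolding l1_name_iff by (auto simp: iv_const intro!: decs)
 qed
 show "l1_name I (%_. tone)" "l1_name I (%_. f n)" by (rule name)+
 show "(%n k. f n) \<in> Fn2" by (intro Fn2I recfn_comp[OF f] recfn_pfst)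
 have "iv (tmax (tsub (tabs (f n)) tone) tzero) = iv tzero"
  by (rule iv_cong) (use unit_valued_dest[OF uv] in \<open>simp add: abs_of_nonneg max_def\<close>)
 then show "l1_dominated I (%_. f n) (%_. tone)" unfolding l1_dominated_iff by (simp add: iv_const)
 show "l1_cauchy_at A d (%n k. f n) x" if x: "pt x"
  unfolding l1_cauchy_at_def
 proof (intro conjI allI impI)
  note r = is_real_tval[OF x]
  fix n
  have "rlim (%k. tval A d x (f n)) (tval A d x (f n))" unfolding rlim_iff[OF r r] by simp
  then show "EX y. l1_value A d (%k. f n) x y" unfolding l1_value_def using r by blast
 next
  note r = is_real_tval[OF x]
  fix e assume e: "posQ e"
  then obtain N where N: "!!m n. N <=. m ==> N <=. n ==> \<bar>ev x (f m) - ev x (f n)\<bar> < qv e"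
   using c[rule_format, OF x] unfolding rcauchy_tval[OF x] posQ_iff by blast
  have val: "is_real y & rv y = ev x (f n)" if y: "l1_value A d (%k. f n) x y" for n y
  proof -
   have y': "is_real y" "rlim (%k. tval A d x (f n)) y" using y unfolding l1_value_def by blast+
   then have *: "\<bar>ev x (f n) - rv y\<bar> < e" if "0 < e" for e
    using rlim_iff[OF r y'(1)] that unfolding ev_def by (meson le_refl')
   have "ev x (f n) = rv y"
   proof (rule ccontr)
    assume "ev x (f n) ~= rv y"
    then show False using *[of "\<bar>ev x (f n) - rv y\<bar>"] by simp
   qed
   then show ?thesis using y'(1) by simp
  qed
  show "EX N. ALL m n y z. N <=. m & N <=. n & l1_value A d (%k. f m) x y & l1_value A d (%k. f n) x z --> rdiff y z <\<^sub>R rconst e"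
  proof (intro exI[of _ N] allI impI)
   fix m n y z assume *: "N <=. m & N <=. n & l1_value A d (%k. f m) x y & l1_value A d (%k. f n) x z"
   have y: "is_real y" "rv y = ev x (f m)" and z: "is_real z" "rv z = ev x (f n)" using val * by blast+
   show "rdiff y z <\<^sub>R rconst e"
    using rlt_iff[OF is_real_diff(1)[OF y(1) z(1)] is_real_const] is_real_diff(2)[OF y(1) z(1)] N[of m n] * e y z
    by (simp add: posQ_iff)
  qed
 qed
 have "rv (l1_integral I (%_. f n)) = iv (f n)" for n
  by (rule eq_if_pw[of _ _ 1]) (use l1_integral(2)[OF name] in simp)
 then show "rcauchy (%n. l1_integral I (%_. f n)) ==> rcauchy (%n. I (f n))"
  unfolding rcauchy_I rcauchy_iff[OF l1_integral(1)[OF name]] by simp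
qed

end

context model
begin

theorem two_WWKL_imp_ae: "two_WWKL ==> ae_cauchy_imp_almost_uniform"
 unfolding ae_cauchy_imp_almost_uniform_def
proof (intro allI impI)
 fix A d I f assume W: two_WWKL and *: "compact_space A d & is_measure A d I & f \<in> Fn &
  almost_every A d I (%x. rcauchy (%n. tval A d x (f n)))"
 interpret mspace M A d I by unfold_locales (use * in blast)+
 show "almost_uniformly_cauchy A d I f" using two_WWKL_imp_almost_uniform[OF W] * by blast
qed

theorem two_WWKL_imp_DCT: "two_WWKL ==> DCT_star"
 unfolding DCT_star_def
proof (intro allI impI)
 fix A d I g f assume W: two_WWKL and *: "compact_space A d & is_measure A d I & l1_name I g &
   f \<in> Fn2 & (ALL n. l1_name I (f n)) & (ALL n. l1_dominated I (f n) g) & almost_every A d I (l1_cauchy_at A d f)"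
 interpret mspace M A d I by unfold_locales (use * in blast)+
 show "rcauchy (%n. l1_integral I (f n))" using two_WWKL_imp_dct[OF W] * by blast
qed

theorem ae_imp_bounded: "ae_cauchy_imp_almost_uniform ==> bounded_convergence"
 unfolding bounded_convergence_def
proof (intro allI impI)
 fix A d I f assume W: ae_cauchy_imp_almost_uniform and *: "compact_space A d & is_measure A d I & f \<in> Fn &
  (ALL n. unit_valued A d (f n)) & (ALL x. point A d x --> rcauchy (%n. tval A d x (f n)))"
 interpret mspace M A d I by unfold_locales (use * in blast)+
 have "almost_every A d I (%x. rcauchy (%n. tval A d x (f n)))" by (rule almost_every_I) (use * in blast)
 then have "almost_uniformly_cauchy A d I f" using W * unfolding ae_cauchy_imp_almost_uniform_def by blast
 then show "rcauchy (%n. I (f n))" using almost_uniform_imp_bounded * by blast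
qed

theorem DCT_imp_bounded: "DCT_star ==> bounded_convergence"
 unfolding bounded_convergence_def
proof (intro allI impI)
 fix A d I f assume W: DCT_star and *: "compact_space A d & is_measure A d I & f \<in> Fn &
  (ALL n. unit_valued A d (f n)) & (ALL x. point A d x --> rcauchy (%n. tval A d x (f n)))"
 interpret mspace M A d I by unfold_locales (use * in blast)+
 have f: "recfn f" "!!n. unit_valued A d (f n)" "ALL x. pt x --> rcauchy (%n. tval A d x (f n))" using * by blast+
 note c = constant_names[OF f]
 have "almost_every A d I (l1_cauchy_at A d (%n k. f n))" by (rule almost_every_I) (rule c(5))
 then have "rcauchy (%n. l1_integral I (%_. f n))"
  using W[unfolded DCT_star_def, rule_format, of A d I "%_. tone" "%n k. f n"] c(1-4) * by blast
 then show "rcauchy (%n. I (f n))" by (rule c(6))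
qed

end

section \<open>The Cantor space of 2-adic residues\<close>

context model
begin

text \<open>The 2-adic distance. Ideal points are plain numbers and distances exact rationals; the
  disjunct \<open>a = b\<close> keeps the search total.\<close>

definition dval :: "'n => 'n => 'n" where
 "dval a b = (if a = b then qnat #0 else qhalf (lst (%n. a = b \<or> md a (pow2 (n +. #1)) ~= md b (pow2 (n +. #1)))))"

abbreviation cdist :: "'n => 'n => 'n => 'n" where
 "cdist a b \<equiv> %k. dval a b"

lemma pow2_pos [simp]: "#0 <. pow2 n"
 using pw_pos[of n] unfolding nv_simps by simp

lemma md_less: "a <. m ==> md a m = a"
 using md_eq[of a \<zero> m a] by (simp add: zero_times zero_plus)

lemma md_pow2_shift: "md (q *. pow2 (n +. k) +. r) (pow2 n) = md r (pow2 n)"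
proof -
 have "q *. pow2 (n +. k) +. r = (q *. pow2 k +. dv r (pow2 n)) *. pow2 n +. md r (pow2 n)"
  using arg_cong[OF div_mod(1)[OF pow2_pos[of n], of r], of nv] unfolding nv_eq nv_add nv_mult pw_add
  by (simp add: algebra_simps)
 from md_eq[OF this div_mod(2)[OF pow2_pos]] show ?thesis .
qed

lemma md_md: assumes "n <=. m" shows "md (md a (pow2 m)) (pow2 n) = md a (pow2 n)"
proof -
 obtain k where m: "m = n +. k" using le_imp_plus[OF assms] by blast
 show ?thesis using md_pow2_shift[of "dv a (pow2 m)" n k "md a (pow2 m)"] div_mod(1)[OF pow2_pos[of m], of a] by (simp add: m)
qed

lemma md_eq_mono: "n <=. m ==> md a (pow2 m) = md b (pow2 m) ==> md a (pow2 n) = md b (pow2 n)"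
 using md_md by metis

lemma dval_ex: "EX n. a = b \<or> md a (pow2 (n +. #1)) ~= md b (pow2 (n +. #1))"
proof (intro exI[of _ "a +. b"])
 have "a <. pow2 (a +. b +. #1)" "b <. pow2 (a +. b +. #1)"
  using pw_ge[of "a +. b +. #1"] nv_nonneg[of a] nv_nonneg[of b] unfolding nv_simps nv_add nv_1 by linarith+
 then show "a = b \<or> md a (pow2 (a +. b +. #1)) ~= md b (pow2 (a +. b +. #1))" by (simp add: md_less)
qed

lemma recfn_dval [decs]: assumes "recfn f" "recfn g" shows "recfn (%p. dval (f p) (g p))"
proof -
 have "recfn (%p. dval (pfst p) (psnd p))" unfolding dval_def by (intro decs recfn_lst dval_ex)
 from recfn_comp[OF this recfn_pair[OF assms]] show ?thesis by simp
qed

lemma isQ_dval [simp]: "isQ (dval a b)"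
 by (simp add: dval_def)

lemma dval_le: "qv (dval a b) <= 1 / pw n \<longleftrightarrow> md a (pow2 n) = md b (pow2 n)"
proof (cases "a = b")
 case False
 let ?P = "%n. a = b \<or> md a (pow2 (n +. #1)) ~= md b (pow2 (n +. #1))"
 have d: "dec ?P" by (intro decs)
 obtain k where "?P k" using dval_ex by blast
 note l = lst_least[OF d this]
 let ?v = "lst ?P"
 have v: "qv (dval a b) = 1 / pw ?v" using False by (simp add: dval_def)
 show ?thesis
 proof (cases "n <=. ?v")
  case True
  then have "1 / pw ?v <= 1 / pw n" using pw_mono by (simp add: divide_simps)
  moreover have "md a (pow2 n) = md b (pow2 n)"
  proof (cases "n = #0")
   case True
   then show ?thesis using div_mod(2)[OF pow2_pos, of _ \<zero>] by simp
  next
   case nz: False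
   then obtain m where m: "n = m +. #1" using zero_or_Suc by blast
   have "~ ?v <=. m" using True unfolding m by (simp add: nv_simps)
   then show ?thesis using l(2)[of m] unfolding m by blast
  qed
  ultimately show ?thesis by (simp add: v)
 next
  case False
  then have vn: "?v <. n" by (simp add: nv_simps not_le)
  then have "?v +. #1 <=. n" unfolding nv_Suc_le nv_simps(3) nv_add nv_1 .
  then have "md a (pow2 n) ~= md b (pow2 n)" using md_eq_mono l(1) \<open>a ~= b\<close> by blast
  moreover have "pw ?v < pw n" using pw_strict_mono[OF vn] pw_pos[of ?v] by linarith
  then have "~ 1 / pw ?v <= 1 / pw n" by (simp add: divide_simps not_le)
  ultimately show ?thesis by (simp add: v)
 qed
qed (simp add: dval_def)

lemma dval_pos: "0 <= qv (dval a b)" and dval_self: "qv (dval a a) = 0" and dval_le_1: "qv (dval a b) <= 1"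
 by (simp_all add: dval_def divide_le_eq pw_ge_1)

lemma dval_cases: "qv (dval a b) = 0 & a = b \<or> (EX v. qv (dval a b) = 1 / pw v)"
 by (auto simp: dval_def)

lemma dval_sym: "qv (dval a b) = qv (dval b a)"
proof -
 have "qv (dval a b) <= qv (dval b a)" for a b
  using dval_cases[of b a] dval_le[of a b] dval_le[of b a] by (metis dval_self order_refl)
 then show ?thesis by (simp add: order_antisym)
qed

lemma dval_ultra: "qv (dval a c) <= max (qv (dval a b)) (qv (dval b c))"
proof (cases "a = b \<or> b = c")
 case False
 then obtain v w where v: "qv (dval a b) = 1 / pw v" "qv (dval b c) = 1 / pw w" using dval_cases by metis
 have e: "md a (pow2 v) = md b (pow2 v)" "md b (pow2 w) = md c (pow2 w)" using dval_le v by (metis order_refl)+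
 have "v <=. w \<or> w <=. v" using lt_linear[of v w] unfolding le_def by blast
 then show ?thesis
 proof
  assume "v <=. w"
  then have "qv (dval a c) <= 1 / pw v" unfolding dval_le using e md_eq_mono by metis
  then show ?thesis unfolding v by simp
 next
  assume "w <=. v"
  then have "qv (dval a c) <= 1 / pw w" unfolding dval_le using e md_eq_mono by metis
  then show ?thesis unfolding v by simp
 qed
qed (auto simp: dval_self dval_pos)

lemma is_real_cdist: "is_real (cdist a b)" "rv (cdist a b) = qv (dval a b)"
 using is_real_const[OF isQ_dval[of a b]] rv_const[OF isQ_dval[of a b]] unfolding rconst_def by simp_all

lemma metric_cdist: "metric_code UNIV cdist"
 unfolding metric_code_def
proof (intro conjI ballI)
 have "dec (%_. True)" by (intro decs)
 then show "UNIV \<in> cls M" by (simp add: dec_def)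
 show "cdist \<in> Fn3" by (intro Fn3I decs)
 fix a b c
 show "is_real (cdist a b)" by (rule is_real_cdist)
 show "rconst (qnat #0) \<le>\<^sub>R cdist a b"
  unfolding rle_iff[OF is_real_const[OF isQ_ops(6)] is_real_cdist(1)] is_real_cdist by (simp add: dval_pos)
 show "cdist a b =\<^sub>R cdist b a" unfolding req_iff[OF is_real_cdist(1) is_real_cdist(1)] is_real_cdist by (rule dval_sym)
 show "cdist a a =\<^sub>R rconst (qnat #0)"
  unfolding req_iff[OF is_real_cdist(1) is_real_const[OF isQ_ops(6)]] is_real_cdist by (simp add: dval_self)
 have "qv (dval a c) <= qv (dval a b) + qv (dval b c)"
  using dval_ultra[of a c b] dval_pos[of a b] dval_pos[of b c] by linarith
 then show "cdist a c \<le>\<^sub>R cdist a b +\<^sub>R cdist b c"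
  unfolding rle_iff[OF is_real_cdist(1) is_real_add(1)[OF is_real_cdist(1) is_real_cdist(1)]] is_real_add(2)[OF is_real_cdist(1) is_real_cdist(1)] is_real_cdist .
qed simp

lemma point_cdist: "point UNIV cdist x \<longleftrightarrow> recfn x & (ALL i j. i <. j --> md (x i) (pow2 i) = md (x j) (pow2 i))"
proof -
 have "cdist a b \<le>\<^sub>R rconst (qhalf i) \<longleftrightarrow> md a (pow2 i) = md b (pow2 i)" for a b i
  unfolding rle_iff[OF is_real_cdist(1) is_real_const[OF isQ_ops(7)]] is_real_cdist by (simp add: dval_le)
 then show ?thesis unfolding point_def by simp
qed

text \<open>The \<open>j\<close>-th net consists of residues, and a coherent sequence is
  approximated by its own residue.\<close>

lemma compact_cdist: "compact_space UNIV cdist"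
 unfolding compact_space_def
proof (intro conjI bexI[of _ "%j i k. i"] bexI[of _ "%j. pow2 (j +. #1)"] allI impI metric_cdist)
 show "(%j i k. i) \<in> Fn3" by (intro Fn3I decs)
 show "recfn (%j. pow2 (j +. #1))" by (intro decs)
 show "point UNIV cdist (%k. i)" for i unfolding point_cdist by (auto intro: recfn_const)
 fix z j assume z: "point UNIV cdist z"
 \<comment> \<open>One level more than \<open>j\<close>, because the distance from the net point has
   to be strictly below \<open>1 / pw j\<close>.\<close>
 let ?i = "md (z (j +. #1)) (pow2 (j +. #1))"
 have zj: "md (z n) (pow2 (j +. #1)) = ?i" if "j +. #1 <=. n" for n
  using z that unfolding point_cdist le_def by metis
 let ?D = "dist cdist (%k. ?i) z"
 have v: "qv (?D k) <= 1 / pw (j +. #1)" if "j +. #1 <=. k +. num 3" for k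
  unfolding dist_def dval_le zj[OF that] by (rule md_md) simp
 \<comment> \<open>The general fact \<open>is_real_dist\<close> presupposes a compact space, so the
   rate is derived here from the ultrametric inequality.\<close>
 have r: "is_real ?D"
  unfolding is_real_iff
 proof (intro conjI allI impI)
  have rz: "recfn z" using z unfolding point_cdist by blast
  show "recfn ?D" unfolding dist_def by (intro decs recfn_comp[OF rz])
  show "isQ (?D k)" for k unfolding dist_def by simp
  fix k i assume ki: "k <=. i"
  let ?m = "k +. num 3" and ?n = "i +. num 3"
  have mn: "?m <=. ?n" using ki by (simp add: nv_simps(3))
  have "md (z ?m) (pow2 ?m) = md (z ?n) (pow2 ?m)" using z mn unfolding point_cdist le_def by metis
  then have zz: "qv (dval (z ?m) (z ?n)) <= 1 / pw ?m" unfolding dval_le .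
  have "qv (dval ?i (z ?m)) <= max (qv (dval ?i (z ?n))) (qv (dval (z ?n) (z ?m)))"
   "qv (dval ?i (z ?n)) <= max (qv (dval ?i (z ?m))) (qv (dval (z ?m) (z ?n)))" by (rule dval_ultra)+
  then have "\<bar>qv (dval ?i (z ?m)) - qv (dval ?i (z ?n))\<bar> <= qv (dval (z ?m) (z ?n))"
   using dval_sym[of "z ?m" "z ?n"] dval_pos[of ?i "z ?n"] dval_pos[of ?i "z ?m"] dval_pos[of "z ?m" "z ?n"] by linarith
  moreover have "1 / pw ?m <= 1 / pw k"
   using pw_mono[of k ?m] by (simp add: nv_simps(3) divide_simps del: num.simps)
  ultimately show "\<bar>qv (?D k) - qv (?D i)\<bar> <= 1 / pw k" using zz unfolding dist_def by linarith
 qed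
 have "qv (?D j') <= 1 / pw (j +. #1)" if "j +. #1 <=. j'" for j'
  by (rule v) (use that in \<open>simp add: nv_simps(3) del: num.simps\<close>)
 then have *: "qv (?D (j +. #1 +. n)) <= 1 / pw (j +. #1)" for n by (simp add: nv_simps(3) nv_nonneg)
 have "rv ?D <= 1 / pw (j +. #1) + 1 / pw n" for n
 proof -
  have "n <=. j +. #1 +. n" using nv_nonneg[of j] unfolding nv_simps nv_add nv_1 by linarith
  then have "1 / pw (j +. #1 +. n) <= 1 / pw n" using pw_mono by (simp add: divide_simps)
  then show ?thesis using is_realD(3)[OF r, of "j +. #1 +. n"] *[of n] by linarith
 qed
 then have "rv ?D <= 1 / pw (j +. #1)" by (rule le_if_pw)
 also have "\<dots> < 1 / pw j" by (simp add: divide_simps)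
 finally have "?D <\<^sub>R rconst (qhalf j)" unfolding rlt_iff[OF r is_real_const[OF isQ_ops(7)]] by simp
 moreover have "?i <=. pow2 (j +. #1)" using div_mod(2)[OF pow2_pos] unfolding le_def by blast
 ultimately show "EX i. i <=. pow2 (j +. #1) & dist cdist (%k. i) z <\<^sub>R rconst (qhalf j)" by blast
qed

end

sublocale model \<subseteq> cantor: cspace M UNIV cdist
 by unfold_locales (rule compact_cdist)

context model
begin

section \<open>Averages over residues and the measure they define\<close>

definition val :: "'n => 'n => 'n" where
 "val c r = tv UNIV (%a. dval a r) c"

lemma UNIV_cls: "UNIV \<in> cls M"
 using cantor.A_cls .

lemma recfn_val [decs]: assumes "recfn f" "recfn g" shows "recfn (%p. val (f p) (g p))"
proof -
 have "recfn (%p. val (f p) (g p))" unfolding val_def by (intro recfn_tv UNIV_cls decs assms recfn_comp[OF assms(2)])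
 then show ?thesis .
qed

lemma dd_cdist: "cantor.dd (%_. r) n = (%a. dval a r)"
 by (simp add: cantor.dd_def dist_def fun_eq_iff)

lemma pt_const: "point UNIV cdist (%_. r)"
 using cantor.pt_ideal[of r] by simp

lemma isQ_val [simp]: "isQ (val c r)"
 using cantor.tv_dd_isQ[OF pt_const, of r \<zero> c] unfolding val_def dd_cdist .

lemma qv_val: "qv (val c r) = cantor.ev (%_. r) c"
 by (rule eq_if_pw) (use cantor.ev_approx[OF pt_const, of r] in \<open>simp add: val_def dd_cdist\<close>)

definition qsum :: "'n => 'n => 'n" where
 "qsum c m = prec (qnat #0) (%i v. v +\<^sub>Q val c i) m"

lemma recfn_qsum [decs]: assumes "recfn f" "recfn g" shows "recfn (%p. qsum (f p) (g p))"
 unfolding qsum_def by (intro decs assms recfn_comp[OF assms(1)])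

lemma qsum_0: "qsum c #0 = qnat #0" and qsum_Suc: "qsum c (m +. #1) = qsum c m +\<^sub>Q val c m"
proof -
 show "qsum c #0 = qnat #0" by (simp add: qsum_def)
 have g: "recfn (%q. psnd q +\<^sub>Q val c (pfst q))" by (intro decs)
 show "qsum c (m +. #1) = qsum c m +\<^sub>Q val c m" unfolding qsum_def by (rule prec_Suc[OF g])
qed

lemma isQ_qsum [simp]: "isQ (qsum c m)"
 by (rule dec_induct'[of "%m. isQ (qsum c m)"]) (intro decs, simp_all add: qsum_0 qsum_Suc)

lemma qv_qsum: "qv (qsum c #0) = 0" "qv (qsum c (m +. #1)) = qv (qsum c m) + qv (val c m)"
 by (simp_all add: qsum_0 qsum_Suc)

lemma dec_qv_le: "recfn f ==> recfn g ==> (!!p. isQ (f p)) ==> (!!p. isQ (g p)) ==> dec (%p. qv (f p) <= qv (g p))"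
 by (subst qle_iff[symmetric]) (assumption | intro decs)+

lemma qv_le_induct:
 assumes "recfn f" "recfn g" "!!p. isQ (f p)" "!!p. isQ (g p)" "qv (f #0) <= qv (g #0)"
  "!!n. qv (f n) <= qv (g n) ==> qv (f (n +. #1)) <= qv (g (n +. #1))"
 shows "qv (f n) <= qv (g n)"
 by (rule dec_induct'[of "%n. qv (f n) <= qv (g n)"]) (rule dec_qv_le assms; assumption?)+

lemma qv_eq_induct:
 assumes "recfn f" "recfn g" "!!p. isQ (f p)" "!!p. isQ (g p)" "qv (f #0) = qv (g #0)"
  "!!n. qv (f n) = qv (g n) ==> qv (f (n +. #1)) = qv (g (n +. #1))"
 shows "qv (f n) = qv (g n)"
proof (rule dec_induct'[of "%n. qv (f n) = qv (g n)"])
 have "dec (%p. qv (f p) <= qv (g p) & qv (g p) <= qv (f p))" by (intro dec_conj dec_qv_le assms)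
 then show "dec (%n. qv (f n) = qv (g n))" by (simp add: order_eq_iff)
qed (use assms in auto)

definition avg :: "'n => 'n => 'n rl" where
 "avg c n = qv (qsum c (pow2 n)) / pw n"

lemma qsum_linear:
 shows "qv (qsum (tadd f g) m) = qv (qsum f m) + qv (qsum g m)"
  and "isQ q ==> qv (qsum (tmul (tconst q) f) m) = qv q * qv (qsum f m)"
  and "qv (qsum tone m) = nv m"
  and "(!!r. 0 <= cantor.ev (%_. r) f) ==> 0 <= qv (qsum f m)"
proof -
 have "qv (qsum (tadd f g) m) = qv (qsum f m +\<^sub>Q qsum g m)"
  by (rule qv_eq_induct[of "qsum (tadd f g)" "%m. qsum f m +\<^sub>Q qsum g m"]) (intro decs, intro decs, simp_all add: qsum_0 qsum_Suc qv_val pt_const)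
 then show "qv (qsum (tadd f g) m) = qv (qsum f m) + qv (qsum g m)" by simp
 show "qv (qsum (tmul (tconst q) f) m) = qv q * qv (qsum f m)" if q: "isQ q"
 proof -
  have "qv (qsum (tmul (tconst q) f) m) = qv (q *\<^sub>Q qsum f m)"
   by (rule qv_eq_induct[of "qsum (tmul (tconst q) f)" "%m. q *\<^sub>Q qsum f m"])
    (intro decs, intro decs, simp_all add: qsum_0 qsum_Suc qv_val pt_const q algebra_simps)
  then show ?thesis using q by simp
 qed
 have t: "qv (val tone r) = 1" for r unfolding qv_val using pt_const[of r] by simp
 have "qv (qsum tone m) = qv (qnat m)"
 proof (rule qv_eq_induct[of "%m. qsum tone m" "%m. qnat m"])
  show "recfn (%m. qsum tone m)" by (rule recfn_qsum[OF recfn_const recfn_ident])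
  show "recfn (%m. qnat m)" by (rule recfn_q1[OF recfn_ident])
  show "qv (qsum tone (n +. #1)) = qv (qnat (n +. #1))" if "qv (qsum tone n) = qv (qnat n)" for n
   using that unfolding qv_qsum t by simp
 qed (simp_all add: qsum_0)
 then show "qv (qsum tone m) = nv m" by simp
 assume f: "!!r. 0 <= cantor.ev (%_. r) f"
 have "qv (qnat #0) <= qv (qsum f m)"
  by (rule qv_le_induct[of "%_. qnat #0" "qsum f"]) (intro decs, intro decs, simp_all add: qsum_0 qsum_Suc qv_val f)
 then show "0 <= qv (qsum f m)" by simp
qed

text \<open>The numbers below \<open>pow2 (n +. #1)\<close> are those below \<open>pow2 n\<close>
  and their translates by \<open>pow2 n\<close>; the average thus changes by half the mean effect of
  the translation.\<close>

lemma avg_step: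
 assumes "isQ e" "!!r. \<bar>cantor.ev (%_. pow2 n +. r) c - cantor.ev (%_. r) c\<bar> <= qv e"
 shows "\<bar>avg c (n +. #1) - avg c n\<bar> <= qv e / 2"
proof -
 let ?T = "%m. qsum c (pow2 n +. m) +\<^sub>Q quminus (qsum c (pow2 n)) +\<^sub>Q quminus (qsum c m)"
 have s: "qv (qsum c (pow2 n +. (m +. #1))) = qv (qsum c (pow2 n +. m)) + qv (val c (pow2 n +. m))" for m
  using qv_qsum(2)[of c "pow2 n +. m"] by (simp add: add_assoc'[symmetric])
 have 1: "qv (?T m) <= qv (qnat m *\<^sub>Q e)" for m
 proof (rule qv_le_induct[of ?T "%m. qnat m *\<^sub>Q e"])
  fix m assume IH: "qv (?T m) <= qv (qnat m *\<^sub>Q e)"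
  then show "qv (?T (m +. #1)) <= qv (qnat (m +. #1) *\<^sub>Q e)"
   using assms(2)[of m] assms(1) by (simp add: s qv_qsum qv_val algebra_simps; linarith)
 qed (intro decs, intro decs, simp_all add: assms(1) qsum_0)
 have 2: "qv (quminus (?T m)) <= qv (qnat m *\<^sub>Q e)" for m
 proof (rule qv_le_induct[of "%m. quminus (?T m)" "%m. qnat m *\<^sub>Q e"])
  fix m assume IH: "qv (quminus (?T m)) <= qv (qnat m *\<^sub>Q e)"
  then show "qv (quminus (?T (m +. #1))) <= qv (qnat (m +. #1) *\<^sub>Q e)"
   using assms(2)[of m] assms(1) by (simp add: s qv_qsum qv_val algebra_simps; linarith)
 qed (intro decs, intro decs, simp_all add: assms(1) qsum_0)
 have e: "pow2 (n +. #1) = pow2 n +. pow2 n" unfolding nv_eq nv_add pw_Suc by simp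
 have "\<bar>qv (qsum c (pow2 (n +. #1))) - 2 * qv (qsum c (pow2 n))\<bar> <= pw n * qv e"
  using 1[of "pow2 n"] 2[of "pow2 n"] assms(1) unfolding e by (simp add: abs_le_iff; linarith)
 then have "\<bar>qv (qsum c (pow2 (n +. #1))) - 2 * qv (qsum c (pow2 n))\<bar> / (2 * pw n) <= pw n * qv e / (2 * pw n)"
  by (rule divide_right_mono) (simp add: less_imp_le)
 moreover have "avg c (n +. #1) - avg c n = (qv (qsum c (pow2 (n +. #1))) - 2 * qv (qsum c (pow2 n))) / (2 * pw n)"
  unfolding avg_def by (simp add: field_simps)
 ultimately show ?thesis by (simp add: abs_divide)
qed

lemma avg_code: "avg c n = qv (qsum c (pow2 n) *\<^sub>Q qhalf n)"
 by (simp add: avg_def)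

text \<open>Translation by \<open>pow2 m\<close> moves a point by at most \<open>1 / pw m\<close>,
  so step \<open>m\<close> costs at most half of \<open>lip c / pw m\<close>, and these costs
  telescope.\<close>

lemma avg_lipschitz: "\<bar>avg c (n +. j) - avg c n\<bar> <= nv (cantor.lip c) / pw n"
proof -
 let ?L = "cantor.lip c"
 have st: "\<bar>avg c (m +. #1) - avg c m\<bar> <= nv ?L * (1 / pw m) / 2" for m
 proof -
  have "\<bar>cantor.ev (%_. pow2 m +. r) c - cantor.ev (%_. r) c\<bar> <= nv ?L * (1 / pw m)" for r
  proof -
   have "md (pow2 m +. r) (pow2 m) = md r (pow2 m)"
    using md_pow2_shift[of \<one> m \<zero> r] by (simp add: one_times)
   then have "qv (dval (pow2 m +. r) r) <= 1 / pw m" unfolding dval_le .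
   then have "cantor.dst (%_. pow2 m +. r) (%_. r) <= 1 / pw m"
    using cantor.dst_ideal[of "pow2 m +. r" r] is_real_cdist by simp
   then have "nv ?L * cantor.dst (%_. pow2 m +. r) (%_. r) <= nv ?L * (1 / pw m)" by (intro mult_left_mono nv_nonneg)
   then show ?thesis using cantor.ev_lipschitz[OF pt_const pt_const, of "pow2 m +. r" c r] by linarith
  qed
  then have "\<bar>avg c (m +. #1) - avg c m\<bar> <= qv (qnat ?L *\<^sub>Q qhalf m) / 2" by (intro avg_step) simp_all
  then show ?thesis by simp
 qed
 let ?R = "%j. qnat ?L *\<^sub>Q (qhalf n +\<^sub>Q quminus (qhalf (n +. j)))"
 let ?A = "%n. qsum c (pow2 n) *\<^sub>Q qhalf n"
 have "qv (qabs (?A (n +. j) +\<^sub>Q quminus (?A n))) <= qv (?R j)"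
 proof (rule qv_le_induct[of "%j. qabs (?A (n +. j) +\<^sub>Q quminus (?A n))" ?R])
  fix j assume IH: "qv (qabs (?A (n +. j) +\<^sub>Q quminus (?A n))) <= qv (?R j)"
  then have "\<bar>avg c (n +. j) - avg c n\<bar> <= nv ?L * (1 / pw n - 1 / pw (n +. j))" by (simp add: avg_def)
  moreover have "nv ?L * (1 / pw (n +. j)) / 2 = nv ?L * (1 / pw (n +. j) - 1 / pw (n +. j +. #1))"
   by (simp add: field_simps)
  ultimately have "\<bar>avg c (n +. j +. #1) - avg c n\<bar> <= nv ?L * (1 / pw n - 1 / pw (n +. j)) + nv ?L * (1 / pw (n +. j) - 1 / pw (n +. j +. #1))"
   using st[of "n +. j"] by linarith
  also have "\<dots> = nv ?L * (1 / pw n - 1 / pw (n +. j +. #1))" by (simp only: distrib_left[symmetric]) simp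
  finally show "qv (qabs (?A (n +. (j +. #1)) +\<^sub>Q quminus (?A n))) <= qv (?R (j +. #1))"
   by (simp add: avg_def add_assoc'[symmetric])
 qed (intro decs, intro decs, simp_all)
 then have "\<bar>avg c (n +. j) - avg c n\<bar> <= nv ?L * (1 / pw n - 1 / pw (n +. j))" by (simp add: avg_def)
 also have "\<dots> <= nv ?L * (1 / pw n)" by (intro mult_left_mono nv_nonneg) simp
 finally show ?thesis by simp
qed

lemma avg_local:
 assumes "!!r. cantor.ev (%_. r) c = cantor.ev (%_. md r (pow2 m)) c" shows "avg c (m +. j) = avg c m"
proof -
 let ?A = "%n. qsum c (pow2 n) *\<^sub>Q qhalf n"
 have "qv (?A (m +. j)) = qv (?A m)"
 proof (rule qv_eq_induct[of "%j. ?A (m +. j)" "%_. ?A m"])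
  fix j assume IH: "qv (?A (m +. j)) = qv (?A m)"
  have "cantor.ev (%_. pow2 (m +. j) +. r) c = cantor.ev (%_. r) c" for r
   using assms[of "pow2 (m +. j) +. r"] assms[of r] md_pow2_shift[of \<one> m j r] by (simp add: one_times)
  then have "\<bar>avg c (m +. j +. #1) - avg c (m +. j)\<bar> <= qv (qnat #0) / 2" by (intro avg_step) simp_all
  then show "qv (?A (m +. (j +. #1))) = qv (?A m)" using IH unfolding avg_code by (simp add: add_assoc'[symmetric])
 qed (intro decs, intro decs, simp_all)
 then show ?thesis unfolding avg_code .
qed

text \<open>The Haar integral on the 2-adic integers, as the limit of the averages; the shift by
  \<open>lip c\<close> provides the rate demanded of reals.\<close>

definition cint :: "'n => 'n => 'n" where
 "cint c k = qsum c (pow2 (k +. cantor.lip c)) *\<^sub>Q qhalf (k +. cantor.lip c)"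

lemma cint_avg: "qv (cint c k) = avg c (k +. cantor.lip c)"
 unfolding cint_def avg_code ..

lemma is_real_cint: "is_real (cint c)"
 unfolding is_real_iff
proof (intro conjI allI impI)
 show "recfn (cint c)" "isQ (cint c k)" for k unfolding cint_def by (intro decs) simp
 fix k j assume "k <=. j"
 then obtain i where j: "j = k +. i" using le_imp_plus by blast
 have "j +. cantor.lip c = k +. cantor.lip c +. i" unfolding j nv_eq nv_add by simp
 then show "\<bar>qv (cint c k) - qv (cint c j)\<bar> <= 1 / pw k"
  using avg_lipschitz[of c "k +. cantor.lip c" i] cantor.lip_pw[of c k] unfolding cint_avg by (simp add: abs_minus_commute)
qed

lemma cint_approx: "\<bar>rv (cint c) - avg c n\<bar> <= nv (cantor.lip c) / pw n"
proof -
 have "\<bar>rv (cint c) - avg c n\<bar> <= nv (cantor.lip c) / pw n + 1 / pw k" for k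
 proof -
  let ?L = "cantor.lip c"
  have "n +. k +. ?L = n +. (k +. ?L)" by (rule add_assoc')
  then have "\<bar>avg c (n +. k +. ?L) - avg c n\<bar> <= nv ?L / pw n" using avg_lipschitz[of c n "k +. ?L"] by simp
  moreover have "\<bar>avg c (n +. k +. ?L) - rv (cint c)\<bar> <= 1 / pw (n +. k)" using is_realD(3)[OF is_real_cint, of c "n +. k"] unfolding cint_avg .
  moreover have "1 / pw (n +. k) <= 1 / pw k"
   using pw_mono[of k "n +. k"] nv_nonneg[of n] by (simp add: nv_simps(3) divide_simps)
  ultimately show ?thesis by linarith
 qed
 then show ?thesis by (rule le_if_pw)
qed

lemma cint_eqI: assumes "!!n. avg c n = r" shows "rv (cint c) = r"
 using cint_approx[of c] unfolding assms by (rule eq_if_pw)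

lemma cint_local: assumes "!!r. cantor.ev (%_. r) c = cantor.ev (%_. md r (pow2 m)) c" shows "rv (cint c) = avg c m"
proof (rule eq_if_pw)
 fix k
 have "\<bar>rv (cint c) - avg c m\<bar> <= nv (cantor.lip c) / pw (m +. k)" using cint_approx[of c "m +. k"] unfolding avg_local[OF assms] .
 also have "\<dots> <= nv (cantor.lip c) / pw k"
  using pw_mono[of k "m +. k"] nv_nonneg[of m] by (intro divide_left_mono nv_nonneg) (simp_all add: nv_simps(3))
 finally show "\<bar>rv (cint c) - avg c m\<bar> <= nv (cantor.lip c) / pw k" .
qed

lemma measure_cint: "is_measure UNIV cdist cint"
 unfolding is_measure_def
proof (intro conjI allI impI)
 show "cint \<in> Fn2" unfolding cint_def by (intro Fn2I decs cantor.recfn_lip)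
 fix f g
 show "is_real (cint f)" by (rule is_real_cint)
 have nz: "\<bar>a - b\<bar> <= c / pw n + (e / pw n + h / pw n) ==> \<bar>a - b\<bar> <= (c + e + h) / pw n" for a b c e h :: "'n rl" and n
  by (simp add: add_divide_distrib)
 show "cint (tadd f g) =\<^sub>R cint f +\<^sub>R cint g"
  unfolding req_iff[OF is_real_cint is_real_add(1)[OF is_real_cint is_real_cint]] is_real_add(2)[OF is_real_cint is_real_cint]
 proof (rule eq_if_pw)
  fix n
  have "avg (tadd f g) n = avg f n + avg g n" unfolding avg_def qsum_linear(1) by (simp add: add_divide_distrib)
  then show "\<bar>rv (cint (tadd f g)) - (rv (cint f) + rv (cint g))\<bar> <= (nv (cantor.lip (tadd f g)) + nv (cantor.lip f) + nv (cantor.lip g)) / pw n"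
   using cint_approx[of "tadd f g" n] cint_approx[of f n] cint_approx[of g n] by (intro nz) linarith
 qed
 show "cint (tmul (tconst q) f) =\<^sub>R rconst q *\<^sub>R cint f" if q: "isQ q" for q
  unfolding req_iff[OF is_real_cint is_real_mul(1)[OF is_real_const[OF q] is_real_cint]] is_real_mul(2)[OF is_real_const[OF q] is_real_cint] rv_const[OF q]
 proof (rule eq_if_pw)
  fix n
  let ?h = "tmul (tconst q) f"
  have a: "avg ?h n = qv q * avg f n" unfolding avg_def qsum_linear(2)[OF q] by simp
  have "\<bar>qv q * rv (cint f) - qv q * avg f n\<bar> <= \<bar>qv q\<bar> * (nv (cantor.lip f) / pw n)"
   unfolding right_diff_distrib[symmetric] abs_mult by (intro mult_left_mono cint_approx) simp
  then show "\<bar>rv (cint ?h) - qv q * rv (cint f)\<bar> <= (nv (cantor.lip ?h) + \<bar>qv q\<bar> * nv (cantor.lip f)) / pw n"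
   using cint_approx[of ?h n] unfolding a add_divide_distrib times_divide_eq_right[symmetric] by linarith
 qed
 show "rconst (qnat #0) \<le>\<^sub>R cint f" if *: "ALL x. point UNIV cdist x --> rconst (qnat #0) \<le>\<^sub>R tval UNIV cdist x f"
  unfolding rle_iff[OF is_real_const[OF isQ_ops(6)] is_real_cint] rv_const[OF isQ_ops(6)] qv_nat nv_0
 proof (rule le_if_pw)
  fix n
  have "0 <= cantor.ev (%_. r) f" for r
   using *[rule_format, OF pt_const[of r]] rle_iff[OF is_real_const[OF isQ_ops(6)] cantor.is_real_tval[OF pt_const]] by (simp add: cantor.ev_def)
  then have "0 <= avg f n" unfolding avg_def using qsum_linear(4) by simp
  then show "0 <= rv (cint f) + nv (cantor.lip f) / pw n" using cint_approx[of f n] by linarith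
 qed
 have "rv (cint tone) = 1" by (rule cint_eqI) (simp add: avg_def qsum_linear(3))
 then show "cint (tconst (qnat #1)) =\<^sub>R rconst (qnat #1)" unfolding req_iff[OF is_real_cint is_real_const[OF isQ_ops(6)]] by simp
qed

end

section \<open>Clopen sets and limit approximations\<close>

context model
begin

interpretation cantor: mspace M UNIV cdist cint
 by unfold_locales (rule measure_cint)

text \<open>The indicator of a residue class. Positive distances are powers of one half, none lies
  strictly between \<open>1 / pw m\<close> and \<open>2 / pw m\<close>, and therefore the clamped
  function takes only the values 0 and 1.\<close>

definition ind :: "'n => 'n => 'n" where
 "ind m r = tclamp (tsub (tconst (qnat (num 2))) (tmul (tconst (qnat (pow2 m))) (tdist r)))"

definition csum :: "('n => bool) => 'n => 'n" where
 "csum C m = tsum (%r. if C r then ind m r else tzero) (pow2 m)"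

lemma recfn_ind [decs]: "recfn f ==> recfn g ==> recfn (%p. ind (f p) (g p))"
 unfolding ind_def by (intro decs)

lemma ev_ind: assumes "r <. pow2 m"
 shows "cantor.ev (%_. s) (ind m r) = (if md s (pow2 m) = r then 1 else 0)"
proof -
 have v: "cantor.ev (%_. s) (ind m r) = max 0 (min 1 (2 - pw m * qv (dval r s)))"
  using cantor.dst_ideal[of r s] is_real_cdist pt_const[of s] by (simp add: ind_def cantor.ev_dist del: num.simps)
 have r: "md r (pow2 m) = r" by (rule md_less[OF assms])
 show ?thesis
 proof (cases "md s (pow2 m) = r")
  case True
  then have "qv (dval r s) <= 1 / pw m" unfolding dval_le r by simp
  then have "pw m * qv (dval r s) <= 1" by (simp add: le_divide_eq mult.commute)
  then show ?thesis using True unfolding v by simp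
 next
  case False
  then have n: "~ qv (dval r s) <= 1 / pw m" unfolding dval_le r by simp
  then obtain w where w: "qv (dval r s) = 1 / pw w" using dval_cases[of r s] by auto
  have "~ m <=. w" using n pw_mono[of m w] unfolding w by (auto simp: divide_simps)
  then have "w <. m" by (simp add: nv_simps not_le)
  from pw_strict_mono[OF this] have "2 <= pw m * qv (dval r s)" unfolding w by (simp add: le_divide_eq)
  then show ?thesis using False unfolding v by simp
 qed
qed

lemma ev_csum:
 assumes C: "dec C" shows "cantor.ev (%_. s) (csum C m) = (if C (md s (pow2 m)) then 1 else 0)"
proof -
 let ?g = "%r. if C r then ind m r else tzero" and ?r = "md s (pow2 m)"
 let ?h = "%n. if ?r <. n & C ?r then tone else tzero"
 have g: "recfn ?g" by (intro decs C)
 have gv: "cantor.ev (%_. s) (?g r) = (if r = ?r & C r then 1 else 0)" if "r <. pow2 m" for r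
  using ev_ind[OF that, of s] pt_const[of s] by auto
 have "n <=. pow2 m --> cantor.ev (%_. s) (tsum ?g n) = cantor.ev (%_. s) (?h n)" for n
 proof (rule corenum_induct[of "%n. n <=. pow2 m --> cantor.ev (%_. s) (tsum ?g n) = cantor.ev (%_. s) (?h n)"])
  have "renum (%n. n <=. pow2 m & (cantor.ev (%_. s) (tsum ?g n) < cantor.ev (%_. s) (?h n) \<or> cantor.ev (%_. s) (?h n) < cantor.ev (%_. s) (tsum ?g n)))"
   by (intro renum_conj renum_disj cantor.renum_ev_less pt_const; (rule renum_dec)?; intro decs dec_subst[OF C])
  then show "renum (%n. ~ (n <=. pow2 m --> cantor.ev (%_. s) (tsum ?g n) = cantor.ev (%_. s) (?h n)))" by (simp add: neq_iff)
  show "#0 <=. pow2 m --> cantor.ev (%_. s) (tsum ?g #0) = cantor.ev (%_. s) (?h #0)"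
   using pt_const[of s] by (simp add: cantor.ev_tsum[OF g])
  fix n assume IH: "n <=. pow2 m --> cantor.ev (%_. s) (tsum ?g n) = cantor.ev (%_. s) (?h n)"
  show "n +. #1 <=. pow2 m --> cantor.ev (%_. s) (tsum ?g (n +. #1)) = cantor.ev (%_. s) (?h (n +. #1))"
  proof
   assume "n +. #1 <=. pow2 m"
   then have n: "n <. pow2 m" by (simp add: lt_Suc_le[symmetric] nv_ops)
   have "~ n <. n" by (simp flip: nv_less)
   then show "cantor.ev (%_. s) (tsum ?g (n +. #1)) = cantor.ev (%_. s) (?h (n +. #1))"
    using IH n pt_const[of s] unfolding cantor.ev_tsum(2)[OF g pt_const] gv[OF n] by (auto simp: lt_Suc le_def)
  qed
 qed
 from this[of "pow2 m"] show ?thesis unfolding csum_def using div_mod(2)[OF pow2_pos, of s m] pt_const[of s] by simp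
qed

lemma ev_csum_pt:
 assumes C: "dec C" and x: "point UNIV cdist x"
 shows "cantor.ev x (csum C m) = (if C (md (x m) (pow2 m)) then 1 else 0)"
proof (rule eq_if_pw)
 fix k
 have "m <=. m +. k" using nv_nonneg[of k] unfolding nv_simps nv_add by linarith
 then have "md (x (m +. k)) (pow2 m) = md (x m) (pow2 m)" using x unfolding point_cdist le_def by metis
 then have "\<bar>cantor.ev x (csum C m) - (if C (md (x m) (pow2 m)) then 1 else 0)\<bar> <= nv (cantor.lip (csum C m)) / pw (m +. k)"
  using cantor.ev_ideal_approx[OF x, of "m +. k" "csum C m"] unfolding ev_csum[OF C] by (simp add: abs_minus_commute)
 also have "\<dots> <= nv (cantor.lip (csum C m)) / pw k"
  using pw_mono[of k "m +. k"] nv_nonneg[of m] by (intro divide_left_mono nv_nonneg) (simp_all add: nv_simps(3))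
 finally show "\<bar>cantor.ev x (csum C m) - (if C (md (x m) (pow2 m)) then 1 else 0)\<bar> <= nv (cantor.lip (csum C m)) / pw k" .
qed

lemma iv_csum: assumes C: "dec C" shows "cantor.iv (csum C m) = nv (cnt C (pow2 m)) / pw m"
proof -
 let ?c = "csum C m"
 have "cantor.ev (%_. r) ?c = cantor.ev (%_. md r (pow2 m)) ?c" for r
  unfolding ev_csum[OF C] using md_less[OF div_mod(2)[OF pow2_pos]] by simp
 then have "cantor.iv ?c = avg ?c m" unfolding cantor.iv_def by (rule cint_local)
 let ?f = "%j. if j <=. pow2 m then qsum ?c j else qnat #0" and ?g = "%j. if j <=. pow2 m then qnat (cnt C j) else qnat #0"
 have "qv (?f j) = qv (?g j)" for j
 proof (rule qv_eq_induct[of ?f ?g])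
  show "recfn ?f" "recfn ?g" by (intro decs dec_subst[OF C])+
  fix j assume IH: "qv (?f j) = qv (?g j)"
  show "qv (?f (j +. #1)) = qv (?g (j +. #1))"
  proof (cases "j +. #1 <=. pow2 m")
   case True
   then have j: "j <. pow2 m" by (simp add: lt_Suc_le[symmetric] nv_ops)
   then show ?thesis using IH True by (simp add: le_def qv_qsum qv_val ev_csum[OF C] md_less[OF j] cnt_Suc[OF C])
  qed simp
 qed (simp_all add: qsum_0)
 from this[of "pow2 m"] have "qv (qsum ?c (pow2 m)) = nv (cnt C (pow2 m))" by simp
 then show ?thesis using \<open>cantor.iv ?c = avg ?c m\<close> by (simp add: avg_def)
qed

text \<open>Bounded convergence only says that the integrals are Cauchy. Interleaving the indicators
  with the zero function makes this a statement about the limit 0.\<close>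

lemma clopen_null:
 assumes B: bounded_convergence and l: "recfn l" and C: "dec (%p. C (pfst p) (psnd p))"
  and miss: "!!x. point UNIV cdist x ==> EX N. ALL n. N <=. n --> ~ C n (md (x (l n)) (pow2 (l n)))" and e: "0 < e"
 shows "EX N. ALL n. N <=. n --> nv (cnt (C n) (pow2 (l n))) / pw (l n) < e"
proof -
 have Cn: "dec (C n)" for n using dec_rel2[OF C recfn_const recfn_ident] .
 define f where "f = (%n. if lastbit n = #0 then csum (C (half n)) (l (half n)) else tzero)"
 have f: "recfn f" unfolding f_def csum_def by (intro decs recfn_comp[OF l] dec_rel2[OF C])
 have fv: "cantor.ev x (f n) = (if lastbit n = #0 & C (half n) (md (x (l (half n))) (pow2 (l (half n)))) then 1 else 0)"
  if "point UNIV cdist x" for x n using ev_csum_pt[OF Cn that] that by (simp add: f_def)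
 have h: "N <=. half n" if "dbl N #0 <=. n" for N n
 proof (rule ccontr)
  assume "~ N <=. half n"
  then have "nv (half n) + 1 <= nv N" unfolding not_lt[symmetric] nv_Suc_le by simp
  moreover have "nv (lastbit n) <= 1" using lastbit_lt[of n] by (auto simp: lt_two)
  moreover have "nv n = 2 * nv (half n) + nv (lastbit n)" using arg_cong[OF dbl_half[of n], of nv] by (simp del: num.simps)
  ultimately show False using that unfolding nv_simps nv_add nv_mult nv_num nv_0 by (simp; linarith)
 qed
 have "rcauchy (%n. cint (f n))"
 proof (rule B[unfolded bounded_convergence_def, rule_format], intro conjI allI impI)
  show "compact_space UNIV cdist" "is_measure UNIV cdist cint" "recfn f" by (rule compact_cdist measure_cint f)+
  show "unit_valued UNIV cdist (f n)" for n unfolding cantor.unit_valued_iff by (simp add: fv)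
  fix x assume x: "point UNIV cdist x"
  then obtain N where N: "!!n. N <=. n ==> ~ C n (md (x (l n)) (pow2 (l n)))" using miss by blast
  have "cantor.ev x (f n) = 0" if "dbl N #0 <=. n" for n using N[OF h[OF that]] x by (simp add: fv)
  then show "rcauchy (%n. tval UNIV cdist x (f n))"
   unfolding cantor.rcauchy_tval[OF x] by (intro allI impI exI[of _ "dbl N #0"]) simp
 qed
 then obtain N where N: "!!m n. N <=. m ==> N <=. n ==> \<bar>cantor.iv (f m) - cantor.iv (f n)\<bar> < e"
  using e unfolding cantor.rcauchy_I by blast
 have "nv (cnt (C n) (pow2 (l n))) / pw (l n) < e" if n: "N <=. n" for n
 proof -
  have le: "N <=. dbl n b" for b using n nv_nonneg[of n] nv_nonneg[of b] unfolding nv_simps nv_add nv_mult nv_num by (simp; linarith)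
  have "f (dbl n #0) = csum (C n) (l n)" "f (dbl n #1) = tzero"
   unfolding f_def half_dbl[OF zero_lt_two(1)] half_dbl[OF zero_lt_two(2)] lastbit_dbl[OF zero_lt_two(1)] lastbit_dbl[OF zero_lt_two(2)] by simp_all
  then show ?thesis using N[OF le[of \<zero>] le[of \<one>]] by (simp only: iv_csum[OF Cn] cantor.iv_const isQ_ops) simp
 qed
 then show ?thesis by blast
qed

lemma cnt_pos: assumes P: "dec P" and "P i" "i <. m" shows "1 <= nv (cnt P m)"
proof -
 have "i +. #1 <=. m" using assms(3) unfolding nv_Suc_le nv_simps(3) nv_add nv_1 .
 from cnt_arg_mono[OF P this] have "nv (cnt P i) + 1 <= nv (cnt P m)"
  using assms(2) unfolding cnt_Suc[OF P] nv_simps(3) by simp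
 then show ?thesis using nv_nonneg[of "cnt P i"] by linarith
qed

text \<open>Bounded convergence yields the bounding principle for \<open>\<Sigma>\<^sup>0\<^sub>2\<close> formulas.\<close>

lemma uniform_limit_below:
 assumes B: bounded_convergence and F: "dec (%p. F (pfst p) (psnd p))" and lim: "!!i. EX N. ALL n. N <=. n --> F n i = F N i"
 shows "EX N. ALL n. N <=. n --> (ALL i. i <. b --> F n i = F N i)"
proof -
 let ?C = "%n i. i <. b & F n i ~= F (n +. #1) i"
 have C: "dec (%p. ?C (pfst p) (psnd p))" by (intro dec_conj dec_not dec_iff dec_rel2[OF F] decs)
 have Cn: "dec (?C n)" for n using dec_rel2[OF C recfn_const recfn_ident] by simp
 \<comment> \<open>As \<open>b\<close> is below \<open>pow2 b\<close>, the indices below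
   \<open>b\<close> are distinct residues of measure \<open>1 / pw b\<close> each. Measure less than
   this means that no value changes any more at stage \<open>n\<close>.\<close>
 have "EX N. ALL n. N <=. n --> nv (cnt (?C n) (pow2 b)) / pw b < 1 / pw b"
 proof (rule clopen_null[OF B recfn_const C])
  fix x
  let ?i = "md (x b) (pow2 b)"
  obtain N where N: "!!n. N <=. n ==> F n ?i = F N ?i" using lim by blast
  have "F n ?i = F (n +. #1) ?i" if "N <=. n" for n
   using N[OF that] N[of "n +. #1"] that by (simp add: nv_simps(3))
  then show "EX N. ALL n. N <=. n --> ~ ?C n ?i" by blast
 qed simp
 then obtain N where N': "!!n. N <=. n ==> nv (cnt (?C n) (pow2 b)) / pw b < 1 / pw b" by blast
 have N: "nv (cnt (?C n) (pow2 b)) < 1" if "N <=. n" for n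
  using N'[OF that] pw_pos[of b] by (simp only: divide_less_cancel)
 have step: "F n i = F (n +. #1) i" if "N <=. n" "i <. b" for n i
 proof (rule ccontr)
  assume "F n i ~= F (n +. #1) i"
  moreover have "i <. pow2 b" using that(2) pw_ge[of b] unfolding nv_simps by linarith
  ultimately have "1 <= nv (cnt (?C n) (pow2 b))" using that(2) by (intro cnt_pos[OF Cn]) auto
  then show False using N[OF that(1)] by linarith
 qed
 have "F (N +. k) i = F N i" if i: "i <. b" for k i
 proof (rule dec_induct'[of "%k. F (N +. k) i = F N i"])
  show "dec (%k. F (N +. k) i = F N i)" by (intro dec_iff dec_rel2[OF F] decs)
  fix k assume "F (N +. k) i = F N i"
  moreover have "N <=. N +. k" using nv_nonneg[of k] unfolding nv_simps nv_add by linarith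
  ultimately show "F (N +. (k +. #1)) i = F N i" using step[of "N +. k" i] i by (simp add: add_assoc')
 qed simp
 then show ?thesis using le_imp_plus by blast
qed

lemma segment_of_iff: "segment_of s Y \<longleftrightarrow> s ~= #0 & (ALL i. i <. len s --> string_bit s i (if i \<in> Y then #1 else #0))"
 unfolding segment_of_def using string_length_len string_length_nonzero len_eq by metis

text \<open>The limit lemma. \<open>S n\<close> is the jump as seen at stage \<open>n\<close>, and a
  fixed initial segment settles by strong bounding. If the value is 0, the segment used for it
  eventually agrees with \<open>S n\<close>, and \<open>phi_unique\<close> excludes a
  stage-\<open>n\<close> computation with value 1.\<close>

lemma limit_approximation:
 assumes X: "X \<in> cls M" and tot: "!!s. phi_jump X e s #0 \<or> phi_jump X e s #1"
 shows "EX F. dec (%p. F (pfst p) (psnd p)) & (ALL s. EX N. ALL n. N <=. n --> (F n s \<longleftrightarrow> phi_jump X e s #1))"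
proof -
 have "renum (%q. phi (pfst q) e (psnd q) #1)" by (intro renum_phi decs)
 then obtain R where R: "dec (%q. R (pfst q) (psnd q))" "!!q. phi (pfst q) e (psnd q) #1 \<longleftrightarrow> (EX m. R q m)"
  unfolding renum_def by blast
 have Rp: "phi t e s #1 \<longleftrightarrow> (EX m. R <<t, s>> m)" for t s using R(2)[of "<<t, s>>"] by simp
 obtain J where J: "dec (%q. J (pfst q) (psnd q))" "!!i. i \<in> jump X \<longleftrightarrow> (EX m. J i m)"
  using renum_jump[OF X] unfolding renum_def by blast
 define S where "S = (%n. {i. EX m. m <. n & J i m})"
 have S: "EX N. ALL n. N <=. n --> segment_of t (S n)" if t: "segment_of t (jump X)" for t
 proof -
  obtain N where N: "!!i. i <. len t ==> (EX m. J i m) ==> EX m. m <. N & J i m" using strong_bounding[OF J(1)] by blast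
  have "segment_of t (S n)" if n: "N <=. n" for n
  proof -
   have "i \<in> S n \<longleftrightarrow> i \<in> jump X" if "i <. len t" for i
    using N[OF that] lt_le_trans'[OF _ n] unfolding S_def J(2) by blast
   then show ?thesis using t unfolding segment_of_iff by simp
  qed
  then show ?thesis by blast
 qed
 define F where "F = (%n s. EX t. t <. n & (EX m. m <. n & R <<t, s>> m & t ~= #0 &
  (ALL i. i <. len t --> string_bit t i (if EX m. m <. n & J i m then #1 else #0))))"
 have F: "dec (%p. F (pfst p) (psnd p))" unfolding F_def by (intro decs dec_rel2[OF R(1)] dec_rel2[OF J(1)])
 have F_iff: "F n s \<longleftrightarrow> (EX t. t <. n & (EX m. m <. n & R <<t, s>> m & segment_of t (S n)))" for n s
  unfolding F_def segment_of_iff S_def by simp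
 have "EX N. ALL n. N <=. n --> (F n s \<longleftrightarrow> phi_jump X e s #1)" for s
 proof (cases "phi_jump X e s #1")
  case True
  then obtain t m where t: "segment_of t (jump X)" "R <<t, s>> m" unfolding phi_jump_def Rp by blast
  obtain N where N: "!!n. N <=. n ==> segment_of t (S n)" using S[OF t(1)] by blast
  have "F n s" if "N +. (t +. m +. #1) <=. n" for n
  proof -
   have "N <=. n" "t <. n" "m <. n" using that nv_nonneg[of N] nv_nonneg[of t] nv_nonneg[of m] unfolding nv_simps nv_add nv_1 by linarith+
   then show ?thesis unfolding F_iff using t(2) N by blast
  qed
  then show ?thesis using True by blast
 next
  case False
  then obtain t0 where t0: "segment_of t0 (jump X)" "phi t0 e s #0" using tot[of s] unfolding phi_jump_def by blast
  obtain N where N: "!!n. N <=. n ==> segment_of t0 (S n)" using S[OF t0(1)] by blast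
  have "~ F n s" if n: "N <=. n" for n
  proof
   assume "F n s"
   then obtain t where t: "segment_of t (S n)" "phi t e s #1" unfolding F_iff Rp by blast
   have "#0 = #1"
   proof (rule phi_unique[OF t0(2) t(2)])
    show "b = b'" if "string_bit t0 i b" "string_bit t i b'" for i b b'
     using segment_of_bit[OF N[OF n] that(1)] segment_of_bit[OF t(1) that(2)] by simp
   qed
   then show False using one_neq_zero by simp
  qed
  then show ?thesis using False by blast
 qed
 then show ?thesis using F by blast
qed

section \<open>Bounded convergence implies 2-WWKL\<close>

definition bitat :: "'n => 'n => bool" where
 "bitat r i \<longleftrightarrow> lastbit (dv r (pow2 i)) = #1"

definition strg :: "'n => 'n => 'n" where
 "strg r k = seg (bitat r) k"

text \<open>Inverse to \<open>strg\<close>, it reverses the digits: a string code has its first bit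
  in the highest place after the leading 1, a 2-adic residue in the lowest.\<close>

definition res :: "'n => 'n" where
 "res = srec #0 (%s b v. b *. pow2 (len s) +. v)"

lemma dec_bitat [decs]: "recfn f ==> recfn g ==> dec (%p. bitat (f p) (g p))"
 unfolding bitat_def by (intro decs)

lemma dec_bitat_at: "dec (bitat r)"
 using dec_bitat[OF recfn_const recfn_ident] .

lemma recfn_strg [decs]: assumes "recfn f" "recfn g" shows "recfn (%p. strg (f p) (g p))"
 unfolding strg_def seg_def by (intro decs assms recfn_comp[OF assms(1)])

lemma seg_cong: assumes X: "dec X" and Y: "dec Y" and "!!i. i <. k ==> X i = Y i" shows "seg X k = seg Y k"
 by (rule seg_unique[OF Y seg_length[OF X]]) (use seg_bit[OF X] assms(3) in force)

lemma bitat_md: assumes "i <. k" shows "bitat (md r (pow2 k)) i = bitat r i"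
proof -
 obtain j where k: "k = i +. (j +. #1)" using lt_obtain[OF assms] .
 have pk: "pw k = pw i * (pw j * 2)" using pw_Suc[of \<zero>] unfolding k pw_add by (simp add: zero_plus)
 define q m where "q = dv r (pow2 k)" and "m = md r (pow2 k)"
 then have r: "nv r = nv q * (pw i * (pw j * 2)) + nv m"
  using arg_cong[OF div_mod(1)[OF pow2_pos[of k], of r], of nv] by (simp add: pk)
 obtain h b where h: "dv m (pow2 i) = dbl h b" "b <. num 2" by (rule dbl_cases)
 then have m: "nv m = (2 * nv h + nv b) * pw i + nv (md m (pow2 i))"
  using arg_cong[OF div_mod(1)[OF pow2_pos[of i], of m], of nv] by (simp del: num.simps)
 have "r = dbl (q *. pow2 j +. h) b *. pow2 i +. md m (pow2 i)"
  unfolding nv_eq nv_add nv_mult nv_num using r m by (simp add: algebra_simps)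
 from dv_eq[OF this div_mod(2)[OF pow2_pos]] show ?thesis unfolding bitat_def m_def[symmetric] h(1) by (simp add: h(2) del: num.simps)
qed

lemma res_step: "recfn (%q. psnd (pfst q) *. pow2 (len (pfst (pfst q))) +. psnd q)"
 by (intro decs)

lemma recfn_res [decs]: "recfn f ==> recfn (%p. res (f p))"
 unfolding res_def by (rule recfn_srec[OF res_step])

lemma res_one: "res #1 = #0"
 unfolding res_def by (rule srec_one[OF res_step])

lemma res_dbl: "s ~= #0 ==> b <. num 2 ==> res (dbl s b) = b *. pow2 (len s) +. res s"
 unfolding res_def by (rule srec_dbl[OF res_step])

lemma res_less: "s ~= #0 ==> res s <. pow2 (len s)"
proof (erule string_induct[rotated 3])
 show "renum (%s. ~ res s <. pow2 (len s))" by (intro renum_dec decs)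
 show "res #1 <. pow2 (len #1)" by (simp add: res_one)
 fix s b assume s: "s ~= #0" "b <. num 2" "res s <. pow2 (len s)"
 have "nv b * pw (len s) <= 1 * pw (len s)" using s(2) by (intro mult_right_mono) (auto simp: lt_two)
 then show "res (dbl s b) <. pow2 (len (dbl s b))"
  using s(3) unfolding res_dbl[OF s(1,2)] len_dbl[OF s(1,2)] nv_simps nv_add nv_mult pw_Suc by linarith
qed

lemma strg_res: "s ~= #0 ==> strg (res s) (len s) = s"
proof (erule string_induct[rotated 3])
 show "renum (%s. strg (res s) (len s) ~= s)" by (intro renum_dec decs)
 show "strg (res #1) (len #1) = #1" by (simp add: strg_def)
 fix s b assume s: "s ~= #0" "b <. num 2" "strg (res s) (len s) = s"
 let ?r = "res (dbl s b)" and ?n = "len s"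
 have r: "?r = b *. pow2 ?n +. res s" by (rule res_dbl[OF s(1,2)])
 have md: "md ?r (pow2 ?n) = res s" and dv: "dv ?r (pow2 ?n) = b" using md_eq[OF r res_less[OF s(1)]] dv_eq[OF r res_less[OF s(1)]] .
 have "seg (bitat ?r) ?n = seg (bitat (res s)) ?n"
  by (rule seg_cong[OF dec_bitat_at dec_bitat_at]) (use bitat_md[of _ ?n ?r] in \<open>simp add: md\<close>)
 then have e: "seg (bitat ?r) ?n = s" using s(3) by (simp add: strg_def)
 have "lastbit b = b" using lastbit_dbl[OF s(2), of \<zero>] by (simp add: times_zero zero_plus del: num.simps)
 then have "(if bitat ?r ?n then #1 else #0) = b" using s(2) one_neq_zero unfolding bitat_def dv by (auto simp: lt_two)
 then show "strg ?r (len (dbl s b)) = dbl s b"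
  unfolding len_dbl[OF s(1,2)] strg_def seg_Suc[OF dec_bitat_at] e by simp
qed

text \<open>Without a path every 2-adic integer leaves the tree and so eventually misses the clopen
  sets given by the stage-\<open>n\<close> approximation at level \<open>l n\<close>. By
  \<open>clopen_null\<close> their measure becomes smaller than \<open>dl\<close>, whereas the
  choice of \<open>l\<close> makes it exceed \<open>dl\<close>.\<close>

theorem bounded_imp_two_WWKL: assumes B: bounded_convergence shows two_WWKL
 unfolding two_WWKL_def
proof (intro ballI allI impI)
 fix X e T
 assume X: "X \<in> cls M" and *: "(ALL s. phi_jump X e s #0 \<or> phi_jump X e s #1) & T = {s. phi_jump X e s #1} &
   binary_tree T & (ALL n. \<exists>s\<in>T. string_length s n) &
   (\<exists>\<delta>. posQ \<delta> & (ALL n. EX c. card_ge {s \<in> T. string_length s n} c & \<delta> *\<^sub>Q qnat (pow2 n) <\<^sub>Q qnat c))"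
 obtain dl where dl: "posQ dl" "!!n. EX c. card_ge {s \<in> T. string_length s n} c & dl *\<^sub>Q qnat (pow2 n) <\<^sub>Q qnat c" using * by blast
 have dQ: "isQ dl" "0 < qv dl" using dl(1) by (simp_all add: posQ_iff)
 have T: "!!s t. t \<in> T ==> prefix s t ==> s \<in> T" "!!t. t \<in> T ==> t ~= #0" using * unfolding binary_tree_def by blast+
 obtain F where F: "dec (%p. F (pfst p) (psnd p))" "!!s. EX N. ALL n. N <=. n --> (F n s \<longleftrightarrow> s \<in> T)"
 proof -
  have tot: "phi_jump X e s #0 \<or> phi_jump X e s #1" and Ts: "s \<in> T \<longleftrightarrow> phi_jump X e s #1" for s using * by blast+
  from limit_approximation[OF X tot] obtain F where "dec (%p. F (pfst p) (psnd p))"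
   "ALL s. EX N. ALL n. N <=. n --> (F n s \<longleftrightarrow> phi_jump X e s #1)" by blast
  then show thesis using that[of F] unfolding Ts by blast
 qed
 show "\<exists>Z\<in>cls M. ALL s. segment_of s Z --> s \<in> T"
 proof (rule ccontr)
  assume "~ (\<exists>Z\<in>cls M. ALL s. segment_of s Z --> s \<in> T)"
  then have no: "EX s. segment_of s Z & s \<notin> T" if "Z \<in> cls M" for Z using that by blast
  \<comment> \<open>The stage-\<open>n\<close> approximation need not be closed under prefixes, so
    all prefixes up to length \<open>k\<close> are tested.\<close>
  define H where "H = (%n k r. ALL j. j <=. k --> F n (strg r j))"
  have H: "dec (%p. H (f p) (g p) (h p))" if "recfn f" "recfn g" "recfn h" for f g h
   unfolding H_def by (intro decs dec_rel2[OF F(1)] that recfn_comp[OF that(1)] recfn_comp[OF that(3)])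
  have Hn: "dec (H n k)" for n k using H[OF recfn_const recfn_const recfn_ident] .
  define L where "L = (%n k. dl *\<^sub>Q qnat (pow2 k) <\<^sub>Q qnat (cnt (H n k) (pow2 k)))"
  have L: "dec (%p. L (f p) (g p))" if "recfn f" "recfn g" for f g
   unfolding L_def by (intro decs H that recfn_comp[OF that(1)] recfn_comp[OF that(2)])
  \<comment> \<open>The largest level up to \<open>n\<close> at which the stage-\<open>n\<close>
    approximation has the required density, sought downward from \<open>n\<close>; the default is
    level 0.\<close>
  define l where "l = (%n. monus n (lst (%y. y = n \<or> L n (monus n y))))"
  have l_ex: "EX y. y = n \<or> L n (monus n y)" for n by blast
  have rl: "recfn l" unfolding l_def by (intro decs recfn_lst l_ex L)
  have l: "k <=. l n & L n (l n)" if k: "k <=. n" "L n k" for n k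
  proof -
   let ?P = "%y. y = n \<or> L n (monus n y)"
   obtain y where y: "n = k +. y" using le_imp_plus[OF k(1)] by blast
   have yk: "n = y +. k" unfolding y nv_eq nv_add by simp
   have "?P y" using k(2) monus_eq[of y k] unfolding yk[symmetric] by simp
   have d: "dec ?P" by (intro decs L)
   note ll = lst_least[where P = ?P, OF d \<open>?P y\<close>]
   have le: "lst ?P <=. y" using ll(2)[OF \<open>?P y\<close>] .
   then have len: "lst ?P <=. n" using nv_nonneg[of k] unfolding y nv_simps nv_add by linarith
   have nl: "nv (l n) = nv n - nv (lst ?P)" unfolding l_def by (rule nv_monus[OF len])
   have "k <=. l n" using le unfolding nv_simps(3) nl unfolding y nv_add by linarith
   moreover have "L n (l n)"
   proof (cases "lst ?P = n")
    case True
    then have "nv (l n) = 0" using nl by simp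
    moreover from this have "nv k <= 0" using \<open>k <=. l n\<close> unfolding nv_simps(3) by simp
    ultimately have "l n = k" using nv_nonneg[of k] unfolding nv_eq by linarith
    then show ?thesis using k(2) by simp
   next
    case False
    then show ?thesis using ll(1) unfolding l_def by blast
   qed
   ultimately show ?thesis by blast
  qed
  have Lk: "EX N. ALL n. N <=. n --> L n k" for k
  proof -
   obtain c where c: "card_ge {s \<in> T. string_length s k} c" "dl *\<^sub>Q qnat (pow2 k) <\<^sub>Q qnat c" using dl(2) by blast
   have "EX N. ALL n. N <=. n --> F n s = F N s" for s using F(2)[of s] le_refl' by metis
   \<comment> \<open>Each single string settles in the limit; here all strings of length up to
     \<open>k\<close>, whose codes lie below \<open>pow2 (k +. #1)\<close>, settle together, so the
     density of the true tree becomes visible at one stage.\<close>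
   from uniform_limit_below[OF B F(1) this, of "pow2 (k +. #1)"]
   obtain N where N: "!!n s. N <=. n ==> s <. pow2 (k +. #1) ==> F n s = F N s" by blast
   have FT: "F n s \<longleftrightarrow> s \<in> T" if ns: "N <=. n" "s <. pow2 (k +. #1)" for n s
   proof -
    obtain N' where N': "!!n. N' <=. n ==> (F n s \<longleftrightarrow> s \<in> T)" using F(2) by blast
    have "N <=. N +. N'" "N' <=. N +. N'" using nv_nonneg[of N] nv_nonneg[of N'] unfolding nv_simps nv_add by linarith+
    then show ?thesis using N[OF _ ns(2), of "N +. N'"] N[OF ns] N'[of "N +. N'"] by blast
   qed
   have "L n k" if n: "N <=. n" for n
   proof -
    have "c <=. cnt (H n k) (pow2 k)"
    proof (rule card_ge_cnt[where f = res, OF Hn c(1)])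
     fix s assume s: "s \<in> T & string_length s k"
     then have nz: "s ~= #0" and lk: "len s = k" using string_length_nonzero len_eq by blast+
     have sr: "strg (res s) k = s" using strg_res[OF nz] by (simp add: lk)
     have "F n (strg (res s) j)" if j: "j <=. k" for j
     proof -
      have p: "prefix (strg (res s) j) s" using seg_prefix[OF dec_bitat_at j, of "res s"] sr unfolding strg_def by simp
      have "strg (res s) j <=. s" by (rule prefix_le[OF p])
      moreover have "s <. pow2 (k +. #1)" using s by (simp add: string_length_def)
      ultimately have "strg (res s) j <. pow2 (k +. #1)" by (rule le_lt_trans')
      then show ?thesis using FT[OF n] T(1)[OF _ p] s by blast
     qed
     then show "H n k (res s) & res s <. pow2 k" using res_less[OF nz] unfolding H_def lk by blast
     fix t assume t: "t \<in> T & string_length t k" and "res s = res t"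
     then show "s = t" using sr strg_res[of t] string_length_nonzero[of t k] len_eq[of t k] by metis
    qed (intro decs)
    then show ?thesis using c(2) dQ unfolding L_def by (simp add: qlt_iff nv_simps(3))
   qed
   then show ?thesis by blast
  qed
  have lk: "EX N. ALL n. N <=. n --> k <=. l n & L n (l n)" for k
  proof -
   obtain N where N: "!!n. N <=. n ==> L n k" using Lk by blast
   have "k <=. l n & L n (l n)" if "N +. k <=. n" for n
   proof -
    have "N <=. n" "k <=. n" using that nv_nonneg[of N] nv_nonneg[of k] unfolding nv_simps nv_add by linarith+
    then show ?thesis using l N by blast
   qed
   then show ?thesis by blast
  qed
  let ?C = "%n. H n (l n)"
  have "EX N. ALL n. N <=. n --> nv (cnt (?C n) (pow2 (l n))) / pw (l n) < qv dl"
  proof (rule clopen_null[OF B rl])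
   show "dec (%p. ?C (pfst p) (psnd p))" by (intro H decs recfn_comp[OF rl])
   fix x assume x: "point UNIV cdist x"
   then have rx: "recfn x" unfolding point_cdist by blast
   \<comment> \<open>Bit \<open>i\<close> of the point depends only on its residue modulo
     \<open>pow2 (i +. #1)\<close>, which \<open>x (i +. #1)\<close> determines.\<close>
   define Z where "Z = {i. bitat (x (i +. #1)) i}"
   have dZ: "dec (%i. i \<in> Z)" unfolding Z_def mem_Collect_eq by (intro decs recfn_comp[OF rx])
   then have "Z \<in> cls M" by (simp add: dec_def)
   then obtain s where s: "segment_of s Z" "s \<notin> T" using no by blast
   obtain k where k: "s = seg (%i. i \<in> Z) k" using s(1) segment_of_seg[OF dZ] by blast
   obtain N1 where N1: "!!n. N1 <=. n ==> ~ F n s" using F(2)[of s] s(2) by blast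
   obtain N2 where N2: "!!n. N2 <=. n ==> k <=. l n" using lk[of k] by blast
   have "~ ?C n (md (x (l n)) (pow2 (l n)))" if n: "N1 +. N2 <=. n" for n
   proof
    let ?r = "md (x (l n)) (pow2 (l n))"
    have n12: "N1 <=. n" "N2 <=. n" using n nv_nonneg[of N1] nv_nonneg[of N2] unfolding nv_simps nv_add by linarith+
    assume "?C n ?r"
    then have "F n (strg ?r k)" using N2[OF n12(2)] unfolding H_def by blast
    moreover have "strg ?r k = s"
     unfolding strg_def k
    proof (rule seg_cong[OF dec_bitat_at dZ])
     fix i assume i: "i <. k"
     have il: "i <. l n" by (rule lt_le_trans'[OF i N2[OF n12(2)]])
     then have il': "i +. #1 <=. l n" unfolding nv_Suc_le nv_simps(3) nv_add nv_1 .
     have ii: "i <. i +. #1" by (simp add: lt_Suc)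
     have "md (x (i +. #1)) (pow2 (i +. #1)) = md (x (l n)) (pow2 (i +. #1))"
      using x il' unfolding point_cdist le_def by metis
     then have "bitat (x (i +. #1)) i = bitat (x (l n)) i" using bitat_md[OF ii] by metis
     then show "bitat ?r i = (i \<in> Z)" using bitat_md[OF il] unfolding Z_def by simp
    qed
    ultimately show False using N1[OF n12(1)] by simp
   qed
   then show "EX N. ALL n. N <=. n --> ~ ?C n (md (x (l n)) (pow2 (l n)))" by blast
  qed (rule dQ)
  then obtain N where N: "!!n. N <=. n ==> nv (cnt (?C n) (pow2 (l n))) / pw (l n) < qv dl" by blast
  obtain N' where N': "!!n. N' <=. n ==> L n (l n)" using lk[of \<zero>] by blast
  let ?n = "N +. N'"
  have le: "N <=. ?n" "N' <=. ?n" using nv_nonneg[of N] nv_nonneg[of N'] unfolding nv_simps nv_add by linarith+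
  have "qv dl * pw (l ?n) < nv (cnt (?C ?n) (pow2 (l ?n)))" using N'[OF le(2)] dQ unfolding L_def by (simp add: qlt_iff)
  moreover have "nv (cnt (?C ?n) (pow2 (l ?n))) < qv dl * pw (l ?n)" using N[OF le(1)] by (simp add: divide_less_eq)
  ultimately show False by simp
 qed
qed

lemma all_equivalent: principles_equivalent
 unfolding principles_equivalent_def
 using two_WWKL_imp_ae two_WWKL_imp_DCT ae_imp_bounded DCT_imp_bounded bounded_imp_two_WWKL by blast

end

theorem theorem4p5:
  fixes M :: "'n l2_struct"
  assumes "L2.RCA0 M"
  shows "(L2.two_WWKL M \<longleftrightarrow> L2.ae_cauchy_imp_almost_uniform M) \<and>
         (L2.ae_cauchy_imp_almost_uniform M \<longleftrightarrow> L2.DCT_star M) \<and>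
         (L2.DCT_star M \<longleftrightarrow> L2.bounded_convergence M)"
proof -
  have "L2.principles_equivalent M"
  proof (rule ccontr)
    assume "\<not> L2.principles_equivalent M"
    with assms have "\<exists>M :: 'n l2_struct. L2.RCA0 M \<and> \<not> L2.principles_equivalent M" by blast
    \<comment> \<open>A failing model makes \<open>mdl\<close> a failing model as well, and for
      \<open>mdl\<close> the types built on it give the equivalence.\<close>
    from someI_ex[OF this] have mdl: "L2.RCA0 (mdl :: 'n l2_struct)" "\<not> L2.principles_equivalent (mdl :: 'n l2_struct)"
      unfolding mdl_def by blast+
    interpret model "mdl :: 'n l2_struct"
      by unfold_locales (rule mdl refl)+
    show False using all_equivalent mdl(2) by blast
  qed
  then show ?thesis unfolding L2.principles_equivalent_def .
qed

end
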